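(* Let $\mathcal H_1$ be the Connes–Moscovici Hopf algebra, and for every pseudogroup $\Gamma$ of local diffeomorphisms of $\mathbb R$ let $\star$ be the star product on $C_c^\infty(\mathbb R\times\mathbb R^+)\rtimes\Gamma[[\hbar]]$ defined in the context. There exists an element $R\in\mathcal H_1\otimes\mathcal H_1[[\hbar]]$ (a formal power series in $\hbar$ with coefficients in $\mathcal H_1\otimes\mathcal H_1$), independent of $\Gamma$, such that for every pseudogroup $\Gamma$ and all elements $f\alpha,\ g\beta\in C_c^\infty(\mathbb R\times\mathbb R^+)\rtimes\Gamma$, $$f\alpha\star g\beta=m\big(R(f\alpha\otimes g\beta)\big),$$ where $m$ is the (undeformed) multiplication map of $C_c^\infty(\mathbb R\times\mathbb R^+)\rtimes\Gamma$. Furthermore, $R$ is a universal deformation formula of $\mathcal H_1$, that is, $$(\Delta\otimes 1)R\,(R\otimes 1)=(1\otimes\Delta)R\,(1\otimes R),\qquad (\epsilon\otimes 1)(R)=1\otimes 1=(1\otimes\epsilon)(R),$$ where $\Delta$ and $\epsilon$ are the coproduct and counit of $\mathcal H_1$.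
   Context: **Groupoid algebra.** Let $M=\mathbb R\times\mathbb R^+$ with coordinates $(x,y)$, $y>0$, and Poisson structure $\partial_x\wedge\partial_y$, i.e. $\{a,b\}=a_xb_y-a_yb_x$. A local diffeomorphism $\gamma$ of $\mathbb R$ acts on $M$ by the symplectic map $\gamma(x,y)=(\gamma(x),y/\gamma'(x))$, and on functions by $\gamma(f)=f\circ\gamma^{-1}$. For a pseudogroup $\Gamma$ of local diffeomorphisms of $\mathbb R$, $C_c^\infty(M)\rtimes\Gamma$ is spanned by the elements $f\alpha$ with $\alpha\in\Gamma$ and $f\in C_c^\infty$ supported in the range of $\alpha$ (acting on $M$), with product $m(f\alpha\otimes g\beta)=f\,\alpha(g)\,\alpha\beta$. **Hopf algebra $\mathcal H_1$.** It is generated as an algebra by $X,Y,\delta_n$ ($n\ge1$) with relations $[Y,X]=X$, $[Y,\delta_n]=n\delta_n$, $[X,\delta_n]=\delta_{n+1}$, $[\delta_k,\delta_l]=0$; the coproduct is determined by $\Delta Y=Y\otimes1+1\otimes Y$, $\Delta\delta_1=\delta_1\otimes1+1\otimes\delta_1$, $\Delta X=X\otimes1+1\otimes X+\delta_1\otimes Y$; the counit by $\epsilon(X)=\epsilon(Y)=\epsilon(\delta_n)=0$; the antipode by $S(Y)=-Y$, $S(\delta_1)=-\delta_1$, $S(X)=-X+\delta_1Y$. It acts on $C_c^\infty(M)\rtimes\Gamma$ by $X(f\alpha)=\frac1y f_x\,\alpha$, $Y(f\alpha)=-yf_y\,\alpha$, $\delta_n(f\alpha)=\delta_n(\alpha)f\alpha$,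 where $\delta_1(\alpha)=\frac1y\big(\log((\alpha^{-1})')\big)'$ and $\delta_n(\alpha)=\frac1y\partial_x(\delta_{n-1}(\alpha))$ for $n\ge2$. In $(\epsilon\otimes1)(R)=1\otimes1$ one identifies $\mathbb C\otimes\mathcal H_1$ with $\mathcal H_1$, etc. **Weyl algebra bundle.** Let $u,v$ be the fiber coordinates corresponding to $x,y$ (they transform like $dx,dy$). Sections of the Weyl algebra bundle $\mathcal W$ are formal power series in $u,v,\hbar$ with coefficients smooth functions on $M$; the fiberwise Moyal product is $a\circ b=\mathrm{mult}\,\exp\!\big(-\frac{i\hbar}{2}(\partial_u\otimes\partial_v-\partial_v\otimes\partial_u)\big)(a\otimes b)$. Give $u,v$ degree $1$ and $\hbar$ degree $2$. The extension $\mathcal W^+$ consists of series $\sum \hbar^k a_{k,m,n}u^mv^n$ in which $k$ may be negative but every term has total degree $2k+m+n\ge0$, with only finitely many terms of each total degree; $\circ$ extends to $\mathcal W^+$. All operations extend to differential forms with values in $\mathcal W$ or $\mathcal W^+$. Put $\delta=dx\,\partial_u+dy\,\partial_v$; on a form-valued section $a$ of fiber polynomial degree $p$ and form degree $q$, $\delta^{-1}a=\frac1{p+q}\big(u\,\iota_{\partial_x}+v\,\iota_{\partial_y}\big)a$ if $p+q>0$ and $\delta^{-1}a=0$ if $p+q=0$. **Fedosov connection.** Let $$Da=da-dx\,\partial_ua-dy\,\partial_va-\tfrac{v}{2y}\,\partial_ua\,dx+\tfrac1{2y}\big(v\,\partial_va-u\,\partial_ua\big)dy .$$ (This is the connection obtained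 from the flat torsion-free symplectic connection $\nabla_{\partial_x}\partial_x=0$, $\nabla_{\partial_x}\partial_y=\nabla_{\partial_y}\partial_x=\frac1{2y}\partial_x$, $\nabla_{\partial_y}\partial_y=-\frac1{2y}\partial_y$; it satisfies $D^2=0$.) For $f\in C^\infty(M)$, $\hat f$ denotes the unique section of $\mathcal W$ with $D\hat f=0$ and $\hat f|_{u=v=0}=f$. **Quantized diffeomorphisms.** A local diffeomorphism $\gamma$ of $\mathbb R$, acting on $M$ by $\gamma(x,y)=(\gamma(x),y/\gamma'(x))$, lifts to sections of $\mathcal W,\mathcal W^+$ (and to forms) via its tangent map: $\gamma(a)(z,\zeta)=a\big(\gamma^{-1}(z),(d\gamma^{-1})_z\zeta\big)$. Set $\gamma(D)=\gamma\circ D\circ\gamma^{-1}$ and let $\Delta_\gamma$ be the $\mathcal W$-valued $1$-form, homogeneous of degree $2$ in $(u,v)$, with $\gamma(D)=D+\frac i\hbar[\Delta_\gamma,\cdot]$. Let $U_\gamma$ be the unique section of $\mathcal W^+$ satisfying $$U_\gamma=1+\delta^{-1}\Big\{(D+\delta)U_\gamma+\tfrac i\hbar\Delta_\gamma\circ U_\gamma\Big\};$$ it is invertible and satisfies $DU_\gamma=-\frac i\hbar\Delta_\gamma\circ U_\gamma$. All these objects are defined over the domains where the partial diffeomorphisms make sense. **Star product.** For $f\alpha,g\beta\in C_c^\infty(M)\rtimes\Gamma$, $$f\alpha\star g\beta=\Big(\hat f\circ U_\alpha^{-1}\circ\alpha(\hat g)\circ\alpha(U_\beta)^{-1}\circ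 U_{\alpha\beta}\Big)\Big|_{u=v=0}\,\alpha\beta,$$ extended $\mathbb C[[\hbar]]$-bilinearly. *)

theory Defs
  imports
    "HOL-Analysis.Analysis"
    "HOL-Library.Poly_Mapping"
    "HOL-Library.Function_Algebras"
    "HOL-Computational_Algebra.Formal_Power_Series"
begin

section \<open>Complex vector spaces and unital algebras\<close>

class cvector = ab_group_add +
  fixes scaleC :: "complex \<Rightarrow> 'a \<Rightarrow> 'a"  (infixr \<open>*\<^sub>C\<close> 75)
  assumes scaleC_add_right: "c *\<^sub>C (x + y) = c *\<^sub>C x + c *\<^sub>C y"
    and scaleC_add_left: "(c + d) *\<^sub>C x = c *\<^sub>C x + d *\<^sub>C x"
    and scaleC_scaleC: "c *\<^sub>C d *\<^sub>C x = (c * d) *\<^sub>C x"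
    and scaleC_one: "1 *\<^sub>C x = x"

class calgebra = cvector + ring_1 +
  assumes scaleC_mult_left: "(c *\<^sub>C x) * y = c *\<^sub>C (x * y)"
    and scaleC_mult_right: "x * (c *\<^sub>C y) = c *\<^sub>C (x * y)"

global_interpretation cvec: vector_space "scaleC :: complex \<Rightarrow> 'a \<Rightarrow> 'a::cvector"
  by unfold_locales (rule scaleC_add_right scaleC_add_left scaleC_scaleC scaleC_one)+

abbreviation clinear :: "('a::cvector \<Rightarrow> 'b::cvector) \<Rightarrow> bool" where
  "clinear \<equiv> Vector_Spaces.linear scaleC scaleC"

lemma clinearI:
  fixes f :: "'a::cvector \<Rightarrow> 'b::cvector"
  assumes "\<And>x y. f (x + y) = f x + f y" "\<And>c x. f (c *\<^sub>C x) = c *\<^sub>C f x"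
  shows "clinear f"
  by unfold_locales (simp_all add: assms)

lemma clinear_add: "clinear f \<Longrightarrow> f (x + y) = f x + f y"
  and clinear_scale: "clinear f \<Longrightarrow> f (c *\<^sub>C x) = c *\<^sub>C f x"
  for f :: "'a::cvector \<Rightarrow> 'b::cvector"
  by (simp_all add: module_hom.add module_hom.scale Vector_Spaces.linear_iff_module_hom)

lemma clinear_zero: "clinear f \<Longrightarrow> f 0 = 0"
  and clinear_diff: "clinear f \<Longrightarrow> f (x - y) = f x - f y"
  and clinear_minus: "clinear f \<Longrightarrow> f (- x) = - f x"
  and clinear_sum: "clinear f \<Longrightarrow> f (sum g A) = (\<Sum>a\<in>A. f (g a))"
  for f :: "'a::cvector \<Rightarrow> 'b::cvector"
  by (simp_all add: module_hom.zero module_hom.diff module_hom.neg module_hom.sum Vector_Spaces.linear_iff_module_hom)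

lemma clinear_comp: "clinear f \<Longrightarrow> clinear g \<Longrightarrow> clinear (\<lambda>x. f (g x))"
  by (rule clinearI) (simp_all add: clinear_add clinear_scale)

lemma clinear_vanish_span:
  assumes "clinear f" "\<And>x. x \<in> S \<Longrightarrow> f x = 0" "x \<in> cvec.span S"
  shows "f x = 0"
  using assms(3)
  by (induction rule: cvec.span_induct_alt)
     (simp_all add: clinear_zero[OF assms(1)] clinear_add[OF assms(1)] clinear_scale[OF assms(1)] assms(2))

lemma clinear_maps_span:
  assumes "clinear f" "\<And>x. x \<in> S \<Longrightarrow> f x \<in> cvec.span T" "x \<in> cvec.span S"
  shows "f x \<in> cvec.span T"
  using assms(3)
  by (induction rule: cvec.span_induct_alt)
     (simp_all add: clinear_zero[OF assms(1)] clinear_add[OF assms(1)] clinear_scale[OF assms(1)] assms(2)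
        cvec.span_zero cvec.span_add cvec.span_scale)

definition cbilinear :: "('a::cvector \<Rightarrow> 'b::cvector \<Rightarrow> 'c::cvector) \<Rightarrow> bool" where
  "cbilinear B \<longleftrightarrow> (\<forall>a. clinear (B a)) \<and> (\<forall>b. clinear (\<lambda>a. B a b))"

lemma cbilinearI:
  assumes "\<And>a. clinear (B a)" "\<And>b. clinear (\<lambda>a. B a b)"
  shows "cbilinear B"
  using assms by (simp add: cbilinear_def)

lemma cbilinearD1: "cbilinear B \<Longrightarrow> clinear (B a)"
  and cbilinearD2: "cbilinear B \<Longrightarrow> clinear (\<lambda>a. B a b)"
  by (simp_all add: cbilinear_def)

instantiation complex :: calgebra
begin
definition scaleC_complex :: "complex \<Rightarrow> complex \<Rightarrow> complex" where "scaleC_complex c x = c * x"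
instance by standard (simp_all add: scaleC_complex_def algebra_simps)
end

instantiation "fun" :: (type, cvector) cvector
begin
definition scaleC_fun :: "complex \<Rightarrow> ('a \<Rightarrow> 'b) \<Rightarrow> 'a \<Rightarrow> 'b" where "scaleC_fun c f = (\<lambda>x. c *\<^sub>C f x)"
instance
  by standard (simp_all add: scaleC_fun_def fun_eq_iff scaleC_add_right scaleC_add_left scaleC_scaleC scaleC_one)
end

instantiation poly_mapping :: (type, cvector) cvector
begin
lift_definition scaleC_poly_mapping :: "complex \<Rightarrow> ('a \<Rightarrow>\<^sub>0 'b) \<Rightarrow> ('a \<Rightarrow>\<^sub>0 'b)"
  is "\<lambda>c f k. c *\<^sub>C f k"
  by (rule finite_subset[rotated], assumption) auto
instance
  by standard (transfer; simp add: fun_eq_iff scaleC_add_right scaleC_add_left scaleC_scaleC scaleC_one)+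
end

lemma lookup_scaleC: "Poly_Mapping.lookup (c *\<^sub>C p) k = c *\<^sub>C Poly_Mapping.lookup p k"
  by transfer simp

definition free_extend :: "('k \<Rightarrow> 'v::cvector) \<Rightarrow> ('k \<Rightarrow>\<^sub>0 complex) \<Rightarrow> 'v" where
  "free_extend F p = (\<Sum>k\<in>Poly_Mapping.keys p. Poly_Mapping.lookup p k *\<^sub>C F k)"

lemma free_extend_superset:
  assumes "finite S" "Poly_Mapping.keys p \<subseteq> S"
  shows "free_extend F p = (\<Sum>k\<in>S. Poly_Mapping.lookup p k *\<^sub>C F k)"
  unfolding free_extend_def using assms by (intro sum.mono_neutral_left) (auto simp: in_keys_iff)

lemma free_extend_single [simp]: "free_extend F (Poly_Mapping.single k c) = c *\<^sub>C F k"
  by (cases "c = 0") (simp_all add: free_extend_def)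

lemma clinear_free_extend: "clinear (free_extend F)"
proof (rule clinearI)
  fix p q :: "'a \<Rightarrow>\<^sub>0 complex"
  let ?S = "Poly_Mapping.keys p \<union> Poly_Mapping.keys q"
  show "free_extend F (p + q) = free_extend F p + free_extend F q"
    using free_extend_superset[of ?S p F] free_extend_superset[of ?S q F]
      free_extend_superset[of ?S "p + q" F] keys_add[of p q]
    by (simp add: lookup_add scaleC_add_left sum.distrib)
next
  fix c and p :: "'a \<Rightarrow>\<^sub>0 complex"
  have "Poly_Mapping.keys (c *\<^sub>C p) \<subseteq> Poly_Mapping.keys p"
    by (auto simp: in_keys_iff lookup_scaleC)
  then show "free_extend F (c *\<^sub>C p) = c *\<^sub>C free_extend F p"
    using free_extend_superset[of "Poly_Mapping.keys p" "c *\<^sub>C p" F]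
    by (simp add: free_extend_def lookup_scaleC cvec.scale_sum_right scaleC_complex_def scaleC_scaleC)
qed

lemma free_induct [case_names single add]:
  fixes p :: "'k \<Rightarrow>\<^sub>0 complex"
  assumes "\<And>k c. P (Poly_Mapping.single k c)" "\<And>p q. P p \<Longrightarrow> P q \<Longrightarrow> P (p + q)"
  shows "P p"
proof -
  have "P (\<Sum>k\<in>K. Poly_Mapping.single k (f k))" if "finite K" for K :: "'k set" and f
    using that
  proof (induction K)
    case empty
    then show ?case using assms(1)[of undefined 0] by simp
  qed (simp add: assms)
  moreover have "p = (\<Sum>k\<in>Poly_Mapping.keys p. Poly_Mapping.single k (Poly_Mapping.lookup p k))"
    by (rule poly_mapping_eqI) (auto simp: lookup_sum lookup_single when_def in_keys_iff sum.delta)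
  ultimately show ?thesis by (metis finite_keys)
qed


section \<open>Tensor products over the complex numbers\<close>

definition tensor_null :: "(('a::cvector \<times> 'b::cvector) \<Rightarrow>\<^sub>0 complex) set" where
  "tensor_null = cvec.span
     ({Poly_Mapping.single (a + a', b) 1 - Poly_Mapping.single (a, b) 1 - Poly_Mapping.single (a', b) 1 | a a' b. True}
    \<union> {Poly_Mapping.single (a, b + b') 1 - Poly_Mapping.single (a, b) 1 - Poly_Mapping.single (a, b') 1 | a b b'. True}
    \<union> {Poly_Mapping.single (c *\<^sub>C a, b) 1 - c *\<^sub>C Poly_Mapping.single (a, b) 1 | c a b. True}
    \<union> {Poly_Mapping.single (a, c *\<^sub>C b) 1 - c *\<^sub>C Poly_Mapping.single (a, b) 1 | c a b. True})"

lemma span_equivp: "equivp (\<lambda>p q. p - q \<in> cvec.span S)"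
proof (rule equivpI)
  show "reflp (\<lambda>p q. p - q \<in> cvec.span S)" by (simp add: reflp_def cvec.span_zero)
  show "symp (\<lambda>p q. p - q \<in> cvec.span S)" 
  proof (rule sympI)
    fix p q assume "p - q \<in> cvec.span S"
    from cvec.span_neg[OF this] show "q - p \<in> cvec.span S" by simp
  qed
  show "transp (\<lambda>p q. p - q \<in> cvec.span S)"
  proof (rule transpI)
    fix p q r assume "p - q \<in> cvec.span S" "q - r \<in> cvec.span S"
    from cvec.span_add[OF this] show "p - r \<in> cvec.span S" by simp
  qed
qed

quotient_type (overloaded) ('a, 'b) tensor =
  "('a::cvector \<times> 'b::cvector) \<Rightarrow>\<^sub>0 complex" / "\<lambda>p q. p - q \<in> tensor_null"
  unfolding tensor_null_def by (rule span_equivp)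

instantiation tensor :: (cvector, cvector) cvector
begin
lift_definition zero_tensor :: "('a, 'b) tensor" is 0 .
lift_definition plus_tensor :: "('a, 'b) tensor \<Rightarrow> ('a, 'b) tensor \<Rightarrow> ('a, 'b) tensor" is "(+)"
proof -
  fix p p' q q' :: "('a \<times> 'b) \<Rightarrow>\<^sub>0 complex"
  assume "p - p' \<in> tensor_null" "q - q' \<in> tensor_null"
  then have "(p - p') + (q - q') \<in> tensor_null" unfolding tensor_null_def by (rule cvec.span_add)
  also have "(p - p') + (q - q') = (p + q) - (p' + q')" by simp
  finally show "(p + q) - (p' + q') \<in> tensor_null" .
qed
lift_definition minus_tensor :: "('a, 'b) tensor \<Rightarrow> ('a, 'b) tensor \<Rightarrow> ('a, 'b) tensor" is "(-)"
proof -
  fix p p' q q' :: "('a \<times> 'b) \<Rightarrow>\<^sub>0 complex"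
  assume "p - p' \<in> tensor_null" "q - q' \<in> tensor_null"
  then have "(p - p') - (q - q') \<in> tensor_null" unfolding tensor_null_def by (rule cvec.span_diff)
  also have "(p - p') - (q - q') = (p - q) - (p' - q')" by simp
  finally show "(p - q) - (p' - q') \<in> tensor_null" .
qed
lift_definition uminus_tensor :: "('a, 'b) tensor \<Rightarrow> ('a, 'b) tensor" is uminus
proof -
  fix p p' :: "('a \<times> 'b) \<Rightarrow>\<^sub>0 complex"
  assume "p - p' \<in> tensor_null"
  then have "- (p - p') \<in> tensor_null" unfolding tensor_null_def by (rule cvec.span_neg)
  also have "- (p - p') = (- p) - (- p')" by simp
  finally show "(- p) - (- p') \<in> tensor_null" .
qed
lift_definition scaleC_tensor :: "complex \<Rightarrow> ('a, 'b) tensor \<Rightarrow> ('a, 'b) tensor" is scaleC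
proof -
  fix c and p p' :: "('a \<times> 'b) \<Rightarrow>\<^sub>0 complex"
  assume "p - p' \<in> tensor_null"
  then have "c *\<^sub>C (p - p') \<in> tensor_null" unfolding tensor_null_def by (rule cvec.span_scale)
  then show "c *\<^sub>C p - c *\<^sub>C p' \<in> tensor_null" by (simp only: cvec.scale_right_diff_distrib)
qed
instance
proof
  fix r s t :: "('a, 'b) tensor" and c d
  show "r + s + t = r + (s + t)"
    by (induct r, induct s, induct t) (simp only: plus_tensor.abs_eq add.assoc)
  show "r + s = s + r"
    by (induct r, induct s) (simp only: plus_tensor.abs_eq add.commute)
  show "0 + r = r"
    by (induct r) (simp only: plus_tensor.abs_eq zero_tensor.abs_eq add_0)
  show "- r + r = 0"
    by (induct r) (simp only: plus_tensor.abs_eq zero_tensor.abs_eq uminus_tensor.abs_eq left_minus)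
  show "r - s = r + - s"
    by (induct r, induct s)
       (simp only: plus_tensor.abs_eq minus_tensor.abs_eq uminus_tensor.abs_eq diff_conv_add_uminus)
  show "c *\<^sub>C (r + s) = c *\<^sub>C r + c *\<^sub>C s"
    by (induct r, induct s) (simp only: plus_tensor.abs_eq scaleC_tensor.abs_eq scaleC_add_right)
  show "(c + d) *\<^sub>C r = c *\<^sub>C r + d *\<^sub>C r"
    by (induct r) (simp only: plus_tensor.abs_eq scaleC_tensor.abs_eq scaleC_add_left)
  show "c *\<^sub>C d *\<^sub>C r = (c * d) *\<^sub>C r"
    by (induct r) (simp only: scaleC_tensor.abs_eq scaleC_scaleC)
  show "1 *\<^sub>C r = r"
    by (induct r) (simp only: scaleC_tensor.abs_eq scaleC_one)
qed
end

lift_definition tensor_mk :: "'a::cvector \<Rightarrow> 'b::cvector \<Rightarrow> ('a, 'b) tensor"  (infixr \<open>\<otimes>\<close> 72)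
  is "\<lambda>a b. Poly_Mapping.single (a, b) 1" .

text \<open>The linear map on the tensor product induced by a bilinear map \<open>B\<close>. It is only meaningful
  for bilinear \<open>B\<close>; then the value does not depend on the representative, see
  \<open>tensor_lift_abs\<close>.\<close>

definition tensor_lift :: "('a::cvector \<Rightarrow> 'b::cvector \<Rightarrow> 'c::cvector) \<Rightarrow> ('a, 'b) tensor \<Rightarrow> 'c" where
  "tensor_lift B t = free_extend (\<lambda>(a, b). B a b) (rep_tensor t)"

lemma tensor_lift_abs:
  assumes "cbilinear B"
  shows "tensor_lift B (abs_tensor p) = free_extend (\<lambda>(a, b). B a b) p"
proof -
  let ?L = "free_extend (\<lambda>(a, b). B a b)"
  have lin: "clinear ?L" by (rule clinear_free_extend)
  note B = clinear_add[OF cbilinearD1[OF assms]] clinear_scale[OF cbilinearD1[OF assms]]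
    clinear_add[OF cbilinearD2[OF assms]] clinear_scale[OF cbilinearD2[OF assms]]
  have "?L q = 0" if "q \<in> tensor_null" for q
    using that unfolding tensor_null_def
    by (rule clinear_vanish_span[OF lin, rotated])
       (auto simp: clinear_diff[OF lin] clinear_scale[OF lin] scaleC_one B)
  moreover have "rep_tensor (abs_tensor p) - p \<in> tensor_null"
    by (rule Quotient_rep_abs[OF Quotient_tensor]) (simp add: tensor_null_def cvec.span_zero)
  ultimately show ?thesis
    using clinear_diff[OF lin, of "rep_tensor (abs_tensor p)" p] by (simp add: tensor_lift_def)
qed

lemma tensor_lift_mk [simp]: "cbilinear B \<Longrightarrow> tensor_lift B (a \<otimes> b) = B a b"
  by (simp add: tensor_mk.abs_eq tensor_lift_abs scaleC_one)

lemma clinear_abs_tensor: "clinear abs_tensor"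
  by (rule clinearI) (simp_all add: plus_tensor.abs_eq scaleC_tensor.abs_eq)

lemma clinear_tensor_lift:
  assumes "cbilinear B"
  shows "clinear (tensor_lift B)"
proof (rule clinearI)
  show "tensor_lift B (s + t) = tensor_lift B s + tensor_lift B t" for s t
    by (induct s, induct t)
       (simp add: plus_tensor.abs_eq tensor_lift_abs[OF assms] clinear_add[OF clinear_free_extend])
  show "tensor_lift B (c *\<^sub>C t) = c *\<^sub>C tensor_lift B t" for c t
    by (induct t)
       (simp add: scaleC_tensor.abs_eq tensor_lift_abs[OF assms] clinear_scale[OF clinear_free_extend])
qed

lemma cbilinear_tensor_mk: "cbilinear (\<otimes>)"
proof (intro cbilinearI clinearI)
  fix a a' :: 'a and b b' :: 'b and c
  have *: "p = q" if "abs_tensor p' = p" "abs_tensor q' = q" "p' - q' \<in> tensor_null"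
    for p q :: "('a, 'b) tensor" and p' q'
    using that tensor.abs_eq_iff by metis
  show "a \<otimes> (b + b') = a \<otimes> b + a \<otimes> b'"
    unfolding tensor_mk.abs_eq plus_tensor.abs_eq
    by (rule *[OF refl refl], unfold tensor_null_def diff_diff_add[symmetric], rule cvec.span_base) blast
  show "(a + a') \<otimes> b = a \<otimes> b + a' \<otimes> b"
    unfolding tensor_mk.abs_eq plus_tensor.abs_eq
    by (rule *[OF refl refl], unfold tensor_null_def diff_diff_add[symmetric], rule cvec.span_base) blast
  show "a \<otimes> (c *\<^sub>C b) = c *\<^sub>C (a \<otimes> b)"
    unfolding tensor_mk.abs_eq scaleC_tensor.abs_eq
    by (rule *[OF refl refl], unfold tensor_null_def, rule cvec.span_base) blast
  show "(c *\<^sub>C a) \<otimes> b = c *\<^sub>C (a \<otimes> b)"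
    unfolding tensor_mk.abs_eq scaleC_tensor.abs_eq
    by (rule *[OF refl refl], unfold tensor_null_def, rule cvec.span_base) blast
qed

lemmas clinear_mk1 = cbilinearD1[OF cbilinear_tensor_mk]
lemmas clinear_mk2 = cbilinearD2[OF cbilinear_tensor_mk]
lemmas tensor_mk_simps =
  clinear_add[OF clinear_mk1] clinear_scale[OF clinear_mk1] clinear_zero[OF clinear_mk1]
  clinear_diff[OF clinear_mk1] clinear_minus[OF clinear_mk1]
  clinear_add[OF clinear_mk2] clinear_scale[OF clinear_mk2] clinear_zero[OF clinear_mk2]
  clinear_diff[OF clinear_mk2] clinear_minus[OF clinear_mk2]

lemma tensor_induct [case_names mk add]:
  fixes t :: "('a::cvector, 'b::cvector) tensor"
  assumes mk: "\<And>a b. P (a \<otimes> b)" and add: "\<And>s t. P s \<Longrightarrow> P t \<Longrightarrow> P (s + t)"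
  shows "P t"
proof -
  have "P (abs_tensor p)" for p :: "('a \<times> 'b) \<Rightarrow>\<^sub>0 complex"
  proof (induction p rule: free_induct)
    case (single k c)
    obtain a b where k: "k = (a, b)" by (cases k)
    have eq: "Poly_Mapping.single k c = c *\<^sub>C Poly_Mapping.single (a, b) 1"
      by (rule poly_mapping_eqI) (simp add: lookup_scaleC lookup_single when_def k scaleC_complex_def)
    have "abs_tensor (Poly_Mapping.single k c) = (c *\<^sub>C a) \<otimes> b"
      unfolding eq scaleC_tensor.abs_eq[symmetric] tensor_mk.abs_eq[symmetric] tensor_mk_simps ..
    then show ?case using mk by simp
  next
    case (add p q)
    then show ?case using assms(2) by (metis plus_tensor.abs_eq)
  qed
  then show ?thesis by (induct t) auto
qed

lemma cbilinear_mult_mk: "cbilinear (\<lambda>a' b'. (a * a') \<otimes> (b * b'))"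
  for a :: "'a::calgebra" and b :: "'b::calgebra"
  by (intro cbilinearI clinearI) (simp_all add: algebra_simps tensor_mk_simps scaleC_mult_right)

definition tensor_lmult ::
    "'a::calgebra \<Rightarrow> 'b::calgebra \<Rightarrow> ('a, 'b) tensor \<Rightarrow> ('a, 'b) tensor" where
  "tensor_lmult a b = tensor_lift (\<lambda>a' b'. (a * a') \<otimes> (b * b'))"

definition tensor_mult ::
    "('a::calgebra, 'b::calgebra) tensor \<Rightarrow> ('a, 'b) tensor \<Rightarrow> ('a, 'b) tensor" where
  "tensor_mult s t = tensor_lift (\<lambda>a b. tensor_lmult a b t) s"

lemma tensor_lmult_mk: "tensor_lmult a b (a' \<otimes> b') = (a * a') \<otimes> (b * b')"
  by (simp add: tensor_lmult_def tensor_lift_mk[OF cbilinear_mult_mk])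

lemmas clinear_lmult = clinear_tensor_lift[OF cbilinear_mult_mk, folded tensor_lmult_def]
lemmas tensor_lmult_simps = tensor_lmult_mk clinear_add[OF clinear_lmult] clinear_scale[OF clinear_lmult]

lemma cbilinear_lmult: "cbilinear (\<lambda>a b. tensor_lmult a b t)"
proof (intro cbilinearI clinearI)
  show "tensor_lmult a (x + y) t = tensor_lmult a x t + tensor_lmult a y t" for a x y
    by (induction t rule: tensor_induct) (simp_all add: tensor_lmult_simps distrib_right tensor_mk_simps)
  show "tensor_lmult (x + y) b t = tensor_lmult x b t + tensor_lmult y b t" for b x y
    by (induction t rule: tensor_induct) (simp_all add: tensor_lmult_simps distrib_right tensor_mk_simps)
  show "tensor_lmult a (c *\<^sub>C x) t = c *\<^sub>C tensor_lmult a x t" for a c x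
    by (induction t rule: tensor_induct)
       (simp_all add: tensor_lmult_simps scaleC_mult_left tensor_mk_simps scaleC_add_right)
  show "tensor_lmult (c *\<^sub>C x) b t = c *\<^sub>C tensor_lmult x b t" for b c x
    by (induction t rule: tensor_induct)
       (simp_all add: tensor_lmult_simps scaleC_mult_left tensor_mk_simps scaleC_add_right)
qed

lemma tensor_mult_lmult: "tensor_mult (a \<otimes> b) t = tensor_lmult a b t"
  by (simp add: tensor_mult_def tensor_lift_mk[OF cbilinear_lmult])

lemma tensor_mult_left:
  "tensor_mult (r + s) t = tensor_mult r t + tensor_mult s t"
  "tensor_mult (c *\<^sub>C s) t = c *\<^sub>C tensor_mult s t"
  unfolding tensor_mult_def
  by (rule clinear_add clinear_scale, rule clinear_tensor_lift[OF cbilinear_lmult])+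

lemma tensor_mult_right:
  "tensor_mult s (r + t) = tensor_mult s r + tensor_mult s t"
  "tensor_mult s (c *\<^sub>C t) = c *\<^sub>C tensor_mult s t"
  by (induction s rule: tensor_induct)
     (simp_all add: tensor_mult_lmult tensor_lmult_simps tensor_mult_left scaleC_add_right)

lemma tensor_mult_mk: "tensor_mult (a \<otimes> b) (a' \<otimes> b') = (a * a') \<otimes> (b * b')"
  by (simp add: tensor_mult_lmult tensor_lmult_mk)

lemmas tensor_mult_simps = tensor_mult_left tensor_mult_right

lemma exists_unital_functional: "\<exists>f :: 'a::calgebra \<Rightarrow> complex. clinear f \<and> f 1 = 1"
proof -
  interpret vector_space_pair "scaleC :: complex \<Rightarrow> 'a \<Rightarrow> 'a" "scaleC :: complex \<Rightarrow> complex \<Rightarrow> complex" ..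
  have "cvec.independent {1 :: 'a}" by (simp add: cvec.independent_insert cvec.independent_empty)
  from linear_independent_extend[OF this, of "\<lambda>_. 1"] show ?thesis by auto
qed

instantiation tensor :: (calgebra, calgebra) calgebra
begin
definition one_tensor :: "('a, 'b) tensor" where "one_tensor = 1 \<otimes> 1"
definition times_tensor :: "('a, 'b) tensor \<Rightarrow> ('a, 'b) tensor \<Rightarrow> ('a, 'b) tensor" where
  "times_tensor = tensor_mult"
instance
proof
  fix r s t :: "('a, 'b) tensor" and c
  show "(r + s) * t = r * t + s * t" "r * (s + t) = r * s + r * t"
    "(c *\<^sub>C r) * s = c *\<^sub>C (r * s)" "r * (c *\<^sub>C s) = c *\<^sub>C (r * s)"
    by (simp_all add: times_tensor_def tensor_mult_simps)
  show "(r * s) * t = r * (s * t)"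
    unfolding times_tensor_def
  proof (induction r rule: tensor_induct)
    case mk: (mk a b)
    show ?case
    proof (induction s rule: tensor_induct)
      case (mk a' b')
      show ?case
        by (induction t rule: tensor_induct) (simp_all add: tensor_mult_mk tensor_mult_simps mult.assoc)
    qed (simp add: tensor_mult_simps)
  qed (simp add: tensor_mult_simps)
  show "1 * t = t" "t * 1 = t"
    unfolding times_tensor_def one_tensor_def
    by (induction t rule: tensor_induct) (simp_all add: tensor_mult_mk tensor_mult_simps)
  obtain f :: "'a \<Rightarrow> complex" where f: "clinear f" "f 1 = 1" using exists_unital_functional by blast
  obtain g :: "'b \<Rightarrow> complex" where g: "clinear g" "g 1 = 1" using exists_unital_functional by blast
  have B: "cbilinear (\<lambda>a b. f a * g b)"
    by (intro cbilinearI clinearI)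
       (simp_all add: clinear_add[OF f(1)] clinear_scale[OF f(1)] clinear_add[OF g(1)] clinear_scale[OF g(1)]
          algebra_simps scaleC_complex_def)
  have "tensor_lift (\<lambda>a b. f a * g b) (1 \<otimes> 1) = 1" by (simp add: B f g)
  moreover have "tensor_lift (\<lambda>a b. f a * g b) 0 = 0" by (rule clinear_zero[OF clinear_tensor_lift[OF B]])
  ultimately show "(0 :: ('a, 'b) tensor) \<noteq> 1" unfolding one_tensor_def by auto
qed
end

lemma tensor_times_mk: "(a \<otimes> b) * (a' \<otimes> b') = (a * a') \<otimes> (b * b')"
  by (simp add: times_tensor_def tensor_mult_mk)

definition tensor_map ::
    "('a::cvector \<Rightarrow> 'c::cvector) \<Rightarrow> ('b::cvector \<Rightarrow> 'd::cvector) \<Rightarrow> ('a, 'b) tensor \<Rightarrow> ('c, 'd) tensor" where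
  "tensor_map f g = tensor_lift (\<lambda>a b. f a \<otimes> g b)"

definition tensor_assoc ::
    "('a::cvector, ('b::cvector, 'c::cvector) tensor) tensor \<Rightarrow> (('a, 'b) tensor, 'c) tensor" where
  "tensor_assoc = tensor_lift (\<lambda>a. tensor_lift (\<lambda>b c. (a \<otimes> b) \<otimes> c))"

definition fps_map :: "('a \<Rightarrow> 'b) \<Rightarrow> 'a fps \<Rightarrow> 'b fps" where
  "fps_map f F = Abs_fps (\<lambda>n. f (fps_nth F n))"


section \<open>The Connes--Moscovici Hopf algebra\<close>

datatype 'g monomial = Monomial (letters: "'g list")

instantiation monomial :: (type) monoid_add
begin
definition zero_monomial :: "'a monomial" where "zero_monomial = Monomial []"
definition plus_monomial :: "'a monomial \<Rightarrow> 'a monomial \<Rightarrow> 'a monomial" where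
  "v + w = Monomial (letters v @ letters w)"
instance by standard (simp_all add: zero_monomial_def plus_monomial_def)
end

text \<open>The free unital algebra on \<open>'g\<close> is the convolution algebra of the free monoid, whose
  operation (concatenation) is written additively as the library's product on
  \<^type>\<open>poly_mapping\<close> requires.\<close>

type_synonym 'g free_algebra = "'g monomial \<Rightarrow>\<^sub>0 complex"

definition gen :: "'g \<Rightarrow> 'g free_algebra" where
  "gen g = Poly_Mapping.single (Monomial [g]) 1"

definition free_hom :: "('g \<Rightarrow> 'a::calgebra) \<Rightarrow> 'g free_algebra \<Rightarrow> 'a" where
  "free_hom \<phi> = free_extend (\<lambda>w. prod_list (map \<phi> (letters w)))"

lemma single_scale: "Poly_Mapping.single k c = c *\<^sub>C Poly_Mapping.single k 1"
  by (rule poly_mapping_eqI) (simp add: lookup_scaleC lookup_single when_def scaleC_complex_def)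

lemma free_algebra_mult_scale:
  fixes p q :: "'g free_algebra"
  shows "(c *\<^sub>C p) * q = c *\<^sub>C (p * q)" "p * (c *\<^sub>C q) = c *\<^sub>C (p * q)"
proof -
  have sc: "c *\<^sub>C Poly_Mapping.single k d = Poly_Mapping.single k (c * d)" for k :: "'g monomial" and d
    by (rule poly_mapping_eqI) (simp add: lookup_scaleC lookup_single when_def scaleC_complex_def)
  have "(c *\<^sub>C p) * q = c *\<^sub>C (p * q) \<and> p * (c *\<^sub>C q) = c *\<^sub>C (p * q)"
  proof (induction p rule: free_induct)
    case (single k d)
    show ?case
      by (induction q rule: free_induct)
         (simp_all add: sc mult_single mult.assoc mult.left_commute distrib_left scaleC_add_right)
  qed (simp add: distrib_right scaleC_add_right)
  then show "(c *\<^sub>C p) * q = c *\<^sub>C (p * q)" "p * (c *\<^sub>C q) = c *\<^sub>C (p * q)" by auto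
qed

lemma clinear_free_hom: "clinear (free_hom \<phi>)"
  unfolding free_hom_def by (rule clinear_free_extend)

lemma free_hom_gen: "free_hom \<phi> (gen g) = \<phi> g"
  by (simp add: free_hom_def gen_def scaleC_one)

lemma free_hom_one: "free_hom \<phi> 1 = 1"
proof -
  have one: "(1 :: 'b free_algebra) = Poly_Mapping.single (Monomial []) 1"
    by (metis single_one zero_monomial_def)
  show ?thesis unfolding one by (simp add: free_hom_def scaleC_one)
qed

lemma free_hom_mult: "free_hom \<phi> (p * q) = free_hom \<phi> p * free_hom \<phi> q"
proof (induction p rule: free_induct)
  case (single k c)
  show ?case
  proof (induction q rule: free_induct)
    case (single l d)
    show ?case
      by (simp add: mult_single free_hom_def plus_monomial_def scaleC_mult_left scaleC_mult_right scaleC_scaleC)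
  qed (simp add: distrib_left clinear_add[OF clinear_free_hom])
qed (simp add: distrib_right clinear_add[OF clinear_free_hom])


text \<open>Generators; \<open>GD k\<close> stands for \<open>\<delta>\<^bsub>k+1\<^esub>\<close>, so that the family is indexed from \<open>1\<close>.\<close>

datatype h1_gen = GX | GY | GD nat

inductive_set h1_relators :: "h1_gen free_algebra set" where
  YX: "gen GY * gen GX - gen GX * gen GY - gen GX \<in> h1_relators"
| YD: "gen GY * gen (GD k) - gen (GD k) * gen GY - of_nat (k + 1) * gen (GD k) \<in> h1_relators"
| XD: "gen GX * gen (GD k) - gen (GD k) * gen GX - gen (GD (k + 1)) \<in> h1_relators"
| DD: "gen (GD k) * gen (GD l) - gen (GD l) * gen (GD k) \<in> h1_relators"

definition h1_ideal :: "h1_gen free_algebra set" where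
  "h1_ideal = cvec.span {p * r * q | p r q. r \<in> h1_relators}"

quotient_type h1 = "h1_gen free_algebra" / "\<lambda>p q. p - q \<in> h1_ideal"
  unfolding h1_ideal_def by (rule span_equivp)

lemma free_hom_ideal:
  assumes "\<And>r. r \<in> h1_relators \<Longrightarrow> free_hom \<phi> r = 0" "p \<in> h1_ideal"
  shows "free_hom \<phi> p = 0"
  using assms(2) unfolding h1_ideal_def
  by (rule clinear_vanish_span[OF clinear_free_hom, rotated]) (auto simp: free_hom_mult assms(1))

lemma h1_ideal_mult:
  assumes "p \<in> h1_ideal"
  shows "q * p \<in> h1_ideal" "p * q \<in> h1_ideal"
proof -
  let ?S = "{p * r * q | p r q. r \<in> h1_relators}"
  have 1: "clinear (\<lambda>p :: h1_gen free_algebra. q * p)"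
    by (rule clinearI) (simp_all add: distrib_left free_algebra_mult_scale)
  have 2: "clinear (\<lambda>p :: h1_gen free_algebra. p * q)"
    by (rule clinearI) (simp_all add: distrib_right free_algebra_mult_scale)
  have "q * x \<in> cvec.span ?S" if "x \<in> ?S" for x
  proof -
    from that obtain a r b where "x = a * r * b" and r: "r \<in> h1_relators" by blast
    then have "q * x = (q * a) * r * b" by (simp add: mult.assoc)
    with r have "q * x \<in> ?S" by blast
    then show ?thesis by (rule cvec.span_base)
  qed
  from clinear_maps_span[OF 1 this assms[unfolded h1_ideal_def]]
  show "q * p \<in> h1_ideal" by (simp add: h1_ideal_def)
  have "x * q \<in> cvec.span ?S" if "x \<in> ?S" for x
  proof -
    from that obtain a r b where "x = a * r * b" and r: "r \<in> h1_relators" by blast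
    then have "x * q = a * r * (b * q)" by (simp add: mult.assoc)
    with r have "x * q \<in> ?S" by blast
    then show ?thesis by (rule cvec.span_base)
  qed
  from clinear_maps_span[OF 2 this assms[unfolded h1_ideal_def]]
  show "p * q \<in> h1_ideal" by (simp add: h1_ideal_def)
qed

lemma one_notin_h1_ideal: "1 \<notin> h1_ideal"
proof
  assume *: "1 \<in> h1_ideal"
  have "free_hom (\<lambda>_. 0 :: complex) r = 0" if "r \<in> h1_relators" for r
    using that by cases (simp_all add: clinear_diff[OF clinear_free_hom] free_hom_mult free_hom_gen)
  from this * have "free_hom (\<lambda>_. 0 :: complex) (1 :: h1_gen free_algebra) = 0"
    by (rule free_hom_ideal)
  then show False by (simp add: free_hom_one)
qed

instantiation h1 :: calgebra
begin
lift_definition zero_h1 :: h1 is 0 .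
lift_definition one_h1 :: h1 is 1 .
lift_definition plus_h1 :: "h1 \<Rightarrow> h1 \<Rightarrow> h1" is "(+)"
proof -
  fix p p' q q'
  assume "p - p' \<in> h1_ideal" "q - q' \<in> h1_ideal"
  then have "(p - p') + (q - q') \<in> h1_ideal" unfolding h1_ideal_def by (rule cvec.span_add)
  also have "(p - p') + (q - q') = (p + q) - (p' + q')" by simp
  finally show "(p + q) - (p' + q') \<in> h1_ideal" .
qed
lift_definition minus_h1 :: "h1 \<Rightarrow> h1 \<Rightarrow> h1" is "(-)"
proof -
  fix p p' q q'
  assume "p - p' \<in> h1_ideal" "q - q' \<in> h1_ideal"
  then have "(p - p') - (q - q') \<in> h1_ideal" unfolding h1_ideal_def by (rule cvec.span_diff)
  also have "(p - p') - (q - q') = (p - q) - (p' - q')" by simp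
  finally show "(p - q) - (p' - q') \<in> h1_ideal" .
qed
lift_definition uminus_h1 :: "h1 \<Rightarrow> h1" is uminus
proof -
  fix p p'
  assume "p - p' \<in> h1_ideal"
  then have "- (p - p') \<in> h1_ideal" unfolding h1_ideal_def by (rule cvec.span_neg)
  also have "- (p - p') = (- p) - (- p')" by simp
  finally show "(- p) - (- p') \<in> h1_ideal" .
qed
lift_definition times_h1 :: "h1 \<Rightarrow> h1 \<Rightarrow> h1" is "(*)"
proof -
  fix p p' q q'
  assume "p - p' \<in> h1_ideal" "q - q' \<in> h1_ideal"
  then have "(p - p') * q \<in> h1_ideal" "p' * (q - q') \<in> h1_ideal" by (simp_all only: h1_ideal_mult)
  then have "(p - p') * q + p' * (q - q') \<in> h1_ideal" unfolding h1_ideal_def by (rule cvec.span_add)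
  also have "(p - p') * q + p' * (q - q') = p * q - p' * q'" by (simp add: algebra_simps)
  finally show "p * q - p' * q' \<in> h1_ideal" .
qed
lift_definition scaleC_h1 :: "complex \<Rightarrow> h1 \<Rightarrow> h1" is scaleC
proof -
  fix c and p p' :: "h1_gen free_algebra"
  assume "p - p' \<in> h1_ideal"
  then have "c *\<^sub>C (p - p') \<in> h1_ideal" unfolding h1_ideal_def by (rule cvec.span_scale)
  then show "c *\<^sub>C p - c *\<^sub>C p' \<in> h1_ideal" by (simp only: cvec.scale_right_diff_distrib)
qed
instance
proof
  fix r s t :: h1 and c d
  show "r + s + t = r + (s + t)"
    by (induct r, induct s, induct t) (simp only: plus_h1.abs_eq add.assoc)
  show "r + s = s + r"
    by (induct r, induct s) (simp only: plus_h1.abs_eq add.commute)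
  show "0 + r = r"
    by (induct r) (simp only: plus_h1.abs_eq zero_h1.abs_eq add_0)
  show "- r + r = 0"
    by (induct r) (simp only: plus_h1.abs_eq zero_h1.abs_eq uminus_h1.abs_eq left_minus)
  show "r - s = r + - s"
    by (induct r, induct s)
       (simp only: plus_h1.abs_eq minus_h1.abs_eq uminus_h1.abs_eq diff_conv_add_uminus)
  show "c *\<^sub>C (r + s) = c *\<^sub>C r + c *\<^sub>C s"
    by (induct r, induct s) (simp only: plus_h1.abs_eq scaleC_h1.abs_eq scaleC_add_right)
  show "(c + d) *\<^sub>C r = c *\<^sub>C r + d *\<^sub>C r"
    by (induct r) (simp only: plus_h1.abs_eq scaleC_h1.abs_eq scaleC_add_left)
  show "c *\<^sub>C d *\<^sub>C r = (c * d) *\<^sub>C r"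
    by (induct r) (simp only: scaleC_h1.abs_eq scaleC_scaleC)
  show "1 *\<^sub>C r = r"
    by (induct r) (simp only: scaleC_h1.abs_eq scaleC_one)
  show "(r * s) * t = r * (s * t)"
    by (induct r, induct s, induct t) (simp only: times_h1.abs_eq mult.assoc)
  show "1 * r = r"
    by (induct r) (simp only: times_h1.abs_eq one_h1.abs_eq mult_1_left)
  show "r * 1 = r"
    by (induct r) (simp only: times_h1.abs_eq one_h1.abs_eq mult_1_right)
  show "(r + s) * t = r * t + s * t"
    by (induct r, induct s, induct t) (simp only: times_h1.abs_eq plus_h1.abs_eq distrib_right)
  show "r * (s + t) = r * s + r * t"
    by (induct r, induct s, induct t) (simp only: times_h1.abs_eq plus_h1.abs_eq distrib_left)
  show "(c *\<^sub>C r) * s = c *\<^sub>C (r * s)" "r * (c *\<^sub>C s) = c *\<^sub>C (r * s)"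
    by (induct r, induct s, simp only: times_h1.abs_eq scaleC_h1.abs_eq free_algebra_mult_scale)+
  show "(0 :: h1) \<noteq> 1"
    unfolding zero_h1.abs_eq one_h1.abs_eq h1.abs_eq_iff
  proof
    assume "0 - 1 \<in> h1_ideal"
    then have "- (0 - 1) \<in> h1_ideal" unfolding h1_ideal_def by (rule cvec.span_neg)
    with one_notin_h1_ideal show False by simp
  qed
qed
end

lift_definition h1_of :: "h1_gen \<Rightarrow> h1" is gen .

abbreviation hX :: h1 where "hX \<equiv> h1_of GX"
abbreviation hY :: h1 where "hY \<equiv> h1_of GY"

text \<open>\<open>hdelta n\<close> is \<open>\<delta>\<^bsub>n\<^esub>\<close> for \<open>n \<ge> 1\<close>.\<close>

definition hdelta :: "nat \<Rightarrow> h1" where "hdelta n = h1_of (GD (n - 1))"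

text \<open>The algebra homomorphism out of \<^typ>\<open>h1\<close> with values \<open>\<phi>\<close> on the generators,
  provided \<open>\<phi>\<close> respects the relations.\<close>

definition h1_hom :: "(h1_gen \<Rightarrow> 'a::calgebra) \<Rightarrow> h1 \<Rightarrow> 'a" where
  "h1_hom \<phi> h = free_hom \<phi> (rep_h1 h)"

lemma h1_hom_abs:
  assumes "\<And>r. r \<in> h1_relators \<Longrightarrow> free_hom \<phi> r = 0"
  shows "h1_hom \<phi> (abs_h1 p) = free_hom \<phi> p"
proof -
  have "rep_h1 (abs_h1 p) - p \<in> h1_ideal"
    by (rule Quotient_rep_abs[OF Quotient_h1]) (simp add: h1_ideal_def cvec.span_zero)
  from free_hom_ideal[OF assms this] show ?thesis
    by (simp add: h1_hom_def clinear_diff[OF clinear_free_hom])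
qed

lemma h1_hom_hom:
  assumes "\<And>r. r \<in> h1_relators \<Longrightarrow> free_hom \<phi> r = 0"
  shows "h1_hom \<phi> (h1_of g) = \<phi> g"
    and "h1_hom \<phi> 1 = 1"
    and "h1_hom \<phi> (x * y) = h1_hom \<phi> x * h1_hom \<phi> y"
    and "clinear (h1_hom \<phi>)"
proof -
  note abs = h1_hom_abs[OF assms]
  show "h1_hom \<phi> (h1_of g) = \<phi> g" by (simp add: h1_of.abs_eq abs free_hom_gen)
  show "h1_hom \<phi> 1 = 1" by (simp add: one_h1.abs_eq abs free_hom_one)
  show "h1_hom \<phi> (x * y) = h1_hom \<phi> x * h1_hom \<phi> y"
    by (induct x, induct y) (simp add: times_h1.abs_eq abs free_hom_mult)
  show "clinear (h1_hom \<phi>)"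
  proof (rule clinearI)
    show "h1_hom \<phi> (x + y) = h1_hom \<phi> x + h1_hom \<phi> y" for x y
      by (induct x, induct y) (simp add: plus_h1.abs_eq abs clinear_add[OF clinear_free_hom])
    show "h1_hom \<phi> (c *\<^sub>C x) = c *\<^sub>C h1_hom \<phi> x" for c x
      by (induct x) (simp add: scaleC_h1.abs_eq abs clinear_scale[OF clinear_free_hom])
  qed
qed

lemma h1_rel:
  "hY * hX - hX * hY = hX"
  "hY * h1_of (GD k) - h1_of (GD k) * hY = of_nat (k + 1) * h1_of (GD k)"
  "hX * h1_of (GD k) - h1_of (GD k) * hX = h1_of (GD (k + 1))"
  "h1_of (GD k) * h1_of (GD l) = h1_of (GD l) * h1_of (GD k)"
proof -
  have mem: "r \<in> h1_ideal" if "r \<in> h1_relators" for r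
  proof -
    have "r = 1 * r * 1" by simp
    with that have "r \<in> {p * r * q | p r q. r \<in> h1_relators}" by blast
    then show ?thesis unfolding h1_ideal_def by (rule cvec.span_base)
  qed
  have nat: "(of_nat n :: h1) = abs_h1 (of_nat n)" for n
    by (induction n) (simp_all add: zero_h1.abs_eq one_h1.abs_eq plus_h1.abs_eq)
  note abs = h1_of.abs_eq times_h1.abs_eq minus_h1.abs_eq nat h1.abs_eq_iff
  show "hY * hX - hX * hY = hX"
    unfolding abs by (rule mem, rule h1_relators.intros)
  show "hY * h1_of (GD k) - h1_of (GD k) * hY = of_nat (k + 1) * h1_of (GD k)"
    unfolding abs by (rule mem, rule h1_relators.intros)
  show "hX * h1_of (GD k) - h1_of (GD k) * hX = h1_of (GD (k + 1))"
    unfolding abs by (rule mem, rule h1_relators.intros)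
  show "h1_of (GD k) * h1_of (GD l) = h1_of (GD l) * h1_of (GD k)"
    unfolding abs by (rule mem, rule h1_relators.intros)
qed

subsection \<open>Counit and coproduct\<close>

definition counit :: "h1 \<Rightarrow> complex" where
  "counit = h1_hom (\<lambda>_. 0)"

definition coprod_X :: "(h1, h1) tensor" where
  "coprod_X = hX \<otimes> 1 + 1 \<otimes> hX + hdelta 1 \<otimes> hY"

definition coprod_Y :: "(h1, h1) tensor" where
  "coprod_Y = hY \<otimes> 1 + 1 \<otimes> hY"

text \<open>The values on \<open>\<delta>\<^bsub>n\<^esub>\<close>, \<open>n > 1\<close>, are forced by \<open>[X, \<delta>\<^bsub>n\<^esub>] = \<delta>\<^bsub>n+1\<^esub>\<close>.\<close>

primrec coprod_GD :: "nat \<Rightarrow> (h1, h1) tensor" where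
  "coprod_GD 0 = hdelta 1 \<otimes> 1 + 1 \<otimes> hdelta 1"
| "coprod_GD (Suc k) = coprod_X * coprod_GD k - coprod_GD k * coprod_X"

text \<open>By \<open>coprod_relators\<close> and \<open>counit_relators\<close> below, these values respect the defining relations;
  \<open>coproduct_simps\<close> and \<open>counit_simps\<close> are the characterizations by generators.\<close>

definition coproduct :: "h1 \<Rightarrow> (h1, h1) tensor" where
  "coproduct = h1_hom (case_h1_gen coprod_X coprod_Y coprod_GD)"

lemma free_hom_of_nat: "free_hom \<phi> (of_nat n) = of_nat n"
  by (induction n) (simp_all add: clinear_zero[OF clinear_free_hom] clinear_add[OF clinear_free_hom] free_hom_one)

lemmas free_hom_simps = free_hom_of_nat free_hom_one free_hom_mult free_hom_gen
  clinear_diff[OF clinear_free_hom] clinear_add[OF clinear_free_hom]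

inductive_set delta_alg :: "h1 set" where
  one: "1 \<in> delta_alg"
| GD: "h1_of (GD k) \<in> delta_alg"
| add: "x \<in> delta_alg \<Longrightarrow> y \<in> delta_alg \<Longrightarrow> x + y \<in> delta_alg"
| scale: "x \<in> delta_alg \<Longrightarrow> c *\<^sub>C x \<in> delta_alg"
| mult: "x \<in> delta_alg \<Longrightarrow> y \<in> delta_alg \<Longrightarrow> x * y \<in> delta_alg"

lemma delta_alg_zero: "0 \<in> delta_alg"
  using delta_alg.scale[OF delta_alg.one, of 0] by (simp add: cvec.scale_zero_left)

lemma delta_alg_commute_GD: "x \<in> delta_alg \<Longrightarrow> x * h1_of (GD k) = h1_of (GD k) * x"
proof (induction rule: delta_alg.induct)
  case (mult x y)
  then show ?case by (metis mult.assoc)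
qed (simp_all add: h1_rel(4) distrib_left distrib_right scaleC_mult_left scaleC_mult_right)

lemma delta_alg_commute: "y \<in> delta_alg \<Longrightarrow> x \<in> delta_alg \<Longrightarrow> x * y = y * x"
proof (induction rule: delta_alg.induct)
  case (mult x y)
  then show ?case by (metis mult.assoc)
qed (simp_all add: delta_alg_commute_GD distrib_left distrib_right scaleC_mult_left scaleC_mult_right)

lemma delta_alg_ad:
  assumes "\<And>k. z * h1_of (GD k) - h1_of (GD k) * z \<in> delta_alg"
  shows "x \<in> delta_alg \<Longrightarrow> z * x - x * z \<in> delta_alg"
proof (induction rule: delta_alg.induct)
  case one
  show ?case by (simp add: delta_alg_zero)
next
  case (GD k)
  show ?case by (rule assms)
next
  case (add x y)
  from delta_alg.add[OF add(3,4)] show ?case by (simp add: algebra_simps)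
next
  case (scale x c)
  from delta_alg.scale[OF scale(2)] show ?case
    by (simp add: cvec.scale_right_diff_distrib scaleC_mult_left scaleC_mult_right)
next
  case (mult x y)
  have "(z * x - x * z) * y + x * (z * y - y * z) \<in> delta_alg"
    by (intro delta_alg.add delta_alg.mult mult)
  then show ?case by (simp add: algebra_simps)
qed

lemma delta_alg_ad_X: "x \<in> delta_alg \<Longrightarrow> hX * x - x * hX \<in> delta_alg"
  by (rule delta_alg_ad) (simp_all only: h1_rel delta_alg.GD)

lemma delta_alg_ad_Y: "x \<in> delta_alg \<Longrightarrow> hY * x - x * hY \<in> delta_alg"
proof (rule delta_alg_ad)
  fix k
  have "(of_nat n :: h1) \<in> delta_alg" for n
    by (induction n) (simp_all add: delta_alg_zero delta_alg.one delta_alg.add)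
  then show "hY * h1_of (GD k) - h1_of (GD k) * hY \<in> delta_alg"
    unfolding h1_rel by (intro delta_alg.mult delta_alg.GD)
qed

inductive_set delta_tensor :: "(h1, h1) tensor set" where
  mk: "a \<in> delta_alg \<Longrightarrow> b \<in> delta_alg \<Longrightarrow> a \<otimes> b \<in> delta_tensor"
| add: "s \<in> delta_tensor \<Longrightarrow> t \<in> delta_tensor \<Longrightarrow> s + t \<in> delta_tensor"

lemma delta_tensor_commute:
  assumes "s \<in> delta_tensor" "t \<in> delta_tensor"
  shows "s * t = t * s"
  using assms(1)
proof (induction rule: delta_tensor.induct)
  case (mk a b)
  from assms(2) show ?case
  proof (induction rule: delta_tensor.induct)
    case (mk a' b')
    then show ?case
      using delta_alg_commute[OF \<open>a \<in> delta_alg\<close> \<open>a' \<in> delta_alg\<close>]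
        delta_alg_commute[OF \<open>b \<in> delta_alg\<close> \<open>b' \<in> delta_alg\<close>]
      by (simp add: tensor_times_mk)
  qed (simp add: distrib_left distrib_right)
qed (simp add: distrib_left distrib_right)

lemma delta_tensor_ad_X: "t \<in> delta_tensor \<Longrightarrow> coprod_X * t - t * coprod_X \<in> delta_tensor"
proof (induction rule: delta_tensor.induct)
  case (mk a b)
  have d: "hdelta 1 \<in> delta_alg" by (simp add: hdelta_def delta_alg.GD)
  have "(hX * a - a * hX) \<otimes> b + a \<otimes> (hX * b - b * hX) + (hdelta 1 * a) \<otimes> (hY * b - b * hY) \<in> delta_tensor"
    by (intro delta_tensor.intros delta_alg_ad_X delta_alg_ad_Y delta_alg.mult mk d)
  also have "(hX * a - a * hX) \<otimes> b + a \<otimes> (hX * b - b * hX) + (hdelta 1 * a) \<otimes> (hY * b - b * hY)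
      = coprod_X * (a \<otimes> b) - (a \<otimes> b) * coprod_X"
    using delta_alg_commute[OF mk(1) d]
    by (simp add: coprod_X_def distrib_left distrib_right tensor_times_mk tensor_mk_simps)
  finally show ?case .
next
  case (add s t)
  from delta_tensor.add[OF add(3,4)] show ?case by (simp add: algebra_simps)
qed

lemma coprod_GD_delta_tensor: "coprod_GD k \<in> delta_tensor"
  by (induction k) (simp_all add: hdelta_def delta_tensor.intros delta_alg.one delta_alg.GD delta_tensor_ad_X)

lemma coprod_YX: "coprod_Y * coprod_X - coprod_X * coprod_Y = coprod_X"
proof -
  have 1: "hY * hX = hX * hY + hX" using h1_rel(1) by (simp add: algebra_simps)
  have 2: "hY * hdelta 1 = hdelta 1 * hY + hdelta 1"
    using h1_rel(2)[of 0] by (simp add: hdelta_def algebra_simps)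
  show ?thesis
    by (simp add: coprod_X_def coprod_Y_def distrib_left distrib_right tensor_times_mk 1 2 tensor_mk_simps
        del: One_nat_def)
qed

lemma coprod_Y_GD:
  "coprod_Y * coprod_GD k - coprod_GD k * coprod_Y = of_nat (k + 1) * coprod_GD k"
proof (induction k)
  case 0
  have 2: "hY * hdelta 1 = hdelta 1 * hY + hdelta 1"
    using h1_rel(2)[of 0] by (simp add: hdelta_def algebra_simps)
  show ?case
    by (simp add: coprod_Y_def distrib_left distrib_right tensor_times_mk 2 tensor_mk_simps del: One_nat_def)
next
  case (Suc k)
  let ?X = coprod_X and ?Y = coprod_Y and ?D = "coprod_GD k"
  have "?Y * (?X * ?D - ?D * ?X) - (?X * ?D - ?D * ?X) * ?Y
      = ((?Y * ?X - ?X * ?Y) * ?D - ?D * (?Y * ?X - ?X * ?Y))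
        + (?X * (?Y * ?D - ?D * ?Y) - (?Y * ?D - ?D * ?Y) * ?X)"
    by (simp add: algebra_simps)
  also have "\<dots> = (?X * ?D - ?D * ?X) + (?X * (of_nat (k + 1) * ?D) - (of_nat (k + 1) * ?D) * ?X)"
    by (simp only: coprod_YX Suc)
  also have "\<dots> = of_nat (Suc k + 1) * (?X * ?D - ?D * ?X)"
  proof -
    have "?X * (of_nat (k + 1) * ?D) = of_nat (k + 1) * (?X * ?D)"
      by (metis mult.assoc mult_of_nat_commute)
    then show ?thesis by (simp add: algebra_simps)
  qed
  finally show ?case by simp
qed

lemma coprod_relators:
  assumes "r \<in> h1_relators"
  shows "free_hom (case_h1_gen coprod_X coprod_Y coprod_GD) r = 0"
  using assms
proof cases
  case YX
  then show ?thesis using coprod_YX by (simp add: free_hom_simps)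
next
  case (YD k)
  then show ?thesis using coprod_Y_GD[of k] by (simp only: free_hom_simps h1_gen.case diff_self)
next
  case (XD k)
  then show ?thesis by (simp add: free_hom_simps)
next
  case (DD k l)
  then show ?thesis
    using delta_tensor_commute[OF coprod_GD_delta_tensor coprod_GD_delta_tensor, of k l]
    by (simp add: free_hom_simps)
qed

lemma coproduct_simps:
  "coproduct hX = hX \<otimes> 1 + 1 \<otimes> hX + hdelta 1 \<otimes> hY"
  "coproduct hY = hY \<otimes> 1 + 1 \<otimes> hY"
  "coproduct (hdelta 1) = hdelta 1 \<otimes> 1 + 1 \<otimes> hdelta 1"
  "coproduct 1 = 1"
  "coproduct (x * y) = coproduct x * coproduct y"
  by (simp_all add: h1_hom_hom[OF coprod_relators, folded coproduct_def] coprod_X_def coprod_Y_def hdelta_def)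

lemma clinear_coproduct: "clinear coproduct"
  unfolding coproduct_def by (rule h1_hom_hom(4)[OF coprod_relators])

lemma counit_relators: "r \<in> h1_relators \<Longrightarrow> free_hom (\<lambda>_. 0 :: complex) r = 0"
  by (cases rule: h1_relators.cases, assumption) (simp_all add: free_hom_simps)

lemma counit_simps:
  "counit (h1_of g) = 0" "counit 1 = 1" "counit (x * y) = counit x * counit y"
  unfolding counit_def by (simp_all add: h1_hom_hom[OF counit_relators])

lemma clinear_counit: "clinear counit"
  unfolding counit_def by (rule h1_hom_hom(4)[OF counit_relators])

section \<open>Partial diffeomorphisms and the crossed product\<close>

type_synonym pt = "real \<times> real"

primrec ck_on :: "nat \<Rightarrow> 'a::real_normed_vector set \<Rightarrow> ('a \<Rightarrow> 'b::real_normed_vector) \<Rightarrow> bool" where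
  "ck_on 0 S f \<longleftrightarrow> continuous_on S f"
| "ck_on (Suc n) S f \<longleftrightarrow>
     (\<forall>z\<in>S. f differentiable (at z)) \<and> (\<forall>v. ck_on n S (\<lambda>z. frechet_derivative f (at z) v))"

text \<open>Only used for open \<open>S\<close>.\<close>

definition smooth_on :: "'a::real_normed_vector set \<Rightarrow> ('a \<Rightarrow> 'b::real_normed_vector) \<Rightarrow> bool" where
  "smooth_on S f \<longleftrightarrow> (\<forall>n. ck_on n S f)"

definition pdx :: "(pt \<Rightarrow> 'b::real_normed_vector) \<Rightarrow> pt \<Rightarrow> 'b" where
  "pdx f z = vector_derivative (\<lambda>t. f (t, snd z)) (at (fst z))"

definition pdy :: "(pt \<Rightarrow> 'b::real_normed_vector) \<Rightarrow> pt \<Rightarrow> 'b" where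
  "pdy f z = vector_derivative (\<lambda>t. f (fst z, t)) (at (snd z))"

definition half_plane :: "pt set" where "half_plane = {z. snd z > 0}"

definition pm_inv :: "('a \<rightharpoonup> 'b) \<Rightarrow> 'b \<rightharpoonup> 'a" where
  "pm_inv f y = (if y \<in> ran f then Some (THE x. f x = Some y) else None)"

text \<open>Local diffeomorphisms are partial maps, composed by \<^term>\<open>(\<circ>\<^sub>m)\<close>. The derivative is positive
  because \<open>(x, y) \<mapsto> (\<gamma> x, y / \<gamma>' x)\<close> has to preserve the half plane.\<close>

definition local_diffeo :: "(real \<rightharpoonup> real) \<Rightarrow> bool" where
  "local_diffeo \<gamma> \<longleftrightarrow>
     open (dom \<gamma>) \<and> open (ran \<gamma>) \<and> inj_on \<gamma> (dom \<gamma>)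
     \<and> smooth_on (dom \<gamma>) (\<lambda>x. the (\<gamma> x)) \<and> smooth_on (ran \<gamma>) (\<lambda>x. the (pm_inv \<gamma> x))
     \<and> (\<forall>x\<in>dom \<gamma>. deriv (\<lambda>t. the (\<gamma> t)) x > 0)"

definition pseudogroup :: "(real \<rightharpoonup> real) set \<Rightarrow> bool" where
  "pseudogroup \<Gamma> \<longleftrightarrow>
     (\<forall>\<gamma>\<in>\<Gamma>. local_diffeo \<gamma>)
     \<and> Some \<in> \<Gamma>
     \<and> (\<forall>\<alpha>\<in>\<Gamma>. \<forall>\<beta>\<in>\<Gamma>. \<alpha> \<circ>\<^sub>m \<beta> \<in> \<Gamma>)
     \<and> (\<forall>\<alpha>\<in>\<Gamma>. pm_inv \<alpha> \<in> \<Gamma>)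
     \<and> (\<forall>\<alpha>\<in>\<Gamma>. \<forall>U. open U \<longrightarrow> \<alpha> |` U \<in> \<Gamma>)
     \<and> (\<forall>\<alpha>. local_diffeo \<alpha> \<and> (\<forall>x\<in>dom \<alpha>. \<exists>U. open U \<and> x \<in> U \<and> \<alpha> |` U \<in> \<Gamma>) \<longrightarrow> \<alpha> \<in> \<Gamma>)"

definition lift :: "(real \<rightharpoonup> real) \<Rightarrow> pt \<rightharpoonup> pt" where
  "lift \<gamma> = (\<lambda>(x, y). if x \<in> dom \<gamma> \<and> y > 0
     then Some (the (\<gamma> x), y / deriv (\<lambda>t. the (\<gamma> t)) x) else None)"

definition fun_act :: "(real \<rightharpoonup> real) \<Rightarrow> (pt \<Rightarrow> complex) \<Rightarrow> pt \<Rightarrow> complex" where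
  "fun_act \<gamma> f z = (case pm_inv (lift \<gamma>) z of None \<Rightarrow> 0 | Some w \<Rightarrow> f w)"

text \<open>Smooth functions with compact support in \<open>S \<subseteq> half_plane\<close>, extended by zero to the plane.\<close>

definition Cc_smooth :: "pt set \<Rightarrow> (pt \<Rightarrow> complex) set" where
  "Cc_smooth S = {f. smooth_on UNIV f \<and> compact (closure {z. f z \<noteq> 0}) \<and> closure {z. f z \<noteq> 0} \<subseteq> S}"

text \<open>Elements of the crossed product are finite formal sums of monomials \<open>f\<alpha>\<close>. The type does not
  impose \<open>\<alpha> \<in> \<Gamma>\<close> or \<open>f \<in> Cc_smooth (ran (lift \<alpha>))\<close>; these conditions cut out the algebra of a
  given \<open>\<Gamma>\<close>.\<close>

type_synonym crossed = "(real \<rightharpoonup> real) \<Rightarrow>\<^sub>0 (pt \<Rightarrow> complex)"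

abbreviation cmon :: "(pt \<Rightarrow> complex) \<Rightarrow> (real \<rightharpoonup> real) \<Rightarrow> crossed" where
  "cmon f \<alpha> \<equiv> Poly_Mapping.single \<alpha> f"

definition cmult :: "crossed \<Rightarrow> crossed \<Rightarrow> crossed" where
  "cmult a b = (\<Sum>\<alpha>\<in>Poly_Mapping.keys a. \<Sum>\<beta>\<in>Poly_Mapping.keys b.
     cmon (\<lambda>z. Poly_Mapping.lookup a \<alpha> z * fun_act \<alpha> (Poly_Mapping.lookup b \<beta>) z) (\<alpha> \<circ>\<^sub>m \<beta>))"

subsection \<open>The action of the Hopf algebra\<close>

text \<open>\<open>delta_fun \<alpha> k\<close> is \<open>\<delta>\<^bsub>k+1\<^esub>(\<alpha>)\<close>, a function on the range of \<open>lift \<alpha>\<close>.\<close>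

primrec delta_fun :: "(real \<rightharpoonup> real) \<Rightarrow> nat \<Rightarrow> pt \<Rightarrow> real" where
  "delta_fun \<alpha> 0 = (\<lambda>(x, y). 1 / y * deriv (\<lambda>t. ln (deriv (\<lambda>s. the (pm_inv \<alpha> s)) t)) x)"
| "delta_fun \<alpha> (Suc k) = (\<lambda>(x, y). 1 / y * pdx (delta_fun \<alpha> k) (x, y))"

fun gen_op :: "h1_gen \<Rightarrow> (real \<rightharpoonup> real) \<Rightarrow> (pt \<Rightarrow> complex) \<Rightarrow> pt \<Rightarrow> complex" where
  "gen_op GX \<alpha> f = (\<lambda>(x, y). of_real (1 / y) * pdx f (x, y))"
| "gen_op GY \<alpha> f = (\<lambda>(x, y). - of_real y * pdy f (x, y))"
| "gen_op (GD k) \<alpha> f = (\<lambda>z. of_real (delta_fun \<alpha> k z) * f z)"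

definition gen_act :: "h1_gen \<Rightarrow> crossed \<Rightarrow> crossed" where
  "gen_act g a = (\<Sum>\<alpha>\<in>Poly_Mapping.keys a. cmon (gen_op g \<alpha> (Poly_Mapping.lookup a \<alpha>)) \<alpha>)"

text \<open>On the crossed product algebra of a pseudogroup the operators \<^term>\<open>gen_act g\<close> are linear and
  satisfy the defining relations of \<^typ>\<open>h1\<close>, so the action below does not depend on the
  representative.\<close>

definition h1_act :: "h1 \<Rightarrow> crossed \<Rightarrow> crossed" where
  "h1_act h a = free_extend (\<lambda>w. foldr gen_act (letters w) a) (rep_h1 h)"

definition h1_act2 :: "(h1, h1) tensor \<Rightarrow> crossed \<Rightarrow> crossed \<Rightarrow> (crossed, crossed) tensor" where
  "h1_act2 t a b = tensor_lift (\<lambda>h k. h1_act h a \<otimes> h1_act k b) t"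

definition cm :: "(crossed, crossed) tensor \<Rightarrow> crossed" where
  "cm = tensor_lift cmult"


section \<open>The Weyl algebra bundle\<close>

text \<open>Fibres: \<open>a k m n\<close> is the coefficient of \<open>\<hbar>\<^sup>k u\<^sup>m v\<^sup>n\<close>. Mind that \<open>0\<close>, \<open>+\<close>, \<open>-\<close> and
  \<^term>\<open>(*\<^sub>C)\<close> are pointwise on this type, but the products and the unit are not the pointwise
  \<open>*\<close> and \<open>1\<close>.\<close>

type_synonym fib = "int \<Rightarrow> nat \<Rightarrow> nat \<Rightarrow> complex"

definition fone :: fib where "fone k m n = (if k = 0 \<and> m = 0 \<and> n = 0 then 1 else 0)"

definition fdu :: "fib \<Rightarrow> fib" where "fdu a k m n = of_nat (m + 1) * a k (m + 1) n"
definition fdv :: "fib \<Rightarrow> fib" where "fdv a k m n = of_nat (n + 1) * a k m (n + 1)"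
definition fmulu :: "fib \<Rightarrow> fib" where "fmulu a k m n = (case m of 0 \<Rightarrow> 0 | Suc m' \<Rightarrow> a k m' n)"
definition fmulv :: "fib \<Rightarrow> fib" where "fmulv a k m n = (case n of 0 \<Rightarrow> 0 | Suc n' \<Rightarrow> a k m n')"

definition i_over_hbar :: "fib \<Rightarrow> fib" where "i_over_hbar a k m n = \<i> * a (k + 1) m n"

text \<open>In the sums over all \<open>k\<^sub>1\<close> and all \<open>r\<close> below only finitely many terms are nonzero if \<open>a\<close> and
  \<open>b\<close> are fibre elements of \<open>\<W>\<^sup>+\<close>.\<close>

definition fmult :: "fib \<Rightarrow> fib \<Rightarrow> fib" where
  "fmult a b k m n = Sum_any (\<lambda>k\<^sub>1. \<Sum>p\<le>m. \<Sum>q\<le>n. a k\<^sub>1 p q * b (k - k\<^sub>1) (m - p) (n - q))"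

definition poisson_power :: "nat \<Rightarrow> fib \<Rightarrow> fib \<Rightarrow> fib" where
  "poisson_power r a b = (\<Sum>j\<le>r. ((- 1) ^ j * of_nat (r choose j)) *\<^sub>C
     fmult ((fdu ^^ (r - j)) ((fdv ^^ j) a)) ((fdv ^^ (r - j)) ((fdu ^^ j) b)))"

definition moyal :: "fib \<Rightarrow> fib \<Rightarrow> fib" where
  "moyal a b k m n = Sum_any (\<lambda>r. (- \<i> / 2) ^ r / fact r * poisson_power r a b (k - int r) m n)"

text \<open>Substitution of \<open>a u + b v\<close> for \<open>u\<close> and \<open>c u + d v\<close> for \<open>v\<close>, expanded binomially.\<close>

definition fsubst :: "real \<Rightarrow> real \<Rightarrow> real \<Rightarrow> real \<Rightarrow> fib \<Rightarrow> fib" where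
  "fsubst a b c d w k m n = (\<Sum>p\<le>m + n. w k p (m + n - p) * of_real
     (\<Sum>i\<le>min p m. of_nat (p choose i) * a ^ i * b ^ (p - i)
        * (of_nat ((m + n - p) choose (m - i)) * c ^ (m - i) * d ^ (m + n - p - (m - i)))))"

text \<open>Sections over an open subset \<open>S\<close> of the half plane, extended by zero so that they are determined
  by their values on \<open>S\<close>; \<open>W_on\<close> and \<open>Wplus_on\<close> are the sections of \<open>\<W>\<close> and \<open>\<W>\<^sup>+\<close>.\<close>

type_synonym wsec = "pt \<Rightarrow> fib"

definition section_on :: "pt set \<Rightarrow> wsec \<Rightarrow> bool" where
  "section_on S a \<longleftrightarrow> (\<forall>k m n. smooth_on S (\<lambda>z. a z k m n)) \<and> (\<forall>z. z \<notin> S \<longrightarrow> a z = 0)"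

definition W_on :: "pt set \<Rightarrow> wsec \<Rightarrow> bool" where
  "W_on S a \<longleftrightarrow> section_on S a \<and> (\<forall>z k m n. k < 0 \<longrightarrow> a z k m n = 0)"

definition Wplus_on :: "pt set \<Rightarrow> wsec \<Rightarrow> bool" where
  "Wplus_on S a \<longleftrightarrow> section_on S a
     \<and> (\<forall>z k m n. 2 * k + int m + int n < 0 \<longrightarrow> a z k m n = 0)
     \<and> (\<forall>d. finite {(k, m, n). 2 * k + int m + int n = d \<and> (\<exists>z. a z k m n \<noteq> 0)})"

definition wmult :: "wsec \<Rightarrow> wsec \<Rightarrow> wsec"  (infixl \<open>\<star>\<^sub>w\<close> 70) where
  "(a \<star>\<^sub>w b) z = moyal (a z) (b z)"

definition winv :: "pt set \<Rightarrow> wsec \<Rightarrow> wsec" where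
  "winv S a = (THE b. Wplus_on S b \<and> (\<forall>z\<in>S. (a \<star>\<^sub>w b) z = fone \<and> (b \<star>\<^sub>w a) z = fone))"

text \<open>A one-form \<open>a dx + b dy\<close> with values in the bundle is the pair \<open>(a, b)\<close>. Of the operators on
  forms only \<open>D\<close> and \<open>\<delta>\<close> on sections and \<open>\<delta>\<^sup>-\<^sup>1\<close> on one-forms are needed.\<close>

type_synonym form1 = "wsec \<times> wsec"

definition fedosov_D :: "wsec \<Rightarrow> form1" where
  "fedosov_D a =
    (\<lambda>z. (\<lambda>k m n. pdx (\<lambda>w. a w k m n) z) - fdu (a z)
        - of_real (1 / (2 * snd z)) *\<^sub>C fmulv (fdu (a z)),
     \<lambda>z. (\<lambda>k m n. pdy (\<lambda>w. a w k m n) z) - fdv (a z)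
        + of_real (1 / (2 * snd z)) *\<^sub>C (fmulv (fdv (a z)) - fmulu (fdu (a z))))"

definition fedosov_delta :: "wsec \<Rightarrow> form1" where
  "fedosov_delta a = (\<lambda>z. fdu (a z), \<lambda>z. fdv (a z))"

text \<open>The term of the result in \<open>u\<^sup>m v\<^sup>n\<close> comes from fibre degree \<open>p = m + n - 1\<close> and form degree
  \<open>q = 1\<close>, whence the factor \<open>1 / (m + n)\<close>; for \<open>m = n = 0\<close> the numerator vanishes.\<close>

definition fedosov_delta_inv :: "form1 \<Rightarrow> wsec" where
  "fedosov_delta_inv \<omega> z k m n = (fmulu (fst \<omega> z) + fmulv (snd \<omega> z)) k m n / of_nat (m + n)"

definition flat_lift :: "(pt \<Rightarrow> complex) \<Rightarrow> wsec" where
  "flat_lift f = (THE a. W_on half_plane a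
     \<and> (\<forall>z\<in>half_plane. fst (fedosov_D a) z = 0 \<and> snd (fedosov_D a) z = 0
          \<and> (\<forall>k. a z k 0 0 = (if k = 0 then f z else 0))))"


section \<open>Quantized diffeomorphisms and the star product\<close>

text \<open>\<open>sec_act \<gamma>\<close> and \<open>form_act \<gamma>\<close> push sections and one-forms on the domain of \<open>lift \<gamma>\<close> forward to its
  range; \<open>\<phi>\<close> is the inverse of \<open>lift \<gamma>\<close>, whose Jacobian matrix acts on \<open>(u, v)\<close> and, for forms, on
  \<open>(dx, dy)\<close>.\<close>

definition sec_act :: "(real \<rightharpoonup> real) \<Rightarrow> wsec \<Rightarrow> wsec" where
  "sec_act \<gamma> a z = (let \<phi> = (\<lambda>z. the (pm_inv (lift \<gamma>) z)) in
     if z \<in> ran (lift \<gamma>)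
     then fsubst (pdx (\<lambda>w. fst (\<phi> w)) z) (pdy (\<lambda>w. fst (\<phi> w)) z)
                 (pdx (\<lambda>w. snd (\<phi> w)) z) (pdy (\<lambda>w. snd (\<phi> w)) z) (a (\<phi> z))
     else 0)"

definition form_act :: "(real \<rightharpoonup> real) \<Rightarrow> form1 \<Rightarrow> form1" where
  "form_act \<gamma> \<omega> = (let \<phi> = (\<lambda>z. the (pm_inv (lift \<gamma>) z)); a = sec_act \<gamma> (fst \<omega>); b = sec_act \<gamma> (snd \<omega>) in
     (\<lambda>z. of_real (pdx (\<lambda>w. fst (\<phi> w)) z) *\<^sub>C a z + of_real (pdx (\<lambda>w. snd (\<phi> w)) z) *\<^sub>C b z,
      \<lambda>z. of_real (pdy (\<lambda>w. fst (\<phi> w)) z) *\<^sub>C a z + of_real (pdy (\<lambda>w. snd (\<phi> w)) z) *\<^sub>C b z))"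

definition transported_D :: "(real \<rightharpoonup> real) \<Rightarrow> wsec \<Rightarrow> form1" where
  "transported_D \<gamma> a = form_act \<gamma> (fedosov_D (sec_act (pm_inv \<gamma>) a))"

definition homogeneous2 :: "wsec \<Rightarrow> bool" where
  "homogeneous2 a \<longleftrightarrow> (\<forall>z k m n. a z k m n \<noteq> 0 \<longrightarrow> m + n = 2)"

definition Delta_form :: "(real \<rightharpoonup> real) \<Rightarrow> form1" where
  "Delta_form \<gamma> = (THE \<omega>. let S = ran (lift \<gamma>); A = fst \<omega>; B = snd \<omega> in
     W_on S A \<and> W_on S B \<and> homogeneous2 A \<and> homogeneous2 B \<and>
     (\<forall>a. W_on S a \<longrightarrow> (\<forall>z\<in>S.
        fst (transported_D \<gamma> a) z = fst (fedosov_D a) z + i_over_hbar ((A \<star>\<^sub>w a) z - (a \<star>\<^sub>w A) z) \<and>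
        snd (transported_D \<gamma> a) z = snd (fedosov_D a) z + i_over_hbar ((B \<star>\<^sub>w a) z - (a \<star>\<^sub>w B) z))))"

definition U_equation_form :: "(real \<rightharpoonup> real) \<Rightarrow> wsec \<Rightarrow> form1" where
  "U_equation_form \<gamma> U =
    (\<lambda>z. fst (fedosov_D U) z + fst (fedosov_delta U) z + i_over_hbar ((fst (Delta_form \<gamma>) \<star>\<^sub>w U) z),
     \<lambda>z. snd (fedosov_D U) z + snd (fedosov_delta U) z + i_over_hbar ((snd (Delta_form \<gamma>) \<star>\<^sub>w U) z))"

definition U_section :: "(real \<rightharpoonup> real) \<Rightarrow> wsec" where
  "U_section \<gamma> = (THE U. Wplus_on (ran (lift \<gamma>)) U \<and>
     (\<forall>z\<in>ran (lift \<gamma>). U z = fone + fedosov_delta_inv (U_equation_form \<gamma> U) z))"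

definition star_section ::
    "(pt \<Rightarrow> complex) \<Rightarrow> (real \<rightharpoonup> real) \<Rightarrow> (pt \<Rightarrow> complex) \<Rightarrow> (real \<rightharpoonup> real) \<Rightarrow> wsec" where
  "star_section f \<alpha> g \<beta> =
     flat_lift f \<star>\<^sub>w winv (ran (lift \<alpha>)) (U_section \<alpha>) \<star>\<^sub>w sec_act \<alpha> (flat_lift g)
     \<star>\<^sub>w winv (ran (lift (\<alpha> \<circ>\<^sub>m \<beta>))) (sec_act \<alpha> (U_section \<beta>)) \<star>\<^sub>w U_section (\<alpha> \<circ>\<^sub>m \<beta>)"

text \<open>The product on monomials; its value on all formal power series follows by
  \<open>\<hbar>\<close>-linear extension.\<close>

definition star :: "(pt \<Rightarrow> complex) \<Rightarrow> (real \<rightharpoonup> real) \<Rightarrow> (pt \<Rightarrow> complex) \<Rightarrow> (real \<rightharpoonup> real) \<Rightarrow> crossed fps" where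
  "star f \<alpha> g \<beta> = Abs_fps (\<lambda>n. cmon (\<lambda>z. star_section f \<alpha> g \<beta> z (int n) 0 0) (\<alpha> \<circ>\<^sub>m \<beta>))"

end

theory Submission
  imports Defs
begin

text \<open>Take the frame X = (1/y) d/dx, Y = -y d/dy and the fibre coordinates yu, v/y, again
  called u and v. In this frame the Fedosov connection has constant coefficients, and a
  diffeomorphism alpha acts on the fibre by the unipotent substitution v -> v - delta_1(alpha) u,
  that is, by exp(-delta_1 u d/dv). Hence every object of the construction is the value on functions
  of a universal series with coefficients in H_1. Put hbar = 1 and split a section by total degree
  into polynomials a_0, a_1, and so on. Then D a = 0 reads d/du a_(n+1) = P a_n and d/dv a_(n+1) = Q
  a_n with P = X - (1/2) v d/du and Q = -Y + (1/2)(u d/du - v d/dv), and a solution is determined by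
  its constant terms (\<open>flat_unique\<close>).

  The lift of f is J_0 f for a universal flat series J_0 (\<open>J0\<close>). The form Delta_gamma
  has only a dx-part, a multiple of u^2 by the Schwarzian element S = delta_2 - (1/2) delta_1^2
  (\<open>hS\<close>). Therefore U_gamma is the value on 1 of a series U (\<open>Uu\<close>) whose
  coefficients are polynomials in the commuting delta_n, and the lift of f times the inverse of
  U_alpha is J f with J = J_0 U^-1 (\<open>JJ\<close>).

  The series J solves the flatness equations with P replaced by P - (i/2) S R_u^2, where R_u is
  right Moyal multiplication by u (\<open>Pr\<close>). These modified equations are compatible with
  the product of the crossed product algebra tensored with the Weyl algebra (\<open>tw\<close>): X
  acts through its coproduct, the term delta_1 (x) Y fits the substitution in v, and the defect that
  remains is S times the inner derivation u d/dv = (i/2)[u^2, .], which the new term absorbs because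
  S is primitive (\<open>tw_Pr\<close>, \<open>tw_Qo\<close>). So the product J * J
  (\<open>MM\<close>) solves the equations of J with X, Y, S replaced by their coproducts.
  Uniqueness gives J * J = Delta(J) R with R free of u and v (\<open>MM_eq\<close>). Applied to f
  and g, multiplied by U_(alpha beta) and taken at u = v = 0, this is the formula for the star
  product (\<open>star_eq\<close>).

  For the twist equation, (J * J) * J and J * (J * J) are computed from J * J = Delta(J) R. Each is
  the iterated coproduct of J times one side of the equation. The twisted product is associative
  because delta_1 is primitive, and the iterated coproduct of J begins with 1, so it cancels
  (\<open>twist_series\<close>). The counit sends J to 1, which gives the two normalizations. A
  parity count shows that R lives in even total degree, so it is a power series in hbar
  (\<open>Rser_odd\<close>).

  The remaining work evaluates the concrete objects in the frame: the exponential Moyal series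
  (\<open>fs_moyal\<close>, \<open>sec_mult\<close>), the connection (\<open>D_zero_iff\<close>),
  the lift (\<open>flat_lift_eq\<close>), the form Delta_gamma (\<open>Delta_form_eq\<close>), the
  section U_gamma (\<open>U_section_eq\<close>), and the fact that the crossed product is a module
  algebra over H_1 (\<open>m2_coproduct\<close>). Each definite description is evaluated by
  exhibiting the universal series and proving uniqueness.\<close>

type_synonym 'c pol = "nat \<times> nat \<Rightarrow>\<^sub>0 'c"

section \<open>Polynomials in the fibre variables with coefficients in a vector space\<close>

lift_definition du :: "'c::cvector pol \<Rightarrow> 'c pol" is "\<lambda>p k. of_nat (fst k + 1) *\<^sub>C p (fst k + 1, snd k)"
  by (rule finite_surj[where f="\<lambda>k. (fst k - 1, snd k)"], assumption) force

lift_definition dv :: "'c::cvector pol \<Rightarrow> 'c pol" is "\<lambda>p k. of_nat (snd k + 1) *\<^sub>C p (fst k, snd k + 1)"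
  by (rule finite_surj[where f="\<lambda>k. (fst k, snd k - 1)"], assumption) force

lift_definition mu :: "'c::cvector pol \<Rightarrow> 'c pol" is "\<lambda>p k. case fst k of 0 \<Rightarrow> 0 | Suc m \<Rightarrow> p (m, snd k)"
  by (rule finite_surj[where f="\<lambda>k. (fst k + 1, snd k)"], assumption) (force split: nat.splits)

lift_definition mv :: "'c::cvector pol \<Rightarrow> 'c pol" is "\<lambda>p k. case snd k of 0 \<Rightarrow> 0 | Suc n \<Rightarrow> p (fst k, n)"
  by (rule finite_surj[where f="\<lambda>k. (fst k, snd k + 1)"], assumption) (force split: nat.splits)

text \<open>Coefficientwise application of a map. The guard at zero keeps the support finite for an
  arbitrary f; for linear f it makes no difference, see \<open>lookup_pm\<close>.\<close>

lift_definition pm :: "('c::cvector \<Rightarrow> 'd::cvector) \<Rightarrow> 'c pol \<Rightarrow> 'd pol" is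
  "\<lambda>f p k. if p k = 0 then 0 else f (p k)"
  by (rule finite_subset[rotated], assumption) auto

declare du.rep_eq [simp] dv.rep_eq [simp] mu.rep_eq [simp] mv.rep_eq [simp] lookup_scaleC [simp]

lemma lookup_pm [simp]: "clinear f \<Longrightarrow> Poly_Mapping.lookup (pm f p) k = f (Poly_Mapping.lookup p k)"
  by (simp add: pm.rep_eq clinear_zero)

abbreviation cst :: "'c::cvector \<Rightarrow> 'c pol" where "cst c \<equiv> Poly_Mapping.single (0, 0) c"

named_theorems lin

lemma clinear_id: "clinear (\<lambda>x. x)" by (rule clinearI) auto
lemma clinear_plus: "clinear f \<Longrightarrow> clinear g \<Longrightarrow> clinear (\<lambda>x. f x + g x)"
  by (rule clinearI) (auto simp: clinear_add clinear_scale scaleC_add_right)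
lemma clinear_diff': "clinear f \<Longrightarrow> clinear g \<Longrightarrow> clinear (\<lambda>x. f x - g x)"
  by (rule clinearI) (auto simp: clinear_add clinear_scale cvec.scale_right_diff_distrib)
lemma clinear_uminus: "clinear f \<Longrightarrow> clinear (\<lambda>x. - f x)"
  by (rule clinearI) (auto simp: clinear_add clinear_scale)
lemma clinear_const_scale: "clinear f \<Longrightarrow> clinear (\<lambda>x. c *\<^sub>C f x)"
  by (rule clinearI) (auto simp: clinear_add clinear_scale scaleC_add_right scaleC_scaleC mult.commute)
lemma clinear_sum': "(\<And>i. i \<in> A \<Longrightarrow> clinear (f i)) \<Longrightarrow> clinear (\<lambda>x. \<Sum>i\<in>A. f i x)"
  by (rule clinearI) (auto simp: clinear_add clinear_scale sum.distrib cvec.scale_sum_right)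
lemma clinear_zero_fun: "clinear (\<lambda>x. 0)"
  by (rule clinearI) auto
lemma clinear_lmult: "clinear (\<lambda>x. a * x)" and clinear_rmult: "clinear (\<lambda>x. x * a)" for a :: "'a::calgebra"
  by (rule clinearI; simp add: algebra_simps scaleC_mult_left scaleC_mult_right)+

lemma clinear_du: "clinear du" and clinear_dv: "clinear dv"
  by (rule clinearI; rule poly_mapping_eqI;
      simp add: lookup_add scaleC_add_right scaleC_scaleC mult.commute)+
lemma clinear_mu: "clinear mu" and clinear_mv: "clinear mv"
  by (rule clinearI; rule poly_mapping_eqI; simp add: lookup_add split: nat.split)+
lemma clinear_lookup: "clinear (\<lambda>p :: _ \<Rightarrow>\<^sub>0 'c::cvector. Poly_Mapping.lookup p k)"
  by (rule clinearI) (auto simp: lookup_add)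
lemma clinear_pm: "clinear f \<Longrightarrow> clinear (pm f)"
  by (rule clinearI; rule poly_mapping_eqI; simp add: lookup_add clinear_add clinear_scale)
lemma clinear_single: "clinear (Poly_Mapping.single k :: 'c::cvector \<Rightarrow> _)"
  by (rule clinearI; rule poly_mapping_eqI; simp add: lookup_add lookup_single when_def)

lemmas clin_intros = clinear_id clinear_du clinear_dv clinear_mu clinear_mv clinear_pm clinear_single
  clinear_plus clinear_diff' clinear_uminus clinear_const_scale clinear_sum' clinear_zero_fun clinear_lookup

lemmas lin_du = clinear_add[OF clinear_du] clinear_scale[OF clinear_du] clinear_zero[OF clinear_du]
  clinear_diff[OF clinear_du] clinear_minus[OF clinear_du] clinear_sum[OF clinear_du]
lemmas lin_dv = clinear_add[OF clinear_dv] clinear_scale[OF clinear_dv] clinear_zero[OF clinear_dv]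
  clinear_diff[OF clinear_dv] clinear_minus[OF clinear_dv] clinear_sum[OF clinear_dv]
lemmas lin_mu = clinear_add[OF clinear_mu] clinear_scale[OF clinear_mu] clinear_zero[OF clinear_mu]
  clinear_diff[OF clinear_mu] clinear_minus[OF clinear_mu] clinear_sum[OF clinear_mu]
lemmas lin_mv = clinear_add[OF clinear_mv] clinear_scale[OF clinear_mv] clinear_zero[OF clinear_mv]
  clinear_diff[OF clinear_mv] clinear_minus[OF clinear_mv] clinear_sum[OF clinear_mv]
lemmas lin_pm = clinear_add[OF clinear_pm] clinear_scale[OF clinear_pm] clinear_zero[OF clinear_pm]
  clinear_diff[OF clinear_pm] clinear_minus[OF clinear_pm] clinear_sum[OF clinear_pm]
lemmas lin_all = lin_du lin_dv lin_mu lin_mv lin_pm scaleC_add_right scaleC_add_left scaleC_scaleC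
  cvec.scale_right_diff_distrib cvec.scale_left_diff_distrib cvec.scale_minus_right cvec.scale_minus_left scaleC_one

lemma pol_induct [case_names single add]:
  fixes p :: "'k \<Rightarrow>\<^sub>0 'c::cvector"
  assumes "\<And>k c. P (Poly_Mapping.single k c)" "\<And>p q. P p \<Longrightarrow> P q \<Longrightarrow> P (p + q)"
  shows "P p"
proof -
  have "P (\<Sum>k\<in>K. Poly_Mapping.single k (f k))" if "finite K" for K :: "'k set" and f
    using that
  proof (induction K)
    case empty
    then show ?case using assms(1)[of undefined 0] by simp
  qed (simp add: assms)
  moreover have "p = (\<Sum>k\<in>Poly_Mapping.keys p. Poly_Mapping.single k (Poly_Mapping.lookup p k))"
    by (rule poly_mapping_eqI) (auto simp: lookup_sum lookup_single when_def in_keys_iff sum.delta)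
  ultimately show ?thesis by (metis finite_keys)
qed

lemma du_mu: "du (mu p) = mu (du p) + p"
  and dv_mu: "dv (mu p) = mu (dv p)"
  and du_mv: "du (mv p) = mv (du p)"
  and dv_mv: "dv (mv p) = mv (dv p) + p"
  and mv_mu: "mv (mu p) = mu (mv p)"
  by (rule poly_mapping_eqI;
      auto simp: lookup_add scaleC_add_left scaleC_add_right scaleC_one scaleC_scaleC cvec.scale_zero_right mult.commute split: nat.split)+

lemma dv_du: "dv (du p) = du (dv p)"
  by (rule poly_mapping_eqI) (simp add: scaleC_scaleC mult.commute)

lemmas weyl_comm = du_mu dv_mu du_mv dv_mv mv_mu dv_du

lemma pm_du: "clinear f \<Longrightarrow> pm f (du p) = du (pm f p)"
  and pm_dv: "clinear f \<Longrightarrow> pm f (dv p) = dv (pm f p)"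
  and pm_mu: "clinear f \<Longrightarrow> pm f (mu p) = mu (pm f p)"
  and pm_mv: "clinear f \<Longrightarrow> pm f (mv p) = mv (pm f p)"
  by (rule poly_mapping_eqI; simp add: clinear_scale clinear_zero split: nat.split)+

lemmas pm_comm = pm_du pm_dv pm_mu pm_mv

lemma pm_single: "clinear f \<Longrightarrow> pm f (Poly_Mapping.single k c) = Poly_Mapping.single k (f c)"
  by (rule poly_mapping_eqI) (simp add: lookup_single when_def clinear_zero)

lemma pm_pm: "clinear f \<Longrightarrow> clinear g \<Longrightarrow> pm f (pm g p) = pm (\<lambda>x. f (g x)) p"
  by (rule poly_mapping_eqI) (simp add: clinear_comp)

lemma pm_plus: "clinear f \<Longrightarrow> clinear g \<Longrightarrow> pm (\<lambda>x. f x + g x) p = pm f p + pm g p"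
  by (rule poly_mapping_eqI) (simp add: lookup_add clinear_plus)

lemma pm_scale: "clinear f \<Longrightarrow> pm (\<lambda>x. c *\<^sub>C f x) p = c *\<^sub>C pm f p"
  by (rule poly_mapping_eqI) (simp add: clinear_const_scale)

lemma du_single: "du (Poly_Mapping.single (Suc m, n) c) = Poly_Mapping.single (m, n) (of_nat (Suc m) *\<^sub>C c)"
  and dv_single: "dv (Poly_Mapping.single (m, Suc n) c) = Poly_Mapping.single (m, n) (of_nat (Suc n) *\<^sub>C c)"
  and du_single0: "du (Poly_Mapping.single (0, n) c) = 0"
  and dv_single0: "dv (Poly_Mapping.single (m, 0) c) = 0"
  and mu_single: "mu (Poly_Mapping.single (m, n) c) = Poly_Mapping.single (Suc m, n) c"
  and mv_single: "mv (Poly_Mapping.single (m, n) c) = Poly_Mapping.single (m, Suc n) c"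
  by (rule poly_mapping_eqI; auto simp: lookup_single when_def split: nat.split)+

section \<open>Moyal multiplication by the generators\<close>

text \<open>Left and right Moyal multiplication by u and v at hbar = 1. The two left operators
  commute with the two right ones, and \<open>du\<close>, \<open>dv\<close>, \<open>mu\<close>,
  \<open>mv\<close> are linear combinations of the four. Identities about products are therefore
  proved by rewriting everything in these operators.\<close>

definition Lu where "Lu p = mu p - (\<i> / 2) *\<^sub>C dv p"
definition Lv where "Lv p = mv p + (\<i> / 2) *\<^sub>C du p"
definition Ru where "Ru p = mu p + (\<i> / 2) *\<^sub>C dv p"
definition Rv where "Rv p = mv p - (\<i> / 2) *\<^sub>C du p"

lemma clinear_Lu: "clinear Lu" and clinear_Lv: "clinear Lv" and clinear_Ru: "clinear Ru" and clinear_Rv: "clinear Rv"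
  unfolding Lu_def Lv_def Ru_def Rv_def by (intro clin_intros)+

lemmas lin_LR =
  clinear_add[OF clinear_Lu] clinear_scale[OF clinear_Lu] clinear_zero[OF clinear_Lu]
  clinear_diff[OF clinear_Lu] clinear_minus[OF clinear_Lu] clinear_sum[OF clinear_Lu]
  clinear_add[OF clinear_Lv] clinear_scale[OF clinear_Lv] clinear_zero[OF clinear_Lv]
  clinear_diff[OF clinear_Lv] clinear_minus[OF clinear_Lv] clinear_sum[OF clinear_Lv]
  clinear_add[OF clinear_Ru] clinear_scale[OF clinear_Ru] clinear_zero[OF clinear_Ru]
  clinear_diff[OF clinear_Ru] clinear_minus[OF clinear_Ru] clinear_sum[OF clinear_Ru]
  clinear_add[OF clinear_Rv] clinear_scale[OF clinear_Rv] clinear_zero[OF clinear_Rv]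
  clinear_diff[OF clinear_Rv] clinear_minus[OF clinear_Rv] clinear_sum[OF clinear_Rv]

lemma LR_comm: "Lu (Ru p) = Ru (Lu p)" "Lu (Rv p) = Rv (Lu p)" "Lv (Ru p) = Ru (Lv p)" "Lv (Rv p) = Rv (Lv p)"
  by (simp_all add: Lu_def Lv_def Ru_def Rv_def lin_all weyl_comm)

lemma du_Ru: "du (Ru p) = Ru (du p) + p" and dv_Ru: "dv (Ru p) = Ru (dv p)"
  and dv_Rv: "dv (Rv p) = Rv (dv p) + p" and du_Rv: "du (Rv p) = Rv (du p)"
  and mu_Ru: "mu (Ru p) = Ru (mu p)" and mv_Rv: "mv (Rv p) = Rv (mv p)"
  by (simp_all add: Lu_def Lv_def Ru_def Rv_def lin_all weyl_comm)

lemma du_LR: "du p = - (\<i> *\<^sub>C (Lv p - Rv p))" and dv_LR: "dv p = \<i> *\<^sub>C (Lu p - Ru p)"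
  by (simp_all add: Lu_def Lv_def Ru_def Rv_def lin_all flip: scaleC_add_left cvec.scale_left_diff_distrib)

lemma mu_LR: "mu p = (1/2) *\<^sub>C (Lu p + Ru p)" and mv_LR: "mv p = (1/2) *\<^sub>C (Lv p + Rv p)"
  by (simp_all add: Lu_def Lv_def Ru_def Rv_def lin_all flip: scaleC_add_left cvec.scale_left_diff_distrib)

lemma pm_LR: assumes "clinear f"
  shows "pm f (Lu p) = Lu (pm f p)" "pm f (Lv p) = Lv (pm f p)" "pm f (Ru p) = Ru (pm f p)" "pm f (Rv p) = Rv (pm f p)"
  using assms by (simp_all add: Lu_def Lv_def Ru_def Rv_def lin_pm pm_comm)

lemma cst_LR: "Lu (cst x) = Ru (cst x)" "Lv (cst x) = Rv (cst x)"
  by (simp_all add: Lu_def Ru_def Lv_def Rv_def du_single0 dv_single0 cvec.scale_zero_right)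

lemma pm_id: "pm (\<lambda>x. x) p = p"
  by (rule poly_mapping_eqI) (simp add: clinear_id)

lemma scaleC_two: "2 *\<^sub>C x = x + x" for x :: "'a::cvector"
  using scaleC_add_left[of 1 1 x] by (simp add: scaleC_one)

text \<open>The constants generate all polynomials under right Moyal multiplication. An operator
  that commutes with \<open>Ru\<close> and \<open>Rv\<close>, or has a known commutation rule with
  them, is thus determined by its values on constants; most identities for the products below are
  proved this way.\<close>

lemma Ru_Rv_induct [case_names cst Ru Rv add scale]:
  fixes p :: "'c::cvector pol"
  assumes c: "\<And>c. P (cst c)" and Ru: "\<And>p. P p \<Longrightarrow> P (Ru p)" and Rv: "\<And>p. P p \<Longrightarrow> P (Rv p)"
    and add: "\<And>p q. P p \<Longrightarrow> P q \<Longrightarrow> P (p + q)" and scale: "\<And>p c. P p \<Longrightarrow> P (c *\<^sub>C p)"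
  shows "P p"
proof -
  have diff: "P (p - q)" if "P p" "P q" for p q
    using add[OF that(1) scale[OF that(2), of "-1"]] by (simp add: lin_all)
  have "P (Poly_Mapping.single (m, n) c)" for m n c
  proof (induction "m + n" arbitrary: m n c rule: less_induct)
    case less
    show ?case
    proof (cases m)
      case (Suc m')
      have "P (dv (Poly_Mapping.single (m', n) c))"
        by (cases n) (auto simp: dv_single0 dv_single c less Suc intro: assms(1)[of 0, simplified])
      moreover have "P (Poly_Mapping.single (m', n) c)" using less Suc by simp
      \<comment> \<open>The monomial with one more factor u is its right Moyal product with u, up to
        a term of lower degree.\<close>
      ultimately have "P (Ru (Poly_Mapping.single (m', n) c) - (\<i>/2) *\<^sub>C dv (Poly_Mapping.single (m', n) c))"
        by (intro diff scale Ru)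
      then show ?thesis by (simp add: Ru_def mu_single Suc)
    next
      case 0
      show ?thesis
      proof (cases n)
        case (Suc n')
        have "P (Rv (Poly_Mapping.single (0, n') c))"
          using less Suc 0 by (intro Rv) simp
        then show ?thesis by (simp add: Rv_def mv_single du_single0 Suc 0 cvec.scale_zero_right)
      qed (simp add: 0 c)
    qed
  qed
  then show ?thesis by (induction p rule: pol_induct) (auto intro: add)
qed

section \<open>The Moyal product with arbitrary coefficient pairings\<close>

text \<open>Left Moyal multiplication by the commutative power v^b, and in \<open>mono_uv\<close> by
  u^a v^b. Peeling one factor v off the left argument commutes it past the exponential of the
  Poisson bidifferential operator, which costs (i/2) d/du on the right argument; a factor u costs
  -(i/2) d/dv.\<close>

primrec mono_v :: "nat \<Rightarrow> 'c::cvector pol \<Rightarrow> 'c pol" where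
  "mono_v 0 q = q"
| "mono_v (Suc b) q = mv (mono_v b q) + (\<i> / 2) *\<^sub>C mono_v b (du q)"

primrec mono_uv :: "nat \<Rightarrow> nat \<Rightarrow> 'c::cvector pol \<Rightarrow> 'c pol" where
  "mono_uv 0 b q = mono_v b q"
| "mono_uv (Suc a) b q = mu (mono_uv a b q) - (\<i> / 2) *\<^sub>C mono_uv a b (dv q)"

lemma clinear_mono_v: "clinear (mono_v b)"
proof (induction b)
  case (Suc b)
  show ?case unfolding mono_v.simps
    by (intro clin_intros clinear_comp[OF clinear_mv] clinear_comp[OF Suc clinear_du] Suc)
qed (simp add: clinear_id)

lemma clinear_mono_uv: "clinear (mono_uv a b)"
proof (induction a)
  case (Suc a)
  show ?case unfolding mono_uv.simps
    by (intro clin_intros clinear_comp[OF clinear_mu] clinear_comp[OF Suc clinear_dv] Suc)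
qed (simp add: clinear_mono_v)

lemmas lin_mono = clinear_add[OF clinear_mono_v] clinear_scale[OF clinear_mono_v] clinear_diff[OF clinear_mono_v]
  clinear_add[OF clinear_mono_uv] clinear_scale[OF clinear_mono_uv] clinear_diff[OF clinear_mono_uv]
  clinear_zero[OF clinear_mono_uv] clinear_sum[OF clinear_mono_uv]

lemma mono_v_Ru: "Ru (mono_v b q) = mono_v b (Ru q)"
proof (induction b arbitrary: q)
  case (Suc b)
  show ?case
    using Suc[symmetric]
    by (simp add: lin_LR lin_all lin_mono du_Ru) (simp add: Ru_def lin_all weyl_comm)
qed auto

lemma mono_v_Rv: "Rv (mono_v b q) = mono_v b (Rv q)"
proof (induction b arbitrary: q)
  case (Suc b)
  show ?case
    using Suc[symmetric]
    by (simp add: lin_LR lin_all lin_mono du_Rv) (simp add: Rv_def lin_all weyl_comm)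
qed auto

lemma mono_uv_Ru: "Ru (mono_uv a b q) = mono_uv a b (Ru q)"
proof (induction a arbitrary: q)
  case (Suc a)
  show ?case
    using Suc[symmetric]
    by (simp add: lin_LR lin_all lin_mono dv_Ru) (simp add: Ru_def lin_all weyl_comm)
qed (simp add: mono_v_Ru)

lemma mono_uv_Rv: "Rv (mono_uv a b q) = mono_uv a b (Rv q)"
proof (induction a arbitrary: q)
  case (Suc a)
  show ?case
    using Suc[symmetric]
    by (simp add: lin_LR lin_all lin_mono dv_Rv) (simp add: Rv_def lin_all weyl_comm)
qed (simp add: mono_v_Rv)

lemmas mono_uv_R = mono_uv_Ru mono_uv_Rv

lemma mono_v_cst: "mono_v b (cst c) = Poly_Mapping.single (0, b) c"
  by (induction b) (simp_all add: mv_single du_single0 clinear_zero[OF clinear_mono_v] cvec.scale_zero_right)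

lemma mono_uv_cst: "mono_uv a b (cst c) = Poly_Mapping.single (a, b) c"
  by (induction a) (simp_all add: mono_v_cst mu_single dv_single0 clinear_zero[OF clinear_mono_uv] cvec.scale_zero_right)

lemma pm_mono_v: "clinear f \<Longrightarrow> pm f (mono_v b q) = mono_v b (pm f q)"
  by (induction b arbitrary: q) (simp_all add: lin_pm pm_comm)

lemma pm_mono_uv: "clinear f \<Longrightarrow> pm f (mono_uv a b q) = mono_uv a b (pm f q)"
  by (induction a arbitrary: q) (simp_all add: lin_pm pm_comm pm_mono_v)

text \<open>The Moyal product at \<open>\<hbar> = 1\<close>; coefficients are multiplied by \<open>B\<close>.\<close>

definition moy :: "('a::cvector \<Rightarrow> 'b::cvector \<Rightarrow> 'c::cvector) \<Rightarrow> 'a pol \<Rightarrow> 'b pol \<Rightarrow> 'c pol" where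
  "moy B p q = (\<Sum>k\<in>Poly_Mapping.keys p. mono_uv (fst k) (snd k) (pm (B (Poly_Mapping.lookup p k)) q))"

lemma cbil_lin:
  assumes "cbilinear B"
  shows "B (x + y) z = B x z + B y z" "B (c *\<^sub>C x) z = c *\<^sub>C B x z" "B 0 z = 0" "B (x - y) z = B x z - B y z"
    "B w (x' + y') = B w x' + B w y'" "B w (c *\<^sub>C x') = c *\<^sub>C B w x'" "B w 0 = 0" "B w (x' - y') = B w x' - B w y'"
  using cbilinearD1[OF assms, of w] cbilinearD2[OF assms, of z]
  by (simp_all add: clinear_add clinear_scale clinear_zero clinear_diff clinear_add[OF cbilinearD2[OF assms]]
      clinear_diff[OF cbilinearD2[OF assms]] clinear_scale[OF cbilinearD2[OF assms]] clinear_zero[OF cbilinearD2[OF assms]])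

context
  fixes B :: "'a::cvector \<Rightarrow> 'b::cvector \<Rightarrow> 'c::cvector"
  assumes B: "cbilinear B"
begin

lemma moy_superset:
  assumes "finite S" "Poly_Mapping.keys p \<subseteq> S"
  shows "moy B p q = (\<Sum>k\<in>S. mono_uv (fst k) (snd k) (pm (B (Poly_Mapping.lookup p k)) q))"
proof -
  have "pm (B 0) q = 0"
    by (rule poly_mapping_eqI) (simp add: cbilinearD1[OF B] cbil_lin(3)[OF B])
  then show ?thesis
    unfolding moy_def using assms by (intro sum.mono_neutral_left) (auto simp: in_keys_iff lin_mono)
qed

lemma clinear_moy_left: "clinear (\<lambda>p. moy B p q)"
proof (rule clinearI)
  fix x y :: "'a pol" and c
  let ?S = "Poly_Mapping.keys x \<union> Poly_Mapping.keys y"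
  have S: "finite ?S" by simp
  have "pm (B (a + b)) q = pm (B a) q + pm (B b) q" for a b
    by (rule poly_mapping_eqI) (simp add: cbilinearD1[OF B] cbil_lin[OF B] lookup_add)
  then show "moy B (x + y) q = moy B x q + moy B y q"
    using moy_superset[OF S, of x q] moy_superset[OF S, of y q]
      moy_superset[OF S, of "x + y" q] keys_add[of x y]
    by (simp add: lookup_add sum.distrib lin_mono)
  have "pm (B (c *\<^sub>C a)) q = c *\<^sub>C pm (B a) q" for a
    by (rule poly_mapping_eqI) (simp add: cbilinearD1[OF B] cbil_lin[OF B])
  moreover have "Poly_Mapping.keys (c *\<^sub>C x) \<subseteq> Poly_Mapping.keys x"
    by (auto simp: in_keys_iff lookup_scaleC cvec.scale_zero_right)
  ultimately show "moy B (c *\<^sub>C x) q = c *\<^sub>C moy B x q"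
    using moy_superset[of "Poly_Mapping.keys x" x q] moy_superset[of "Poly_Mapping.keys x" "c *\<^sub>C x" q]
    by (simp add: lin_mono cvec.scale_sum_right)
qed

lemma clinear_moy_right: "clinear (moy B p)"
  unfolding moy_def
  by (intro clinear_sum' clinear_comp[OF clinear_mono_uv] clinear_pm cbilinearD1[OF B])

lemma cbilinear_moy: "cbilinear (moy B)"
  by (intro cbilinearI clinear_moy_left clinear_moy_right)

lemma moy_single: "moy B (Poly_Mapping.single (a, b) x) q = mono_uv a b (pm (B x) q)"
  using moy_superset[of "{(a, b)}" "Poly_Mapping.single (a, b) x" q] by (simp add: lookup_single)

lemma moy_cst_left: "moy B (cst x) q = pm (B x) q"
  by (simp add: moy_single)

lemma moy_cst_right: "moy B p (cst y) = pm (\<lambda>x. B x y) p"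
  by (induction p rule: pol_induct, case_tac k)
     (simp_all add: moy_single pm_single cbilinearD1[OF B] cbilinearD2[OF B] mono_uv_cst
       clinear_add[OF clinear_moy_left] clinear_add[OF clinear_pm])

lemma moy_R: "moy B p (Ru q) = Ru (moy B p q)" "moy B p (Rv q) = Rv (moy B p q)"
  by (simp_all add: moy_def lin_LR mono_uv_R pm_LR cbilinearD1[OF B])

lemmas moy_lin_left = clinear_add[OF clinear_moy_left] clinear_scale[OF clinear_moy_left] clinear_zero[OF clinear_moy_left]
  clinear_diff[OF clinear_moy_left] clinear_minus[OF clinear_moy_left] clinear_sum[OF clinear_moy_left]
lemmas moy_lin_right = clinear_add[OF clinear_moy_right] clinear_scale[OF clinear_moy_right] clinear_zero[OF clinear_moy_right]
  clinear_diff[OF clinear_moy_right] clinear_minus[OF clinear_moy_right] clinear_sum[OF clinear_moy_right]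

lemma moy_L: "moy B (Lu p) q = Lu (moy B p q)" "moy B (Lv p) q = Lv (moy B p q)"
  by (induction q rule: Ru_Rv_induct)
     (simp_all add: moy_cst_right pm_LR cbilinearD2[OF B] moy_R moy_lin_right lin_LR LR_comm)

text \<open>Associativity with a generator in the middle. For constant second argument both sides
  are right multiplication by the generator, since generators commute with constants
  (\<open>cst_LR\<close>).\<close>

lemma moy_mid: "moy B (Ru p) q = moy B p (Lu q)" "moy B (Rv p) q = moy B p (Lv q)"
  by (induction q rule: Ru_Rv_induct)
     (simp_all add: moy_cst_right pm_LR cbilinearD2[OF B] moy_R moy_lin_right lin_LR LR_comm cst_LR)

lemma moy_unique:
  assumes "clinear T" "\<And>q. T (Ru q) = Ru (T q)" "\<And>q. T (Rv q) = Rv (T q)"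
    "\<And>y. T (cst y) = pm (\<lambda>x. B x y) p"
  shows "T q = moy B p q"
  by (induction q rule: Ru_Rv_induct)
     (simp_all add: assms(2-) moy_cst_right moy_R moy_lin_right clinear_add[OF assms(1)] clinear_scale[OF assms(1)])

text \<open>The derivatives are commutators with generators (\<open>du_LR\<close>,
  \<open>dv_LR\<close>), so the Leibniz rule is a telescoping consequence of associativity with
  generators.\<close>

lemma moy_du: "du (moy B p q) = moy B (du p) q + moy B p (du q)"
  and moy_dv: "dv (moy B p q) = moy B (dv p) q + moy B p (dv q)"
  by (simp_all add: du_LR dv_LR moy_lin_left moy_lin_right moy_R moy_mid moy_L lin_all)

end

section \<open>The twisted product of crossed product and Weyl algebra\<close>

definition Nop :: "'c::cvector pol \<Rightarrow> 'c pol" where "Nop p = mu (dv p)"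

lemma clinear_Nop: "clinear Nop"
  unfolding Nop_def by (intro clinear_comp[OF clinear_mu clinear_dv])

lemmas lin_Nop = clinear_add[OF clinear_Nop] clinear_scale[OF clinear_Nop] clinear_zero[OF clinear_Nop]
  clinear_diff[OF clinear_Nop] clinear_minus[OF clinear_Nop] clinear_sum[OF clinear_Nop]

text \<open>The derivation u d/dv is inner, equal to (i/2)[u^2, .]. This is why the Schwarzian
  defect of the connection can be written as a commutator with a section, and it is the source of
  Delta_gamma.\<close>

lemma Nop_LR: "Nop p = (\<i> / 2) *\<^sub>C (Lu (Lu p) - Ru (Ru p))"
  by (simp add: Nop_def mu_LR dv_LR lin_LR LR_comm lin_all)

lemma Nop_Ru: "Nop (Ru p) = Ru (Nop p)"
  and Nop_Rv: "Nop (Rv p) = Rv (Nop p) + Ru p"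
  by (simp_all add: Nop_def Ru_def Rv_def lin_all weyl_comm)

lemma pm_Nop: "clinear f \<Longrightarrow> pm f (Nop p) = Nop (pm f p)"
  by (simp add: Nop_def pm_comm)

lemma Nop_cst: "Nop (cst c) = 0"
  by (simp add: Nop_def dv_single0 lin_mu)

lemma clinear_funpow: "clinear f \<Longrightarrow> clinear (f ^^ n)" for f :: "'a::cvector \<Rightarrow> 'a"
proof (induction n)
  case 0
  have "f ^^ 0 = (\<lambda>x. x)" by (rule ext) simp
  then show ?case using clinear_id by metis
next
  case (Suc n)
  have "f ^^ Suc n = (\<lambda>x. f ((f ^^ n) x))" by (rule ext) simp
  then show ?case using clinear_comp[OF \<open>clinear f\<close> Suc.IH[OF \<open>clinear f\<close>]] by metis
qed

lemma Nop_pow_Ru: "(Nop ^^ n) (Ru p) = Ru ((Nop ^^ n) p)"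
  by (induction n) (simp_all add: Nop_Ru)

lemma Nop_pow_Rv: "(Nop ^^ n) (Rv p) = Rv ((Nop ^^ n) p) + of_nat n *\<^sub>C Ru ((Nop ^^ (n - 1)) p)"
proof (induction n)
  case (Suc n)
  then show ?case
    by (cases n) (simp_all add: lin_Nop Nop_Rv Nop_Ru lin_all add_ac scaleC_two)
qed (simp add: cvec.scale_zero_left)

lemma Nop_pow_zero:
  assumes "\<And>k. snd k \<ge> d \<Longrightarrow> Poly_Mapping.lookup p k = 0"
  shows "(Nop ^^ d) p = 0"
  using assms
proof (induction d arbitrary: p)
  case 0
  then show ?case by (intro poly_mapping_eqI) simp
next
  case (Suc d)
  have "(Nop ^^ d) (Nop p) = 0"
    by (rule Suc.IH) (simp add: Nop_def Suc.prems cvec.scale_zero_right split: nat.split)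
  then show ?case by (simp add: funpow_swap1)
qed

text \<open>Each application of u d/dv lowers the degree in v, so the exponential in
  \<open>tw\<close> is a finite sum on every polynomial.\<close>

lemma Nop_nilpotent: "\<exists>n. \<forall>m\<ge>n. (Nop ^^ m) p = 0"
proof -
  obtain n where n: "\<And>k. k \<in> Poly_Mapping.keys p \<Longrightarrow> snd k < n"
    using finite_nat_set_iff_bounded[of "snd ` Poly_Mapping.keys p"] by auto
  have "(Nop ^^ m) p = 0" if "m \<ge> n" for m
    by (rule Nop_pow_zero) (use n that in \<open>force simp: in_keys_iff\<close>)
  then show ?thesis by blast
qed

lemma vdu_LR: "mv (du p) = - ((\<i> / 2) *\<^sub>C (Lv (Lv p) - Rv (Rv p)))"
  by (simp add: mv_LR du_LR lin_LR LR_comm lin_all)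

text \<open>Together with u d/dv and v d/du this operator spans the copy of sl_2 formed by the inner
  derivations of quadratic elements.\<close>

definition Gop :: "'x::cvector pol \<Rightarrow> 'x pol" where "Gop p = mu (du p) - mv (dv p)"

lemma Gop_LR: "Gop p = (\<i> / 2) *\<^sub>C (Ru (Rv p) + Rv (Ru p) - Lu (Lv p) - Lv (Lu p))"
  by (simp add: Gop_def mu_LR dv_LR mv_LR du_LR lin_LR LR_comm lin_all algebra_simps)

text \<open>The product of the crossed product algebra tensored with the Weyl algebra: a diffeomorphism
  acts on the fibre by \<open>exp (- \<delta>\<^sub>1 u \<partial>\<^sub>v)\<close>, and \<open>d\<close> is multiplication by \<open>\<delta>\<^sub>1\<close>.\<close>

definition tw :: "('a::cvector \<Rightarrow> 'b::cvector \<Rightarrow> 'c::cvector) \<Rightarrow> ('a \<Rightarrow> 'a) \<Rightarrow> 'a pol \<Rightarrow> 'b pol \<Rightarrow> 'c pol" where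
  "tw B d p q = Sum_any (\<lambda>n. ((- 1) ^ n / fact n) *\<^sub>C moy B (pm (d ^^ n) p) ((Nop ^^ n) q))"

context
  fixes B :: "'a::cvector \<Rightarrow> 'b::cvector \<Rightarrow> 'c::cvector" and d :: "'a \<Rightarrow> 'a"
  assumes B: "cbilinear B" and d: "clinear d"
begin

lemmas mll = moy_lin_left[OF B]
lemmas mlr = moy_lin_right[OF B]

lemma tw_eq:
  assumes "\<And>m. m \<ge> n \<Longrightarrow> (Nop ^^ m) q = 0"
  shows "tw B d p q = (\<Sum>i<n. ((- 1) ^ i / fact i) *\<^sub>C moy B (pm (d ^^ i) p) ((Nop ^^ i) q))"
  unfolding tw_def
proof (rule Sum_any.expand_superset)
  show "{a. ((- 1) ^ a / fact a) *\<^sub>C moy B (pm (d ^^ a) p) ((Nop ^^ a) q) \<noteq> 0} \<subseteq> {..<n}"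
    using assms by (force simp: mlr cvec.scale_zero_right not_less[symmetric])
qed auto

lemma clinear_tw_left: "clinear (\<lambda>p. tw B d p q)"
proof -
  obtain n where n: "\<forall>m\<ge>n. (Nop ^^ m) q = 0" using Nop_nilpotent by blast
  have "(\<lambda>p. tw B d p q) = (\<lambda>p. \<Sum>i<n. ((- 1) ^ i / fact i) *\<^sub>C moy B (pm (d ^^ i) p) ((Nop ^^ i) q))"
    by (rule ext, rule tw_eq) (use n in blast)
  moreover have "clinear \<dots>"
    by (intro clinear_sum' clinear_const_scale clinear_comp[OF clinear_moy_left[OF B]] clinear_pm clinear_funpow d)
  ultimately show ?thesis by simp
qed

lemma clinear_tw_right: "clinear (tw B d p)"
proof (rule clinearI)
  fix x y :: "'b pol" and c
  obtain n where n: "\<forall>m\<ge>n. (Nop ^^ m) x = 0" using Nop_nilpotent by blast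
  obtain n' where n': "\<forall>m\<ge>n'. (Nop ^^ m) y = 0" using Nop_nilpotent by blast
  let ?n = "max n n'"
  note l = clinear_add[OF clinear_funpow[OF clinear_Nop]] clinear_scale[OF clinear_funpow[OF clinear_Nop]]
  show "tw B d p (x + y) = tw B d p x + tw B d p y"
    using n n' by (simp add: tw_eq[of ?n] l mlr scaleC_add_right sum.distrib)
  show "tw B d p (c *\<^sub>C x) = c *\<^sub>C tw B d p x"
    using n by (simp add: tw_eq[of n] l mlr cvec.scale_zero_right cvec.scale_sum_right scaleC_scaleC mult.commute)
qed

lemma cbilinear_tw: "cbilinear (tw B d)"
  by (intro cbilinearI clinear_tw_left clinear_tw_right)

lemmas tll = clinear_add[OF clinear_tw_left] clinear_scale[OF clinear_tw_left] clinear_zero[OF clinear_tw_left]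
  clinear_diff[OF clinear_tw_left] clinear_minus[OF clinear_tw_left] clinear_sum[OF clinear_tw_left]
lemmas tlr = clinear_add[OF clinear_tw_right] clinear_scale[OF clinear_tw_right] clinear_zero[OF clinear_tw_right]
  clinear_diff[OF clinear_tw_right] clinear_minus[OF clinear_tw_right] clinear_sum[OF clinear_tw_right]

lemma tw_cst_right: "tw B d p (cst y) = pm (\<lambda>x. B x y) p"
proof -
  have "(Nop ^^ m) (cst y) = 0" if "m \<ge> 1" for m
    by (rule Nop_pow_zero) (use that in \<open>auto simp: lookup_single when_def\<close>)
  then have "tw B d p (cst y) = moy B (pm (\<lambda>x. x) p) (cst y)"
    by (subst tw_eq[of 1]) (auto simp: id_def scaleC_one)
  then show ?thesis by (simp add: pm_id moy_cst_right[OF B])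
qed

lemma tw_Ru: "tw B d p (Ru q) = Ru (tw B d p q)"
proof -
  obtain n where n: "\<forall>m\<ge>n. (Nop ^^ m) q = 0" using Nop_nilpotent by blast
  show ?thesis
    using n by (simp add: tw_eq[of n] Nop_pow_Ru lin_LR moy_R[OF B])
qed

text \<open>The map exp(-d u d/dv) is an automorphism of the Moyal product that fixes u and sends v
  to v - d u; a right factor v therefore splits into these two.\<close>

lemma tw_Rv: "tw B d p (Rv q) = Rv (tw B d p q) - Ru (tw B d (pm d p) q)"
proof -
  obtain n where n: "\<forall>m\<ge>n. (Nop ^^ m) q = 0" using Nop_nilpotent by blast
  let ?T = "\<lambda>i. ((- 1) ^ i / fact i) *\<^sub>C moy B (pm (d ^^ i) p) ((Nop ^^ i) q)"
  let ?T' = "\<lambda>i. ((- 1) ^ i / fact i) *\<^sub>C moy B (pm (d ^^ i) (pm d p)) ((Nop ^^ i) q)"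
  have "(Nop ^^ m) (Rv q) = 0" if "m \<ge> Suc n" for m
    using that n by (simp add: Nop_pow_Rv lin_LR cvec.scale_zero_right le_diff_conv)
  then have "tw B d p (Rv q) = (\<Sum>i<Suc n. ((- 1) ^ i / fact i) *\<^sub>C moy B (pm (d ^^ i) p) ((Nop ^^ i) (Rv q)))"
    by (rule tw_eq)
  also have "\<dots> = (\<Sum>i<Suc n. Rv (?T i)) + (\<Sum>i<Suc n. ((- 1) ^ i / fact i * of_nat i) *\<^sub>C
      Ru (moy B (pm (d ^^ i) p) ((Nop ^^ (i - 1)) q)))"
    by (simp add: Nop_pow_Rv mlr moy_R[OF B] lin_LR scaleC_add_right sum.distrib scaleC_scaleC)
  also have "(\<Sum>i<Suc n. Rv (?T i)) = Rv (tw B d p q)"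
    using n by (simp add: tw_eq[of n] lin_LR mlr cvec.scale_zero_right)
  also have "(\<Sum>i<Suc n. ((- 1) ^ i / fact i * of_nat i) *\<^sub>C Ru (moy B (pm (d ^^ i) p) ((Nop ^^ (i - 1)) q)))
    = (\<Sum>i<n. - Ru (?T' i))" (is "sum ?F _ = _")
  proof -
    \<comment> \<open>The factor i + 1 from the commutation rule cancels in the factorial, leaving
      minus the i-th term of the series in which one d has been moved to the left factor.\<close>
    have "?F (Suc i) = - Ru (?T' i)" for i
    proof -
      have "d ^^ Suc i = (\<lambda>x. (d ^^ i) (d x))" by (rule ext) (simp add: funpow_swap1)
      then have 1: "pm (d ^^ Suc i) p = pm (d ^^ i) (pm d p)"
        by (simp only: pm_pm[OF clinear_funpow[OF d] d])
      have 2: "(- 1) ^ Suc i / fact (Suc i) * of_nat (Suc i) = (- ((- 1) ^ i / fact i) :: complex)"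
        by (simp add: fact_Suc field_simps del: of_nat_Suc)
      show ?thesis unfolding 1 2 by (simp add: lin_LR)
    qed
    moreover have "?F 0 = 0" by (simp add: cvec.scale_zero_left)
    ultimately show ?thesis by (simp only: sum.lessThan_Suc_shift add_0)
  qed
  also have "\<dots> = - Ru (tw B d (pm d p) q)"
    using n by (simp add: tw_eq[of n] lin_LR sum_negf)
  finally show ?thesis by simp
qed

lemma tw_unique:
  assumes "\<And>p. clinear (T p)" "\<And>p q. T p (Ru q) = Ru (T p q)"
    "\<And>p q. T p (Rv q) = Rv (T p q) - Ru (T (pm d p) q)"
    "\<And>p y. T p (cst y) = pm (\<lambda>x. B x y) p"
  shows "T p q = tw B d p q"
  by (induction q arbitrary: p rule: Ru_Rv_induct)
     (simp_all add: assms(2-) tw_cst_right tw_Ru tw_Rv tlr clinear_add[OF assms(1)] clinear_scale[OF assms(1)])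

lemma tw_L: "tw B d (Lu p) q = Lu (tw B d p q)" "tw B d (Lv p) q = Lv (tw B d p q)"
  by (induction q arbitrary: p rule: Ru_Rv_induct)
     (simp_all add: tw_cst_right pm_LR cbilinearD2[OF B] d tw_Ru tw_Rv tlr lin_LR LR_comm)

lemma tw_mid_u: "tw B d (Ru p) q = tw B d p (Lu q)"
  by (induction q arbitrary: p rule: Ru_Rv_induct)
     (simp_all add: tw_cst_right pm_LR cbilinearD2[OF B] d tw_Ru tw_Rv tlr lin_LR LR_comm cst_LR)

text \<open>Moving v from the left factor to the right one crosses the fibre action, so the inverse
  substitution v -> v + d u appears.\<close>

lemma tw_mid_v: "tw B d (Rv p) q = tw B d p (Lv q) + tw B d (pm d p) (Lu q)"
proof (induction q arbitrary: p rule: Ru_Rv_induct)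
  case (Rv q)
  then show ?case
    by (simp add: tw_Rv LR_comm pm_LR d lin_LR)
qed (simp_all add: tw_cst_right pm_LR cbilinearD2[OF B] d tw_Ru tw_Rv tlr lin_LR LR_comm cst_LR scaleC_add_right)

lemma Rv_tw: "Rv (tw B d p q) = tw B d p (Rv q) + tw B d (pm d p) (Ru q)"
  by (simp add: tw_Rv tw_Ru)

lemma Ru_tw: "Ru (tw B d p q) = tw B d p (Ru q)"
  by (simp add: tw_Ru)

lemmas tw_norm = tw_mid_u tw_mid_v tw_L[symmetric] Rv_tw Ru_tw pm_LR[OF d] tll tlr lin_LR LR_comm
  clinear_add[OF clinear_pm[OF d]] clinear_diff[OF clinear_pm[OF d]] clinear_scale[OF clinear_pm[OF d]]
  clinear_minus[OF clinear_pm[OF d]]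

lemma tw_du: "du (tw B d p q) = tw B d (du p) q + tw B d p (du q) - tw B d (pm d p) (dv q)"
  by (simp add: du_LR dv_LR tw_norm lin_all)

lemma tw_dv: "dv (tw B d p q) = tw B d (dv p) q + tw B d p (dv q)"
  by (simp add: du_LR dv_LR tw_norm lin_all)

text \<open>Conjugation in sl_2 by exp(-d u d/dv) sends v d/du to v d/du + d (u d/du - v d/dv) - d^2
  u d/dv, and in \<open>tw_Gop\<close> sends u d/du - v d/dv to itself minus 2 d u d/dv.\<close>

lemma tw_vdu: "mv (du (tw B d p q)) = tw B d (mv (du p)) q + tw B d p (mv (du q))
    + tw B d (pm d p) (Gop q) - tw B d (pm d (pm d p)) (Nop q)"
  by (simp add: vdu_LR Gop_LR Nop_LR tw_norm lin_all)

lemma tw_Gop: "Gop (tw B d p q) = tw B d (Gop p) q + tw B d p (Gop q)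
    - tw B d (pm d p) (Nop q) - tw B d (pm d p) (Nop q)"
  by (simp add: Gop_LR Nop_LR tw_norm lin_all)

end

section \<open>Covariant derivatives and their compatibility with the coproduct\<close>

text \<open>The part of the connection other than delta, in the invariant frame: \<open>P0\<close>
  differentiates along X and \<open>Qo\<close> along -Y. In \<open>Pl\<close> and \<open>Pr\<close>
  the first operator is corrected by the Schwarzian element times left or right multiplication by
  u^2: \<open>Pl\<close> governs U_gamma, \<open>Pr\<close> governs the lift of a function times the
  inverse of U_gamma.\<close>

definition P0 :: "('c::cvector \<Rightarrow> 'c) \<Rightarrow> 'c pol \<Rightarrow> 'c pol" where
  "P0 X p = pm X p - (1/2) *\<^sub>C mv (du p)"
definition Pr :: "('c::cvector \<Rightarrow> 'c) \<Rightarrow> ('c \<Rightarrow> 'c) \<Rightarrow> 'c pol \<Rightarrow> 'c pol" where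
  "Pr X S p = P0 X p - (\<i>/2) *\<^sub>C pm S (Ru (Ru p))"
definition Pl :: "('c::cvector \<Rightarrow> 'c) \<Rightarrow> ('c \<Rightarrow> 'c) \<Rightarrow> 'c pol \<Rightarrow> 'c pol" where
  "Pl X S p = P0 X p + (\<i>/2) *\<^sub>C pm S (Lu (Lu p))"
definition Qo :: "('c::cvector \<Rightarrow> 'c) \<Rightarrow> 'c pol \<Rightarrow> 'c pol" where
  "Qo Y p = - pm Y p - (1/2) *\<^sub>C mv (dv p) + (1/2) *\<^sub>C mu (du p)"

lemma scaleC_half: "(1/2) *\<^sub>C x + (1/2) *\<^sub>C x = x" for x :: "'a::cvector"
  by (simp add: scaleC_one flip: scaleC_add_left)

lemma Qo_Gop: "Qo Y p = - pm Y p + (1/2) *\<^sub>C Gop p"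
  by (simp add: Qo_def Gop_def lin_all)

lemma clinear_P0: "clinear X \<Longrightarrow> clinear (P0 X)"
  unfolding P0_def by (intro clin_intros clinear_comp[OF clinear_mv])
lemma clinear_Pl: "clinear X \<Longrightarrow> clinear S \<Longrightarrow> clinear (Pl X S)"
  unfolding Pl_def
  by (intro clin_intros clinear_P0 clinear_comp[OF clinear_pm] clinear_comp[OF clinear_Lu clinear_Lu])
lemma clinear_Pr: "clinear X \<Longrightarrow> clinear S \<Longrightarrow> clinear (Pr X S)"
  unfolding Pr_def
  by (intro clin_intros clinear_P0 clinear_comp[OF clinear_pm] clinear_comp[OF clinear_Ru clinear_Ru])
lemma clinear_Qo: "clinear Y \<Longrightarrow> clinear (Qo Y)"
  unfolding Qo_def by (intro clin_intros clinear_comp[OF clinear_mv] clinear_comp[OF clinear_mu])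

text \<open>\<open>X, Y, d\<close> act through the coproduct; \<open>d2\<close> is the commutator of \<open>X\<close> and \<open>d\<close>, and
  \<open>S = d2 - d\<^sup>2 / 2\<close> is primitive.\<close>

locale coproduct_action =
  fixes B :: "'a::cvector \<Rightarrow> 'b::cvector \<Rightarrow> 'c::cvector"
    and d d2 X1 Y1 S1 :: "'a \<Rightarrow> 'a" and X2 Y2 S2 :: "'b \<Rightarrow> 'b" and X3 Y3 S3 :: "'c \<Rightarrow> 'c"
  assumes B: "cbilinear B"
    and lins: "clinear d" "clinear d2" "clinear X1" "clinear Y1" "clinear S1" "clinear X2" "clinear Y2" "clinear S2"
      "clinear X3" "clinear Y3" "clinear S3"
    and X3: "X3 (B x y) = B (X1 x) y + B x (X2 y) + B (d x) (Y2 y)"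
    and Y3: "Y3 (B x y) = B (Y1 x) y + B x (Y2 y)"
    and S3: "S3 (B x y) = B (S1 x) y + B x (S2 y)"
    and X1d: "X1 (d x) = d (X1 x) + d2 x"
    and Y1d: "Y1 (d x) = d (Y1 x) + d x"
    and d2d: "d2 (d x) = d (d2 x)"
    and S1: "S1 x = d2 x - (1/2) *\<^sub>C d (d x)"
begin

lemmas clin_pm = clinear_add[OF clinear_pm] clinear_scale[OF clinear_pm] clinear_diff[OF clinear_pm]
lemmas tw_rules = tw_cst_right[OF B lins(1)] tw_Ru[OF B lins(1)] tw_Rv[OF B lins(1)] tll[OF B lins(1)] tlr[OF B lins(1)]

lemma pm_X1d: "pm X1 (pm d p) = pm d (pm X1 p) + pm d2 p"
  and pm_Y1d: "pm Y1 (pm d p) = pm d (pm Y1 p) + pm d p"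
  and pm_d2d: "pm d2 (pm d p) = pm d (pm d2 p)"
  and pm_S1: "pm S1 p = pm d2 p - (1/2) *\<^sub>C pm d (pm d p)"
  by (rule poly_mapping_eqI; simp add: lins X1d Y1d d2d S1 lookup_add lookup_minus)+

lemma cst_X: "pm X3 (pm (\<lambda>x. B x y) p) = pm (\<lambda>x. B x y) (pm X1 p) + pm (\<lambda>x. B x (X2 y)) p + pm (\<lambda>x. B x (Y2 y)) (pm d p)"
  and cst_Y: "pm Y3 (pm (\<lambda>x. B x y) p) = pm (\<lambda>x. B x y) (pm Y1 p) + pm (\<lambda>x. B x (Y2 y)) p"
  and cst_S: "pm S3 (pm (\<lambda>x. B x y) p) = pm (\<lambda>x. B x y) (pm S1 p) + pm (\<lambda>x. B x (S2 y)) p"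
  by (rule poly_mapping_eqI; simp add: lins cbilinearD2[OF B] X3 Y3 S3 lookup_add)+

lemmas lin_d = lins(1,2)[THEN clinear_pm, THEN clinear_add] lins(1,2)[THEN clinear_pm, THEN clinear_scale]
lemmas pm_LR' = lins[THEN pm_LR(1)] lins[THEN pm_LR(2)] lins[THEN pm_LR(3)] lins[THEN pm_LR(4)]
lemmas lin_ops = lins[THEN clinear_pm, THEN clinear_add] lins[THEN clinear_pm, THEN clinear_scale]
  lins[THEN clinear_pm, THEN clinear_diff] lins[THEN clinear_pm, THEN clinear_minus]

text \<open>Beyond the coproduct of X, moving X past exp(-d u d/dv) differentiates the exponent.
  Since the commutator \<open>d2\<close> of X and d commutes with d, the only correction is -d2 u
  d/dv. In the same way \<open>tw_Y\<close> picks up -d u d/dv, because d has weight one under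
  Y.\<close>

lemma tw_X: "pm X3 (tw B d p q) = tw B d (pm X1 p) q + tw B d p (pm X2 q) + tw B d (pm d p) (pm Y2 q)
    - tw B d (pm d2 p) (Nop q)"
  by (induction q arbitrary: p rule: Ru_Rv_induct)
     (simp_all add: tw_rules cst_X pm_single lins Nop_cst lin_LR lin_ops pm_LR' pm_X1d pm_d2d Nop_Ru Nop_Rv lin_Nop
       scaleC_add_right cvec.scale_right_diff_distrib)

lemma tw_Y: "pm Y3 (tw B d p q) = tw B d (pm Y1 p) q + tw B d p (pm Y2 q) - tw B d (pm d p) (Nop q)"
  by (induction q arbitrary: p rule: Ru_Rv_induct)
     (simp_all add: tw_rules cst_Y pm_single lins Nop_cst lin_LR lin_ops pm_LR' pm_Y1d Nop_Ru Nop_Rv lin_Nop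
       scaleC_add_right cvec.scale_right_diff_distrib)

lemma pm_S1d: "pm S1 (pm d p) = pm d (pm S1 p)"
  by (simp add: pm_S1 lin_ops pm_d2d)

lemma tw_S: "pm S3 (tw B d p q) = tw B d (pm S1 p) q + tw B d p (pm S2 q)"
  by (induction q arbitrary: p rule: Ru_Rv_induct)
     (simp_all add: tw_rules cst_S pm_single lins lin_LR lin_ops pm_LR' pm_S1d
       scaleC_add_right cvec.scale_right_diff_distrib)

text \<open>The decisive cancellation. The operator \<open>P0\<close> alone fails to be compatible
  with the twisted product by -S u d/dv. Since S is primitive and u d/dv = (i/2)(L_u^2 - R_u^2),
  subtracting (i/2) S R_u^2 from \<open>P0\<close> on all three factors produces exactly the same
  defect and removes it.\<close>

lemma tw_Pr: "Pr X3 S3 (tw B d p q) = tw B d (Pr X1 S1 p) q + tw B d p (Pr X2 S2 q) - tw B d (pm d p) (Qo Y2 q)"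
proof -
  \<comment> \<open>X contributes -d2 u d/dv and the conjugated -(1/2) v d/du contributes (1/2) d^2
    u d/dv; together they are -S u d/dv. The terms of first order in d combine to -d applied with
    \<open>Qo\<close> on the right factor.\<close>
  have 1: "P0 X3 (tw B d p q) = tw B d (P0 X1 p) q + tw B d p (P0 X2 q) - tw B d (pm d p) (Qo Y2 q) - tw B d (pm S1 p) (Nop q)"
    by (simp add: P0_def Qo_Gop tw_X tw_vdu[OF B lins(1)] tw_rules lin_all pm_S1)
  have 2: "(\<i>/2) *\<^sub>C pm S3 (Ru (Ru (tw B d p q))) = (\<i>/2) *\<^sub>C tw B d (pm S1 (Ru (Ru p))) q
      + (\<i>/2) *\<^sub>C tw B d p (pm S2 (Ru (Ru q))) - tw B d (pm S1 p) (Nop q)"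
    by (simp add: tw_Ru[OF B lins(1), symmetric] tw_S pm_LR' tw_mid_u[OF B lins(1)] Nop_LR
        tll[OF B lins(1)] tlr[OF B lins(1)] lin_all)
  show ?thesis
    unfolding Pr_def 1 2 by (simp add: tw_rules)
qed

lemma tw_Qo: "Qo Y3 (tw B d p q) = tw B d (Qo Y1 p) q + tw B d p (Qo Y2 q)"
proof -
  have h: "- ((1/2) *\<^sub>C z) - (1/2) *\<^sub>C z = - z" for z :: "'c pol"
    by (simp only: diff_conv_add_uminus minus_add_distrib[symmetric] scaleC_half)
  show ?thesis
    by (simp add: Qo_Gop tw_Y tw_Gop[OF B lins(1)] tw_rules lin_all h)
qed

end

subsection \<open>Flat series\<close>

text \<open>Here \<open>a n\<close> is the component of total degree n, where u and v have degree 1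
  and hbar has degree 2, written with hbar = 1. The operator delta lowers the total degree by one
  while the rest of the connection preserves it, hence the shift of index; the component of degree 0
  is a constant.\<close>

definition flat :: "('c::cvector pol \<Rightarrow> 'c pol) \<Rightarrow> ('c pol \<Rightarrow> 'c pol) \<Rightarrow> (nat \<Rightarrow> 'c pol) \<Rightarrow> bool" where
  "flat P Q a \<longleftrightarrow> du (a 0) = 0 \<and> dv (a 0) = 0 \<and> (\<forall>n. du (a (Suc n)) = P (a n) \<and> dv (a (Suc n)) = Q (a n))"

definition conv :: "('a \<Rightarrow> 'b \<Rightarrow> 'c::comm_monoid_add) \<Rightarrow> (nat \<Rightarrow> 'a) \<Rightarrow> (nat \<Rightarrow> 'b) \<Rightarrow> nat \<Rightarrow> 'c" where
  "conv T a b n = (\<Sum>i\<le>n. T (a i) (b (n - i)))"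

lemma pol_eqI:
  assumes "du p = du q" "dv p = dv q" "Poly_Mapping.lookup p (0, 0) = Poly_Mapping.lookup q (0, 0)"
  shows "p = q"
proof (rule poly_mapping_eqI)
  fix k :: "nat \<times> nat"
  obtain m n where k: "k = (m, n)" by (cases k)
  have c: "of_nat (Suc j) *\<^sub>C x = of_nat (Suc j) *\<^sub>C y \<longleftrightarrow> x = y" for j and x y :: 'a
    by (simp only: cvec.scale_cancel_left of_nat_eq_0_iff) simp
  show "Poly_Mapping.lookup p k = Poly_Mapping.lookup q k"
  proof (cases m)
    case (Suc m')
    have "Poly_Mapping.lookup (du p) (m', n) = Poly_Mapping.lookup (du q) (m', n)" using assms by simp
    then show ?thesis using c[of m'] by (simp add: k Suc)
  next
    case 0
    show ?thesis
    proof (cases n)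
      case (Suc n')
      have "Poly_Mapping.lookup (dv p) (m, n') = Poly_Mapping.lookup (dv q) (m, n')" using assms by simp
      then show ?thesis using c[of n'] by (simp add: k Suc 0)
    qed (use assms 0 k in simp)
  qed
qed

lemma flat_unique:
  assumes "flat P Q a" "flat P Q b" "\<And>n. Poly_Mapping.lookup (a n) (0, 0) = Poly_Mapping.lookup (b n) (0, 0)"
  shows "a = b"
proof
  note a = assms(1)[unfolded flat_def] and b = assms(2)[unfolded flat_def]
  show "a n = b n" for n
  proof (induction n)
    case 0
    show ?case
      by (rule pol_eqI[OF _ _ assms(3)]) (simp_all only: a b)
  next
    case (Suc n)
    then show ?case
      by (intro pol_eqI[OF _ _ assms(3)]) (simp_all only: a b)
  qed
qed

text \<open>A primitive with zero constant term, obtained by integrating f in u, and g in v along u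
  = 0. Its u-derivative is always f; its v-derivative is g under the integrability condition of
  \<open>dv_prim\<close>.\<close>

lift_definition prim :: "'c::cvector pol \<Rightarrow> 'c pol \<Rightarrow> 'c pol" is
  "\<lambda>f g k. case k of (Suc m, n) \<Rightarrow> (1 / of_nat (Suc m)) *\<^sub>C f (m, n) | (0, Suc n) \<Rightarrow> (1 / of_nat (Suc n)) *\<^sub>C g (0, n) | (0, 0) \<Rightarrow> 0"
proof -
  fix f g :: "nat \<times> nat \<Rightarrow> 'c"
  assume *: "finite {x. f x \<noteq> 0}" "finite {x. g x \<noteq> 0}"
  have "finite ((\<lambda>k. (Suc (fst k), snd k)) ` {x. f x \<noteq> 0} \<union> (\<lambda>k. (fst k, Suc (snd k))) ` {x. g x \<noteq> 0})"
    using * by simp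
  then show "finite {x. (case x of (Suc m, n) \<Rightarrow> (1 / of_nat (Suc m)) *\<^sub>C f (m, n)
     | (0, Suc n) \<Rightarrow> (1 / of_nat (Suc n)) *\<^sub>C g (0, n) | (0, 0) \<Rightarrow> 0) \<noteq> 0}"
    by (rule finite_subset[rotated]) (force split: nat.splits)
qed

lemma du_prim: "du (prim f g) = f"
  by (rule poly_mapping_eqI)
     (simp add: prim.rep_eq scaleC_scaleC scaleC_one del: of_nat_Suc flip: Suc_eq_plus1)

lemma dv_prim:
  assumes "dv f = du g"
  shows "dv (prim f g) = g"
proof (rule pol_eqI)
  show "du (dv (prim f g)) = du g" by (metis assms du_prim dv_du)
next
  have z: "Poly_Mapping.lookup (dv (prim f g)) (0, n) = Poly_Mapping.lookup g (0, n)" for n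
    by (simp add: prim.rep_eq scaleC_scaleC scaleC_one del: of_nat_Suc flip: Suc_eq_plus1)
  have 1: "du p = 0 \<Longrightarrow> Poly_Mapping.lookup p (Suc m, n) = 0" for p :: "'a pol" and m n
  proof -
    assume "du p = 0"
    then have "Poly_Mapping.lookup (du p) (m, n) = 0" by simp
    then show ?thesis by (simp del: of_nat_Suc)
  qed
  have "dv (prim f g) - g = 0"
  proof (rule poly_mapping_eqI)
    fix k :: "nat \<times> nat"
    have "du (dv (prim f g) - g) = 0" by (metis assms du_prim dv_du lin_du(4) right_minus_eq)
    from 1[OF this] z show "Poly_Mapping.lookup (dv (prim f g) - g) k = Poly_Mapping.lookup 0 k"
      by (cases k, cases "fst k") (auto simp: lookup_minus)
  qed
  then have *: "dv (prim f g) = g" by simp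
  then show "dv (dv (prim f g)) = dv g" by simp
  show "Poly_Mapping.lookup (dv (prim f g)) (0, 0) = Poly_Mapping.lookup g (0, 0)" by (simp add: *)
qed

lemma lookup_prim0: "Poly_Mapping.lookup (prim f g) (0, 0) = 0"
  by (simp add: prim.rep_eq)

primrec fsol :: "('c::cvector pol \<Rightarrow> 'c pol) \<Rightarrow> ('c pol \<Rightarrow> 'c pol) \<Rightarrow> 'c \<Rightarrow> nat \<Rightarrow> 'c pol" where
  "fsol P Q c 0 = cst c"
| "fsol P Q c (Suc n) = prim (P (fsol P Q c n)) (Q (fsol P Q c n))"

text \<open>Integrability propagates by induction on the degree. The commutation rules with
  \<open>du\<close> and \<open>dv\<close> reduce condition n + 1 to the relation PQ - QP = P, which
  expresses that the connection has square zero.\<close>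

lemma flat_fsol:
  assumes P: "clinear P" and Q: "clinear Q"
    and dvP: "\<And>p. dv (P p) = P (dv p) - (1/2) *\<^sub>C du p"
    and duQ: "\<And>p. du (Q p) = Q (du p) + (1/2) *\<^sub>C du p"
    and PQ: "\<And>p. P (Q p) - Q (P p) = P p"
  shows "flat P Q (fsol P Q c)"
proof -
  have "dv (P (fsol P Q c n)) = du (Q (fsol P Q c n))" for n
  proof (induction n)
    case 0
    show ?case by (simp add: dvP duQ du_single0 dv_single0 clinear_zero[OF P] clinear_zero[OF Q])
  next
    case (Suc n)
    have "dv (P (fsol P Q c (Suc n))) = P (Q (fsol P Q c n)) - (1/2) *\<^sub>C P (fsol P Q c n)"
      by (simp add: dvP du_prim dv_prim[OF Suc])
    also have "\<dots> = Q (P (fsol P Q c n)) + (P (fsol P Q c n) - (1/2) *\<^sub>C P (fsol P Q c n))"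
      using PQ[of "fsol P Q c n"] by (simp add: algebra_simps)
    also have "P (fsol P Q c n) - (1/2) *\<^sub>C P (fsol P Q c n) = (1/2) *\<^sub>C P (fsol P Q c n)"
      using scaleC_half[of "P (fsol P Q c n)"] by (simp add: algebra_simps)
    also have "Q (P (fsol P Q c n)) + \<dots> = du (Q (fsol P Q c (Suc n)))"
      by (simp add: duQ du_prim)
    finally show ?case .
  qed
  then show ?thesis
    by (simp add: flat_def du_prim dv_prim du_single0 dv_single0)
qed

lemma lookup_fsol0: "Poly_Mapping.lookup (fsol P Q c n) (0, 0) = (if n = 0 then c else 0)"
  by (cases n) (simp_all add: lookup_prim0)

text \<open>The Schwarzian term respects PQ - QP = P because the weight two of S under Y combines
  with the weight two of u^2 under u d/du - v d/dv, which enters Q with factor 1/2.\<close>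

lemma flat_Pl_fsol:
  assumes "clinear X" "clinear Y" "clinear S"
    and YX: "\<And>x. Y (X x) = X (Y x) + X x" and YS: "\<And>x. Y (S x) = S (Y x) + S x + S x"
  shows "flat (Pl X S) (Qo Y) (fsol (Pl X S) (Qo Y) c)"
proof (rule flat_fsol[OF clinear_Pl[OF assms(1,3)] clinear_Qo[OF assms(2)]])
  note l = assms(1-3)
  fix p
  show "dv (Pl X S p) = Pl X S (dv p) - (1/2) *\<^sub>C du p"
    by (simp add: Pl_def P0_def Lu_def lin_all weyl_comm pm_comm l)
  show "du (Qo Y p) = Qo Y (du p) + (1/2) *\<^sub>C du p"
    by (simp add: Qo_def lin_all weyl_comm pm_comm l)
  have YX': "pm Y (pm X p) = pm X (pm Y p) + pm X p" for p
    by (rule poly_mapping_eqI) (simp add: l YX lookup_add)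
  have YS': "pm Y (pm S p) = pm S (pm Y p) + pm S p + pm S p" for p
    by (rule poly_mapping_eqI) (simp add: l YS lookup_add)
  have G1: "Gop (mv (du p)) = mv (du (Gop p)) - mv (du p) - mv (du p)" for p :: "'a pol"
    by (simp add: Gop_def lin_all weyl_comm)
  have G2: "Gop (Lu p) = Lu (Gop p) + Lu p" for p :: "'a pol"
    by (simp add: Gop_def Lu_def lin_all weyl_comm)
  have pG: "clinear f \<Longrightarrow> pm f (Gop p) = Gop (pm f p)" for f :: "'a \<Rightarrow> 'a" and p
    by (simp add: Gop_def pm_comm lin_pm)
  have lG: "Gop (p + q) = Gop p + Gop q" "Gop (p - q) = Gop p - Gop q" "Gop (c *\<^sub>C p) = c *\<^sub>C Gop p" "Gop (- p) = - Gop p"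
    for p q :: "'a pol" and c
    by (simp_all add: Gop_def lin_all)
  show "Pl X S (Qo Y p) - Qo Y (Pl X S p) = Pl X S p"
    by (simp add: Pl_def P0_def Qo_Gop lin_all lin_LR l pm_LR pG lG pm_comm YX' YS' G1 G2 flip: scaleC_add_left)
qed

text \<open>Products of flat series are flat. The product T may obey the Leibniz rule for
  \<open>du\<close> only up to a term with D on the left and \<open>dv\<close> on the right; by
  flatness of b that \<open>dv\<close> becomes \<open>Qb\<close>, so the correction matches the one
  allowed in P3.\<close>

lemma flat_conv:
  assumes T: "cbilinear T" and a: "flat Pa Qa a" and b: "flat Pb Qb b"
    and lin: "clinear P3" "clinear Q3"
    and du: "\<And>p q. du (T p q) = T (du p) q + T p (du q) - T (D p) (dv q)"
    and dv: "\<And>p q. dv (T p q) = T (dv p) q + T p (dv q)"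
    and P3: "\<And>i j. P3 (T (a i) (b j)) = T (Pa (a i)) (b j) + T (a i) (Pb (b j)) - T (D (a i)) (Qb (b j))"
    and Q3: "\<And>i j. Q3 (T (a i) (b j)) = T (Qa (a i)) (b j) + T (a i) (Qb (b j))"
  shows "flat P3 Q3 (conv T a b)"
proof -
  note a = a[unfolded flat_def] and b = b[unfolded flat_def]
  have left: "(\<Sum>i\<le>Suc n. T (E (a i)) (b (Suc n - i))) = (\<Sum>i\<le>n. T (E (a (Suc i))) (b (n - i)))"
    if "E (a 0) = 0" for E n
    by (subst sum.atMost_Suc_shift) (simp add: that cbil_lin[OF T])
  have right: "(\<Sum>i\<le>Suc n. T (F (a i)) (E (b (Suc n - i)))) = (\<Sum>i\<le>n. T (F (a i)) (E (b (Suc (n - i)))))"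
    if "E (b 0) = 0" for E F n
    by (simp add: that cbil_lin[OF T] Suc_diff_le)
  show ?thesis
    unfolding flat_def
  proof (intro conjI allI)
    show "du (conv T a b 0) = 0" "dv (conv T a b 0) = 0"
      using a b by (simp_all add: conv_def du dv cbil_lin[OF T])
    fix n
    have "du (conv T a b (Suc n)) = (\<Sum>i\<le>Suc n. T (du (a i)) (b (Suc n - i)))
        + (\<Sum>i\<le>Suc n. T (a i) (du (b (Suc n - i)))) - (\<Sum>i\<le>Suc n. T (D (a i)) (dv (b (Suc n - i))))"
      unfolding conv_def by (simp add: lin_du du sum.distrib sum_subtractf del: sum.atMost_Suc)
    also have "\<dots> = P3 (conv T a b n)"
      using a b unfolding left[of du, OF conjunct1[OF a]] right[of dv D, OF conjunct1[OF conjunct2[OF b]]]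
        right[of du "\<lambda>x. x", OF conjunct1[OF b]]
      by (simp add: conv_def clinear_sum[OF lin(1)] P3 sum.distrib sum_subtractf)
    finally show "du (conv T a b (Suc n)) = P3 (conv T a b n)" .
    have "dv (conv T a b (Suc n)) = (\<Sum>i\<le>Suc n. T (dv (a i)) (b (Suc n - i)))
        + (\<Sum>i\<le>Suc n. T (a i) (dv (b (Suc n - i))))"
      unfolding conv_def by (simp add: lin_dv dv sum.distrib sum_subtractf del: sum.atMost_Suc)
    also have "\<dots> = Q3 (conv T a b n)"
      using a b unfolding left[of dv, OF conjunct1[OF conjunct2[OF a]]] right[of dv "\<lambda>x. x", OF conjunct1[OF conjunct2[OF b]]]
      by (simp add: conv_def clinear_sum[OF lin(2)] Q3 sum.distrib sum_subtractf)
    finally show "dv (conv T a b (Suc n)) = Q3 (conv T a b n)" .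
  qed
qed

text \<open>Degree by degree: once the lower components of a vanish, the convolution in degree n is
  the product of \<open>a n\<close> with the leading term of b.\<close>

lemma conv_cancel_right:
  assumes T: "cbilinear T" and b: "\<And>p. T p (b 0) = 0 \<Longrightarrow> p = 0" and z: "\<And>n. conv T a b n = 0"
  shows "a n = 0"
proof (induction n rule: less_induct)
  case (less n)
  have "conv T a b n = T (a n) (b 0)"
    unfolding conv_def by (subst sum.remove[of _ n]) (auto simp: less cbil_lin[OF T] intro!: sum.neutral)
  then show ?case using z b by metis
qed

lemma conv_cancel_left:
  assumes T: "cbilinear T" and a: "\<And>p. T (a 0) p = 0 \<Longrightarrow> p = 0" and z: "\<And>n. conv T a b n = 0"
  shows "b n = 0"
proof (induction n rule: less_induct)
  case (less n)
  have "conv T a b n = T (a 0) (b n)"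
    unfolding conv_def by (subst sum.remove[of _ 0]) (auto simp: less cbil_lin[OF T] intro!: sum.neutral)
  then show ?case using z a by metis
qed

lemma conv_diff_left: "cbilinear T \<Longrightarrow> conv T (\<lambda>n. a n - a' n) b n = conv T a b n - conv T a' b n"
  and conv_diff_right: "cbilinear T \<Longrightarrow> conv T c (\<lambda>n. b n - b' n) n = conv T c b n - conv T c b' n"
  by (simp_all add: conv_def cbil_lin sum_subtractf)

lemma conv_assoc:
  assumes "cbilinear T" "cbilinear T'" "cbilinear V" "cbilinear V'"
    and VT: "\<And>i j k. V (T (a i) (b j)) (c k) = V' (a i) (T' (b j) (c k))"
  shows "conv V (conv T a b) c n = conv V' a (conv T' b c) n"
proof -
  have 1: "V (sum f A) z = (\<Sum>i\<in>A. V (f i) z)" for f z and A :: "nat set"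
    using clinear_sum[OF cbilinearD2[OF assms(3)]] .
  have 2: "V' z (sum f A) = (\<Sum>i\<in>A. V' z (f i))" for f z and A :: "nat set"
    using clinear_sum[OF cbilinearD1[OF assms(4)]] .
  have "conv V (conv T a b) c n = (\<Sum>k\<le>n. \<Sum>i\<le>k. V' (a i) (T' (b (k - i)) (c (n - k))))"
    by (simp add: conv_def 1 VT)
  also have "\<dots> = (\<Sum>i\<le>n. \<Sum>j\<le>n - i. V' (a i) (T' (b j) (c (n - i - j))))"
  proof -
    let ?g = "\<lambda>i j. V' (a i) (T' (b j) (c (n - (i + j))))"
    have "(\<Sum>k\<le>n. \<Sum>i\<le>k. V' (a i) (T' (b (k - i)) (c (n - k)))) = (\<Sum>k\<le>n. \<Sum>i\<le>k. ?g i (k - i))"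
      by (intro sum.cong refl) simp
    also have "\<dots> = sum (\<lambda>(i, j). ?g i j) {(i, j). i + j \<le> n}"
      by (rule sum.triangle_reindex_eq[symmetric])
    also have "{(i, j). i + j \<le> n} = Sigma {..n} (\<lambda>i. {..n - i})" by auto
    finally show ?thesis by (simp add: sum.Sigma diff_diff_eq)
  qed
  also have "\<dots> = conv V' a (conv T' b c) n"
    by (simp add: conv_def 2)
  finally show ?thesis .
qed

lemma pm_conv: "clinear f \<Longrightarrow> pm f (conv T a b n) = (\<Sum>i\<le>n. pm f (T (a i) (b (n - i))))"
  by (simp add: conv_def lin_pm)

lemma conv_du_Suc:
  assumes T: "cbilinear T" and E: "clinear E" and L: "\<And>p q. E (T p q) = T (E p) q + T p (E q)"
    and "E (a 0) = 0" "E (b 0) = 0"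
  shows "E (conv T a b (Suc n)) = (\<Sum>i\<le>n. T (E (a (Suc i))) (b (n - i))) + (\<Sum>i\<le>n. T (a i) (E (b (Suc (n - i)))))"
proof -
  have "(\<Sum>i\<le>Suc n. T (E (a i)) (b (Suc n - i))) = (\<Sum>i\<le>n. T (E (a (Suc i))) (b (n - i)))"
    by (subst sum.atMost_Suc_shift) (simp add: assms cbil_lin[OF T])
  moreover have "(\<Sum>i\<le>Suc n. T (a i) (E (b (Suc n - i)))) = (\<Sum>i\<le>n. T (a i) (E (b (Suc (n - i)))))"
    by (simp add: assms cbil_lin[OF T] Suc_diff_le)
  ultimately show ?thesis
    unfolding conv_def by (simp add: clinear_sum[OF E] L sum.distrib del: sum.atMost_Suc)
qed

lemma conv_comm:
  assumes "cbilinear T" "cbilinear T'" "cbilinear V" "cbilinear V'"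
    and VT: "\<And>i j k. V (T (a i) (b j)) (c k) = V' (T' (a i) (c k)) (b j)"
  shows "conv V (conv T a b) c n = conv V' (conv T' a c) b n"
proof -
  have e: "conv W (conv S a b) c n = (\<Sum>i\<le>n. \<Sum>j\<le>n - i. W (S (a i) (b j)) (c (n - i - j)))"
    if W: "cbilinear W" for W S b c
  proof -
    let ?g = "\<lambda>i j. W (S (a i) (b j)) (c (n - (i + j)))"
    have "conv W (conv S a b) c n = (\<Sum>k\<le>n. \<Sum>i\<le>k. ?g i (k - i))"
      by (simp add: conv_def clinear_sum[OF cbilinearD2[OF W]])
    also have "\<dots> = sum (\<lambda>(i, j). ?g i j) {(i, j). i + j \<le> n}"
      by (rule sum.triangle_reindex_eq[symmetric])
    also have "{(i, j). i + j \<le> n} = Sigma {..n} (\<lambda>i. {..n - i})" by auto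
    finally show ?thesis by (simp add: sum.Sigma diff_diff_eq)
  qed
  have r: "(\<Sum>j\<le>m. f j (m - j)) = (\<Sum>j\<le>m. f (m - j) j)" for f :: "nat \<Rightarrow> nat \<Rightarrow> 'z::comm_monoid_add" and m
    by (rule sum.reindex_bij_witness[where i="\<lambda>j. m - j" and j="\<lambda>j. m - j"]) auto
  show ?thesis
    unfolding e[OF assms(3)] e[OF assms(4)] VT
    by (rule sum.cong[OF refl], rule r)
qed

lemma moy_nat:
  assumes B: "cbilinear B" and B': "cbilinear B'" and l: "clinear f" "clinear g" "clinear h"
    and eq: "\<And>x y. f (B x y) = B' (g x) (h y)"
  shows "pm f (moy B p q) = moy B' (pm g p) (pm h q)"
proof (induction q rule: Ru_Rv_induct)
  case (cst c)
  show ?case by (rule poly_mapping_eqI)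
      (simp add: moy_cst_right[OF B] moy_cst_right[OF B'] pm_single l cbilinearD2[OF B] cbilinearD2[OF B'] eq)
qed (simp_all add: moy_R[OF B] moy_R[OF B'] moy_lin_right[OF B] moy_lin_right[OF B'] pm_LR l lin_pm)

lemma tw_nat:
  assumes B: "cbilinear B" and B': "cbilinear B'" and l: "clinear f" "clinear g" "clinear h"
    and d: "clinear d" "clinear d'" and eq: "\<And>x y. f (B x y) = B' (g x) (h y)" and gd: "\<And>x. g (d x) = d' (g x)"
  shows "pm f (tw B d p q) = tw B' d' (pm g p) (pm h q)"
proof (induction q arbitrary: p rule: Ru_Rv_induct)
  case (cst c)
  show ?case by (rule poly_mapping_eqI)
      (simp add: tw_cst_right[OF B d(1)] tw_cst_right[OF B' d(2)] pm_single l cbilinearD2[OF B] cbilinearD2[OF B'] eq)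
next
  case (Rv q)
  have "pm g (pm d p) = pm d' (pm g p)"
    by (rule poly_mapping_eqI) (simp add: l d gd)
  then show ?case
    by (simp add: tw_Rv[OF B d(1)] tw_Rv[OF B' d(2)] pm_LR l lin_pm Rv)
qed (simp_all add: tw_Ru[OF B d(1)] tw_Ru[OF B' d(2)] tlr[OF B d(1)] tlr[OF B' d(2)] pm_LR l lin_pm)

text \<open>Associativity rests on d' being primitive over B: the exponential in d' then splits into
  the exponentials belonging to the two factors. The proof is by induction on the last
  factor.\<close>

lemma tw_assoc:
  assumes B: "cbilinear B" "cbilinear B1" "cbilinear B2" "cbilinear B3" and d: "clinear d" "clinear e" "clinear d'"
    and eq: "\<And>x y z. B1 (B x y) z = B2 x (B3 y z)"
    and dB: "\<And>x y. d' (B x y) = B (d x) y + B x (e y)"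
  shows "tw B1 d' (tw B d p q) s = tw B2 d p (tw B3 e q s)"
proof (induction s arbitrary: p q rule: Ru_Rv_induct)
  case (cst c)
  show ?case
    unfolding tw_cst_right[OF B(2) d(3)] tw_cst_right[OF B(4) d(2)]
    by (subst tw_nat[OF B(1) B(3), of _ "\<lambda>x. x" "\<lambda>y. B3 y c" d d])
      (simp_all add: cbilinearD2[OF B(2)] cbilinearD2[OF B(4)] d eq clinear_id pm_id)
next
  case (Rv s)
  have dt: "pm d' (tw B d p q) = tw B d (pm d p) q + tw B d p (pm e q)" for p q
  proof (induction q arbitrary: p rule: Ru_Rv_induct)
    case (cst c)
    show ?case by (rule poly_mapping_eqI)
      (simp add: tw_cst_right[OF B(1) d(1)] pm_single d cbilinearD2[OF B(1)] dB lookup_add)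
  next
    case (Rv q)
    show ?case
      by (simp add: tw_Rv[OF B(1) d(1)] pm_LR d lin_pm Rv lin_LR)
  qed (simp_all add: tw_Ru[OF B(1) d(1)] tlr[OF B(1) d(1)] pm_LR d lin_pm lin_LR scaleC_add_right)
  show ?case
    by (simp add: tw_Rv[OF B(2) d(3)] tw_Rv[OF B(4) d(2)] tlr[OF B(3) d(1)] tw_Rv[OF B(3) d(1)]
        tw_Ru[OF B(3) d(1)] dt tll[OF B(2) d(3)] lin_LR Rv)
qed (simp_all add: tw_Ru[OF B(2) d(3)] tw_Ru[OF B(3) d(1)] tw_Ru[OF B(4) d(2)] tlr[OF B(2) d(3)] tlr[OF B(3) d(1)]
     tlr[OF B(4) d(2)])

lemma flat_pm:
  assumes "flat P Q a" "clinear f" "\<And>p. pm f (P p) = P' (pm f p)" "\<And>p. pm f (Q p) = Q' (pm f p)"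
  shows "flat P' Q' (\<lambda>n. pm f (a n))"
  using assms unfolding flat_def by (metis pm_du pm_dv lin_pm(3))

lemma pm_P0: "clinear f \<Longrightarrow> clinear X \<Longrightarrow> clinear X' \<Longrightarrow> (\<And>x. f (X x) = X' (f x)) \<Longrightarrow> pm f (P0 X p) = P0 X' (pm f p)"
  by (rule poly_mapping_eqI)
    (simp add: P0_def lookup_minus lookup_add clinear_diff clinear_scale clinear_zero split: nat.split)

lemma pm_Qo: "clinear f \<Longrightarrow> clinear X \<Longrightarrow> clinear X' \<Longrightarrow> (\<And>x. f (X x) = X' (f x)) \<Longrightarrow> pm f (Qo X p) = Qo X' (pm f p)"
  by (rule poly_mapping_eqI)
    (simp add: Qo_def lookup_minus lookup_add clinear_diff clinear_add clinear_scale clinear_minus clinear_zero split: nat.split)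

lemma pm_Pl:
  assumes l: "clinear f" "clinear X" "clinear X'" "clinear S" "clinear S'"
    and "\<And>x. f (X x) = X' (f x)" "\<And>x. f (S x) = S' (f x)"
  shows "pm f (Pl X S p) = Pl X' S' (pm f p)"
proof -
  have "pm f (pm S p) = pm S' (pm f p)" for p
    by (rule poly_mapping_eqI) (simp add: assms)
  then show ?thesis
    by (simp add: Pl_def lin_pm l pm_LR pm_P0[OF l(1-3) assms(6)])
qed

subsection \<open>Coefficients in an algebra\<close>

abbreviation (input) lm :: "'a::calgebra \<Rightarrow> 'a \<Rightarrow> 'a" where "lm x \<equiv> \<lambda>y. x * y"
definition ad :: "'a::calgebra \<Rightarrow> 'a \<Rightarrow> 'a" where "ad x y = x * y - y * x"

lemma clinear_ad: "clinear (ad x)"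
  by (rule clinearI) (simp_all add: ad_def algebra_simps scaleC_mult_left scaleC_mult_right cvec.scale_right_diff_distrib)

text \<open>Coefficients multiply in the opposite order because they are operators on functions. If
  y is a polynomial in the delta_n, then y acts by multiplication, so the function x f times the
  function y 1 is (y x) f; see \<open>conv_hseq\<close>.\<close>

definition om :: "'a::calgebra pol \<Rightarrow> 'a pol \<Rightarrow> 'a pol" where "om = moy (\<lambda>x y. y * x)"

lemma cbilinear_mult: "cbilinear (\<lambda>x y :: 'a::calgebra. x * y)"
  by (intro cbilinearI clinear_lmult clinear_rmult)

lemma cbilinear_opp: "cbilinear (\<lambda>x y :: 'a::calgebra. y * x)"
  by (intro cbilinearI clinear_lmult clinear_rmult)

lemma cbilinear_om: "cbilinear om"
  unfolding om_def by (rule cbilinear_moy[OF cbilinear_opp])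

lemma om_du: "du (om p q) = om (du p) q + om p (du q)" and om_dv: "dv (om p q) = om (dv p) q + om p (dv q)"
  unfolding om_def by (simp_all add: moy_du[OF cbilinear_opp] moy_dv[OF cbilinear_opp])

lemma om_one: "om p (cst 1) = p"
  by (simp add: om_def moy_cst_right[OF cbilinear_opp] pm_id)

lemma om_vdu: "mv (du (om p q)) = om (mv (du p)) q + om p (mv (du q))"
  and om_Gop: "Gop (om p q) = om (Gop p) q + om p (Gop q)"
  unfolding om_def
  by (simp_all add: vdu_LR Gop_LR moy_mid[OF cbilinear_opp] moy_R[OF cbilinear_opp, symmetric] moy_L[OF cbilinear_opp, symmetric]
     moy_lin_left[OF cbilinear_opp] moy_lin_right[OF cbilinear_opp] lin_LR LR_comm lin_all)

text \<open>For a coefficient q p of the product, x q p = q (x p) + [x, q] p: the left factor sees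
  left multiplication by x and the right factor sees the commutator.\<close>

lemma om_pm_lm: "pm (lm x) (om p q) = om (pm (lm x) p) q + om p (pm (ad x) q)"
proof -
  have "om p (pm (ad x) q) = pm (lm x) (om p q) - om (pm (lm x) p) q"
    unfolding om_def
  proof (induction q rule: Ru_Rv_induct)
    case (cst c)
    show ?case by (rule poly_mapping_eqI,
        simp add: moy_cst_right[OF cbilinear_opp] pm_single clinear_ad clinear_lmult lookup_minus clinear_rmult,
        simp add: ad_def algebra_simps)
  qed (simp_all add: pm_LR clinear_lmult clinear_ad moy_R[OF cbilinear_opp] lin_LR lin_pm[OF clinear_lmult] lin_pm[OF clinear_ad]
      moy_lin_left[OF cbilinear_opp] moy_lin_right[OF cbilinear_opp] cvec.scale_right_diff_distrib)
  then show ?thesis by simp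
qed

lemma om_commute:
  assumes "\<And>k. s * Poly_Mapping.lookup q k = Poly_Mapping.lookup q k * s"
  shows "om (pm (lm s) p) q = om p (pm (lm s) q)"
proof (induction p rule: pol_induct)
  case (single k c)
  have "pm (\<lambda>y. y * (s * c)) q = pm (\<lambda>y. y * c) (pm (lm s) q)"
    by (rule poly_mapping_eqI) (simp add: clinear_lmult clinear_rmult assms mult.assoc)
  then show ?case
    by (cases k) (simp add: om_def moy_single[OF cbilinear_opp] pm_single clinear_lmult)
qed (simp add: cbil_lin[OF cbilinear_om] lin_pm[OF clinear_lmult])

context
  fixes X Y S :: "'a::calgebra"
begin

text \<open>The factor u^2 with coefficient S in the middle can be read as belonging to either
  factor, since S commutes with the coefficients of q. So the term subtracted on the left in
  \<open>Pr\<close> cancels the one added on the right in \<open>Pl\<close>.\<close>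

lemma om_P:
  assumes "\<And>k. S * Poly_Mapping.lookup q k = Poly_Mapping.lookup q k * S"
  shows "P0 (lm X) (om p q) = om (Pr (lm X) (lm S) p) q + om p (Pl (ad X) (lm S) q)"
proof -
  have "om (pm (lm S) (Ru (Ru p))) q = om p (pm (lm S) (Lu (Lu q)))"
    by (simp add: om_commute[OF assms]) (simp add: om_def moy_mid[OF cbilinear_opp] pm_LR clinear_lmult)
  then show ?thesis
    by (simp add: P0_def Pr_def Pl_def om_pm_lm om_vdu cbil_lin[OF cbilinear_om] lin_all)
qed

lemma om_Q: "Qo (lm Y) (om p q) = om (Qo (lm Y) p) q + om p (Qo (ad Y) q)"
  by (simp add: Qo_Gop om_pm_lm om_Gop cbil_lin[OF cbilinear_om] lin_all
     clinear_minus[OF cbilinearD1[OF cbilinear_om]] clinear_minus[OF cbilinearD2[OF cbilinear_om]])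

context
  fixes b :: "nat \<Rightarrow> 'a pol"
  assumes b: "flat (Pl (ad X) (lm S)) (Qo (ad Y)) b" and b0: "b 0 = cst 1"
    and comm: "\<And>n k. S * Poly_Mapping.lookup (b n) k = Poly_Mapping.lookup (b n) k * S"
begin

lemma flat_om:
  assumes a: "flat (Pr (lm X) (lm S)) (Qo (lm Y)) a"
  shows "flat (P0 (lm X)) (Qo (lm Y)) (conv om a b)"
  by (rule flat_conv[OF cbilinear_om a b, where D="\<lambda>_. 0"])
    (simp_all add: clinear_P0 clinear_Qo clinear_lmult om_du om_dv cbil_lin[OF cbilinear_om] om_P[OF comm] om_Q)

text \<open>Converse of \<open>flat_om\<close>, used to divide a flat series by U. The Leibniz rule
  turns flatness of the product into vanishing of the convolution of the defect of a with b, and b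
  begins with 1.\<close>

lemma flat_om_cancel:
  assumes a: "flat (P0 (lm X)) (Qo (lm Y)) (conv om a b)" and a0: "du (a 0) = 0" "dv (a 0) = 0"
  shows "flat (Pr (lm X) (lm S)) (Qo (lm Y)) a"
proof -
  note b' = b[unfolded flat_def] and a' = a[unfolded flat_def]
  have c: "om p (b 0) = 0 \<Longrightarrow> p = 0" for p by (simp add: b0 om_one)
  have "conv om (\<lambda>n. du (a (Suc n)) - Pr (lm X) (lm S) (a n)) b n = 0" for n
  proof -
    have "du (conv om a b (Suc n)) = conv om (\<lambda>n. du (a (Suc n))) b n + (\<Sum>i\<le>n. om (a i) (Pl (ad X) (lm S) (b (n - i))))"
      using conv_du_Suc[where a=a and b=b, OF cbilinear_om clinear_du om_du a0(1) conjunct1[OF b'], of n]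
      by (simp only: b') (simp add: conv_def)
    moreover have "du (conv om a b (Suc n)) = P0 (lm X) (conv om a b n)" using a' by simp
    moreover have "P0 (lm X) (conv om a b n) = conv om (\<lambda>n. Pr (lm X) (lm S) (a n)) b n
       + (\<Sum>i\<le>n. om (a i) (Pl (ad X) (lm S) (b (n - i))))"
      by (simp add: conv_def clinear_sum[OF clinear_P0[OF clinear_lmult]] om_P[OF comm] sum.distrib)
    ultimately show ?thesis by (simp add: conv_diff_left[OF cbilinear_om])
  qed
  from conv_cancel_right[OF cbilinear_om c this] have 1: "du (a (Suc n)) = Pr (lm X) (lm S) (a n)" for n by simp
  have "conv om (\<lambda>n. dv (a (Suc n)) - Qo (lm Y) (a n)) b n = 0" for n
  proof -
    have "dv (conv om a b (Suc n)) = conv om (\<lambda>n. dv (a (Suc n))) b n + (\<Sum>i\<le>n. om (a i) (Qo (ad Y) (b (n - i))))"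
      using conv_du_Suc[where a=a and b=b, OF cbilinear_om clinear_dv om_dv a0(2) conjunct1[OF conjunct2[OF b']], of n]
      by (simp only: b') (simp add: conv_def)
    moreover have "dv (conv om a b (Suc n)) = Qo (lm Y) (conv om a b n)" using a' by simp
    moreover have "Qo (lm Y) (conv om a b n) = conv om (\<lambda>n. Qo (lm Y) (a n)) b n
       + (\<Sum>i\<le>n. om (a i) (Qo (ad Y) (b (n - i))))"
      by (simp add: conv_def clinear_sum[OF clinear_Qo[OF clinear_lmult]] om_Q sum.distrib)
    ultimately show ?thesis by (simp add: conv_diff_left[OF cbilinear_om])
  qed
  from conv_cancel_right[OF cbilinear_om c this] have 2: "dv (a (Suc n)) = Qo (lm Y) (a n)" for n by simp
  show ?thesis unfolding flat_def using 1 2 a0 by simp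
qed

end

end

text \<open>Division of series: when multiplying by \<open>b 0\<close> on the right is the identity,
  \<open>conv T x b\<close> equals c for this x, see \<open>conv_rquot\<close>.\<close>

fun rquot :: "('a::ab_group_add \<Rightarrow> 'b \<Rightarrow> 'a) \<Rightarrow> (nat \<Rightarrow> 'a) \<Rightarrow> (nat \<Rightarrow> 'b) \<Rightarrow> nat \<Rightarrow> 'a" where
  "rquot T c b n = c n - (\<Sum>i<n. T (rquot T c b i) (b (n - i)))"

declare rquot.simps [simp del]

lemma conv_rquot:
  assumes "\<And>p. T p (b 0) = p"
  shows "conv T (rquot T c b) b n = c n"
proof -
  have "conv T (rquot T c b) b n = (\<Sum>i<n. T (rquot T c b i) (b (n - i))) + T (rquot T c b n) (b 0)"
    by (simp add: conv_def flip: lessThan_Suc_atMost)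
  also have "\<dots> = c n" by (subst (2) rquot.simps) (simp add: assms)
  finally show ?thesis .
qed

declare One_nat_def [simp del]

section \<open>The universal series with coefficients in the Hopf algebra\<close>

text \<open>Only X, Y and delta_1 are needed as generators, because delta_(n+1) is the commutator of
  X and delta_n.\<close>

lemma h1_induct [case_names one X Y D add scale mult]:
  assumes one: "P 1" and X: "P hX" and Y: "P hY" and D: "P (hdelta 1)"
    and add: "\<And>x y. P x \<Longrightarrow> P y \<Longrightarrow> P (x + y)" and scale: "\<And>c x. P x \<Longrightarrow> P (c *\<^sub>C x)"
    and mult: "\<And>x y. P x \<Longrightarrow> P y \<Longrightarrow> P (x * y)"
  shows "P h"
proof -
  have diff: "P (x - y)" if "P x" "P y" for x y
    using add[OF that(1) scale[OF that(2), of "-1"]] by (simp add: lin_all)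
  have GD: "P (h1_of (GD k))" for k
  proof (induction k)
    case 0
    show ?case using D by (simp add: hdelta_def)
  next
    case (Suc k)
    show ?case
      using diff[OF mult[OF X Suc] mult[OF Suc X]] h1_rel(3)[of k] by (simp add: Suc_eq_plus1 del: add_is_1)
  qed
  have gens: "P (h1_of g)" for g by (cases g) (auto simp: X Y GD)
  have word: "P (abs_h1 (Poly_Mapping.single (Monomial w) 1))" for w
  proof (induction w)
    case Nil
    have "abs_h1 (Poly_Mapping.single (Monomial []) 1) = 1"
      by (metis one_h1.abs_eq single_one zero_monomial_def)
    then show ?case using one by simp
  next
    case (Cons g w)
    have "abs_h1 (Poly_Mapping.single (Monomial (g # w)) 1) = h1_of g * abs_h1 (Poly_Mapping.single (Monomial w) 1)"
      by (simp add: h1_of.abs_eq times_h1.abs_eq gen_def mult_single plus_monomial_def)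
    then show ?case using mult[OF gens Cons] by simp
  qed
  have "P (abs_h1 p)" for p
  proof (induction p rule: free_induct)
    case (single k c)
    show ?case
      using scale[OF word[of "letters k"], of c] by (cases k) (simp add: scaleC_h1.abs_eq flip: single_scale)
  next
    case (add p q)
    then show ?case using assms(5) by (metis plus_h1.abs_eq)
  qed
  then show ?thesis by (induct h) auto
qed

text \<open>On the monomials f alpha this element acts by the Schwarzian derivative of the inverse
  of alpha, divided by y^2.\<close>

definition hS :: h1 where "hS = hdelta 2 - (1/2) *\<^sub>C (hdelta 1 * hdelta 1)"

lemma h1_comm:
  "hY * hX = hX * hY + hX" "hX * hdelta 1 = hdelta 1 * hX + hdelta 2" "hY * hdelta 1 = hdelta 1 * hY + hdelta 1"
  "hY * hdelta 2 = hdelta 2 * hY + hdelta 2 + hdelta 2" "hdelta 2 * hdelta 1 = hdelta 1 * hdelta 2"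
  using h1_rel(1) h1_rel(2)[of 0] h1_rel(2)[of 1] h1_rel(3)[of 0] h1_rel(4)[of 0 1]
  by (simp_all add: hdelta_def algebra_simps mult_2 mult_2_right numeral_2_eq_2 One_nat_def)

lemma h1_comm':
  "hY * (hX * z) = hX * (hY * z) + hX * z" "hX * (hdelta 1 * z) = hdelta 1 * (hX * z) + hdelta 2 * z"
  "hY * (hdelta 1 * z) = hdelta 1 * (hY * z) + hdelta 1 * z"
  "hdelta 2 * (hdelta 1 * z) = hdelta 1 * (hdelta 2 * z)"
  by (simp_all only: mult.assoc[symmetric] h1_comm distrib_right)

lemma hS_delta_alg: "hS \<in> delta_alg"
proof -
  have "hdelta 2 + (- (1/2)) *\<^sub>C (hdelta 1 * hdelta 1) \<in> delta_alg"
    unfolding hdelta_def by (intro delta_alg.intros)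
  then show ?thesis by (simp add: hS_def cvec.scale_minus_left)
qed

lemma hY_hS: "hY * hS = hS * hY + hS + hS"
proof -
  have "hY * (hdelta 1 * hdelta 1) = hdelta 1 * hdelta 1 * hY + hdelta 1 * hdelta 1 + hdelta 1 * hdelta 1"
    by (simp add: h1_comm' h1_comm distrib_left mult.assoc add.assoc)
  then show ?thesis
    by (simp add: hS_def right_diff_distrib left_diff_distrib h1_comm scaleC_mult_left scaleC_mult_right scaleC_add_right)
qed

text \<open>The coproduct of delta_2 has the extra term delta_1 (x) delta_1, and that of delta_1^2
  has twice this term; the factor 1/2 cancels them.\<close>

lemma coproduct_hS: "coproduct hS = hS \<otimes> 1 + 1 \<otimes> hS"
proof -
  have d2: "hdelta 2 = hX * hdelta 1 - hdelta 1 * hX" by (simp add: h1_comm)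
  have 1: "coproduct (hdelta 2) = hdelta 2 \<otimes> 1 + 1 \<otimes> hdelta 2 + hdelta 1 \<otimes> hdelta 1"
    unfolding d2 clinear_diff[OF clinear_coproduct] coproduct_simps
    by (simp add: distrib_left distrib_right tensor_times_mk h1_comm tensor_mk_simps)
  have 2: "coproduct (hdelta 1 * hdelta 1) = (hdelta 1 * hdelta 1) \<otimes> 1 + 1 \<otimes> (hdelta 1 * hdelta 1)
      + (hdelta 1 \<otimes> hdelta 1 + hdelta 1 \<otimes> hdelta 1)"
    unfolding coproduct_simps
    by (simp add: distrib_left distrib_right tensor_times_mk)
  show ?thesis
    unfolding hS_def clinear_diff[OF clinear_coproduct] clinear_scale[OF clinear_coproduct] 1 2
    by (simp add: tensor_mk_simps scaleC_add_right scaleC_half)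
qed

text \<open>\<open>Uu\<close> is the universal form of U_gamma, evaluated on the function 1.
  \<open>J0\<close> is the universal flat lift. \<open>JJ\<close> is the quotient of the two, the
  universal form of the lift of f times the inverse of U_alpha.\<close>

definition Uu :: "nat \<Rightarrow> h1 pol" where "Uu = fsol (Pl (ad hX) (\<lambda>x. hS * x)) (Qo (ad hY)) 1"
definition J0 :: "nat \<Rightarrow> h1 pol" where "J0 = fsol (P0 (\<lambda>x. hX * x)) (Qo (\<lambda>x. hY * x)) 1"
definition JJ :: "nat \<Rightarrow> h1 pol" where "JJ = rquot om J0 Uu"

lemma Pl_zero: "Pl X (\<lambda>_. 0) = P0 X"
proof
  fix p :: "'a pol"
  have "pm (\<lambda>_. 0) (Lu (Lu p)) = (0 :: 'a pol)" by (rule poly_mapping_eqI) (simp add: clinear_zero_fun)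
  then show "Pl X (\<lambda>_. 0) p = P0 X p" by (simp add: Pl_def)
qed

lemma flat_J0: "flat (P0 (\<lambda>x. hX * x)) (Qo (\<lambda>x. hY * x)) J0"
  unfolding J0_def using flat_Pl_fsol[of "\<lambda>x. hX * x" "\<lambda>x. hY * x" "\<lambda>_. 0" 1, unfolded Pl_zero]
  by (simp add: clinear_lmult clinear_zero_fun h1_comm')

lemma flat_Uu: "flat (Pl (ad hX) (\<lambda>x. hS * x)) (Qo (ad hY)) Uu"
  unfolding Uu_def
proof (rule flat_Pl_fsol)
  show "ad hY (ad hX x) = ad hX (ad hY x) + ad hX x" for x
    by (simp add: ad_def algebra_simps h1_comm h1_comm')
  show "ad hY (hS * x) = hS * ad hY x + hS * x + hS * x" for x
    by (simp add: ad_def right_diff_distrib mult.assoc[symmetric] hY_hS distrib_right)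
qed (simp_all add: clinear_ad clinear_lmult)

lemma J0_0: "Poly_Mapping.lookup (J0 n) (0, 0) = (if n = 0 then 1 else 0)"
  and Uu_0: "Poly_Mapping.lookup (Uu n) (0, 0) = (if n = 0 then 1 else 0)"
  unfolding J0_def Uu_def by (rule lookup_fsol0)+

lemma J0_cst: "J0 0 = cst 1" and Uu_cst: "Uu 0 = cst 1"
  by (simp_all add: J0_def Uu_def)

lemma conv_om_JJ: "conv om JJ Uu = J0"
  unfolding JJ_def by (rule ext, rule conv_rquot) (simp add: Uu_cst om_one)

lemma JJ_cst: "JJ 0 = cst 1"
  using fun_cong[OF conv_om_JJ, of 0] by (simp add: conv_def Uu_cst J0_cst om_one)

lemma delta_alg_sub: "x \<in> delta_alg \<Longrightarrow> y \<in> delta_alg \<Longrightarrow> x - y \<in> delta_alg"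
  using delta_alg.add[of x "(-1) *\<^sub>C y"] delta_alg.scale[of y "-1"] by (simp add: lin_all)

text \<open>The commutative subalgebra generated by the delta_n is stable under the adjoint action
  of X and Y and contains S, so the recursion never leaves it. This makes the coefficients of U
  commute with S and act on functions by multiplication.\<close>

lemma Uu_delta_alg: "Poly_Mapping.lookup (Uu n) k \<in> delta_alg"
proof (induction n arbitrary: k)
  case 0
  show ?case by (simp add: Uu_cst lookup_single when_def delta_alg.one delta_alg_zero)
next
  case (Suc n)
  have X: "ad hX x \<in> delta_alg" and Y: "ad hY x \<in> delta_alg" and S: "hS * x \<in> delta_alg" if "x \<in> delta_alg" for x
    using that by (auto simp: ad_def intro: delta_alg_ad_X delta_alg_ad_Y delta_alg.mult hS_delta_alg)
  have neg: "- x \<in> delta_alg" if "x \<in> delta_alg" for x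
    using delta_alg_sub[OF delta_alg_zero that] by simp
  note cl = Suc X Y S delta_alg_zero delta_alg.add delta_alg_sub delta_alg.scale neg
  have P: "Poly_Mapping.lookup (Pl (ad hX) (\<lambda>x. hS * x) (Uu n)) k \<in> delta_alg" for k
    by (auto simp: Pl_def P0_def Lu_def lookup_add lookup_minus clinear_ad clinear_lmult intro!: cl split: nat.split)
  have Q: "Poly_Mapping.lookup (Qo (ad hY) (Uu n)) k \<in> delta_alg" for k
    by (auto simp: Qo_def lookup_add lookup_minus clinear_ad intro!: cl split: nat.split)
  show ?case
    unfolding Uu_def fsol.simps unfolding Uu_def[symmetric]
    by (auto simp: prim.rep_eq intro!: cl P Q split: nat.split prod.split)
qed

lemma Uu_comm: "hS * Poly_Mapping.lookup (Uu n) k = Poly_Mapping.lookup (Uu n) k * hS"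
  by (rule delta_alg_commute[OF Uu_delta_alg hS_delta_alg, symmetric, THEN sym])

lemma flat_JJ: "flat (Pr (\<lambda>x. hX * x) (\<lambda>x. hS * x)) (Qo (\<lambda>x. hY * x)) JJ"
  by (rule flat_om_cancel[OF flat_Uu Uu_cst Uu_comm])
     (simp_all add: conv_om_JJ flat_J0 JJ_cst du_single0 dv_single0)

abbreviation dlt :: "h1 \<Rightarrow> h1" where "dlt \<equiv> \<lambda>x. hdelta 1 * x"

interpretation cop: coproduct_action "(\<otimes>)" dlt "\<lambda>x. hdelta 2 * x"
  "\<lambda>x. hX * x" "\<lambda>x. hY * x" "\<lambda>x. hS * x" "\<lambda>x. hX * x" "\<lambda>x. hY * x" "\<lambda>x. hS * x"
  "\<lambda>x. coproduct hX * x" "\<lambda>x. coproduct hY * x" "\<lambda>x. coproduct hS * x"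
proof
  show "hS * x = hdelta 2 * x - (1/2) *\<^sub>C (hdelta 1 * (hdelta 1 * x))" for x
    by (simp add: hS_def left_diff_distrib scaleC_mult_left mult.assoc)
  show "hX * (hdelta 1 * x) = hdelta 1 * (hX * x) + hdelta 2 * x"
    and "hY * (hdelta 1 * x) = hdelta 1 * (hY * x) + hdelta 1 * x"
    and "hdelta 2 * (hdelta 1 * x) = hdelta 1 * (hdelta 2 * x)" for x
    by (rule h1_comm')+
  fix x y
  show "coproduct hX * x \<otimes> y = (hX * x) \<otimes> y + x \<otimes> (hX * y) + (hdelta 1 * x) \<otimes> (hY * y)"
    and "coproduct hY * x \<otimes> y = (hY * x) \<otimes> y + x \<otimes> (hY * y)"
    and "coproduct hS * x \<otimes> y = (hS * x) \<otimes> y + x \<otimes> (hS * y)"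
    by (simp_all add: coproduct_hS coproduct_simps distrib_right tensor_times_mk)
qed (rule cbilinear_tensor_mk | simp add: distrib_left scaleC_mult_right)+

section \<open>The element R as a quotient of flat series\<close>

abbreviation tw2 where "tw2 \<equiv> tw (\<otimes>) dlt"
text \<open>Universal form of the product of the lift of f, the inverse of U_alpha, and the
  alpha-image of the lift of g times the inverse of U_beta.\<close>

definition MM :: "nat \<Rightarrow> (h1, h1) tensor pol" where "MM = conv tw2 JJ JJ"

lemma cbilinear_tw2: "cbilinear tw2"
  by (rule cbilinear_tw[OF cbilinear_tensor_mk clinear_lmult])

lemma flat_MM: "flat (Pr (\<lambda>x. coproduct hX * x) (\<lambda>x. coproduct hS * x)) (Qo (\<lambda>x. coproduct hY * x)) MM"
  unfolding MM_def
  by (rule flat_conv[OF cbilinear_tw2 flat_JJ flat_JJ, where D="pm dlt"])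
    (simp_all add: clinear_Pr clinear_Qo clinear_lmult cop.tw_Pr cop.tw_Qo
      tw_du[OF cbilinear_tensor_mk clinear_lmult] tw_dv[OF cbilinear_tensor_mk clinear_lmult])

definition dU where "dU n = pm coproduct (Uu n)"
definition dJ0 where "dJ0 n = pm coproduct (J0 n)"
definition dJ where "dJ n = pm coproduct (JJ n)"

lemma coproduct_ad: "coproduct (ad x y) = ad (coproduct x) (coproduct y)"
  by (simp add: ad_def clinear_diff[OF clinear_coproduct] coproduct_simps)

lemma flat_dU: "flat (Pl (ad (coproduct hX)) (\<lambda>x. coproduct hS * x)) (Qo (ad (coproduct hY))) dU"
  unfolding dU_def
  by (rule flat_pm[OF flat_Uu clinear_coproduct])
    (simp_all add: pm_Pl pm_Qo clinear_coproduct clinear_ad clinear_lmult coproduct_ad coproduct_simps)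

lemma flat_dJ0: "flat (P0 (\<lambda>x. coproduct hX * x)) (Qo (\<lambda>x. coproduct hY * x)) dJ0"
  unfolding dJ0_def
  by (rule flat_pm[OF flat_J0 clinear_coproduct])
    (simp_all add: pm_P0 pm_Qo clinear_coproduct clinear_lmult coproduct_simps)

lemma dU_cst: "dU 0 = cst 1" and dJ_cst: "dJ 0 = cst 1"
  by (simp_all add: dU_def dJ_def Uu_cst JJ_cst pm_single clinear_coproduct coproduct_simps)

lemma dU_comm: "coproduct hS * Poly_Mapping.lookup (dU n) k = Poly_Mapping.lookup (dU n) k * coproduct hS"
  by (simp add: dU_def clinear_coproduct Uu_comm flip: coproduct_simps(5))

text \<open>In the star product the remaining factor is U_(alpha beta), which corresponds to the
  coproduct of U; the constant term is the restriction to u = v = 0. The index n is the total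
  degree, so the power of hbar is n/2.\<close>

definition Rser :: "nat \<Rightarrow> (h1, h1) tensor" where "Rser n = Poly_Mapping.lookup (conv om MM dU n) (0, 0)"

definition rt :: "'a::calgebra pol \<Rightarrow> 'a \<Rightarrow> 'a pol" where "rt p r = pm (\<lambda>x. x * r) p"

lemma lookup_rt [simp]: "Poly_Mapping.lookup (rt p r) k = Poly_Mapping.lookup p k * r"
  by (simp add: rt_def clinear_rmult)

lemma cbilinear_rt: "cbilinear rt"
  by (intro cbilinearI clinearI; rule poly_mapping_eqI;
      simp add: lookup_add distrib_left distrib_right scaleC_mult_right scaleC_mult_left)

lemma rt_cst: "rt (cst 1) r = cst r"
  by (simp add: rt_def pm_single clinear_rmult)

text \<open>The flatness operators act on coefficients from the left, so right multiplication by
  constants, in convolution, preserves flatness.\<close>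

lemma flat_rt:
  assumes a: "flat P Q a" and l: "clinear P" "clinear Q"
    and P: "\<And>p r. P (rt p r) = rt (P p) r" and Q: "\<And>p r. Q (rt p r) = rt (Q p) r"
  shows "flat P Q (conv rt a r)"
proof -
  note a' = a[unfolded flat_def]
  have dr: "du (rt p r) = rt (du p) r" "dv (rt p r) = rt (dv p) r" for p and r :: 'a
    by (simp_all add: rt_def pm_comm clinear_rmult)
  show ?thesis
    unfolding flat_def conv_def
    by (auto simp: lin_du lin_dv dr a' cbil_lin[OF cbilinear_rt] P Q clinear_sum[OF l(1)] clinear_sum[OF l(2)]
        sum.atMost_Suc_shift simp del: sum.atMost_Suc)
qed

lemma dJ0_om: "conv om dJ dU = dJ0"
proof
  fix n
  have "pm coproduct (conv om JJ Uu n) = conv om dJ dU n"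
    unfolding pm_conv[OF clinear_coproduct]
    by (simp add: conv_def dJ_def dU_def om_def
       moy_nat[OF cbilinear_opp cbilinear_opp clinear_coproduct clinear_coproduct clinear_coproduct] coproduct_simps)
  then show "conv om dJ dU n = dJ0 n" by (simp add: conv_om_JJ dJ0_def)
qed

text \<open>Both J * J times Delta(U), and Delta(J_0) R, are flat for the uncorrected equations with
  X and Y replaced by their coproducts, and they have the same constant terms. Hence they agree;
  writing Delta(J_0) as Delta(J) times Delta(U) and cancelling Delta(U) leaves J * J = Delta(J)
  R.\<close>

lemma MM_eq: "MM = conv rt dJ Rser"
proof -
  have "conv om MM dU = conv rt dJ0 Rser"
  proof (rule flat_unique)
    show "flat (P0 (\<lambda>x. coproduct hX * x)) (Qo (\<lambda>x. coproduct hY * x)) (conv om MM dU)"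
      by (rule flat_om[OF flat_dU dU_cst dU_comm flat_MM])
    show "flat (P0 (\<lambda>x. coproduct hX * x)) (Qo (\<lambda>x. coproduct hY * x)) (conv rt dJ0 Rser)"
    proof (rule flat_rt[OF flat_dJ0])
      fix p and r :: "(h1, h1) tensor"
      show "P0 (\<lambda>x. coproduct hX * x) (rt p r) = rt (P0 (\<lambda>x. coproduct hX * x) p) r"
        unfolding rt_def
        by (rule pm_P0[symmetric]) (simp_all only: clinear_rmult clinear_lmult mult.assoc)
      show "Qo (\<lambda>x. coproduct hY * x) (rt p r) = rt (Qo (\<lambda>x. coproduct hY * x) p) r"
        unfolding rt_def
        by (rule pm_Qo[symmetric]) (simp_all only: clinear_rmult clinear_lmult mult.assoc)
    qed (simp_all add: clinear_P0 clinear_Qo clinear_lmult)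
    fix n
    \<comment> \<open>The constant terms of J_0 are 1 in degree 0 and 0 in all other degrees, so a
      single summand survives.\<close>
    have "Poly_Mapping.lookup (conv rt dJ0 Rser n) (0, 0) = (\<Sum>i\<le>n. if i = 0 then Rser n else 0)"
      unfolding conv_def lookup_sum
      by (intro sum.cong) (auto simp: dJ0_def clinear_coproduct J0_0 coproduct_simps clinear_zero)
    then show "Poly_Mapping.lookup (conv om MM dU n) (0, 0) = Poly_Mapping.lookup (conv rt dJ0 Rser n) (0, 0)"
      by (simp add: Rser_def)
  qed
  also have "conv rt dJ0 Rser = conv om (conv rt dJ Rser) dU"
  proof
    fix n
    \<comment> \<open>Right multiplication of coefficients touches only the left factor of
      \<open>om\<close>, whose coefficients stand on the right.\<close>
    have "rt (om p q) r = om (rt p r) q" for p q :: "(h1, h1) tensor pol" and r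
      unfolding rt_def om_def
      by (subst moy_nat[OF cbilinear_opp cbilinear_opp clinear_rmult clinear_rmult clinear_id])
        (simp_all add: mult.assoc pm_id)
    then show "conv rt dJ0 Rser n = conv om (conv rt dJ Rser) dU n"
      unfolding dJ0_om[symmetric]
      by (intro conv_comm cbilinear_rt cbilinear_om)
  qed
  finally have *: "conv om MM dU = conv om (conv rt dJ Rser) dU" .
  have "MM n - conv rt dJ Rser n = 0" for n
    by (rule conv_cancel_right[where a="\<lambda>n. MM n - conv rt dJ Rser n" and b=dU, OF cbilinear_om])
      (auto simp: dU_cst om_one conv_diff_left[OF cbilinear_om] *)
  then show ?thesis by auto
qed

lemma MM_cst: "MM 0 = cst 1"
  by (simp add: MM_def conv_def JJ_cst tw_cst_right[OF cbilinear_tensor_mk clinear_lmult] pm_single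
     cbilinearD2[OF cbilinear_tensor_mk] one_tensor_def)

section \<open>Threefold tensor products and the twist equation\<close>

lemma
  fixes a :: "'a::cvector" and b :: "'b::cvector" and c :: "'c::cvector"
  shows tensor_assoc_clinear: "clinear (tensor_assoc :: ('a, ('b, 'c) tensor) tensor \<Rightarrow> _)"
    and tensor_assoc_mk: "tensor_assoc (a \<otimes> b \<otimes> c) = (a \<otimes> b) \<otimes> c"
proof -
  have 1: "cbilinear (\<lambda>b c. (a \<otimes> b) \<otimes> c)" for a :: 'a
    by (intro cbilinearI clinearI) (simp_all add: tensor_mk_simps)
  define F where "F = (\<lambda>a :: 'a. tensor_lift (\<lambda>b c. (a \<otimes> b :: ('a, 'b) tensor) \<otimes> (c :: 'c)))"
  have F: "F a (b \<otimes> c) = (a \<otimes> b) \<otimes> c" "F a (s + t) = F a s + F a t" for a b c s t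
    unfolding F_def by (simp_all only: tensor_lift_mk[OF 1] clinear_add[OF clinear_tensor_lift[OF 1]])
  have 2: "cbilinear F"
  proof (intro cbilinearI)
    show "clinear (F a)" for a unfolding F_def by (rule clinear_tensor_lift[OF 1])
    show "clinear (\<lambda>a. F a t)" for t
    proof (rule clinearI)
      show "F (x + y) t = F x t + F y t" for x y
        by (induction t rule: tensor_induct) (simp_all add: F tensor_mk_simps)
      show "F (r *\<^sub>C x) t = r *\<^sub>C F x t" for r x
        by (induction t rule: tensor_induct) (simp_all add: F tensor_mk_simps scaleC_add_right)
    qed
  qed
  note 2 = 2[unfolded F_def]
  show "clinear (tensor_assoc :: ('a, ('b, 'c) tensor) tensor \<Rightarrow> _)" using clinear_tensor_lift[OF 2] by (simp add: tensor_assoc_def)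
  show "tensor_assoc (a \<otimes> b \<otimes> c) = (a \<otimes> b) \<otimes> c"
    by (simp add: tensor_assoc_def tensor_lift_mk[OF 2] tensor_lift_mk[OF 1])
qed

lemma cbilinear_tensor_map: "clinear f \<Longrightarrow> clinear g \<Longrightarrow> cbilinear (\<lambda>a b. f a \<otimes> g b)"
  by (intro cbilinearI clinearI) (simp_all add: clinear_add clinear_scale tensor_mk_simps)

lemma tensor_map_mk: "clinear f \<Longrightarrow> clinear g \<Longrightarrow> tensor_map f g (a \<otimes> b) = f a \<otimes> g b"
  and clinear_tensor_map: "clinear f \<Longrightarrow> clinear g \<Longrightarrow> clinear (tensor_map f g)"
  unfolding tensor_map_def by (simp_all add: cbilinear_tensor_map clinear_tensor_lift)

lemma clinear_id': "clinear id"
  by (rule clinearI) auto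

lemma tensor_map_mult:
  assumes "clinear f" "clinear g" "\<And>x y. f (x * y) = f x * f y" "\<And>x y. g (x * y) = g x * g y"
  shows "tensor_map f g (s * t) = tensor_map f g s * tensor_map f g t"
proof (induction s rule: tensor_induct)
  case (mk a b)
  show ?case
    by (induction t rule: tensor_induct)
      (simp_all add: tensor_times_mk tensor_map_mk assms distrib_left clinear_add[OF clinear_tensor_map])
qed (simp add: distrib_right clinear_add[OF clinear_tensor_map] assms)

lemma tensor_assoc_mult: "tensor_assoc (s * t) = tensor_assoc s * tensor_assoc t"
proof (induction s rule: tensor_induct)
  case (mk a b)
  show ?case
  proof (induction b rule: tensor_induct)
    case (mk b c)
    show ?case
    proof (induction t rule: tensor_induct)
      case (mk a' b')
      show ?case
        by (induction b' rule: tensor_induct)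
          (simp_all add: tensor_times_mk tensor_assoc_mk tensor_mk_simps distrib_left clinear_add[OF tensor_assoc_clinear])
    qed (simp add: distrib_left clinear_add[OF tensor_assoc_clinear])
  qed (simp add: tensor_mk_simps distrib_right clinear_add[OF tensor_assoc_clinear])
qed (simp add: distrib_right clinear_add[OF tensor_assoc_clinear])

type_synonym h3 = "((h1, h1) tensor, h1) tensor"

definition cop12 :: "(h1, h1) tensor \<Rightarrow> h3" where "cop12 = tensor_map coproduct id"
definition cop23 :: "(h1, h1) tensor \<Rightarrow> h3" where "cop23 t = tensor_assoc (tensor_map id coproduct t)"

lemma cop12_mk: "cop12 (a \<otimes> b) = coproduct a \<otimes> b"
  and cop12_mult: "cop12 (s * t) = cop12 s * cop12 t"
  and clinear_cop12: "clinear cop12"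
  unfolding cop12_def
  by (simp_all add: tensor_map_mk clinear_coproduct clinear_id' tensor_map_mult coproduct_simps clinear_tensor_map)

lemma cop23_mk: "cop23 (a \<otimes> b) = tensor_assoc (a \<otimes> coproduct b)"
  and cop23_mult: "cop23 (s * t) = cop23 s * cop23 t"
  and clinear_cop23: "clinear cop23"
  unfolding cop23_def
  by (simp_all add: tensor_map_mk clinear_coproduct clinear_id' tensor_map_mult coproduct_simps clinear_tensor_map
      tensor_assoc_mult clinear_comp[OF tensor_assoc_clinear])

lemma coassoc: "cop12 (coproduct h) = cop23 (coproduct h)"
proof (induction h rule: h1_induct)
  case one
  show ?case by (simp add: coproduct_simps one_tensor_def cop12_mk cop23_mk tensor_assoc_mk)
qed (simp_all add: coproduct_simps cop12_mk cop23_mk tensor_assoc_mk one_tensor_def clinear_add[OF clinear_cop12]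
   clinear_add[OF clinear_cop23] clinear_add[OF tensor_assoc_clinear] clinear_scale[OF clinear_cop12]
   clinear_scale[OF clinear_cop23] cop12_mult cop23_mult tensor_mk_simps clinear_add[OF clinear_coproduct]
   clinear_scale[OF clinear_coproduct])

lemma cbilinear_mk23: "cbilinear (\<lambda>(x :: h1) t. tensor_assoc (x \<otimes> (t :: (h1, h1) tensor)))"
  by (intro cbilinearI clinearI)
    (simp_all add: tensor_mk_simps clinear_add[OF tensor_assoc_clinear] clinear_scale[OF tensor_assoc_clinear])

abbreviation ddlt :: "(h1, h1) tensor \<Rightarrow> (h1, h1) tensor" where "ddlt \<equiv> \<lambda>x. coproduct (hdelta 1) * x"
abbreviation tw12 :: "(h1, h1) tensor pol \<Rightarrow> h1 pol \<Rightarrow> h3 pol" where "tw12 \<equiv> tw (\<otimes>) ddlt"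
abbreviation tw23 :: "h1 pol \<Rightarrow> (h1, h1) tensor pol \<Rightarrow> h3 pol" where "tw23 \<equiv> tw (\<lambda>x t. tensor_assoc (x \<otimes> t)) dlt"

text \<open>An instance of \<open>tw_assoc\<close>; the hypothesis on the twisting maps is that
  delta_1 is primitive.\<close>

lemma tw12_tw23: "tw12 (tw2 p q) s = tw23 p (tw2 q s)"
  by (rule tw_assoc[OF cbilinear_tensor_mk cbilinear_tensor_mk cbilinear_mk23 cbilinear_tensor_mk clinear_lmult clinear_lmult clinear_lmult])
    (simp_all add: tensor_assoc_mk coproduct_simps distrib_right tensor_times_mk)

lemma cbilinear_tw12: "cbilinear tw12" and cbilinear_tw23: "cbilinear tw23"
  by (intro cbilinear_tw cbilinear_tensor_mk cbilinear_mk23 clinear_lmult)+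

text \<open>The iterated coproduct of J. By \<open>coassoc\<close> it can be read with the second
  coproduct on either side.\<close>

definition KK :: "nat \<Rightarrow> h3 pol" where "KK n = pm (\<lambda>h. cop12 (coproduct h)) (JJ n)"

lemma KK_fun: "KK = (\<lambda>n. pm (\<lambda>h. cop12 (coproduct h)) (JJ n))"
  by (rule ext) (rule KK_def)

lemma pm_conv_rt:
  assumes "clinear f" "\<And>x y. f (x * y) = f x * f y"
  shows "pm f (conv rt a r n) = conv rt (\<lambda>n. pm f (a n)) (\<lambda>n. f (r n)) n"
proof -
  have "pm f (rt p x) = rt (pm f p) (f x)" for p x
    by (rule poly_mapping_eqI) (simp add: assms)
  then show ?thesis unfolding pm_conv[OF assms(1)] by (simp add: conv_def)
qed

lemma twist12: "conv rt KK (conv (*) (\<lambda>n. cop12 (Rser n)) (\<lambda>n. Rser n \<otimes> 1)) n = conv tw12 (conv tw2 JJ JJ) JJ n"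
proof -
  have "conv rt KK (conv (*) (\<lambda>n. cop12 (Rser n)) (\<lambda>n. Rser n \<otimes> 1)) n
    = conv rt (conv rt KK (\<lambda>n. cop12 (Rser n))) (\<lambda>n. Rser n \<otimes> 1) n"
    by (rule conv_assoc[symmetric]; (rule cbilinear_rt cbilinear_mult)?)
      (rule poly_mapping_eqI, simp add: mult.assoc)
  also have "conv rt KK (\<lambda>n. cop12 (Rser n)) = (\<lambda>n. pm cop12 (MM n))"
    unfolding MM_eq pm_conv_rt[OF clinear_cop12 cop12_mult]
    by (simp add: KK_fun dJ_def pm_pm clinear_coproduct clinear_cop12)
  also have "(\<lambda>n. pm cop12 (MM n)) = conv tw12 dJ JJ"
  proof
    fix n
    show "pm cop12 (MM n) = conv tw12 dJ JJ n"
      unfolding MM_def pm_conv[OF clinear_cop12] unfolding conv_def dJ_def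
      by (subst tw_nat[OF cbilinear_tensor_mk cbilinear_tensor_mk clinear_cop12 clinear_coproduct clinear_id])
        (simp_all add: clinear_lmult cop12_mk coproduct_simps pm_id)
  qed
  also have "conv rt (conv tw12 dJ JJ) (\<lambda>n. Rser n \<otimes> 1) n = conv tw12 (conv rt dJ Rser) JJ n"
  proof -
    have tr: "rt (tw12 p q) (r \<otimes> 1) = tw12 (rt p r) q" for p q r
      unfolding rt_def
      by (subst tw_nat[OF cbilinear_tensor_mk cbilinear_tensor_mk clinear_rmult clinear_rmult clinear_id])
        (simp_all add: clinear_lmult tensor_times_mk mult.assoc pm_id)
    have B: "cbilinear (\<lambda>p r. rt p (r \<otimes> (1 :: h1)) :: h3 pol)"
      by (intro cbilinearI clinearI) (simp_all add: cbil_lin[OF cbilinear_rt] tensor_mk_simps)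
    have "conv rt (conv tw12 dJ JJ) (\<lambda>n. Rser n \<otimes> 1) n = conv (\<lambda>p r. rt p (r \<otimes> 1)) (conv tw12 dJ JJ) Rser n"
      by (simp add: conv_def)
    also have "\<dots> = conv tw12 (conv rt dJ Rser) JJ n"
      by (intro conv_comm B cbilinear_tw12 cbilinear_rt) (rule tr)
    finally show ?thesis .
  qed
  finally show ?thesis by (simp add: MM_eq[symmetric] MM_def)
qed

lemma twist23: "conv rt KK (conv (*) (\<lambda>n. cop23 (Rser n)) (\<lambda>n. tensor_assoc (1 \<otimes> Rser n))) n = conv tw23 JJ (conv tw2 JJ JJ) n"
proof -
  have "conv rt KK (conv (*) (\<lambda>n. cop23 (Rser n)) (\<lambda>n. tensor_assoc (1 \<otimes> Rser n))) n
    = conv rt (conv rt KK (\<lambda>n. cop23 (Rser n))) (\<lambda>n. tensor_assoc (1 \<otimes> Rser n)) n"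
    by (rule conv_assoc[symmetric]; (rule cbilinear_rt cbilinear_mult)?)
      (rule poly_mapping_eqI, simp add: mult.assoc)
  also have "conv rt KK (\<lambda>n. cop23 (Rser n)) = (\<lambda>n. pm cop23 (MM n))"
    unfolding MM_eq pm_conv_rt[OF clinear_cop23 cop23_mult]
    by (simp add: KK_fun dJ_def pm_pm clinear_coproduct clinear_cop23 coassoc)
  also have "(\<lambda>n. pm cop23 (MM n)) = conv tw23 JJ dJ"
  proof
    fix n
    show "pm cop23 (MM n) = conv tw23 JJ dJ n"
      unfolding MM_def pm_conv[OF clinear_cop23] unfolding conv_def dJ_def
      by (subst tw_nat[OF cbilinear_tensor_mk cbilinear_mk23 clinear_cop23 clinear_id clinear_coproduct])
        (simp_all add: clinear_lmult cop23_mk pm_id)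
  qed
  also have "conv rt (conv tw23 JJ dJ) (\<lambda>n. tensor_assoc (1 \<otimes> Rser n)) n = conv tw23 JJ (conv rt dJ Rser) n"
  proof -
    have e: "tensor_assoc (x \<otimes> t) * tensor_assoc (1 \<otimes> r) = tensor_assoc (x \<otimes> (t * r))" for x :: h1 and t r :: "(h1, h1) tensor"
      by (simp add: tensor_times_mk flip: tensor_assoc_mult)
    have tr: "rt (tw23 p q) (tensor_assoc (1 \<otimes> r)) = tw23 p (rt q r)" for p q r
      unfolding rt_def
      by (subst tw_nat[OF cbilinear_mk23 cbilinear_mk23 clinear_rmult clinear_id clinear_rmult])
        (simp_all add: clinear_lmult e pm_id)
    have B: "cbilinear (\<lambda>p r. rt p (tensor_assoc ((1 :: h1) \<otimes> r)) :: h3 pol)"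
      by (intro cbilinearI clinearI) (simp_all add: cbil_lin[OF cbilinear_rt] tensor_mk_simps
          clinear_add[OF tensor_assoc_clinear] clinear_scale[OF tensor_assoc_clinear])
    have "conv rt (conv tw23 JJ dJ) (\<lambda>n. tensor_assoc (1 \<otimes> Rser n)) n
       = conv (\<lambda>p r. rt p (tensor_assoc (1 \<otimes> r))) (conv tw23 JJ dJ) Rser n"
      by (simp add: conv_def)
    also have "\<dots> = conv tw23 JJ (conv rt dJ Rser) n"
      by (intro conv_assoc B cbilinear_tw23 cbilinear_rt) (rule tr)
    finally show ?thesis .
  qed
  finally show ?thesis by (simp add: MM_eq[symmetric] MM_def)
qed

text \<open>The iterated coproduct of J multiplies both sides to the two bracketings of J * J * J,
  which agree. It begins with 1 and is cancelled on the left.\<close>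

lemma twist_series:
  "conv (*) (\<lambda>n. cop12 (Rser n)) (\<lambda>n. Rser n \<otimes> 1) n = conv (*) (\<lambda>n. cop23 (Rser n)) (\<lambda>n. tensor_assoc (1 \<otimes> Rser n)) n"
proof -
  let ?a = "conv (*) (\<lambda>n. cop12 (Rser n)) (\<lambda>n. Rser n \<otimes> 1)"
  let ?b = "conv (*) (\<lambda>n. cop23 (Rser n)) (\<lambda>n. tensor_assoc (1 \<otimes> Rser n))"
  have K0: "KK 0 = cst 1"
    by (simp add: KK_def JJ_cst pm_single clinear_comp[OF clinear_cop12 clinear_coproduct] coproduct_simps
        one_tensor_def cop12_mk)
  have "conv tw12 (conv tw2 JJ JJ) JJ n = conv tw23 JJ (conv tw2 JJ JJ) n" for n
    by (intro conv_assoc cbilinear_tw12 cbilinear_tw23 cbilinear_tw2 tw12_tw23)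
  then have "conv rt KK ?a n = conv rt KK ?b n" for n
    by (simp only: twist12 twist23)
  then have "?a n - ?b n = 0"
  proof (intro conv_cancel_left[where b="\<lambda>n. ?a n - ?b n", OF cbilinear_rt])
    fix p assume "rt (KK 0) p = 0"
    then have "cst p = 0" by (simp add: K0 rt_cst)
    then have "Poly_Mapping.lookup (cst p) (0, 0) = Poly_Mapping.lookup (0 :: h3 pol) (0, 0)" by simp
    then show "p = 0" by simp
  qed (simp add: conv_diff_right[OF cbilinear_rt])
  then show ?thesis by simp
qed

subsection \<open>Counit\<close>

lemma flat_const0: "flat (Pl (\<lambda>_. 0) (\<lambda>_. 0)) (Qo (\<lambda>_. 0)) (\<lambda>n. if n = 0 then cst c else 0)"
  by (auto simp: flat_def Pl_zero P0_def Qo_def du_single0 dv_single0 lin_all pm_single clinear_zero_fun)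

lemma counit_hdelta: "counit (hdelta n) = 0"
  by (simp add: hdelta_def counit_simps)

lemma counit_zero: "counit (ad x y) = 0" "counit (hX * y) = 0" "counit (hY * y) = 0" "counit (hdelta 1 * y) = 0" "counit hS = 0"
  by (simp_all add: ad_def hS_def clinear_diff[OF clinear_counit] clinear_scale[OF clinear_counit] counit_simps hdelta_def
      left_diff_distrib scaleC_mult_left mult.commute cvec.scale_zero_right)

text \<open>The counit annihilates commutators and everything with a factor X, Y or S on the left.
  The image of a universal series is thus flat for the trivial operators, and the constant series is
  the only one with these constant terms.\<close>

lemma counit_Uu: "pm counit (Uu n) = (if n = 0 then cst 1 else 0)"
  and counit_J0: "pm counit (J0 n) = (if n = 0 then cst 1 else 0)"
proof -
  have "(\<lambda>n. pm counit (Uu n)) = (\<lambda>n. if n = 0 then cst 1 else 0)"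
    by (rule flat_unique[OF flat_pm[OF flat_Uu clinear_counit pm_Pl pm_Qo] flat_const0])
      (simp_all add: clinear_counit clinear_ad clinear_lmult clinear_zero_fun counit_zero Uu_0 counit_simps
        clinear_zero[OF clinear_counit])
  then show "pm counit (Uu n) = (if n = 0 then cst 1 else 0)" by metis
  have "(\<lambda>n. pm counit (J0 n)) = (\<lambda>n. if n = 0 then cst 1 else 0)"
    by (rule flat_unique[OF flat_pm[OF flat_J0 clinear_counit pm_P0 pm_Qo] flat_const0[unfolded Pl_zero]])
      (simp_all add: clinear_counit clinear_lmult clinear_zero_fun counit_zero J0_0 counit_simps
        clinear_zero[OF clinear_counit])
  then show "pm counit (J0 n) = (if n = 0 then cst 1 else 0)" by metis
qed

lemma conv_unit_right: "cbilinear T \<Longrightarrow> conv T a (\<lambda>n. if n = 0 then c else 0) n = T (a n) c"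
  unfolding conv_def by (subst sum.remove[of _ n]) (auto simp: cbil_lin intro!: sum.neutral)

lemma conv_unit_left: "cbilinear T \<Longrightarrow> conv T (\<lambda>n. if n = 0 then c else 0) b n = T c (b n)"
  unfolding conv_def by (subst sum.remove[of _ 0]) (auto simp: cbil_lin intro!: sum.neutral)

lemma counit_JJ: "pm counit (JJ n) = (if n = 0 then cst 1 else 0)"
proof -
  have "pm counit (conv om JJ Uu n) = conv om (\<lambda>n. pm counit (JJ n)) (\<lambda>n. pm counit (Uu n)) n"
    unfolding pm_conv[OF clinear_counit]
    by (simp add: conv_def om_def
        moy_nat[OF cbilinear_opp cbilinear_opp clinear_counit clinear_counit clinear_counit] counit_simps)
  then show ?thesis
    by (simp add: conv_om_JJ counit_J0 counit_Uu conv_unit_right[OF cbilinear_om] om_one del: if_split)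
qed

lemma tw_zero:
  fixes B :: "'a::cvector \<Rightarrow> 'b::cvector \<Rightarrow> 'c::cvector"
  assumes "cbilinear B" shows "tw B (\<lambda>_. 0) p q = moy B p q"
proof -
  have z: "pm (\<lambda>_. 0) p = (0 :: 'a pol)" for p :: "'a pol"
    by (rule poly_mapping_eqI) (simp add: clinear_zero_fun)
  show ?thesis
    by (rule tw_unique[OF assms clinear_zero_fun, symmetric, of "moy B"])
      (simp_all add: clinear_moy_right assms moy_R moy_lin_left z moy_cst_right lin_LR)
qed

lemma lookup_cancel:
  assumes "\<And>n. conv rt a r n = conv rt a s n" "a 0 = cst 1"
  shows "r n = s n"
proof -
  have "r n - s n = 0"
  proof (rule conv_cancel_left[where a=a and b="\<lambda>n. r n - s n", OF cbilinear_rt])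
    fix p assume "rt (a 0) p = 0"
    then have "Poly_Mapping.lookup (cst p) (0, 0) = Poly_Mapping.lookup (0 :: 'a pol) (0, 0)" by (simp add: assms rt_cst)
    then show "p = 0" by simp
  qed (simp add: conv_diff_right[OF cbilinear_rt] assms)
  then show ?thesis by simp
qed

text \<open>Apply the counit on the left factor to J * J = Delta(J) R. On the left-hand side J
  becomes 1 and delta_1 becomes 0, so the twisted product collapses to J. On the right-hand side the
  coproduct of J becomes J, which is then cancelled.\<close>

lemma counit_left: "tensor_map counit id (Rser n) = (if n = 0 then 1 else 0)"
proof -
  define E where "E = (tensor_map counit id :: (h1, h1) tensor \<Rightarrow> (complex, h1) tensor)"
  let ?a = "\<lambda>n. pm (\<lambda>h. 1 \<otimes> h :: (complex, h1) tensor) (JJ n)"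
  have e: "clinear E" "\<And>x y. E (x * y) = E x * E y" "\<And>x y. E (x \<otimes> y) = counit x \<otimes> y"
    unfolding E_def
    by (simp_all add: clinear_tensor_map clinear_counit clinear_id' tensor_map_mult counit_simps tensor_map_mk)
  have eC: "E (coproduct h) = 1 \<otimes> h" for h
  proof (induction h rule: h1_induct)
    case one
    show ?case by (simp only: coproduct_simps one_tensor_def e(3) counit_simps)
  qed (simp_all add: coproduct_simps e counit_simps clinear_add[OF e(1)] clinear_scale[OF e(1)] tensor_mk_simps tensor_times_mk
      clinear_add[OF clinear_coproduct] clinear_scale[OF clinear_coproduct] counit_hdelta)
  have "conv rt ?a (\<lambda>n. E (Rser n)) n = ?a n" for n
  proof -
    have "conv rt ?a (\<lambda>n. E (Rser n)) n = pm E (MM n)"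
      unfolding MM_eq pm_conv_rt[OF e(1,2)]
      by (simp add: dJ_def pm_pm e(1) clinear_coproduct eC)
    also have "\<dots> = conv (moy (\<otimes>)) (\<lambda>n. pm counit (JJ n)) JJ n"
      unfolding MM_def pm_conv[OF e(1)] unfolding conv_def
      by (subst tw_nat[OF cbilinear_tensor_mk cbilinear_tensor_mk e(1) clinear_counit clinear_id, where d'="\<lambda>_. 0"])
        (simp_all add: clinear_lmult clinear_zero_fun e counit_zero pm_id tw_zero cbilinear_tensor_mk)
    also have "\<dots> = ?a n"
      by (simp add: counit_JJ conv_unit_left[OF cbilinear_moy[OF cbilinear_tensor_mk]] moy_cst_left[OF cbilinear_tensor_mk] del: if_split)
    finally show ?thesis .
  qed
  then have "conv rt ?a (\<lambda>n. E (Rser n)) n = conv rt ?a (\<lambda>n. if n = 0 then 1 else 0) n" for n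
    by (simp add: conv_unit_right[OF cbilinear_rt]) (rule poly_mapping_eqI, simp)
  from lookup_cancel[OF this] show ?thesis
    by (simp add: JJ_cst pm_single clinear_mk1 one_tensor_def E_def)
qed

lemma counit_right: "tensor_map id counit (Rser n) = (if n = 0 then 1 else 0)"
proof -
  define E where "E = (tensor_map id counit :: (h1, h1) tensor \<Rightarrow> (h1, complex) tensor)"
  let ?a = "\<lambda>n. pm (\<lambda>h. h \<otimes> 1 :: (h1, complex) tensor) (JJ n)"
  have e: "clinear E" "\<And>x y. E (x * y) = E x * E y" "\<And>x y. E (x \<otimes> y) = x \<otimes> counit y"
    unfolding E_def
    by (simp_all add: clinear_tensor_map clinear_counit clinear_id' tensor_map_mult counit_simps tensor_map_mk)
  have eC: "E (coproduct h) = h \<otimes> 1" for h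
  proof (induction h rule: h1_induct)
    case one
    show ?case by (simp only: coproduct_simps one_tensor_def e(3) counit_simps)
  qed (simp_all add: coproduct_simps e counit_simps clinear_add[OF e(1)] clinear_scale[OF e(1)] tensor_mk_simps tensor_times_mk
      clinear_add[OF clinear_coproduct] clinear_scale[OF clinear_coproduct] counit_hdelta)
  have "conv rt ?a (\<lambda>n. E (Rser n)) n = ?a n" for n
  proof -
    have "conv rt ?a (\<lambda>n. E (Rser n)) n = pm E (MM n)"
      unfolding MM_eq pm_conv_rt[OF e(1,2)]
      by (simp add: dJ_def pm_pm e(1) clinear_coproduct eC)
    also have "\<dots> = conv (tw (\<otimes>) dlt) JJ (\<lambda>n. pm counit (JJ n)) n"
      unfolding MM_def pm_conv[OF e(1)] unfolding conv_def
      by (subst tw_nat[OF cbilinear_tensor_mk cbilinear_tensor_mk e(1) clinear_id clinear_counit, where d'=dlt])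
        (simp_all add: clinear_lmult e pm_id)
    also have "\<dots> = ?a n"
      by (simp add: counit_JJ conv_unit_right[OF cbilinear_tw[OF cbilinear_tensor_mk clinear_lmult]]
          tw_cst_right[OF cbilinear_tensor_mk clinear_lmult] del: if_split)
    finally show ?thesis .
  qed
  then have "conv rt ?a (\<lambda>n. E (Rser n)) n = conv rt ?a (\<lambda>n. if n = 0 then 1 else 0) n" for n
    by (simp add: conv_unit_right[OF cbilinear_rt]) (rule poly_mapping_eqI, simp)
  from lookup_cancel[OF this] show ?thesis
    by (simp add: JJ_cst pm_single clinear_mk2 one_tensor_def E_def)
qed

subsection \<open>Parity\<close>

text \<open>The substitution of (-u, -v) for (u, v), an automorphism of the Moyal and twisted
  products.\<close>

lift_definition sg :: "'c::cvector pol \<Rightarrow> 'c pol" is "\<lambda>p k. (- 1) ^ (fst k + snd k) *\<^sub>C p k"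
  by (rule finite_subset[rotated], assumption) (auto simp: cvec.scale_zero_right)

declare sg.rep_eq [simp]

lemma clinear_sg: "clinear sg"
  by (rule clinearI; rule poly_mapping_eqI; simp add: lookup_add scaleC_add_right scaleC_scaleC mult.commute)

lemmas lin_sg = clinear_add[OF clinear_sg] clinear_scale[OF clinear_sg] clinear_zero[OF clinear_sg]
  clinear_diff[OF clinear_sg] clinear_minus[OF clinear_sg] clinear_sum[OF clinear_sg]

lemma sg_ops: "sg (du p) = - du (sg p)" "sg (dv p) = - dv (sg p)" "sg (mu p) = - mu (sg p)" "sg (mv p) = - mv (sg p)"
  by (rule poly_mapping_eqI;
      auto simp: scaleC_scaleC power_add cvec.scale_zero_right mult_ac simp flip: cvec.scale_minus_left split: nat.split)+

lemma sg_pm: "clinear f \<Longrightarrow> sg (pm f p) = pm f (sg p)"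
  by (rule poly_mapping_eqI) (simp add: clinear_scale)

lemma sg_LR: "sg (Lu p) = - Lu (sg p)" "sg (Ru p) = - Ru (sg p)" "sg (Rv p) = - Rv (sg p)"
  by (simp_all add: Lu_def Ru_def Rv_def lin_sg sg_ops lin_all)

lemma sg_cst: "sg (cst c) = cst c"
  by (rule poly_mapping_eqI) (auto simp: lookup_single when_def cvec.scale_zero_right scaleC_one)

lemma sg_moy: assumes B: "cbilinear B" shows "sg (moy B p q) = moy B (sg p) (sg q)"
  by (induction q rule: Ru_Rv_induct)
    (simp_all add: moy_cst_right[OF B] sg_cst sg_pm cbilinearD2[OF B] moy_R[OF B] sg_LR
      clinear_minus[OF clinear_moy_right[OF B]] moy_lin_right[OF B] lin_sg)

lemma sg_tw: assumes B: "cbilinear B" and d: "clinear d" shows "sg (tw B d p q) = tw B d (sg p) (sg q)"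
  by (induction q arbitrary: p rule: Ru_Rv_induct)
    (simp_all add: tw_cst_right[OF B d] sg_cst sg_pm cbilinearD2[OF B] tw_Ru[OF B d] tw_Rv[OF B d] sg_LR d
      clinear_minus[OF clinear_tw_right[OF B d]] tlr[OF B d] lin_sg)

lemma sg_P: "clinear X \<Longrightarrow> clinear S \<Longrightarrow> sg (Pl X S p) = Pl X S (sg p)"
  "clinear X \<Longrightarrow> sg (P0 X p) = P0 X (sg p)" "clinear X \<Longrightarrow> sg (Qo X p) = Qo X (sg p)"
  by (simp_all add: Pl_def P0_def Qo_def lin_sg sg_pm sg_ops sg_LR lin_all lin_LR)

text \<open>The component of degree n contains only monomials u^i v^j with i + j of the same parity
  as n. This is exactly the condition that the exponent (n - i - j)/2 of hbar, suppressed in the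
  notation, is an integer.\<close>

definition par :: "(nat \<Rightarrow> 'c::cvector pol) \<Rightarrow> bool" where
  "par a \<longleftrightarrow> (\<forall>n. sg (a n) = (- 1) ^ n *\<^sub>C a n)"

text \<open>Applying \<open>sg\<close> and the sign (-1)^n gives again a flat series with the same
  constant terms, provided the constant terms vanish in positive degree; uniqueness does the
  rest.\<close>

lemma par_flat:
  assumes a: "flat P Q a" and lP: "clinear P" and lQ: "clinear Q" and P: "\<And>p. sg (P p) = P (sg p)" and Q: "\<And>p. sg (Q p) = Q (sg p)"
    and c: "\<And>n. n > 0 \<Longrightarrow> Poly_Mapping.lookup (a n) (0, 0) = 0"
  shows "par a"
proof -
  note a' = a[unfolded flat_def]
  have sq: "(-1) ^ n *\<^sub>C (-1) ^ n *\<^sub>C x = x" for n and x :: "'z::cvector"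
    by (simp add: scaleC_scaleC scaleC_one flip: power_mult_distrib)
  have du': "du (sg p) = - sg (du p)" "dv (sg p) = - sg (dv p)" for p :: "'a pol"
    by (simp_all add: sg_ops)
  have "flat P Q (\<lambda>n. (-1) ^ n *\<^sub>C sg (a n))"
    unfolding flat_def
    using a' by (simp add: lin_all du' P Q clinear_scale[OF lP] clinear_scale[OF lQ] lin_sg)
  from flat_unique[OF this a]
  have "(\<lambda>n. (-1) ^ n *\<^sub>C sg (a n)) = a"
  proof -
    have "(-1) ^ n *\<^sub>C Poly_Mapping.lookup (a n) (0, 0) = Poly_Mapping.lookup (a n) (0, 0)" for n
      by (cases n) (simp_all add: c scaleC_one cvec.scale_zero_right)
    with flat_unique[OF \<open>flat P Q (\<lambda>n. (-1) ^ n *\<^sub>C sg (a n))\<close> a] show ?thesis by (simp add: scaleC_one)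
  qed
  then have "(-1) ^ n *\<^sub>C sg (a n) = a n" for n by metis
  then have "sg (a n) = (-1) ^ n *\<^sub>C a n" for n using sq[of n "sg (a n)"] by metis
  then show ?thesis by (simp add: par_def)
qed

lemma par_conv:
  assumes T: "cbilinear T" and "par a" "par b" and "\<And>p q. sg (T p q) = T (sg p) (sg q)"
  shows "par (conv T a b)"
  using assms(2,3) unfolding par_def conv_def
  by (auto simp: lin_sg assms(4) cbil_lin[OF T] scaleC_scaleC cvec.scale_sum_right simp flip: power_add intro!: sum.cong)

lemma par_Uu: "par Uu"
  by (rule par_flat[OF flat_Uu])
    (simp_all add: clinear_Pl clinear_Qo clinear_ad clinear_lmult sg_P Uu_0)

lemma par_J0: "par J0"
  by (rule par_flat[OF flat_J0])
    (simp_all add: clinear_P0 clinear_Qo clinear_lmult sg_P J0_0)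

lemma sg_om: "sg (om p q) = om (sg p) (sg q)"
  unfolding om_def by (rule sg_moy[OF cbilinear_opp])

lemma par_JJ: "par JJ"
proof -
  have "sg (JJ n) = (-1) ^ n *\<^sub>C JJ n" for n
  proof (induction n rule: less_induct)
    case (less n)
    have "JJ n = J0 n - (\<Sum>i<n. om (JJ i) (Uu (n - i)))"
      unfolding JJ_def by (subst rquot.simps) simp
    moreover have "sg (om (JJ i) (Uu (n - i))) = (-1) ^ n *\<^sub>C om (JJ i) (Uu (n - i))" if "i < n" for i
      using less[OF that] par_Uu that unfolding par_def
      by (simp add: sg_om cbil_lin[OF cbilinear_om] scaleC_scaleC flip: power_add)
    ultimately show ?case
      using par_J0 by (simp add: par_def lin_sg cvec.scale_sum_right cvec.scale_right_diff_distrib)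
  qed
  then show ?thesis by (simp add: par_def)
qed

lemma par_lookup:
  assumes "par a" "odd (n + fst k + snd k)"
  shows "Poly_Mapping.lookup (a n) k = 0"
proof -
  have "Poly_Mapping.lookup (sg (a n)) k = Poly_Mapping.lookup ((-1) ^ n *\<^sub>C a n) k"
    using assms(1) by (simp add: par_def)
  then have "(-1) ^ (fst k + snd k) *\<^sub>C Poly_Mapping.lookup (a n) k = (-1) ^ n *\<^sub>C Poly_Mapping.lookup (a n) k"
    by simp
  moreover have "(-1) ^ (fst k + snd k) = (- ((-1) ^ n) :: complex)"
    using assms(2) by (cases "even n") (auto simp: minus_one_power_iff)
  ultimately have "- ((-1) ^ n *\<^sub>C Poly_Mapping.lookup (a n) k) = (-1) ^ n *\<^sub>C Poly_Mapping.lookup (a n) k"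
    by (simp only: cvec.scale_minus_left)
  then have "2 *\<^sub>C (-1) ^ n *\<^sub>C Poly_Mapping.lookup (a n) k = 0"
    by (metis scaleC_two add.left_inverse)
  then show ?thesis by simp
qed

lemma Rser_odd: "odd n \<Longrightarrow> Rser n = 0"
  unfolding Rser_def
proof (rule par_lookup)
  have dU: "par dU" using par_Uu unfolding par_def dU_def
    by (simp add: sg_pm clinear_coproduct lin_pm)
  show "par (conv om MM dU)"
    unfolding MM_def
    by (intro par_conv cbilinear_om cbilinear_tw2 dU par_JJ sg_om sg_tw cbilinear_tensor_mk clinear_lmult)
qed simp

section \<open>R as a power series in hbar\<close>

text \<open>Since hbar has degree 2, the coefficient of its n-th power sits in total degree 2n; the
  odd degrees are zero by \<open>Rser_odd\<close>.\<close>

definition Rfps :: "(h1, h1) tensor fps" where "Rfps = Abs_fps (\<lambda>n. Rser (2 * n))"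

text \<open>Converts convolution in the total degree into the Cauchy product of power series in
  hbar.\<close>

lemma conv_even:
  assumes T: "cbilinear T" and "\<And>n. odd n \<Longrightarrow> a n = 0" "\<And>n. odd n \<Longrightarrow> b n = 0"
  shows "conv T a b (2 * n) = (\<Sum>i\<le>n. T (a (2 * i)) (b (2 * (n - i))))"
proof -
  have "conv T a b (2 * n) = (\<Sum>i\<in>(\<lambda>i. 2 * i) ` {..n}. T (a i) (b (2 * n - i)))"
    unfolding conv_def
  proof (rule sum.mono_neutral_right)
    show "\<forall>i\<in>{..2 * n} - (\<lambda>i. 2 * i) ` {..n}. T (a i) (b (2 * n - i)) = 0"
    proof
      fix i assume i: "i \<in> {..2 * n} - (\<lambda>i. 2 * i) ` {..n}"
      have "odd i"
      proof
        assume "even i"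
        then obtain j where "i = 2 * j" by (elim evenE)
        with i show False by auto
      qed
      then show "T (a i) (b (2 * n - i)) = 0" by (simp add: assms(2) cbil_lin[OF T])
    qed
  qed auto
  also have "\<dots> = (\<Sum>i\<le>n. T (a (2 * i)) (b (2 * (n - i))))"
    by (subst sum.reindex) (auto simp: inj_on_def right_diff_distrib')
  finally show ?thesis .
qed

lemma twist_fps:
  "fps_map (tensor_map coproduct id) Rfps * fps_map (\<lambda>t. t \<otimes> 1) Rfps =
    fps_map (\<lambda>t. tensor_assoc (tensor_map id coproduct t)) Rfps * fps_map (\<lambda>t. tensor_assoc (1 \<otimes> t)) Rfps"
proof (rule fps_ext)
  fix n
  have "conv (*) (\<lambda>n. cop12 (Rser n)) (\<lambda>n. Rser n \<otimes> 1) (2 * n)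
    = conv (*) (\<lambda>n. cop23 (Rser n)) (\<lambda>n. tensor_assoc (1 \<otimes> Rser n)) (2 * n)"
    by (rule twist_series)
  moreover have "conv (*) (\<lambda>n. cop12 (Rser n)) (\<lambda>n. Rser n \<otimes> 1) (2 * n)
     = (\<Sum>i\<le>n. cop12 (Rser (2 * i)) * (Rser (2 * (n - i)) \<otimes> 1))"
    by (rule conv_even[OF cbilinear_mult]) (simp_all add: Rser_odd tensor_mk_simps clinear_zero[OF clinear_cop12])
  moreover have "conv (*) (\<lambda>n. cop23 (Rser n)) (\<lambda>n. tensor_assoc (1 \<otimes> Rser n)) (2 * n)
     = (\<Sum>i\<le>n. cop23 (Rser (2 * i)) * tensor_assoc (1 \<otimes> Rser (2 * (n - i))))"
    by (rule conv_even[OF cbilinear_mult])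
      (simp_all add: Rser_odd tensor_mk_simps clinear_zero[OF clinear_cop23] clinear_zero[OF tensor_assoc_clinear])
  ultimately show "fps_nth (fps_map (tensor_map coproduct id) Rfps * fps_map (\<lambda>t. t \<otimes> 1) Rfps) n =
    fps_nth (fps_map (\<lambda>t. tensor_assoc (tensor_map id coproduct t)) Rfps * fps_map (\<lambda>t. tensor_assoc (1 \<otimes> t)) Rfps) n"
    by (simp add: fps_mult_nth fps_map_def Rfps_def cop12_def cop23_def atLeast0AtMost)
qed

lemma counit_fps: "fps_map (tensor_map counit id) Rfps = 1" "fps_map (tensor_map id counit) Rfps = 1"
  by (rule fps_ext; simp add: fps_map_def Rfps_def counit_left counit_right)+

declare One_nat_def [simp]

section \<open>The recursive Moyal product agrees with the exponential series\<close>

type_synonym cf = "nat \<Rightarrow> nat \<Rightarrow> complex"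

definition fU :: "cf \<Rightarrow> cf" where "fU A m n = of_nat (Suc m) * A (Suc m) n"
definition fV :: "cf \<Rightarrow> cf" where "fV A m n = of_nat (Suc n) * A m (Suc n)"
definition mU :: "cf \<Rightarrow> cf" where "mU A m n = (case m of 0 \<Rightarrow> 0 | Suc m' \<Rightarrow> A m' n)"
definition mV :: "cf \<Rightarrow> cf" where "mV A m n = (case n of 0 \<Rightarrow> 0 | Suc n' \<Rightarrow> A m n')"
definition cau :: "cf \<Rightarrow> cf \<Rightarrow> cf" where "cau A B m n = (\<Sum>p\<le>m. \<Sum>q\<le>n. A p q * B (m - p) (n - q))"

text \<open>Multiplication after the r-th power of the Poisson bidifferential operator, on arrays
  without any finiteness condition.\<close>

primrec moT :: "nat \<Rightarrow> cf \<Rightarrow> cf \<Rightarrow> cf" where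
  "moT 0 A B = cau A B"
| "moT (Suc r) A B = moT r (fU A) (fV B) - moT r (fV A) (fU B)"

lemma fUV: "fU (fV A) = fV (fU A)"
  by (intro ext) (simp add: fU_def fV_def)

lemma f_mU: "fU (mU A) = A + mU (fU A)" "fV (mU A) = mU (fV A)" "fV (mV A) = A + mV (fV A)" "fU (mV A) = mV (fU A)"
  by (intro ext; auto simp: fU_def fV_def mU_def mV_def algebra_simps split: nat.split)+

lemma f_lin: "fU (A + B) = fU A + fU B" "fV (A + B) = fV A + fV B"
  "fU (\<lambda>m n. c * A m n) = (\<lambda>m n. c * fU A m n)" "fV (\<lambda>m n. c * A m n) = (\<lambda>m n. c * fV A m n)"
  by (intro ext; simp add: fU_def fV_def algebra_simps)+

lemma m_lin: "mU (A + B) = mU A + mU B" "mV (A + B) = mV A + mV B" "mU (A - B) = mU A - mU B" "mV (A - B) = mV A - mV B"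
  by (intro ext; simp add: mU_def mV_def split: nat.split)+

lemma cau_add: "cau (A + A') B = cau A B + cau A' B"
  by (intro ext) (simp add: cau_def algebra_simps sum.distrib)

lemma moT_add: "moT r (A + A') B = moT r A B + moT r A' B"
  by (induction r arbitrary: A A' B) (simp_all add: cau_add f_lin)

lemma cau_mU: "cau (mU A) B = mU (cau A B)"
proof (intro ext)
  fix m n
  show "cau (mU A) B m n = mU (cau A B) m n"
    by (cases m) (simp_all add: cau_def mU_def sum.atMost_Suc_shift del: sum.atMost_Suc)
qed

lemma cau_mV: "cau (mV A) B = mV (cau A B)"
proof (intro ext)
  fix m n
  show "cau (mV A) B m n = mV (cau A B) m n"
    by (cases n) (simp_all add: cau_def mV_def sum.atMost_Suc_shift del: sum.atMost_Suc)
qed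

text \<open>The commutator of the r-th power of the Poisson operator with u acting on the left
  factor is r times the (r-1)-st power followed by d/dv on the right factor.\<close>

lemma moT_mU: "moT r (mU A) B = mU (moT r A B) + (\<lambda>m n. of_nat r * moT (r - 1) A (fV B) m n)"
proof (induction r arbitrary: A B)
  case 0
  show ?case by (intro ext) (simp add: cau_mU)
next
  case (Suc r)
  show ?case
  proof (intro ext)
    fix m n
    have k: "of_nat r * moT (r - 1) (fU A) (fV (fV B)) m n - of_nat r * moT (r - 1) (fV A) (fV (fU B)) m n = of_nat r * moT r A (fV B) m n"
      by (cases r) (simp_all add: fUV algebra_simps)
    show "moT (Suc r) (mU A) B m n = (mU (moT (Suc r) A B) + (\<lambda>m n. of_nat (Suc r) * moT (Suc r - 1) A (fV B) m n)) m n"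
      unfolding moT.simps f_mU moT_add Suc.IH m_lin using k by (simp add: algebra_simps)
  qed
qed

lemma moT_mV: "moT r (mV A) B = mV (moT r A B) - (\<lambda>m n. of_nat r * moT (r - 1) A (fU B) m n)"
proof (induction r arbitrary: A B)
  case 0
  show ?case by (intro ext) (simp add: cau_mV)
next
  case (Suc r)
  show ?case
  proof (intro ext)
    fix m n
    have k: "of_nat r * moT (r - 1) (fU A) (fU (fV B)) m n - of_nat r * moT (r - 1) (fV A) (fU (fU B)) m n = of_nat r * moT r A (fU B) m n"
      by (cases r) (simp_all add: fUV algebra_simps)
    show "moT (Suc r) (mV A) B m n = (mV (moT (Suc r) A B) - (\<lambda>m n. of_nat (Suc r) * moT (Suc r - 1) A (fU B) m n)) m n"
      unfolding moT.simps f_mU moT_add Suc.IH m_lin using k by (simp add: algebra_simps)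
  qed
qed

abbreviation LK :: "complex pol \<Rightarrow> cf" where "LK p \<equiv> \<lambda>m n. Poly_Mapping.lookup p (m, n)"

lemma LK_ops: "LK (du p) = fU (LK p)" "LK (dv p) = fV (LK p)" "LK (mu p) = mU (LK p)" "LK (mv p) = mV (LK p)"
  "LK (p + q) = LK p + LK q"
  by (intro ext; simp add: fU_def fV_def mU_def mV_def scaleC_complex_def lookup_add split: nat.split)+

abbreviation mo :: "complex pol \<Rightarrow> complex pol \<Rightarrow> complex pol" where "mo \<equiv> moy (*)"

lemmas mo_bil = cbilinear_mult[where ?'a = complex]

lemma mo_mu: "mo (mu p) q = mu (mo p q) - (\<i> / 2) *\<^sub>C mo p (dv q)"
proof (induction p rule: pol_induct)
  case (single k c)
  then show ?case by (cases k) (simp add: mu_single moy_single[OF mo_bil] pm_dv clinear_lmult)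
qed (simp add: lin_mu moy_lin_left[OF mo_bil] scaleC_add_right)

lemma mono_uv_v: "mono_uv a (Suc b) q = mv (mono_uv a b q) + (\<i> / 2) *\<^sub>C mono_uv a b (du q)"
  by (induction a arbitrary: q) (simp_all add: lin_all weyl_comm lin_mono)

lemma mo_mv: "mo (mv p) q = mv (mo p q) + (\<i> / 2) *\<^sub>C mo p (du q)"
proof (induction p rule: pol_induct)
  case (single k c)
  then show ?case by (cases k) (simp add: mv_single moy_single[OF mo_bil] pm_du clinear_lmult mono_uv_v)
qed (simp add: lin_mv moy_lin_left[OF mo_bil] scaleC_add_right)

definition mc :: "nat \<Rightarrow> complex" where "mc r = (- \<i> / 2) ^ r / fact r"

lemma mc_Suc: "mc (Suc r) * of_nat (Suc r) = - (\<i> / 2) * mc r"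
  by (simp add: mc_def field_simps del: of_nat_Suc)

text \<open>The first R terms of the exponential series give all products with p on the left, and
  all later terms vanish, uniformly in the right factor. The bound depends only on p because each
  term differentiates p once more.\<close>

definition mo_rep :: "complex pol \<Rightarrow> nat \<Rightarrow> bool" where
  "mo_rep p R \<longleftrightarrow> (\<forall>r\<ge>R. \<forall>B. moT r (LK p) B = 0) \<and> (\<forall>q m n. LK (mo p q) m n = (\<Sum>r<R. mc r * moT r (LK p) (LK q) m n))"

lemma mo_rep_mono:
  assumes "mo_rep p R" "R \<le> R'"
  shows "mo_rep p R'"
proof -
  have "(\<Sum>r<R'. mc r * moT r (LK p) (LK q) m n) = (\<Sum>r<R. mc r * moT r (LK p) (LK q) m n)" for q m n
    using assms by (intro sum.mono_neutral_right) (auto simp: mo_rep_def not_less)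
  then show ?thesis using assms by (simp add: mo_rep_def)
qed

text \<open>One more factor u needs one more term of the series. The terms produced by
  \<open>moT_mU\<close> reassemble, by the recursion \<open>mc_Suc\<close> of the exponential
  coefficients, to the correction in \<open>mo_mu\<close>.\<close>

lemma mo_rep_mu:
  assumes "mo_rep p R"
  shows "mo_rep (mu p) (Suc R)"
  unfolding mo_rep_def
proof (intro conjI allI impI)
  fix r B assume "Suc R \<le> r"
  then show "moT r (LK (mu p)) B = 0"
    unfolding LK_ops(3) moT_mU using assms
    by (cases r) (auto simp: mo_rep_def fun_eq_iff mU_def simp del: moT.simps split: nat.split)
next
  fix q m n
  note a = mo_rep_mono[OF assms, of "Suc R"]
  have 1: "LK (mu (mo p q)) m n = (\<Sum>r<Suc R. mc r * mU (moT r (LK p) (LK q)) m n)"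
    using a unfolding mo_rep_def LK_ops by (cases m) (simp_all add: mU_def)
  have "(\<Sum>r<Suc R. mc r * (of_nat r * moT (r - 1) (LK p) (fV (LK q)) m n))
     = (\<Sum>r<R. mc (Suc r) * (of_nat (Suc r) * moT r (LK p) (fV (LK q)) m n))"
    by (subst sum.lessThan_Suc_shift) simp
  also have "\<dots> = - (\<i> / 2) * LK (mo p (dv q)) m n"
  proof -
    have "LK (mo p (dv q)) m n = (\<Sum>r<R. mc r * moT r (LK p) (fV (LK q)) m n)"
      using assms unfolding mo_rep_def LK_ops(2)[symmetric] by blast
    then show ?thesis by (simp only: sum_distrib_left mult.assoc[symmetric] mc_Suc)
  qed
  finally have 2: "(\<Sum>r<Suc R. mc r * (of_nat r * moT (r - 1) (LK p) (fV (LK q)) m n)) = - (\<i> / 2) * LK (mo p (dv q)) m n" .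
  have 3: "LK (mo (mu p) q) m n = LK (mu (mo p q)) m n - (\<i> / 2) * LK (mo p (dv q)) m n"
    by (simp only: mo_mu lookup_minus lookup_scaleC scaleC_complex_def)
  show "LK (mo (mu p) q) m n = (\<Sum>r<Suc R. mc r * moT r (LK (mu p)) (LK q) m n)"
    unfolding 3 1 unfolding LK_ops(3) moT_mU plus_fun_apply fun_diff_def distrib_left right_diff_distrib sum.distrib sum_subtractf 2
    by simp
qed

lemma mo_rep_mv:
  assumes "mo_rep p R"
  shows "mo_rep (mv p) (Suc R)"
  unfolding mo_rep_def
proof (intro conjI allI impI)
  fix r B assume "Suc R \<le> r"
  then show "moT r (LK (mv p)) B = 0"
    unfolding LK_ops(4) moT_mV using assms
    by (cases r) (auto simp: mo_rep_def fun_eq_iff mV_def simp del: moT.simps split: nat.split)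
next
  fix q m n
  note a = mo_rep_mono[OF assms, of "Suc R"]
  have 1: "LK (mv (mo p q)) m n = (\<Sum>r<Suc R. mc r * mV (moT r (LK p) (LK q)) m n)"
    using a unfolding mo_rep_def LK_ops by (cases n) (simp_all add: mV_def)
  have "(\<Sum>r<Suc R. mc r * (of_nat r * moT (r - 1) (LK p) (fU (LK q)) m n))
     = (\<Sum>r<R. mc (Suc r) * (of_nat (Suc r) * moT r (LK p) (fU (LK q)) m n))"
    by (subst sum.lessThan_Suc_shift) simp
  also have "\<dots> = - (\<i> / 2) * LK (mo p (du q)) m n"
  proof -
    have "LK (mo p (du q)) m n = (\<Sum>r<R. mc r * moT r (LK p) (fU (LK q)) m n)"
      using assms unfolding mo_rep_def LK_ops(1)[symmetric] by blast
    then show ?thesis by (simp only: sum_distrib_left mult.assoc[symmetric] mc_Suc)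
  qed
  finally have 2: "(\<Sum>r<Suc R. mc r * (of_nat r * moT (r - 1) (LK p) (fU (LK q)) m n)) = - (\<i> / 2) * LK (mo p (du q)) m n" .
  have 3: "LK (mo (mv p) q) m n = LK (mv (mo p q)) m n + (\<i> / 2) * LK (mo p (du q)) m n"
    by (simp only: mo_mv lookup_add lookup_scaleC scaleC_complex_def)
  show "LK (mo (mv p) q) m n = (\<Sum>r<Suc R. mc r * moT r (LK (mv p)) (LK q) m n)"
    unfolding 3 1 unfolding LK_ops(4) moT_mV plus_fun_apply fun_diff_def distrib_left right_diff_distrib sum.distrib sum_subtractf 2
    by simp
qed

lemma mo_rep_cst: "mo_rep (cst c) 1"
proof -
  have U: "fU (LK (cst c)) = (\<lambda>_ _. 0)" "fV (LK (cst c)) = (\<lambda>_ _. 0)" by (intro ext; simp add: fU_def fV_def lookup_single when_def)+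
  have z: "moT r (\<lambda>_ _. 0) B = 0" for r B
    by (induction r arbitrary: B) (auto simp: cau_def fun_eq_iff fU_def[abs_def] fV_def[abs_def])
  have "moT r (LK (cst c)) B = 0" if "r \<ge> 1" for r B
    using that by (cases r) (simp_all add: U z)
  moreover have "cau (LK (cst c)) B m n = c * B m n" for B m n
  proof -
    have "(\<Sum>q\<le>n. LK (cst c) p q * B (m - p) (n - q)) = (if p = 0 then c * B m n else 0)" for p
      by (cases "p = 0") (simp_all add: lookup_single when_def if_distrib[where f="\<lambda>x. x * _"] cong: if_cong)
    then show ?thesis by (simp add: cau_def)
  qed
  ultimately show ?thesis
    by (simp add: mo_rep_def moy_cst_left[OF mo_bil] clinear_lmult mc_def)
qed

lemma mo_rep_exists: "\<exists>R. mo_rep p R"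
proof (induction p rule: pol_induct)
  case (single k c)
  have "\<exists>R. mo_rep (Poly_Mapping.single (0, b) c) R" for b
  proof (induction b)
    case (Suc b)
    then obtain R where "mo_rep (Poly_Mapping.single (0, b) c) R" ..
    from mo_rep_mv[OF this] show ?case by (auto simp: mv_single)
  qed (use mo_rep_cst in blast)
  then have "\<exists>R. mo_rep (Poly_Mapping.single (a, b) c) R" for a b
  proof (induction a)
    case (Suc a)
    then obtain R where "mo_rep (Poly_Mapping.single (a, b) c) R" by blast
    from mo_rep_mu[OF this] show ?case by (auto simp: mu_single)
  qed
  then show ?case by (cases k) auto
next
  case (add p q)
  then obtain R R' where "mo_rep p R" "mo_rep q R'" by blast
  then have "mo_rep p (max R R')" "mo_rep q (max R R')" by (auto intro: mo_rep_mono)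
  moreover have "moT r (\<lambda>m n. Poly_Mapping.lookup p (m, n) + Poly_Mapping.lookup q (m, n)) B = moT r (LK p) B + moT r (LK q) B" for r B
    using moT_add[of r "LK p" "LK q" B] by (simp add: plus_fun_def)
  ultimately have "mo_rep (p + q) (max R R')"
    unfolding mo_rep_def
    by (simp add: lookup_add moy_lin_left[OF mo_bil] distrib_left sum.distrib)
  then show ?case by blast
qed

subsection \<open>Fibres as series\<close>

text \<open>The component of total degree i: the exponent of hbar is determined by i, m and n, and
  the entry is zero when the parity leaves no integral exponent.\<close>

definition lk :: "fib \<Rightarrow> int \<Rightarrow> cf" where
  "lk a i m n = (if even (i - int m - int n) then a ((i - int m - int n) div 2) m n else 0)"

lemma lk_fdu: "lk (fdu a) i = fU (lk a (i + 1))" and lk_fdv: "lk (fdv a) i = fV (lk a (i + 1))"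
proof -
  have e: "i + 1 - int (Suc m) - int n = i - int m - int n" "i + 1 - int m - int (Suc n) = i - int m - int n" for m n
    by auto
  show "lk (fdu a) i = fU (lk a (i + 1))" "lk (fdv a) i = fV (lk a (i + 1))"
    by (intro ext; unfold lk_def fU_def fV_def e fdu_def fdv_def; simp)+
qed

text \<open>Total degrees are at least -d. A fibre derivative lowers the degree by one, so the bound
  has to be relaxed along the powers of the Poisson operator.\<close>

definition lowb :: "nat \<Rightarrow> fib \<Rightarrow> bool" where
  "lowb d a \<longleftrightarrow> (\<forall>k m n. 2 * k + int m + int n < - int d \<longrightarrow> a k m n = 0)"

lemma lowb_fdu: "lowb d a \<Longrightarrow> lowb (Suc d) (fdu a)" and lowb_fdv: "lowb d a \<Longrightarrow> lowb (Suc d) (fdv a)"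
  by (auto simp: lowb_def fdu_def fdv_def)

text \<open>The sum over exponents of hbar is reorganized by total degree. The lower bounds on both
  factors make the range of degrees finite.\<close>

lemma fmult_lk:
  assumes a: "lowb da a" and b: "lowb db b"
  shows "fmult a b k m n = (\<Sum>i\<in>{- int da..2 * k + int m + int n + int db}. cau (lk a i) (lk b (2 * k + int m + int n - i)) m n)"
proof -
  let ?N = "2 * k + int m + int n"
  let ?I = "{- int da..?N + int db}" and ?K = "{- int (da + m + n)..\<bar>?N\<bar> + int db}"
  let ?g = "\<lambda>p q k1. a k1 p q * b (k - k1) (m - p) (n - q)"
  have g: "?g p q k1 = 0" if "p \<le> m" "q \<le> n" "2 * k1 + int p + int q \<notin> ?I" for p q k1
  proof (cases "2 * k1 + int p + int q < - int da")
    case True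
    then show ?thesis using a by (simp add: lowb_def)
  next
    case False
    with that have "2 * (k - k1) + int (m - p) + int (n - q) < - int db" by (auto simp: of_nat_diff)
    then show ?thesis using b unfolding lowb_def by (metis mult_zero_right)
  qed
  have gK: "?g p q k1 = 0" if "p \<le> m" "q \<le> n" "k1 \<notin> ?K" for p q k1
    by (rule g) (use that in auto)
  have "fmult a b k m n = (\<Sum>k1\<in>?K. \<Sum>p\<le>m. \<Sum>q\<le>n. ?g p q k1)"
    unfolding fmult_def
  proof (rule Sum_any.expand_superset)
    show "{k1. (\<Sum>p\<le>m. \<Sum>q\<le>n. ?g p q k1) \<noteq> 0} \<subseteq> ?K"
    proof
      fix k1 assume *: "k1 \<in> {k1. (\<Sum>p\<le>m. \<Sum>q\<le>n. ?g p q k1) \<noteq> 0}"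
      show "k1 \<in> ?K"
      proof (rule ccontr)
        assume "k1 \<notin> ?K"
        then have "(\<Sum>p\<le>m. \<Sum>q\<le>n. ?g p q k1) = 0" by (intro sum.neutral ballI gK) auto
        with * show False by simp
      qed
    qed
  qed simp
  also have "\<dots> = (\<Sum>p\<le>m. \<Sum>q\<le>n. \<Sum>k1\<in>?K. ?g p q k1)"
    by (subst sum.swap, rule sum.cong[OF refl], subst sum.swap, rule refl)
  also have "\<dots> = (\<Sum>p\<le>m. \<Sum>q\<le>n. \<Sum>i\<in>?I. lk a i p q * lk b (?N - i) (m - p) (n - q))"
  proof (rule sum.cong[OF refl], rule sum.cong[OF refl])
    fix p q assume pq: "p \<in> {..m}" "q \<in> {..n}"
    let ?s = "int p + int q"
    have e: "?N - (2 * k1 + ?s) - int (m - p) - int (n - q) = 2 * (k - k1)" for k1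
      using pq by (simp add: of_nat_diff)
    have v: "lk a (2 * k1 + ?s) p q * lk b (?N - (2 * k1 + ?s)) (m - p) (n - q) = ?g p q k1" for k1
      unfolding lk_def e by simp
    show "(\<Sum>k1\<in>?K. ?g p q k1) = (\<Sum>i\<in>?I. lk a i p q * lk b (?N - i) (m - p) (n - q))"
    \<comment> \<open>The degrees reached from k1 all have the parity of p + q; degrees of the other
      parity have zero terms by the definition of \<open>lk\<close>, so they are put among the
      neutral indices.\<close>
    proof (rule sum.reindex_bij_witness_not_neutral[where j="\<lambda>k1. 2 * k1 + ?s" and i="\<lambda>i. (i - ?s) div 2"
          and S'="{k1 \<in> ?K. ?g p q k1 = 0}" and T'="{i \<in> ?I. lk a i p q * lk b (?N - i) (m - p) (n - q) = 0}"])
      fix k1 assume "k1 \<in> ?K - {k1 \<in> ?K. ?g p q k1 = 0}"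
      then have nz: "?g p q k1 \<noteq> 0" by simp
      then have I: "2 * k1 + ?s \<in> ?I" using g[of p q k1] pq by force
      show "(2 * k1 + ?s - ?s) div 2 = k1" by simp
      show "2 * k1 + ?s \<in> ?I - {i \<in> ?I. lk a i p q * lk b (?N - i) (m - p) (n - q) = 0}"
        unfolding Diff_iff mem_Collect_eq v using I nz by blast
    next
      show "lk a (2 * k1 + ?s) p q * lk b (?N - (2 * k1 + ?s)) (m - p) (n - q) = ?g p q k1" for k1 by (rule v)
    next
      fix i assume "i \<in> ?I - {i \<in> ?I. lk a i p q * lk b (?N - i) (m - p) (n - q) = 0}"
      then have nz: "lk a i p q * lk b (?N - i) (m - p) (n - q) \<noteq> 0"
        unfolding Diff_iff mem_Collect_eq by fast
      have ev: "even (i - ?s)"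
      proof (rule ccontr)
        assume "odd (i - ?s)"
        then have "lk a i p q = 0" unfolding lk_def diff_diff_eq by (rule if_not_P)
        with nz show False by simp
      qed
      then show ii: "2 * ((i - ?s) div 2) + ?s = i" by simp
      have "lk a i p q * lk b (?N - i) (m - p) (n - q) = ?g p q ((i - ?s) div 2)"
        using v[of "(i - ?s) div 2"] unfolding ii .
      with nz have nz': "?g p q ((i - ?s) div 2) \<noteq> 0" by (simp only: not_False_eq_True)
      moreover have "(i - ?s) div 2 \<in> ?K"
      proof (rule ccontr)
        assume "(i - ?s) div 2 \<notin> ?K"
        from gK[OF pq[unfolded atMost_iff] this] nz' show False by contradiction
      qed
      ultimately show "(i - ?s) div 2 \<in> ?K - {k1 \<in> ?K. ?g p q k1 = 0}"
        unfolding Diff_iff mem_Collect_eq by blast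
    next
      show "finite {k1 \<in> ?K. ?g p q k1 = 0}"
        by (rule finite_subset[OF _ finite_atLeastAtMost_int]) (rule Collect_restrict)
      show "finite {i \<in> ?I. lk a i p q * lk b (?N - i) (m - p) (n - q) = 0}"
        by (rule finite_subset[OF _ finite_atLeastAtMost_int]) (rule Collect_restrict)
    next
      show "?g p q k1 = 0" if "k1 \<in> {k1 \<in> ?K. ?g p q k1 = 0}" for k1
        using that unfolding mem_Collect_eq by (rule conjunct2)
      show "lk a i p q * lk b (?N - i) (m - p) (n - q) = 0"
        if "i \<in> {i \<in> ?I. lk a i p q * lk b (?N - i) (m - p) (n - q) = 0}" for i
        using that unfolding mem_Collect_eq by (rule conjunct2)
    qed
  qed
  also have "\<dots> = (\<Sum>i\<in>?I. cau (lk a i) (lk b (?N - i)) m n)"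
    unfolding cau_def by (subst (2) sum.swap, subst sum.swap, rule refl)
  finally show ?thesis .
qed

text \<open>Pascal's rule, used to turn the binomial expansion of the Poisson power into the
  recursion shared with \<open>moT\<close>.\<close>

lemma pascal_sum:
  fixes G :: "nat \<Rightarrow> nat \<Rightarrow> 'z::cvector"
  shows "(\<Sum>j\<le>Suc r. ((- 1) ^ j * of_nat (Suc r choose j)) *\<^sub>C G (Suc r - j) j)
    = (\<Sum>j\<le>r. ((- 1) ^ j * of_nat (r choose j)) *\<^sub>C G (Suc (r - j)) j)
    - (\<Sum>j\<le>r. ((- 1) ^ j * of_nat (r choose j)) *\<^sub>C G (r - j) (Suc j))"
proof -
  let ?c = "\<lambda>j. (- 1) ^ j * of_nat (r choose j) :: complex"
  have "(\<Sum>j\<le>Suc r. ((- 1) ^ j * of_nat (Suc r choose j)) *\<^sub>C G (Suc r - j) j)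
    = G (Suc r) 0 + (\<Sum>j\<le>r. ((- 1) ^ Suc j * of_nat (Suc r choose Suc j)) *\<^sub>C G (r - j) (Suc j))"
    by (subst sum.atMost_Suc_shift) (simp add: scaleC_one)
  also have "(\<Sum>j\<le>r. ((- 1) ^ Suc j * of_nat (Suc r choose Suc j)) *\<^sub>C G (r - j) (Suc j))
    = (\<Sum>j\<le>r. ?c (Suc j) *\<^sub>C G (r - j) (Suc j)) - (\<Sum>j\<le>r. ?c j *\<^sub>C G (r - j) (Suc j))"
  proof -
    have "(- 1) ^ Suc j * of_nat (Suc r choose Suc j) = ?c (Suc j) - ?c j" for j
      by (simp add: algebra_simps)
    then show ?thesis by (simp only: cvec.scale_left_diff_distrib sum_subtractf)
  qed
  also have "G (Suc r) 0 + ((\<Sum>j\<le>r. ?c (Suc j) *\<^sub>C G (r - j) (Suc j)) - (\<Sum>j\<le>r. ?c j *\<^sub>C G (r - j) (Suc j)))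
    = (\<Sum>j\<le>Suc r. ?c j *\<^sub>C G (Suc r - j) j) - (\<Sum>j\<le>r. ?c j *\<^sub>C G (r - j) (Suc j))"
  proof -
    have "(\<Sum>j\<le>Suc r. ?c j *\<^sub>C G (Suc r - j) j) = G (Suc r) 0 + (\<Sum>j\<le>r. ?c (Suc j) *\<^sub>C G (r - j) (Suc j))"
      by (subst sum.atMost_Suc_shift) (simp add: scaleC_one)
    then show ?thesis by (simp del: sum.atMost_Suc)
  qed
  also have "(\<Sum>j\<le>Suc r. ?c j *\<^sub>C G (Suc r - j) j) = (\<Sum>j\<le>r. ?c j *\<^sub>C G (Suc (r - j)) j)"
    by (simp add: Suc_diff_le cvec.scale_zero_left)
  finally show ?thesis .
qed

lemma fdu_fdv: "fdu (fdv a) = fdv (fdu a)"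
  by (intro ext) (simp add: fdu_def fdv_def)

lemma fd_pow: "(fdv ^^ i) (fdu a) = fdu ((fdv ^^ i) a)" "(fdu ^^ i) (fdv a) = fdv ((fdu ^^ i) a)"
  by (induction i) (simp_all add: fdu_fdv)

lemma poisson_Suc: "poisson_power (Suc r) a b = poisson_power r (fdu a) (fdv b) - poisson_power r (fdv a) (fdu b)"
proof -
  have 1: "(fdu ^^ (r - j)) ((fdv ^^ j) (fdu a)) = (fdu ^^ (Suc (r - j))) ((fdv ^^ j) a)"
    "(fdv ^^ (r - j)) ((fdu ^^ j) (fdv b)) = (fdv ^^ (Suc (r - j))) ((fdu ^^ j) b)"
    "(fdu ^^ (r - j)) ((fdv ^^ j) (fdv a)) = (fdu ^^ (r - j)) ((fdv ^^ Suc j) a)"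
    "(fdv ^^ (r - j)) ((fdu ^^ j) (fdu b)) = (fdv ^^ (r - j)) ((fdu ^^ Suc j) b)" for j
    by (simp_all add: fd_pow funpow_swap1)
  show ?thesis
    unfolding poisson_power_def 1
    by (rule pascal_sum[of r "\<lambda>i j. fmult ((fdu ^^ i) ((fdv ^^ j) a)) ((fdv ^^ i) ((fdu ^^ j) b))"])
qed

lemma poisson_lk:
  assumes "lowb da a" "lowb db b"
  shows "poisson_power r a b k m n = (\<Sum>i\<in>{- int da - int r..2 * k + int m + int n + int db + int r}.
    moT r (lk a (i + int r)) (lk b (2 * k + int m + int n - i + int r)) m n)"
  using assms
proof (induction r arbitrary: a b da db)
  case 0
  then show ?case by (simp add: poisson_power_def fmult_lk scaleC_one)
next
  case (Suc r)
  let ?N = "2 * k + int m + int n"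
  have e: "{- int (Suc da) - int r..?N + int (Suc db) + int r} = {- int da - int (Suc r)..?N + int db + int (Suc r)}"
    "i + int r + 1 = i + int (Suc r)" "?N - i + int r + 1 = ?N - i + int (Suc r)" for i
    by auto
  show ?case
    unfolding poisson_Suc fun_diff_def Suc.IH[OF lowb_fdu[OF Suc.prems(1)] lowb_fdv[OF Suc.prems(2)]]
      Suc.IH[OF lowb_fdv[OF Suc.prems(1)] lowb_fdu[OF Suc.prems(2)]] lk_fdu lk_fdv e
    by (simp add: sum_subtractf fun_diff_def)
qed

text \<open>The r-th Poisson power lowers the fibre degree by 2r and is accompanied by hbar^r of
  degree 2r. So the Moyal product preserves total degree, and its component is a finite sum over
  splittings of the degree.\<close>

lemma moyal_lk:
  assumes "lowb 0 a" "lowb 0 b"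
  shows "moyal a b k m n = Sum_any (\<lambda>r. \<Sum>i\<in>{0..2 * k + int m + int n}. mc r * moT r (lk a i) (lk b (2 * k + int m + int n - i)) m n)"
proof -
  let ?N = "2 * k + int m + int n"
  have "poisson_power r a b (k - int r) m n = (\<Sum>i\<in>{0..?N}. moT r (lk a i) (lk b (?N - i)) m n)" for r
    unfolding poisson_lk[OF assms]
    by (rule sum.reindex_bij_witness[where i="\<lambda>i. i - int r" and j="\<lambda>i. i + int r"]) (auto simp: algebra_simps)
  then show ?thesis
    unfolding moyal_def mc_def by (simp add: sum_distrib_left)
qed

definition wp :: "fib \<Rightarrow> bool" where
  "wp a \<longleftrightarrow> (\<forall>k m n. 2 * k + int m + int n < 0 \<longrightarrow> a k m n = 0)
     \<and> (\<forall>d. finite {(k, m, n). 2 * k + int m + int n = d \<and> a k m n \<noteq> 0})"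

text \<open>The fibre element as a sequence of polynomials by total degree, expressed in the
  rescaled coordinates yu and v/y. The rescaling is symplectic, so it respects the Moyal product
  (\<open>scl_mo\<close>).\<close>

definition fs :: "complex \<Rightarrow> fib \<Rightarrow> nat \<Rightarrow> complex pol" where
  "fs y a N = Abs_poly_mapping (\<lambda>(m, n). lk a (int N) m n * y ^ n / y ^ m)"

lemma lookup_fs:
  assumes "wp a"
  shows "Poly_Mapping.lookup (fs y a N) (m, n) = lk a (int N) m n * y ^ n / y ^ m"
proof -
  have "finite ((\<lambda>(k, m, n). (m, n)) ` {(k, m, n). 2 * k + int m + int n = int N \<and> a k m n \<noteq> 0})"
    using assms by (simp add: wp_def)
  then have "finite {x. (case x of (m, n) \<Rightarrow> lk a (int N) m n * y ^ n / y ^ m) \<noteq> 0}"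
  proof (rule finite_subset[rotated], intro subsetI)
    fix x assume "x \<in> {x. (case x of (m, n) \<Rightarrow> lk a (int N) m n * y ^ n / y ^ m) \<noteq> 0}"
    then obtain m n where x: "x = (m, n)" and "lk a (int N) m n \<noteq> 0" by (cases x) auto
    then have "even (int N - int m - int n)" "a ((int N - int m - int n) div 2) m n \<noteq> 0"
      by (auto simp: lk_def split: if_splits)
    then show "x \<in> (\<lambda>(k, m, n). (m, n)) ` {(k, m, n). 2 * k + int m + int n = int N \<and> a k m n \<noteq> 0}"
      using x by (intro image_eqI[of _ _ "((int N - int m - int n) div 2, m, n)"]) auto
  qed
  then show ?thesis by (simp add: fs_def)
qed

lemma LK_fs1: "wp a \<Longrightarrow> LK (fs 1 a N) = lk a (int N)"
  by (intro ext) (simp add: lookup_fs)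

lemma moyal_conv1:
  assumes "wp a" "wp b" "2 * k + int m + int n = int N"
  shows "moyal a b k m n = LK (conv mo (fs 1 a) (fs 1 b) N) m n"
proof -
  have low: "lowb 0 a" "lowb 0 b" using assms by (auto simp: lowb_def wp_def)
  have "\<forall>i. \<exists>R. mo_rep (fs 1 a i) R" using mo_rep_exists by blast
  then obtain R where R: "\<And>i. mo_rep (fs 1 a i) (R i)" unfolding choice_iff by blast
  \<comment> \<open>A bound valid for the finitely many components of degree at most N allows the
    two summations to be exchanged.\<close>
  define RR where "RR = Max (R ` {..N})"
  have RR: "mo_rep (fs 1 a i) RR" if "i \<le> N" for i
    by (rule mo_rep_mono[OF R]) (use that in \<open>simp add: RR_def\<close>)
  have z: "moT r (lk a (int i)) B = 0" if "i \<le> N" "r \<ge> RR" for i r B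
    using RR[OF that(1)] that(2) unfolding mo_rep_def LK_fs1[OF assms(1)] by blast
  have "moyal a b k m n = Sum_any (\<lambda>r. \<Sum>i\<le>N. mc r * moT r (lk a (int i)) (lk b (int (N - i))) m n)"
    unfolding moyal_lk[OF low] assms(3)
    by (rule arg_cong[where f=Sum_any], rule ext,
        rule sum.reindex_bij_witness[where i=int and j=nat]) (auto simp: of_nat_diff)
  also have "\<dots> = (\<Sum>r<RR. \<Sum>i\<le>N. mc r * moT r (lk a (int i)) (lk b (int (N - i))) m n)"
  proof (rule Sum_any.expand_superset)
    show "{r. (\<Sum>i\<le>N. mc r * moT r (lk a (int i)) (lk b (int (N - i))) m n) \<noteq> 0} \<subseteq> {..<RR}"
    proof (rule subsetI, rule ccontr)
      fix r assume 1: "r \<in> {r. (\<Sum>i\<le>N. mc r * moT r (lk a (int i)) (lk b (int (N - i))) m n) \<noteq> 0}" and "r \<notin> {..<RR}"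
      then have "(\<Sum>i\<le>N. mc r * moT r (lk a (int i)) (lk b (int (N - i))) m n) = 0"
        by (intro sum.neutral ballI) (simp add: z)
      with 1 show False by simp
    qed
  qed simp
  also have "\<dots> = (\<Sum>i\<le>N. \<Sum>r<RR. mc r * moT r (lk a (int i)) (lk b (int (N - i))) m n)"
    by (rule sum.swap)
  also have "\<dots> = (\<Sum>i\<le>N. LK (mo (fs 1 a i) (fs 1 b (N - i))) m n)"
    using RR by (intro sum.cong refl) (simp add: mo_rep_def LK_fs1 assms)
  finally show ?thesis by (simp add: conv_def lookup_sum)
qed

lemma moyal_neg:
  assumes "wp a" "wp b" "2 * k + int m + int n < 0"
  shows "moyal a b k m n = 0"
proof -
  have low: "lowb 0 a" "lowb 0 b" using assms by (auto simp: lowb_def wp_def)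
  show ?thesis unfolding moyal_lk[OF low] using assms(3) by simp
qed

lemma wp_moyal:
  assumes "wp a" "wp b"
  shows "wp (moyal a b)"
  unfolding wp_def
proof (intro conjI allI impI)
  fix d :: int
  show "finite {(k, m, n). 2 * k + int m + int n = d \<and> moyal a b k m n \<noteq> 0}"
  proof (cases "d < 0")
    case True
    then have "{(k, m, n). 2 * k + int m + int n = d \<and> moyal a b k m n \<noteq> 0} = {}"
      using moyal_neg[OF assms] by auto
    then show ?thesis by (metis finite.emptyI)
  next
    case False
    then obtain N where N: "d = int N" by (metis int_nat_eq linorder_not_less nat_eq_iff)
    let ?K = "Poly_Mapping.keys (conv mo (fs 1 a) (fs 1 b) N)"
    have "{(k, m, n). 2 * k + int m + int n = d \<and> moyal a b k m n \<noteq> 0} \<subseteq> (\<lambda>(m, n). ((d - int m - int n) div 2, m, n)) ` ?K"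
    proof (clarsimp, goal_cases)
      case (1 k m n)
      then have "(m, n) \<in> ?K" using moyal_conv1[OF assms, of k m n N] N by (auto simp: in_keys_iff)
      moreover have "k = (d - int m - int n) div 2" using 1 by auto
      ultimately show ?case using 1 by force
    qed
    then show ?thesis by (rule finite_subset) simp
  qed
qed (rule moyal_neg[OF assms])

definition scl :: "complex \<Rightarrow> complex pol \<Rightarrow> complex pol" where
  "scl y p = Abs_poly_mapping (\<lambda>(m, n). Poly_Mapping.lookup p (m, n) * y ^ n / y ^ m)"

lemma lookup_scl: "Poly_Mapping.lookup (scl y p) (m, n) = Poly_Mapping.lookup p (m, n) * y ^ n / y ^ m"
proof -
  have "finite {x. (case x of (m, n) \<Rightarrow> Poly_Mapping.lookup p (m, n) * y ^ n / y ^ m) \<noteq> 0}"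
    by (rule finite_subset[of _ "Poly_Mapping.keys p"]) (auto simp: in_keys_iff)
  then show ?thesis by (simp add: scl_def)
qed

lemma clinear_scl: "clinear (scl y)"
  by (rule clinearI; rule poly_mapping_eqI; clarify;
      simp add: lookup_scl lookup_add scaleC_complex_def algebra_simps add_divide_distrib)

lemma scl_ops:
  assumes "y \<noteq> 0"
  shows "scl y (Ru p) = (1 / y) *\<^sub>C Ru (scl y p)" "scl y (Rv p) = y *\<^sub>C Rv (scl y p)"
  using assms
  by (rule_tac [!] poly_mapping_eqI; clarify;
      simp add: Ru_def Rv_def lookup_scl lookup_add lookup_minus scaleC_complex_def field_simps split: nat.split)+

lemma scl_mo:
  assumes y: "y \<noteq> 0"
  shows "scl y (mo p q) = mo (scl y p) (scl y q)"
proof (induction q rule: Ru_Rv_induct)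
  case (cst c)
  have "scl y (cst c) = cst c"
    by (rule poly_mapping_eqI) (auto simp: lookup_scl lookup_single when_def split: if_splits)
  then show ?case
    by (auto intro!: poly_mapping_eqI simp: moy_cst_right[OF mo_bil] clinear_rmult lookup_scl)
qed (simp_all add: moy_R[OF mo_bil] scl_ops y moy_lin_right[OF mo_bil] clinear_add[OF clinear_scl] clinear_scale[OF clinear_scl])

lemma fs_scl: "wp a \<Longrightarrow> fs y a N = scl y (fs 1 a N)"
  by (rule poly_mapping_eqI) (auto simp: lookup_scl lookup_fs)

text \<open>Entries with an integral exponent of hbar are compared by \<open>moyal_conv1\<close>;
  the remaining entries vanish on both sides by parity.\<close>

lemma fs_moyal:
  assumes "wp a" "wp b" "y \<noteq> 0"
  shows "fs y (moyal a b) = conv mo (fs y a) (fs y b)"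
proof
  fix N
  have e: "conv mo (fs y a) (fs y b) N = scl y (conv mo (fs 1 a) (fs 1 b) N)"
    by (simp add: conv_def fs_scl[OF assms(1), of y] fs_scl[OF assms(2), of y] scl_mo[OF assms(3)] clinear_sum[OF clinear_scl])
  show "fs y (moyal a b) N = conv mo (fs y a) (fs y b) N"
    unfolding e fs_scl[OF wp_moyal[OF assms(1,2)], of y]
  proof (rule arg_cong[where f="scl y"], rule poly_mapping_eqI, clarify)
    fix m n
    show "LK (fs 1 (moyal a b) N) m n = LK (conv mo (fs 1 a) (fs 1 b) N) m n"
    proof (cases "even (int N - int m - int n)")
      case True
      then show ?thesis
        using moyal_conv1[OF assms(1,2), of "(int N - int m - int n) div 2" m n N]
        by (simp add: lookup_fs wp_moyal assms lk_def)
    next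
      case False
      then have o: "odd (N + fst (m, n) + snd (m, n))"
        by (metis (no_types, opaque_lifting) diff_diff_eq even_add even_diff even_of_nat fst_conv of_nat_add snd_conv)
      have "par (fs 1 c)" if "wp c" for c
        unfolding par_def
      proof (intro allI poly_mapping_eqI, clarify)
        fix N m n
        have "even (int N - int m - int n) \<Longrightarrow> (- 1 :: complex) ^ (m + n) = (- 1) ^ N"
          by (metis (no_types, opaque_lifting) diff_diff_eq even_add even_diff even_of_nat minus_one_power_iff of_nat_add)
        then show "Poly_Mapping.lookup (sg (fs 1 c N)) (m, n) = Poly_Mapping.lookup ((- 1) ^ N *\<^sub>C fs 1 c N) (m, n)"
          by (auto simp: lookup_fs[OF that] lk_def scaleC_complex_def)
      qed
      then have "par (conv mo (fs 1 a) (fs 1 b))"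
        using assms by (intro par_conv[OF cbilinear_moy[OF mo_bil] _ _ sg_moy[OF mo_bil]]) blast+
      from par_lookup[OF this o] False show ?thesis
        by (simp add: lookup_fs wp_moyal assms lk_def)
    qed
  qed
qed

lemma fs_inject:
  assumes "wp a" "wp b" "y \<noteq> 0" "fs y a = fs y b"
  shows "a = b"
proof (intro ext)
  fix k m n
  show "a k m n = b k m n"
  proof (cases "2 * k + int m + int n < 0")
    case True
    then show ?thesis using assms by (simp add: wp_def)
  next
    case False
    define N where "N = nat (2 * k + int m + int n)"
    have "int N - int m - int n = 2 * k" using False by (simp add: N_def)
    then have "lk c (int N) m n = c k m n" for c by (simp add: lk_def)
    moreover have "Poly_Mapping.lookup (fs y a N) (m, n) = Poly_Mapping.lookup (fs y b N) (m, n)" by (simp only: assms(4))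
    ultimately show ?thesis
      unfolding lookup_fs[OF assms(1)] lookup_fs[OF assms(2)] using assms(3) by simp
  qed
qed

section \<open>Calculus of smooth functions on open sets\<close>

definition pd :: "'a::real_normed_vector \<Rightarrow> ('a \<Rightarrow> 'b::real_normed_vector) \<Rightarrow> 'a \<Rightarrow> 'b" where
  "pd v f z = frechet_derivative f (at z) v"

lemma pd_has: "f differentiable (at z) \<Longrightarrow> (f has_derivative (\<lambda>v. pd v f z)) (at z)"
  unfolding pd_def using frechet_derivative_works by blast

lemma pd_eqI: "(f has_derivative f') (at z) \<Longrightarrow> pd v f z = f' v"
  unfolding pd_def using frechet_derivative_at by metis

lemma ck_on_Suc: "ck_on (Suc n) S f \<longleftrightarrow> (\<forall>z\<in>S. f differentiable (at z)) \<and> (\<forall>v. ck_on n S (pd v f))"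
  by (simp add: pd_def[abs_def])

lemma ck_on_0: "ck_on 0 S f \<longleftrightarrow> continuous_on S f" by simp

declare ck_on.simps [simp del]

lemma diff_cong_open:
  assumes "open S" "z \<in> S" "\<And>z. z \<in> S \<Longrightarrow> f z = g z" "f differentiable (at z)"
  shows "g differentiable (at z)" "pd v g z = pd v f z"
proof -
  have "(g has_derivative (\<lambda>v. pd v f z)) (at z)"
    using has_derivative_transform_within_open[OF pd_has[OF assms(4)] assms(1,2)] assms(3) by metis
  then show "g differentiable (at z)" "pd v g z = pd v f z"
    by (auto simp: differentiable_def intro: pd_eqI)
qed

lemma ck_on_cong:
  assumes "open S" "\<And>z. z \<in> S \<Longrightarrow> f z = g z" "ck_on n S f"
  shows "ck_on n S g"
  using assms(2,3)
proof (induction n arbitrary: f g)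
  case 0
  then show ?case using continuous_on_cong[of S S f g] by (simp add: ck_on_0)
next
  case (Suc n)
  note d = diff_cong_open[OF assms(1), of _ f g, OF _ Suc.prems(1)]
  have dz: "\<forall>z\<in>S. f differentiable (at z)" using Suc.prems by (simp add: ck_on_Suc)
  have "ck_on n S (pd v g)" for v
    by (rule Suc.IH[of "pd v f"]) (use Suc.prems dz d(2) in \<open>auto simp: ck_on_Suc\<close>)
  then show ?case using d(1) dz by (auto simp: ck_on_Suc)
qed

lemma ck_on_Suc_imp: "ck_on (Suc n) S f \<Longrightarrow> ck_on n S f"
proof (induction n arbitrary: f)
  case 0
  then show ?case
    by (auto simp: ck_on_0 ck_on_Suc intro!: continuous_at_imp_continuous_on differentiable_imp_continuous_within)
next
  case (Suc n)
  then show ?case by (metis ck_on_Suc)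
qed

lemma ck_on_subset: "ck_on n S f \<Longrightarrow> T \<subseteq> S \<Longrightarrow> ck_on n T f"
  by (induction n arbitrary: f) (auto simp: ck_on_0 ck_on_Suc intro: continuous_on_subset)

lemma ck_const: "ck_on n S (\<lambda>_. c)"
proof (induction n arbitrary: c)
  case (Suc n)
  have "pd v (\<lambda>_. c) = (\<lambda>_. 0)" for v :: 'a
    by (rule ext, rule pd_eqI[where f'="\<lambda>_. 0", THEN trans]) (auto intro: derivative_eq_intros)
  then show ?case using Suc by (simp add: ck_on_Suc)
qed (simp add: ck_on_0)

lemma ck_linear:
  assumes L: "bounded_linear L" and "open S" "ck_on n S f"
  shows "ck_on n S (\<lambda>z. L (f z))"
  using assms(3)
proof (induction n arbitrary: f)
  case 0
  then show ?case by (auto simp: ck_on_0 intro: bounded_linear.continuous_on[OF L])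
next
  case (Suc n)
  have d: "((\<lambda>z. L (f z)) has_derivative (\<lambda>v. L (pd v f z))) (at z)" if "z \<in> S" for z
    using bounded_linear.has_derivative[OF L pd_has] Suc.prems that by (auto simp: ck_on_Suc)
  have "ck_on n S (pd v (\<lambda>z. L (f z)))" for v
    by (rule ck_on_cong[OF assms(2), of "\<lambda>z. L (pd v f z)"])
      (use Suc in \<open>auto simp: ck_on_Suc pd_eqI[OF d]\<close>)
  then show ?case using d by (auto simp: ck_on_Suc differentiable_def)
qed

lemma ck_add:
  assumes "open S" "ck_on n S f" "ck_on n S g"
  shows "ck_on n S (\<lambda>z. f z + g z)"
  using assms(2,3)
proof (induction n arbitrary: f g)
  case 0
  then show ?case by (auto simp: ck_on_0 intro: continuous_intros)
next
  case (Suc n)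
  have d: "((\<lambda>z. f z + g z) has_derivative (\<lambda>v. pd v f z + pd v g z)) (at z)" if "z \<in> S" for z
    using Suc.prems that by (intro has_derivative_add pd_has) (auto simp: ck_on_Suc)
  have "ck_on n S (pd v (\<lambda>z. f z + g z))" for v
    by (rule ck_on_cong[OF assms(1), of "\<lambda>z. pd v f z + pd v g z"])
      (use Suc in \<open>auto simp: ck_on_Suc pd_eqI[OF d]\<close>)
  then show ?case using d by (auto simp: ck_on_Suc differentiable_def)
qed

lemma ck_bilinear:
  assumes B: "bounded_bilinear B" and "open S" "ck_on n S f" "ck_on n S g"
  shows "ck_on n S (\<lambda>z. B (f z) (g z))"
  using assms(3,4)
proof (induction n arbitrary: f g)
  case 0
  then show ?case by (auto simp: ck_on_0 intro: bounded_bilinear.continuous_on[OF B])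
next
  case (Suc n)
  have d: "((\<lambda>z. B (f z) (g z)) has_derivative (\<lambda>v. B (f z) (pd v g z) + B (pd v f z) (g z))) (at z)" if "z \<in> S" for z
    using Suc.prems that by (intro bounded_bilinear.FDERIV[OF B] pd_has) (auto simp: ck_on_Suc)
  have "ck_on n S (\<lambda>z. B (f z) (pd v g z) + B (pd v f z) (g z))" for v
    using Suc.prems by (intro ck_add assms(2) Suc.IH) (auto simp: ck_on_Suc intro: ck_on_Suc_imp[unfolded ck_on_Suc])
  then have "ck_on n S (pd v (\<lambda>z. B (f z) (g z)))" for v
    by (rule ck_on_cong[OF assms(2), rotated]) (auto simp: pd_eqI[OF d])
  then show ?case using d by (auto simp: ck_on_Suc differentiable_def)
qed

lemma ck_sum:
  assumes "open S" "\<And>i. i \<in> A \<Longrightarrow> ck_on n S (f i)"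
  shows "ck_on n S (\<lambda>z. \<Sum>i\<in>A. f i z)"
  using assms(2) by (induction A rule: infinite_finite_induct) (auto intro: ck_add ck_const assms(1))

lemma ck_comp:
  fixes \<phi> :: "'a::real_normed_vector \<Rightarrow> 'b::euclidean_space"
  assumes "open S" "open T" "ck_on n S \<phi>" "ck_on n T f" "\<phi> ` S \<subseteq> T"
  shows "ck_on n S (\<lambda>z. f (\<phi> z))"
  using assms(3,4)
proof (induction n arbitrary: f)
  case 0
  then show ?case using continuous_on_compose2[of T f S \<phi>] assms(5) by (auto simp: ck_on_0)
next
  case (Suc n)
  have fd: "f differentiable (at (\<phi> z))" if "z \<in> S" for z
    using Suc.prems(2) that assms(5) by (auto simp: ck_on_Suc)
  have d: "((\<lambda>z. f (\<phi> z)) has_derivative (\<lambda>v. pd (pd v \<phi> z) f (\<phi> z))) (at z)" if "z \<in> S" for z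
    using diff_chain_at[of \<phi> "\<lambda>v. pd v \<phi> z" z f "\<lambda>w. pd w f (\<phi> z)", OF pd_has pd_has[OF fd[OF that]]] Suc.prems(1) that
    by (simp add: ck_on_Suc o_def)
  \<comment> \<open>The chain rule differentiates f in the direction \<open>pd v \<phi> z\<close>,
    which varies with z, while smoothness of f speaks of fixed directions; expansion in the basis
    separates the two.\<close>
  have e: "pd w f (\<phi> z) = (\<Sum>b\<in>Basis. (w \<bullet> b) *\<^sub>R pd b f (\<phi> z))" if "z \<in> S" for w z
  proof -
    interpret bounded_linear "\<lambda>w. pd w f (\<phi> z)"
      using pd_has[OF fd[OF that]] by (rule has_derivative_bounded_linear)
    show ?thesis
      by (subst euclidean_representation[of w, symmetric]) (simp only: sum scaleR)
  qed
  have "ck_on n S (\<lambda>z. \<Sum>b\<in>Basis. (pd v \<phi> z \<bullet> b) *\<^sub>R pd b f (\<phi> z))" for v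
    using Suc.prems
    by (intro ck_sum assms(1) ck_bilinear[OF bounded_bilinear_scaleR] Suc.IH ck_linear[OF bounded_linear_inner_left])
      (auto simp: ck_on_Suc intro: ck_on_Suc_imp[unfolded ck_on_Suc])
  then have "ck_on n S (pd v (\<lambda>z. f (\<phi> z)))" for v
    by (rule ck_on_cong[OF assms(1), rotated]) (simp add: pd_eqI[OF d] e)
  then show ?case using d by (auto simp: ck_on_Suc differentiable_def)
qed

lemma smooth_const: "smooth_on S (\<lambda>_. c)"
  and smooth_cong: "open S \<Longrightarrow> (\<And>z. z \<in> S \<Longrightarrow> f z = g z) \<Longrightarrow> smooth_on S f \<Longrightarrow> smooth_on S g"
  and smooth_subset: "smooth_on S f \<Longrightarrow> T \<subseteq> S \<Longrightarrow> smooth_on T f"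
  and smooth_add: "open S \<Longrightarrow> smooth_on S f \<Longrightarrow> smooth_on S h \<Longrightarrow> smooth_on S (\<lambda>z. f z + h z)"
  and smooth_linear: "bounded_linear L \<Longrightarrow> open S \<Longrightarrow> smooth_on S f \<Longrightarrow> smooth_on S (\<lambda>z. L (f z))"
  and smooth_sum: "open S \<Longrightarrow> (\<And>i. i \<in> A \<Longrightarrow> smooth_on S (k i)) \<Longrightarrow> smooth_on S (\<lambda>z. \<Sum>i\<in>A. k i z)"
  unfolding smooth_on_def by (blast intro: ck_const ck_on_cong ck_on_subset ck_add ck_linear ck_sum)+

lemma smooth_bilinear: "bounded_bilinear B \<Longrightarrow> open S \<Longrightarrow> smooth_on S f \<Longrightarrow> smooth_on S g \<Longrightarrow> smooth_on S (\<lambda>z. B (f z) (g z))"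
  unfolding smooth_on_def by (blast intro: ck_bilinear)

lemmas smooth_mult = smooth_bilinear[OF bounded_bilinear_mult]
lemmas smooth_of_real = smooth_linear[OF bounded_linear_of_real]

lemma smooth_comp:
  fixes \<phi> :: "'a::real_normed_vector \<Rightarrow> 'b::euclidean_space"
  shows "open S \<Longrightarrow> open T \<Longrightarrow> smooth_on S \<phi> \<Longrightarrow> smooth_on T f \<Longrightarrow> \<phi> ` S \<subseteq> T \<Longrightarrow> smooth_on S (\<lambda>z. f (\<phi> z))"
  unfolding smooth_on_def by (blast intro: ck_comp)

lemma smooth_diffable: "smooth_on S f \<Longrightarrow> z \<in> S \<Longrightarrow> f differentiable (at z)"
  and smooth_pd: "smooth_on S f \<Longrightarrow> smooth_on S (pd v f)"
  unfolding smooth_on_def using ck_on_Suc by blast+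

lemma smooth_ident: "smooth_on S (\<lambda>z. z)"
proof -
  have "pd v (\<lambda>z. z) = (\<lambda>_. v)" for v :: 'a
    by (rule ext, rule pd_eqI[where f'="\<lambda>v. v", THEN trans]) (auto intro: derivative_eq_intros)
  then have "ck_on n S (\<lambda>z. z)" for n
    by (cases n) (simp_all add: ck_on_0 ck_on_Suc ck_const)
  then show ?thesis by (simp add: smooth_on_def)
qed

lemma ck_inverse: "ck_on n (- {0}) (inverse :: real \<Rightarrow> real)"
proof (induction n)
  case 0
  show ?case by (auto simp: ck_on_0 intro!: continuous_intros)
next
  case (Suc n)
  have d: "(inverse has_derivative (\<lambda>v. - (inverse x * v * inverse x))) (at x)" if "x \<in> - {0}" for x :: real
    using that by (intro has_derivative_inverse') auto
  have "ck_on n (- {0}) (\<lambda>x :: real. (- v) *\<^sub>R (inverse x * inverse x))" for v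
    by (intro ck_linear[OF bounded_linear_scaleR_right] ck_bilinear[OF bounded_bilinear_mult] Suc) auto
  then have "ck_on n (- {0}) (pd v inverse)" for v :: real
    by (rule ck_on_cong[rotated 2]) (auto simp: pd_eqI[OF d])
  then show ?case using d by (auto simp: ck_on_Suc differentiable_def)
qed

lemma smooth_inverse:
  fixes f :: "'a::real_normed_vector \<Rightarrow> real"
  assumes "open S" "smooth_on S f" "\<And>z. z \<in> S \<Longrightarrow> f z \<noteq> 0"
  shows "smooth_on S (\<lambda>z. inverse (f z))"
  by (rule smooth_comp[OF assms(1) _ assms(2), of "- {0}"]) (use assms(3) ck_inverse in \<open>auto simp: smooth_on_def\<close>)

lemma smooth_divide:
  fixes f g :: "'a::real_normed_vector \<Rightarrow> real"
  assumes "open S" "smooth_on S f" "smooth_on S g" "\<And>z. z \<in> S \<Longrightarrow> g z \<noteq> 0"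
  shows "smooth_on S (\<lambda>z. f z / g z)"
  unfolding divide_inverse by (intro smooth_mult smooth_inverse assms)

lemma smooth_power:
  fixes f :: "'a::real_normed_vector \<Rightarrow> 'b::{real_normed_algebra_1}"
  assumes "open S" "smooth_on S f"
  shows "smooth_on S (\<lambda>z. f z ^ n)"
  by (induction n) (simp_all add: smooth_const smooth_mult assms)

lemma smooth_fst: "smooth_on S fst" and smooth_snd: "smooth_on S snd"
  for S :: "('a::real_normed_vector \<times> 'b::real_normed_vector) set"
proof -
  have "smooth_on UNIV (\<lambda>z :: 'a \<times> 'b. fst z)" "smooth_on UNIV (\<lambda>z :: 'a \<times> 'b. snd z)"
    by (rule smooth_linear[OF bounded_linear_fst] smooth_linear[OF bounded_linear_snd]; simp add: smooth_ident)+
  then show "smooth_on S fst" "smooth_on S snd" by (simp_all only: smooth_subset[OF _ subset_UNIV])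
qed

lemma smooth_Pair:
  assumes "open S" "smooth_on S f" "smooth_on S g"
  shows "smooth_on S (\<lambda>z. (f z, g z))"
proof -
  have "smooth_on S (\<lambda>z. (f z, 0) + (0, g z))"
    by (intro smooth_add assms smooth_linear[of "\<lambda>x. (x, 0)"] smooth_linear[of "\<lambda>x. (0, x)"]
       bounded_linear_Pair bounded_linear_ident bounded_linear_zero)
  then show ?thesis by simp
qed

lemma smooth_deriv:
  fixes f :: "real \<Rightarrow> real"
  assumes "open S" "smooth_on S f"
  shows "smooth_on S (deriv f)" "\<And>x. x \<in> S \<Longrightarrow> (f has_real_derivative deriv f x) (at x)"
    "\<And>x. x \<in> S \<Longrightarrow> pd 1 f x = deriv f x"
proof -
  show d: "(f has_real_derivative deriv f x) (at x)" if "x \<in> S" for x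
    using smooth_diffable[OF assms(2) that] by (simp add: DERIV_deriv_iff_real_differentiable)
  show e: "pd 1 f x = deriv f x" if "x \<in> S" for x
    using pd_eqI[OF d[OF that, unfolded has_field_derivative_def], of 1] by simp
  show "smooth_on S (deriv f)"
    by (rule smooth_cong[OF assms(1) _ smooth_pd[OF assms(2), of 1]]) (rule e)
qed

section \<open>Partial derivatives on the plane\<close>

lemma pd_linear_comb:
  assumes "f differentiable (at z)"
  shows "pd (a *\<^sub>R v + b *\<^sub>R w) f z = a *\<^sub>R pd v f z + b *\<^sub>R pd w f z"
proof -
  interpret bounded_linear "\<lambda>w. pd w f z"
    using pd_has[OF assms] by (rule has_derivative_bounded_linear)
  show ?thesis by (simp only: add scaleR)
qed

lemma pdx_pd: "f differentiable (at z) \<Longrightarrow> pdx f z = pd (1, 0) f z"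
  and pdy_pd: "f differentiable (at z) \<Longrightarrow> pdy f z = pd (0, 1) f z"
proof -
  assume f: "f differentiable (at z)"
  obtain x y where z: "z = (x, y)" by (cases z)
  interpret bounded_linear "\<lambda>w. pd w f z"
    using pd_has[OF f] by (rule has_derivative_bounded_linear)
  have "((\<lambda>t. (t, y)) has_derivative (\<lambda>h. (h, 0))) (at x)"
    by (intro has_derivative_Pair has_derivative_ident has_derivative_const)
  from diff_chain_at[OF this, OF pd_has[OF f[unfolded z]]]
  have "((\<lambda>t. f (t, y)) has_derivative (\<lambda>h. pd (h, 0) f z)) (at x)" by (simp add: z o_def)
  moreover have "(\<lambda>h. pd (h, 0) f z) = (\<lambda>h. h *\<^sub>R pd (1, 0) f z)"
  proof
    show "pd (h, 0) f z = h *\<^sub>R pd (1, 0) f z" for h using scaleR[of h "(1, 0)"] by simp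
  qed
  ultimately have "((\<lambda>t. f (t, y)) has_vector_derivative pd (1, 0) f z) (at x)"
    by (simp only: has_vector_derivative_def)
  then show "pdx f z = pd (1, 0) f z" by (simp add: pdx_def z vector_derivative_at)
  have "((\<lambda>t. (x, t)) has_derivative (\<lambda>h. (0, h))) (at y)"
    by (intro has_derivative_Pair has_derivative_ident has_derivative_const)
  from diff_chain_at[OF this, OF pd_has[OF f[unfolded z]]]
  have "((\<lambda>t. f (x, t)) has_derivative (\<lambda>h. pd (0, h) f z)) (at y)" by (simp add: z o_def)
  moreover have "(\<lambda>h. pd (0, h) f z) = (\<lambda>h. h *\<^sub>R pd (0, 1) f z)"
  proof
    show "pd (0, h) f z = h *\<^sub>R pd (0, 1) f z" for h using scaleR[of h "(0, 1)"] by simp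
  qed
  ultimately have "((\<lambda>t. f (x, t)) has_vector_derivative pd (0, 1) f z) (at y)"
    by (simp only: has_vector_derivative_def)
  then show "pdy f z = pd (0, 1) f z" by (simp add: pdy_def z vector_derivative_at)
qed

lemma pdxy_vec:
  assumes "f differentiable (at (x, y))"
  shows "((\<lambda>t. f (t, y)) has_vector_derivative pdx f (x, y)) (at x)"
    "((\<lambda>t. f (x, t)) has_vector_derivative pdy f (x, y)) (at y)"
proof -
  interpret bounded_linear "\<lambda>w. pd w f (x, y)"
    using pd_has[OF assms] by (rule has_derivative_bounded_linear)
  have "((\<lambda>t. (t, y)) has_derivative (\<lambda>h. (h, 0))) (at x)"
    by (intro has_derivative_Pair has_derivative_ident has_derivative_const)
  from diff_chain_at[OF this, OF pd_has[OF assms]]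
  have "(\<lambda>t. f (t, y)) differentiable (at x)" by (auto simp: o_def differentiable_def)
  then show "((\<lambda>t. f (t, y)) has_vector_derivative pdx f (x, y)) (at x)"
    by (simp add: pdx_def vector_derivative_works[symmetric])
  have "((\<lambda>t. (x, t)) has_derivative (\<lambda>h. (0, h))) (at y)"
    by (intro has_derivative_Pair has_derivative_ident has_derivative_const)
  from diff_chain_at[OF this, OF pd_has[OF assms]]
  have "(\<lambda>t. f (x, t)) differentiable (at y)" by (auto simp: o_def differentiable_def)
  then show "((\<lambda>t. f (x, t)) has_vector_derivative pdy f (x, y)) (at y)"
    by (simp add: pdy_def vector_derivative_works[symmetric])
qed

lemma smooth_pdx: "open S \<Longrightarrow> smooth_on S f \<Longrightarrow> smooth_on S (pdx f)"
  and smooth_pdy: "open S \<Longrightarrow> smooth_on S f \<Longrightarrow> smooth_on S (pdy f)"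
  by (rule smooth_cong[of S "pd (1, 0) f"] smooth_cong[of S "pd (0, 1) f"]; auto simp: pdx_pd pdy_pd smooth_diffable intro: smooth_pd)+

lemma pdxy_cong:
  assumes "open S" "z \<in> S" "\<And>z. z \<in> S \<Longrightarrow> f z = g z"
  shows "pdx f z = pdx g z" "pdy f z = pdy g z"
proof -
  obtain x y where z: "z = (x, y)" by (cases z)
  have "eventually (\<lambda>w. w \<in> S) (nhds (x, y))" using assms z by (simp add: eventually_nhds_in_open)
  then have e: "eventually (\<lambda>w. f w = g w) (nhds (x, y))" by eventually_elim (rule assms(3))
  have "filterlim (\<lambda>t. (t, y)) (nhds (x, y)) (nhds x)" "filterlim (\<lambda>t. (x, t)) (nhds (x, y)) (nhds y)"
    by (intro tendsto_intros filterlim_ident)+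
  from this[THEN filterlim_iff[THEN iffD1], rule_format, OF e]
  have 1: "eventually (\<lambda>t. f (t, y) = g (t, y)) (nhds x)" "eventually (\<lambda>t. f (x, t) = g (x, t)) (nhds y)" by auto
  show "pdx f z = pdx g z" "pdy f z = pdy g z"
    unfolding pdx_def pdy_def z fst_conv snd_conv
    by (rule vector_derivative_cong_eq; use 1 in simp)+
qed

lemma pdxy_add:
  assumes "f differentiable (at z)" "g differentiable (at z)"
  shows "pdx (\<lambda>z. f z + g z) z = pdx f z + pdx g z" "pdy (\<lambda>z. f z + g z) z = pdy f z + pdy g z"
  using assms pd_eqI[OF has_derivative_add[OF pd_has pd_has], OF assms]
  by (simp_all add: pdx_pd pdy_pd differentiable_add)

lemma pdxy_mult:
  fixes f g :: "pt \<Rightarrow> 'a::real_normed_field"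
  assumes "f differentiable (at z)" "g differentiable (at z)"
  shows "pdx (\<lambda>z. f z * g z) z = pdx f z * g z + f z * pdx g z" "pdy (\<lambda>z. f z * g z) z = pdy f z * g z + f z * pdy g z"
  using assms pd_eqI[OF has_derivative_mult[OF pd_has pd_has], OF assms]
  by (simp_all add: pdx_pd pdy_pd)

lemma pdxy_const: "pdx (\<lambda>_. c) z = 0" "pdy (\<lambda>_. c) z = 0"
  by (simp_all add: pdx_def pdy_def)

lemma pdxy_cmult:
  fixes f :: "pt \<Rightarrow> 'a::real_normed_field"
  assumes "f differentiable (at z)"
  shows "pdx (\<lambda>z. c * f z) z = c * pdx f z" "pdy (\<lambda>z. c * f z) z = c * pdy f z"
  using pdxy_mult[of "\<lambda>_. c" z f] assms by (simp_all add: pdxy_const)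

lemma pdxy_sum:
  assumes "\<And>i. i \<in> A \<Longrightarrow> f i differentiable (at z)"
  shows "pdx (\<lambda>z. \<Sum>i\<in>A. f i z) z = (\<Sum>i\<in>A. pdx (f i) z)" "pdy (\<lambda>z. \<Sum>i\<in>A. f i z) z = (\<Sum>i\<in>A. pdy (f i) z)"
  using assms by (induction A rule: infinite_finite_induct) (simp_all add: pdxy_const pdxy_add)

lemma pdxy_of_real:
  fixes f :: "pt \<Rightarrow> real"
  assumes "f differentiable (at z)"
  shows "pdx (\<lambda>z. of_real (f z) :: complex) z = of_real (pdx f z)" "pdy (\<lambda>z. of_real (f z) :: complex) z = of_real (pdy f z)"
    "(\<lambda>z. of_real (f z) :: complex) differentiable (at z)"
proof -
  have d: "((\<lambda>z. of_real (f z) :: complex) has_derivative (\<lambda>v. of_real (pd v f z))) (at z)"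
    by (rule bounded_linear.has_derivative[OF bounded_linear_of_real pd_has[OF assms]])
  then show "(\<lambda>z. of_real (f z) :: complex) differentiable (at z)" by (auto simp: differentiable_def)
  then show "pdx (\<lambda>z. of_real (f z) :: complex) z = of_real (pdx f z)" "pdy (\<lambda>z. of_real (f z) :: complex) z = of_real (pdy f z)"
    using pd_eqI[OF d] assms by (simp_all add: pdx_pd pdy_pd)
qed

lemma pdxy_comp:
  fixes f :: "pt \<Rightarrow> complex" and p q :: "pt \<Rightarrow> real"
  assumes p: "p differentiable (at z)" and q: "q differentiable (at z)" and f: "f differentiable (at (p z, q z))"
  shows "pdx (\<lambda>z. f (p z, q z)) z = of_real (pdx p z) * pdx f (p z, q z) + of_real (pdx q z) * pdy f (p z, q z)"
    "pdy (\<lambda>z. f (p z, q z)) z = of_real (pdy p z) * pdx f (p z, q z) + of_real (pdy q z) * pdy f (p z, q z)"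
    "(\<lambda>z. f (p z, q z)) differentiable (at z)"
proof -
  have d: "((\<lambda>z. f (p z, q z)) has_derivative (\<lambda>v. pd (pd v p z, pd v q z) f (p z, q z))) (at z)"
    using diff_chain_at[OF has_derivative_Pair[OF pd_has[OF p] pd_has[OF q]], of f] pd_has[OF f] by (simp add: o_def)
  have e: "pd (a, b) f (p z, q z) = of_real a * pdx f (p z, q z) + of_real b * pdy f (p z, q z)" for a b
    using pd_linear_comb[OF f, of a "(1, 0)" b "(0, 1)"] f by (simp add: pdx_pd pdy_pd scaleR_conv_of_real)
  show D: "(\<lambda>z. f (p z, q z)) differentiable (at z)" using d by (auto simp: differentiable_def)
  show "pdx (\<lambda>z. f (p z, q z)) z = of_real (pdx p z) * pdx f (p z, q z) + of_real (pdx q z) * pdy f (p z, q z)"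
    "pdy (\<lambda>z. f (p z, q z)) z = of_real (pdy p z) * pdx f (p z, q z) + of_real (pdy q z) * pdy f (p z, q z)"
    unfolding pdx_pd[OF D] pdy_pd[OF D] pd_eqI[OF d] e using p q by (simp_all add: pdx_pd pdy_pd)
qed

lemma pdxy_fst_only:
  fixes g :: "real \<Rightarrow> real"
  assumes "(g has_real_derivative g') (at x)"
  shows "pdx (\<lambda>z. g (fst z)) (x, y) = g'" "pdy (\<lambda>z. g (fst z)) (x, y) = 0"
    "(\<lambda>z. g (fst z)) differentiable (at (x, y))"
proof -
  have "((\<lambda>z :: pt. g (fst z)) has_derivative (\<lambda>v. g' * fst v)) (at (x, y))"
    by (rule has_derivative_compose[where f=fst and g=g and g'="\<lambda>v. g' * v" and f'=fst, simplified])
      (use assms in \<open>auto simp: has_field_derivative_def intro!: derivative_eq_intros\<close>)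
  then show "(\<lambda>z. g (fst z)) differentiable (at (x, y))" by (auto simp: differentiable_def)
  show "pdx (\<lambda>z. g (fst z)) (x, y) = g'" "pdy (\<lambda>z. g (fst z)) (x, y) = 0"
    using assms by (simp_all add: pdx_def pdy_def has_real_derivative_iff_has_vector_derivative vector_derivative_at)
qed

text \<open>Both iterated integrals of the mixed derivative are differentiated under the integral sign.\<close>

lemma schwarz:
  fixes f :: "pt \<Rightarrow> complex"
  assumes S: "open S" and f: "smooth_on S f" and z: "z \<in> S"
  shows "pdy (pdx f) z = pdx (pdy f) z"
proof -
  obtain x0 y0 where z0: "z = (x0, y0)" by (cases z)
  obtain A B where AB: "open A" "open B" "x0 \<in> A" "y0 \<in> B" "A \<times> B \<subseteq> S"
    using open_prod_elim[OF S z] unfolding z0 mem_Times_iff fst_conv snd_conv by metis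
  obtain d where d: "d > 0" "ball x0 d \<subseteq> A" using openE[OF AB(1,3)] .
  obtain e where e: "e > 0" "cball y0 e \<subseteq> B" using open_contains_cball[THEN iffD1, OF AB(2)] AB(4) by blast
  define a b where "a = y0 - e" and "b = y0 + e"
  have cb: "cball y0 e = {a..b}" by (auto simp: a_def b_def dist_real_def abs_le_iff)
  have sub: "(x, t) \<in> S" if "x \<in> ball x0 d" "t \<in> {a..b}" for x t using that d e AB cb by blast
  have fd: "f differentiable (at w)" "pdx f differentiable (at w)" "pdy f differentiable (at w)"
    "pdx (pdy f) differentiable (at w)" if "w \<in> S" for w
    using that by (auto intro: smooth_diffable S f smooth_pdx smooth_pdy)
  have c: "continuous_on S (pdx (pdy f))"
    by (auto intro!: continuous_at_imp_continuous_on differentiable_imp_continuous_within fd)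
  have cy: "continuous_on S (pdy f)"
    by (auto intro!: continuous_at_imp_continuous_on differentiable_imp_continuous_within fd)
  have x0: "x0 \<in> ball x0 d" using d by simp
  have I: "integral {a..y} (\<lambda>t. pdy f (x, t)) = f (x, y) - f (x, a)" if "x \<in> ball x0 d" "y \<in> {a..b}" for x y
  proof (rule integral_unique, rule fundamental_theorem_of_calculus)
    show "a \<le> y" using that by simp
    fix t assume "t \<in> {a..y}"
    then have "(x, t) \<in> S" using that by (intro sub) auto
    from pdxy_vec(2)[OF fd(1)[OF this]]
    show "((\<lambda>t. f (x, t)) has_vector_derivative pdy f (x, t)) (at t within {a..y})"
      by (rule has_vector_derivative_at_within)
  qed
  have L: "pdx f (x0, y) - pdx f (x0, a) = integral {a..y} (\<lambda>t. pdx (pdy f) (x0, t))" if y: "y \<in> {a..b}" for y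
  proof -
    have "((\<lambda>x. integral (cbox a y) (\<lambda>t. pdy f (x, t))) has_vector_derivative integral (cbox a y) (\<lambda>t. pdx (pdy f) (x0, t)))
        (at x0 within ball x0 d)"
    proof (rule leibniz_rule_vector_derivative)
      show "((\<lambda>x. pdy f (x, t)) has_vector_derivative pdx (pdy f) (x, t)) (at x within ball x0 d)"
        if "x \<in> ball x0 d" "t \<in> cbox a y" for x t
        using pdxy_vec(1)[OF fd(3)[OF sub[of x t]]] that y by (auto intro: has_vector_derivative_at_within)
      show "(\<lambda>t. pdy f (x, t)) integrable_on cbox a y" if "x \<in> ball x0 d" for x
        using that y
        by (intro integrable_continuous continuous_on_compose2[OF cy] continuous_intros) (auto intro!: sub)
      show "continuous_on (ball x0 d \<times> cbox a y) (\<lambda>(x, t). pdx (pdy f) (x, t))"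
        using y by (auto intro!: continuous_on_subset[OF c] sub)
    qed (use d in auto)
    then have "((\<lambda>x. integral {a..y} (\<lambda>t. pdy f (x, t))) has_vector_derivative integral {a..y} (\<lambda>t. pdx (pdy f) (x0, t))) (at x0)"
      using at_within_open[OF x0] by (simp add: cbox_interval)
    moreover have "((\<lambda>x. f (x, y) - f (x, a)) has_vector_derivative pdx f (x0, y) - pdx f (x0, a)) (at x0)"
      using y by (intro has_vector_derivative_diff pdxy_vec(1) fd sub x0) auto
    then have "((\<lambda>x. integral {a..y} (\<lambda>t. pdy f (x, t))) has_vector_derivative pdx f (x0, y) - pdx f (x0, a)) (at x0)"
      by (rule has_vector_derivative_transform_within_open[OF _ open_ball x0]) (use I y in auto)
    ultimately show ?thesis using vector_derivative_unique_at by blast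
  qed
  have y0: "y0 \<in> {a<..<b}" using e by (simp add: a_def b_def)
  have "((\<lambda>y. integral {a..y} (\<lambda>t. pdx (pdy f) (x0, t))) has_vector_derivative pdx (pdy f) (x0, y0)) (at y0 within {a..b})"
    by (rule integral_has_vector_derivative) (use y0 in \<open>auto intro!: continuous_on_compose2[OF c] continuous_intros sub x0\<close>)
  then have "((\<lambda>y. integral {a..y} (\<lambda>t. pdx (pdy f) (x0, t))) has_vector_derivative pdx (pdy f) (x0, y0)) (at y0)"
    using y0 by (simp only: at_within_Icc_at greaterThanLessThan_iff)
  then have 1: "((\<lambda>y. pdx f (x0, y) - pdx f (x0, a)) has_vector_derivative pdx (pdy f) (x0, y0)) (at y0)"
    by (rule has_vector_derivative_transform_within_open[OF _ open_greaterThanLessThan y0]) (rule L[symmetric], simp)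
  have "((\<lambda>y. pdx f (x0, y) - pdx f (x0, a)) has_vector_derivative pdy (pdx f) (x0, y0) - 0) (at y0)"
    using y0 by (intro has_vector_derivative_diff pdxy_vec(2) fd sub x0 has_vector_derivative_const) auto
  from vector_derivative_unique_at[OF this 1] show ?thesis by (simp add: z0)
qed

section \<open>Local diffeomorphisms and the functions delta_n\<close>

definition ps :: "(real \<rightharpoonup> real) \<Rightarrow> real \<Rightarrow> real" where "ps \<gamma> = (\<lambda>s. the (pm_inv \<gamma> s))"
definition phi :: "(real \<rightharpoonup> real) \<Rightarrow> pt \<Rightarrow> pt" where "phi \<gamma> z = (ps \<gamma> (fst z), snd z / deriv (ps \<gamma>) (fst z))"
text \<open>The logarithmic derivative of the inverse map's derivative. The function
  \<open>delta_fun\<close> of index k is its k-th derivative divided by y^(k+1), see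
  \<open>delta_fun_eq\<close>.\<close>

definition lnd :: "(real \<rightharpoonup> real) \<Rightarrow> real \<Rightarrow> real" where "lnd \<gamma> = deriv (\<lambda>t. ln (deriv (ps \<gamma>) t))"

lemma ran_lift: "ran (lift \<gamma>) = {z :: pt. fst z \<in> ran \<gamma> \<and> snd z > 0}" if "local_diffeo \<gamma>"
proof (intro set_eqI iffI)
  fix z assume "z \<in> ran (lift \<gamma>)"
  then obtain x y where "x \<in> dom \<gamma>" "y > 0" "z = (the (\<gamma> x), y / deriv (\<lambda>t. the (\<gamma> t)) x)"
    by (auto simp: ran_def lift_def split: if_splits)
  then show "z \<in> {z. fst z \<in> ran \<gamma> \<and> snd z > 0}"
    using that by (auto simp: local_diffeo_def ran_def)
next
  fix z :: pt assume "z \<in> {z. fst z \<in> ran \<gamma> \<and> snd z > 0}"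
  then obtain t where t: "\<gamma> t = Some (fst z)" "snd z > 0" by (auto simp: ran_def)
  then have d: "deriv (\<lambda>t. the (\<gamma> t)) t > 0" using that by (auto simp: local_diffeo_def)
  have "lift \<gamma> (t, snd z * deriv (\<lambda>t. the (\<gamma> t)) t) = Some z"
    using t d by (auto simp: lift_def intro!: prod_eqI)
  then show "z \<in> ran (lift \<gamma>)" by (auto simp: ran_def)
qed

locale ldiff =
  fixes \<gamma> :: "real \<rightharpoonup> real"
  assumes ld: "local_diffeo \<gamma>"
begin

abbreviation "S \<equiv> ran (lift \<gamma>)"

lemma S_iff: "z \<in> S \<longleftrightarrow> fst z \<in> ran \<gamma> \<and> snd z > 0"
  using ran_lift[OF ld] by auto

lemma open_ran: "open (ran \<gamma>)" and open_dom: "open (dom \<gamma>)" using ld by (simp_all add: local_diffeo_def)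

lemma open_S: "open S"
proof -
  have "S = ran \<gamma> \<times> {0<..}" using S_iff by auto
  then show ?thesis using open_ran by (simp add: open_Times)
qed

lemma inj: "\<gamma> s = Some x \<Longrightarrow> \<gamma> t = Some x \<Longrightarrow> s = t"
  using ld by (auto simp: local_diffeo_def inj_on_def dom_def)

lemma pm_inv_iff: "pm_inv \<gamma> x = Some t \<longleftrightarrow> \<gamma> t = Some x"
proof
  assume "pm_inv \<gamma> x = Some t"
  then have "x \<in> ran \<gamma>" "t = (THE t. \<gamma> t = Some x)" by (auto simp: pm_inv_def split: if_splits)
  then show "\<gamma> t = Some x" using theI[of "\<lambda>t. \<gamma> t = Some x"] inj by (auto simp: ran_def)
next
  assume *: "\<gamma> t = Some x"
  then have "(THE t. \<gamma> t = Some x) = t" using inj by blast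
  then show "pm_inv \<gamma> x = Some t" using * by (auto simp: pm_inv_def ran_def)
qed

lemma ps_ran: "x \<in> ran \<gamma> \<Longrightarrow> \<gamma> (ps \<gamma> x) = Some x"
  unfolding ps_def ran_def by (auto simp flip: pm_inv_iff)

lemma ps_the: "t \<in> dom \<gamma> \<Longrightarrow> ps \<gamma> (the (\<gamma> t)) = t"
proof -
  assume "t \<in> dom \<gamma>"
  then obtain x where x: "\<gamma> t = Some x" by blast
  with pm_inv_iff[THEN iffD2, OF x] show ?thesis by (simp add: ps_def)
qed

lemma smooth_ps: "smooth_on (ran \<gamma>) (ps \<gamma>)" and smooth_the: "smooth_on (dom \<gamma>) (\<lambda>x. the (\<gamma> x))"
  using ld by (simp_all add: local_diffeo_def ps_def)

lemma smooth_ps': "smooth_on (ran \<gamma>) (deriv (ps \<gamma>))"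
  and ps_deriv: "x \<in> ran \<gamma> \<Longrightarrow> (ps \<gamma> has_real_derivative deriv (ps \<gamma>) x) (at x)"
  using smooth_deriv[OF open_ran smooth_ps] by auto

lemma ps'_inv: "x \<in> ran \<gamma> \<Longrightarrow> deriv (ps \<gamma>) x * deriv (\<lambda>t. the (\<gamma> t)) (ps \<gamma> x) = 1"
proof -
  assume x: "x \<in> ran \<gamma>"
  have d: "ps \<gamma> x \<in> dom \<gamma>" using ps_ran[OF x] by auto
  have "((\<lambda>x. the (\<gamma> (ps \<gamma> x))) has_real_derivative deriv (\<lambda>t. the (\<gamma> t)) (ps \<gamma> x) * deriv (ps \<gamma>) x) (at x)"
    using DERIV_chain[OF smooth_deriv(2)[OF open_dom smooth_the d] ps_deriv[OF x]] by (simp add: o_def)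
  moreover have "((\<lambda>x. the (\<gamma> (ps \<gamma> x))) has_real_derivative 1) (at x)"
    by (rule has_field_derivative_transform_within_open[OF DERIV_ident open_ran x]) (simp add: ps_ran)
  ultimately have "deriv (\<lambda>t. the (\<gamma> t)) (ps \<gamma> x) * deriv (ps \<gamma>) x = 1" by (rule DERIV_unique)
  then show ?thesis by (simp add: mult.commute)
qed

lemma ps'_pos: "x \<in> ran \<gamma> \<Longrightarrow> deriv (ps \<gamma>) x > 0"
proof -
  assume x: "x \<in> ran \<gamma>"
  have "ps \<gamma> x \<in> dom \<gamma>" using ps_ran[OF x] by auto
  then have "deriv (\<lambda>t. the (\<gamma> t)) (ps \<gamma> x) > 0" using ld by (auto simp: local_diffeo_def)
  with ps'_inv[OF x] show ?thesis by (metis zero_less_mult_pos2 zero_less_one)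
qed

lemma lift_phi: "z \<in> S \<Longrightarrow> lift \<gamma> (phi \<gamma> z) = Some z"
proof -
  assume z: "z \<in> S"
  then have x: "fst z \<in> ran \<gamma>" "snd z > 0" using S_iff by auto
  have "ps \<gamma> (fst z) \<in> dom \<gamma>" using ps_ran[OF x(1)] by auto
  moreover have "snd z / deriv (ps \<gamma>) (fst z) / deriv (\<lambda>t. the (\<gamma> t)) (ps \<gamma> (fst z)) = snd z"
    using ps'_inv[OF x(1)] ps'_pos[OF x(1)] by simp
  ultimately show ?thesis
    using x ps_ran[OF x(1)] ps'_pos[OF x(1)] by (auto simp: lift_def phi_def intro!: prod_eqI)
qed

lemma lift_inj: "lift \<gamma> w = Some z \<Longrightarrow> lift \<gamma> w' = Some z \<Longrightarrow> w = w'"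
proof -
  assume a: "lift \<gamma> w = Some z" "lift \<gamma> w' = Some z"
  obtain x y x' y' where w: "w = (x, y)" "w' = (x', y')" by (cases w, cases w')
  have d: "x \<in> dom \<gamma>" "x' \<in> dom \<gamma>" "the (\<gamma> x) = fst z" "the (\<gamma> x') = fst z"
    "y / deriv (\<lambda>t. the (\<gamma> t)) x = snd z" "y' / deriv (\<lambda>t. the (\<gamma> t)) x' = snd z"
    using a by (auto simp: lift_def w split: if_splits)
  then have "x = x'" using ps_the by metis
  moreover have "deriv (\<lambda>t. the (\<gamma> t)) x > 0" using d ld by (auto simp: local_diffeo_def)
  ultimately show ?thesis using d by (simp add: w field_simps)
qed

lemma pm_inv_lift: "pm_inv (lift \<gamma>) z = (if z \<in> S then Some (phi \<gamma> z) else None)"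
proof (cases "z \<in> S")
  case True
  then have "(THE w. lift \<gamma> w = Some z) = phi \<gamma> z" using lift_phi lift_inj by blast
  with True show ?thesis by (simp add: pm_inv_def)
qed (simp add: pm_inv_def)

lemma fun_act_eq: "fun_act \<gamma> f z = (if z \<in> S then f (phi \<gamma> z) else 0)"
  by (simp add: fun_act_def pm_inv_lift)

lemma phi_dom: "z \<in> S \<Longrightarrow> phi \<gamma> z \<in> dom (lift \<gamma>)"
  using lift_phi by (rule domI)

lemma smooth_phi1: "smooth_on S (\<lambda>z. ps \<gamma> (fst z))"
  and smooth_ps'_fst: "smooth_on S (\<lambda>z. deriv (ps \<gamma>) (fst z))"
  by (rule smooth_comp[OF open_S open_ran smooth_fst]; use smooth_ps smooth_ps' S_iff in auto)+

lemma smooth_phi2: "smooth_on S (\<lambda>z. snd z / deriv (ps \<gamma>) (fst z))"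
  by (rule smooth_divide[OF open_S smooth_snd smooth_ps'_fst]) (use S_iff ps'_pos in force)

lemma smooth_phi: "smooth_on S (phi \<gamma>)"
  unfolding phi_def[abs_def] by (rule smooth_Pair[OF open_S smooth_phi1 smooth_phi2])

lemma lnd_eq: "x \<in> ran \<gamma> \<Longrightarrow> lnd \<gamma> x = deriv (deriv (ps \<gamma>)) x / deriv (ps \<gamma>) x"
proof -
  assume x: "x \<in> ran \<gamma>"
  have "((\<lambda>t. ln (deriv (ps \<gamma>) t)) has_real_derivative 1 / deriv (ps \<gamma>) x * deriv (deriv (ps \<gamma>)) x) (at x)"
    by (rule DERIV_chain2[OF DERIV_ln_divide[OF ps'_pos[OF x]] smooth_deriv(2)[OF open_ran smooth_ps' x]])
  then show ?thesis unfolding lnd_def by (simp add: DERIV_imp_deriv)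
qed

lemma smooth_lnd: "smooth_on (ran \<gamma>) (lnd \<gamma>)"
proof (rule smooth_cong[OF open_ran])
  show "smooth_on (ran \<gamma>) (\<lambda>x. deriv (deriv (ps \<gamma>)) x / deriv (ps \<gamma>) x)"
    by (rule smooth_divide[OF open_ran smooth_deriv(1)[OF open_ran smooth_ps'] smooth_ps']) (use ps'_pos in force)
qed (simp add: lnd_eq)

lemma smooth_lnd_k: "smooth_on (ran \<gamma>) ((deriv ^^ k) (lnd \<gamma>))"
  by (induction k) (auto intro: smooth_lnd smooth_deriv(1)[OF open_ran])

lemma y_inv_deriv:
  assumes "(g has_real_derivative g') (at x)" "y > 0"
  shows "pdx (\<lambda>z. g (fst z) / snd z ^ k) (x, y) = g' / y ^ k"
    "pdy (\<lambda>z. g (fst z) / snd z ^ k) (x, y) = - (of_nat k * g x / y ^ Suc k)"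
proof -
  have "((\<lambda>t. g t / y ^ k) has_real_derivative g' / y ^ k) (at x)"
    by (rule DERIV_cdivide[OF assms(1)])
  then show "pdx (\<lambda>z. g (fst z) / snd z ^ k) (x, y) = g' / y ^ k"
    by (simp add: pdx_def has_real_derivative_iff_has_vector_derivative vector_derivative_at)
  have "((\<lambda>t. g x / t ^ k) has_real_derivative - (of_nat k * g x / y ^ Suc k)) (at y)"
    using assms(2) by (auto intro!: derivative_eq_intros simp: field_simps power2_eq_square power_add[symmetric])
       (cases k, auto simp: field_simps)
  then show "pdy (\<lambda>z. g (fst z) / snd z ^ k) (x, y) = - (of_nat k * g x / y ^ Suc k)"
    by (simp add: pdy_def has_real_derivative_iff_has_vector_derivative vector_derivative_at)
qed

lemma delta_fun_eq: "z \<in> S \<Longrightarrow> delta_fun \<gamma> k z = (deriv ^^ k) (lnd \<gamma>) (fst z) / snd z ^ Suc k"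
proof (induction k arbitrary: z)
  case 0
  then show ?case by (cases z) (simp add: lnd_def ps_def)
next
  case (Suc k)
  obtain x y where z: "z = (x, y)" by (cases z)
  have x: "x \<in> ran \<gamma>" "y > 0" using Suc.prems S_iff z by auto
  have "pdx (delta_fun \<gamma> k) z = pdx (\<lambda>z. (deriv ^^ k) (lnd \<gamma>) (fst z) / snd z ^ Suc k) z"
    by (rule pdxy_cong(1)[OF open_S Suc.prems]) (rule Suc.IH)
  also have "\<dots> = (deriv ^^ Suc k) (lnd \<gamma>) x / y ^ Suc k"
    unfolding z using y_inv_deriv(1)[OF smooth_deriv(2)[OF open_ran smooth_lnd_k x(1)] x(2), of k "Suc k"] by simp
  finally show ?case using x by (simp add: z field_simps)
qed

lemma smooth_delta_fun: "smooth_on S (delta_fun \<gamma> k)"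
proof (rule smooth_cong[OF open_S])
  show "smooth_on S (\<lambda>z. (deriv ^^ k) (lnd \<gamma>) (fst z) / snd z ^ Suc k)"
    by (intro smooth_divide smooth_power open_S smooth_snd smooth_comp[OF open_S open_ran smooth_fst smooth_lnd_k])
      (use S_iff in auto)
qed (simp add: delta_fun_eq)

text \<open>These two derivatives are the commutators of X and Y with multiplication by delta_(k+1):
  the second is homogeneity of degree -(k+1) in y.\<close>

lemma delta_pd:
  assumes "z \<in> S"
  shows "pdx (delta_fun \<gamma> k) z = snd z * delta_fun \<gamma> (Suc k) z"
    "snd z * pdy (delta_fun \<gamma> k) z = - (of_nat (Suc k) * delta_fun \<gamma> k z)"
proof -
  obtain x y where z: "z = (x, y)" by (cases z)
  have x: "x \<in> ran \<gamma>" "y > 0" using assms S_iff z by auto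
  show "pdx (delta_fun \<gamma> k) z = snd z * delta_fun \<gamma> (Suc k) z" using x by (simp add: z)
  have "pdy (delta_fun \<gamma> k) z = pdy (\<lambda>z. (deriv ^^ k) (lnd \<gamma>) (fst z) / snd z ^ Suc k) z"
    by (rule pdxy_cong(2)[OF open_S assms]) (rule delta_fun_eq)
  also have "\<dots> = - (of_nat (Suc k) * (deriv ^^ k) (lnd \<gamma>) x / y ^ Suc (Suc k))"
    unfolding z using y_inv_deriv(2)[OF smooth_deriv(2)[OF open_ran smooth_lnd_k x(1)] x(2), of k "Suc k"] .
  finally have P: "pdy (delta_fun \<gamma> k) z = - (of_nat (Suc k) * (deriv ^^ k) (lnd \<gamma>) x / y ^ Suc (Suc k))" .
  show "snd z * pdy (delta_fun \<gamma> k) z = - (of_nat (Suc k) * delta_fun \<gamma> k z)"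
    unfolding P delta_fun_eq[OF assms] using x by (simp add: z)
qed

lemma phi_pd:
  assumes "z \<in> S"
  shows "pdx (\<lambda>z. ps \<gamma> (fst z)) z = deriv (ps \<gamma>) (fst z)" "pdy (\<lambda>z. ps \<gamma> (fst z)) z = 0"
    "pdx (\<lambda>z. snd z / deriv (ps \<gamma>) (fst z)) z = - snd z * deriv (deriv (ps \<gamma>)) (fst z) / (deriv (ps \<gamma>) (fst z))\<^sup>2"
    "pdy (\<lambda>z. snd z / deriv (ps \<gamma>) (fst z)) z = 1 / deriv (ps \<gamma>) (fst z)"
proof -
  obtain x y where z: "z = (x, y)" by (cases z)
  have x: "x \<in> ran \<gamma>" "y > 0" using assms S_iff z by auto
  show "pdx (\<lambda>z. ps \<gamma> (fst z)) z = deriv (ps \<gamma>) (fst z)" "pdy (\<lambda>z. ps \<gamma> (fst z)) z = 0"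
    using pdxy_fst_only[OF ps_deriv[OF x(1)]] by (simp_all add: z)
  have "((\<lambda>t. y / deriv (ps \<gamma>) t) has_real_derivative - y * deriv (deriv (ps \<gamma>)) x / (deriv (ps \<gamma>) x)\<^sup>2) (at x)"
    using smooth_deriv(2)[OF open_ran smooth_ps' x(1)] ps'_pos[OF x(1)]
    by (auto intro!: derivative_eq_intros simp: power2_eq_square)
  then show "pdx (\<lambda>z. snd z / deriv (ps \<gamma>) (fst z)) z = - snd z * deriv (deriv (ps \<gamma>)) (fst z) / (deriv (ps \<gamma>) (fst z))\<^sup>2"
    by (simp add: z pdx_def has_real_derivative_iff_has_vector_derivative vector_derivative_at)
  have "((\<lambda>t. t / deriv (ps \<gamma>) x) has_real_derivative 1 / deriv (ps \<gamma>) x) (at y)"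
    by (rule DERIV_cdivide[OF DERIV_ident])
  then show "pdy (\<lambda>z. snd z / deriv (ps \<gamma>) (fst z)) z = 1 / deriv (ps \<gamma>) (fst z)"
    by (simp add: z pdy_def has_real_derivative_iff_has_vector_derivative vector_derivative_at)
qed

lemma fun_act_pd:
  fixes f :: "pt \<Rightarrow> complex"
  assumes z: "z \<in> S" and T: "f differentiable (at (phi \<gamma> z))"
  shows "pdx (\<lambda>z. f (phi \<gamma> z)) z = deriv (ps \<gamma>) (fst z) * pdx f (phi \<gamma> z)
      - of_real (snd z * deriv (deriv (ps \<gamma>)) (fst z) / (deriv (ps \<gamma>) (fst z))\<^sup>2) * pdy f (phi \<gamma> z)"
    "pdy (\<lambda>z. f (phi \<gamma> z)) z = of_real (1 / deriv (ps \<gamma>) (fst z)) * pdy f (phi \<gamma> z)"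
    "(\<lambda>z. f (phi \<gamma> z)) differentiable (at z)"
  using pdxy_comp[OF smooth_diffable[OF smooth_phi1 z] smooth_diffable[OF smooth_phi2 z], of f] T
  by (simp_all add: phi_def phi_pd[OF z])

end

subsection \<open>The action of the Hopf algebra on functions\<close>

text \<open>Smooth functions on the range, extended by zero so that equality is equality of
  functions. No condition at the boundary is imposed, so the indicator of the range, which plays the
  role of 1 for U_gamma, is included.\<close>

definition VA :: "(real \<rightharpoonup> real) \<Rightarrow> (pt \<Rightarrow> complex) set" where
  "VA \<gamma> = {f. smooth_on (ran (lift \<gamma>)) f \<and> (\<forall>z. z \<notin> ran (lift \<gamma>) \<longrightarrow> f z = 0)}"

text \<open>The generator cut off outside the range. At a boundary point of the range the derivative
  in \<open>gen_op\<close> need not exist, so its value there would be arbitrary.\<close>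

definition sop :: "(real \<rightharpoonup> real) \<Rightarrow> h1_gen \<Rightarrow> (pt \<Rightarrow> complex) \<Rightarrow> pt \<Rightarrow> complex" where
  "sop \<gamma> g f z = (if z \<in> ran (lift \<gamma>) then gen_op g \<gamma> f z else 0)"

definition facto :: "(real \<rightharpoonup> real) \<Rightarrow> h1_gen free_algebra \<Rightarrow> (pt \<Rightarrow> complex) \<Rightarrow> pt \<Rightarrow> complex" where
  "facto \<gamma> p f = free_extend (\<lambda>w. foldr (sop \<gamma>) (letters w) f) p"

definition hact :: "(real \<rightharpoonup> real) \<Rightarrow> h1 \<Rightarrow> (pt \<Rightarrow> complex) \<Rightarrow> pt \<Rightarrow> complex" where
  "hact \<gamma> h f = facto \<gamma> (rep_h1 h) f"

lemma VA_lin: "local_diffeo \<gamma> \<Longrightarrow> f \<in> VA \<gamma> \<Longrightarrow> g \<in> VA \<gamma> \<Longrightarrow> f + g \<in> VA \<gamma>" "local_diffeo \<gamma> \<Longrightarrow> f \<in> VA \<gamma> \<Longrightarrow> c *\<^sub>C f \<in> VA \<gamma>"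
  "0 \<in> VA \<gamma>"
  using smooth_add[of "ran (lift \<gamma>)" f g] smooth_mult[of "ran (lift \<gamma>)" "\<lambda>_. c" f] ldiff.open_S[of \<gamma>]
  by (auto simp: VA_def ldiff_def plus_fun_def scaleC_fun_def scaleC_complex_def zero_fun_def smooth_const)

context ldiff begin

lemma VA_diff: "f \<in> VA \<gamma> \<Longrightarrow> z \<in> S \<Longrightarrow> f differentiable (at z)"
  by (auto simp: VA_def intro: smooth_diffable)

lemma sop_S: "z \<in> S \<Longrightarrow> sop \<gamma> GX f z = of_real (1 / snd z) * pdx f z"
  "z \<in> S \<Longrightarrow> sop \<gamma> GY f z = - of_real (snd z) * pdy f z"
  "z \<in> S \<Longrightarrow> sop \<gamma> (GD k) f z = of_real (delta_fun \<gamma> k z) * f z"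
  by (cases z, simp add: sop_def)+

lemma sop_notin: "z \<notin> S \<Longrightarrow> sop \<gamma> g f z = 0"
  by (simp add: sop_def)

lemma smooth_y: "smooth_on S (\<lambda>z. of_real (1 / snd z) :: complex)" "smooth_on S (\<lambda>z. - of_real (snd z) :: complex)"
proof -
  show "smooth_on S (\<lambda>z. of_real (1 / snd z) :: complex)"
    by (intro smooth_of_real smooth_divide open_S smooth_const smooth_snd) (use S_iff in auto)
  show "smooth_on S (\<lambda>z. - of_real (snd z) :: complex)"
    by (rule smooth_linear[OF bounded_linear_minus[OF bounded_linear_ident] open_S]) (intro smooth_of_real open_S smooth_snd)
qed

lemma sop_VA: assumes "f \<in> VA \<gamma>" shows "sop \<gamma> g f \<in> VA \<gamma>"
proof -
  have f: "smooth_on S f" using assms by (simp add: VA_def)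
  have "smooth_on S (sop \<gamma> g f)"
  proof (cases g)
    case GX
    show ?thesis unfolding GX
      by (rule smooth_cong[OF open_S _ smooth_mult[OF open_S smooth_y(1) smooth_pdx[OF open_S f]]]) (simp add: sop_S)
  next
    case GY
    show ?thesis unfolding GY
      by (rule smooth_cong[OF open_S _ smooth_mult[OF open_S smooth_y(2) smooth_pdy[OF open_S f]]]) (simp add: sop_S)
  next
    case (GD k)
    show ?thesis unfolding GD
      by (rule smooth_cong[OF open_S _ smooth_mult[OF open_S smooth_of_real[OF open_S smooth_delta_fun[of k]] f]]) (simp add: sop_S)
  qed
  then show ?thesis by (simp add: VA_def sop_notin)
qed

lemma sop_lin:
  assumes "f \<in> VA \<gamma>" "f' \<in> VA \<gamma>"
  shows "sop \<gamma> g (f + f') = sop \<gamma> g f + sop \<gamma> g f'" "sop \<gamma> g (c *\<^sub>C f) = c *\<^sub>C sop \<gamma> g f"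
proof -
  show "sop \<gamma> g (f + f') = sop \<gamma> g f + sop \<gamma> g f'"
  proof
    show "sop \<gamma> g (f + f') z = (sop \<gamma> g f + sop \<gamma> g f') z" for z
      using pdxy_add[OF VA_diff[OF assms(1)] VA_diff[OF assms(2)], of z]
      by (cases "z \<in> S"; cases g) (simp_all add: sop_S sop_notin plus_fun_def distrib_left)
  qed
  show "sop \<gamma> g (c *\<^sub>C f) = c *\<^sub>C sop \<gamma> g f"
  proof
    show "sop \<gamma> g (c *\<^sub>C f) z = (c *\<^sub>C sop \<gamma> g f) z" for z
      using pdxy_cmult[OF VA_diff[OF assms(1)], of z c]
      by (cases "z \<in> S"; cases g) (simp_all add: sop_S sop_notin scaleC_fun_def scaleC_complex_def)
  qed
qed

lemma sop_zero: "sop \<gamma> g 0 = 0"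
  using sop_lin(2)[OF VA_lin(3) VA_lin(3), of g 0] by (simp add: cvec.scale_zero_left)

abbreviation "wd w f \<equiv> foldr (sop \<gamma>) w f"

lemma wd_VA: "f \<in> VA \<gamma> \<Longrightarrow> wd w f \<in> VA \<gamma>"
  by (induction w) (auto intro: sop_VA)

lemma wd_scale: "f \<in> VA \<gamma> \<Longrightarrow> wd w (c *\<^sub>C f) = c *\<^sub>C wd w f"
  by (induction w) (simp_all add: sop_lin(2)[OF wd_VA wd_VA])

lemma wd_add: "f \<in> VA \<gamma> \<Longrightarrow> f' \<in> VA \<gamma> \<Longrightarrow> wd w (f + f') = wd w f + wd w f'"
  by (induction w) (simp_all add: sop_lin(1)[OF wd_VA wd_VA])

lemma clinear_fact: "clinear (\<lambda>p. facto \<gamma> p f)"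
  unfolding facto_def by (rule clinear_free_extend)

lemmas fact_lin = clinear_add[OF clinear_fact] clinear_scale[OF clinear_fact] clinear_diff[OF clinear_fact] clinear_zero[OF clinear_fact]

lemma fact_single: "facto \<gamma> (Poly_Mapping.single (Monomial w) c) f = c *\<^sub>C wd w f"
  by (simp add: facto_def)

lemma fact_VA: "f \<in> VA \<gamma> \<Longrightarrow> facto \<gamma> p f \<in> VA \<gamma>"
proof (induction p rule: free_induct)
  case (single k c)
  then show ?case by (cases k) (simp add: fact_single VA_lin wd_VA ld)
qed (simp add: fact_lin VA_lin ld)

lemma fact_add: "f \<in> VA \<gamma> \<Longrightarrow> f' \<in> VA \<gamma> \<Longrightarrow> facto \<gamma> p (f + f') = facto \<gamma> p f + facto \<gamma> p f'"
proof (induction p rule: free_induct)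
  case (single k d)
  obtain w where k: "k = Monomial w" by (cases k)
  show ?case unfolding k fact_single wd_add[OF single] by (rule scaleC_add_right)
next
  case (add p q)
  show ?case unfolding fact_lin(1) add.IH[OF add.prems] by (simp only: add_ac)
qed

lemma fact_scale: "f \<in> VA \<gamma> \<Longrightarrow> facto \<gamma> p (c *\<^sub>C f) = c *\<^sub>C facto \<gamma> p f"
proof (induction p rule: free_induct)
  case (single k d)
  obtain w where k: "k = Monomial w" by (cases k)
  show ?case unfolding k fact_single wd_scale[OF single] by (simp add: scaleC_scaleC mult.commute)
next
  case (add p q)
  show ?case unfolding fact_lin(1) add.IH[OF add.prems] by (simp only: scaleC_add_right)
qed

lemmas fact_linf = fact_add fact_scale

lemma fact_mult: "f \<in> VA \<gamma> \<Longrightarrow> facto \<gamma> (p * q) f = facto \<gamma> p (facto \<gamma> q f)"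
proof (induction q rule: free_induct)
  case (single l d)
  note f = \<open>f \<in> VA \<gamma>\<close>
  obtain v where l: "l = Monomial v" by (cases l)
  show ?case
  proof (induction p rule: free_induct)
    case (single k c)
    obtain w where k: "k = Monomial w" by (cases k)
    show ?case
      by (simp add: k l mult_single plus_monomial_def fact_single wd_scale[OF wd_VA[OF f]] scaleC_scaleC mult.commute)
  next
    case (add p q)
    then show ?case by (simp only: distrib_right fact_lin(1))
  qed
next
  case (add p q)
  note f = \<open>f \<in> VA \<gamma>\<close>
  show ?case
    unfolding distrib_left fact_lin(1) fact_add[OF fact_VA[OF f] fact_VA[OF f]] add.IH[OF f] ..
qed

lemma fact_gen: "facto \<gamma> (gen g) f = sop \<gamma> g f"
  by (simp add: gen_def fact_single scaleC_one)

lemma fact_of_nat: "f \<in> VA \<gamma> \<Longrightarrow> facto \<gamma> (of_nat n) f = of_nat n *\<^sub>C f"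
proof (induction n)
  case (Suc n)
  have "facto \<gamma> 1 f = f"
    using fact_single[of "[]" 1 f] by (simp add: scaleC_one single_one[symmetric] zero_monomial_def del: single_one)
  with Suc show ?case by (simp add: fact_lin scaleC_add_left scaleC_one)
qed (simp add: fact_lin cvec.scale_zero_left)

text \<open>The mixed derivatives cancel by \<open>schwarz\<close>; the derivative of 1/y leaves one
  copy of X f.\<close>

lemma sop_YX: assumes f: "f \<in> VA \<gamma>" shows "sop \<gamma> GY (sop \<gamma> GX f) = sop \<gamma> GX (sop \<gamma> GY f) + sop \<gamma> GX f"
proof
  fix z
  show "sop \<gamma> GY (sop \<gamma> GX f) z = (sop \<gamma> GX (sop \<gamma> GY f) + sop \<gamma> GX f) z"
  proof (cases "z \<in> S")
    case True
    have sf: "smooth_on S f" using f by (simp add: VA_def)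
    obtain x y where z: "z = (x, y)" by (cases z)
    have y: "y > 0" using True S_iff z by simp
    have "pdy (sop \<gamma> GX f) z = pdy (\<lambda>z. of_real (1 / snd z) * pdx f z) z"
      by (rule pdxy_cong(2)[OF open_S True]) (simp add: sop_S)
    also have "\<dots> = pdy (\<lambda>z. of_real (1 / snd z)) z * pdx f z + of_real (1 / snd z) * pdy (pdx f) z"
      by (intro pdxy_mult(2) smooth_diffable[OF smooth_y(1) True] smooth_diffable[OF smooth_pdx[OF open_S sf] True])
    also have "pdy (\<lambda>z. of_real (1 / snd z) :: complex) z = - of_real (1 / y\<^sup>2)"
    proof -
      have "((\<lambda>t. 1 / t) has_real_derivative - (1 / y\<^sup>2)) (at y)"
        using y by (auto intro!: derivative_eq_intros simp: power2_eq_square)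
      then have "((\<lambda>t. of_real (1 / t) :: complex) has_vector_derivative of_real (- (1 / y\<^sup>2))) (at y)"
        unfolding has_real_derivative_iff_has_vector_derivative
        by (rule bounded_linear.has_vector_derivative[OF bounded_linear_of_real])
      then show ?thesis by (simp add: pdy_def z vector_derivative_at)
    qed
    finally have P: "pdy (sop \<gamma> GX f) z = - of_real (1 / y\<^sup>2) * pdx f z + of_real (1 / snd z) * pdy (pdx f) z" .
    have 1: "sop \<gamma> GY (sop \<gamma> GX f) z = of_real (1 / y) * pdx f z - pdy (pdx f) z"
      unfolding sop_S(2)[OF True] P using y by (simp add: z field_simps power2_eq_square)
    have "pdx (sop \<gamma> GY f) z = pdx (\<lambda>z. - of_real (snd z) * pdy f z) z"
      by (rule pdxy_cong(1)[OF open_S True]) (simp add: sop_S)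
    also have "\<dots> = pdx (\<lambda>z. - of_real (snd z)) z * pdy f z + - of_real (snd z) * pdx (pdy f) z"
      by (intro pdxy_mult(1) smooth_diffable[OF smooth_y(2) True] smooth_diffable[OF smooth_pdy[OF open_S sf] True])
    also have "pdx (\<lambda>z. - of_real (snd z) :: complex) z = 0" by (simp add: pdx_def)
    finally have P': "pdx (sop \<gamma> GY f) z = 0 * pdy f z + - of_real (snd z) * pdx (pdy f) z" .
    have 2: "sop \<gamma> GX (sop \<gamma> GY f) z = - pdx (pdy f) z"
      unfolding sop_S(1)[OF True] P' using y by (simp add: z)
    show ?thesis using 1 2 schwarz[OF open_S sf True] True by (simp add: plus_fun_def sop_S z)
  qed (simp add: sop_notin plus_fun_def)
qed

lemma smooth_delta_c: "smooth_on S (\<lambda>z. of_real (delta_fun \<gamma> k z) :: complex)"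
  by (intro smooth_of_real open_S smooth_delta_fun)

lemma sop_delta_pd:
  assumes f: "f \<in> VA \<gamma>" and z: "z \<in> S"
  shows "pdx (sop \<gamma> (GD k) f) z = of_real (pdx (delta_fun \<gamma> k) z) * f z + of_real (delta_fun \<gamma> k z) * pdx f z"
    "pdy (sop \<gamma> (GD k) f) z = of_real (pdy (delta_fun \<gamma> k) z) * f z + of_real (delta_fun \<gamma> k z) * pdy f z"
proof -
  have e: "pdx (sop \<gamma> (GD k) f) z = pdx (\<lambda>z. of_real (delta_fun \<gamma> k z) * f z) z"
    "pdy (sop \<gamma> (GD k) f) z = pdy (\<lambda>z. of_real (delta_fun \<gamma> k z) * f z) z"
    by (rule pdxy_cong[OF open_S z], simp add: sop_S)+
  note d = smooth_diffable[OF smooth_delta_fun z]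
  show "pdx (sop \<gamma> (GD k) f) z = of_real (pdx (delta_fun \<gamma> k) z) * f z + of_real (delta_fun \<gamma> k z) * pdx f z"
    "pdy (sop \<gamma> (GD k) f) z = of_real (pdy (delta_fun \<gamma> k) z) * f z + of_real (delta_fun \<gamma> k z) * pdy f z"
    unfolding e pdxy_mult[OF pdxy_of_real(3)[OF d] VA_diff[OF f z]] pdxy_of_real[OF d] by auto
qed

lemma sop_YD: assumes f: "f \<in> VA \<gamma>" shows "sop \<gamma> GY (sop \<gamma> (GD k) f) = sop \<gamma> (GD k) (sop \<gamma> GY f) + of_nat (Suc k) *\<^sub>C sop \<gamma> (GD k) f"
proof
  fix z
  show "sop \<gamma> GY (sop \<gamma> (GD k) f) z = (sop \<gamma> (GD k) (sop \<gamma> GY f) + of_nat (Suc k) *\<^sub>C sop \<gamma> (GD k) f) z"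
  proof (cases "z \<in> S")
    case True
    have "of_real (snd z) * of_real (pdy (delta_fun \<gamma> k) z) = (- (of_nat (Suc k) * of_real (delta_fun \<gamma> k z)) :: complex)"
      using arg_cong[OF delta_pd(2)[OF True, of k], of complex_of_real] by (simp del: of_nat_Suc)
    then show ?thesis
      by (simp add: sop_S True sop_delta_pd[OF f True] plus_fun_def scaleC_fun_def scaleC_complex_def algebra_simps del: of_nat_Suc)
  qed (simp add: sop_notin plus_fun_def scaleC_fun_def scaleC_complex_def)
qed

lemma sop_XD: assumes f: "f \<in> VA \<gamma>" shows "sop \<gamma> GX (sop \<gamma> (GD k) f) = sop \<gamma> (GD k) (sop \<gamma> GX f) + sop \<gamma> (GD (Suc k)) f"
proof
  fix z
  show "sop \<gamma> GX (sop \<gamma> (GD k) f) z = (sop \<gamma> (GD k) (sop \<gamma> GX f) + sop \<gamma> (GD (Suc k)) f) z"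
  proof (cases "z \<in> S")
    case True
    then have y: "snd z > 0" using S_iff by simp
    show ?thesis using y
      by (simp add: sop_S True sop_delta_pd[OF f True] plus_fun_def delta_pd(1)[OF True] field_simps del: delta_fun.simps)
  qed (simp add: sop_notin plus_fun_def)
qed

lemma sop_DD: "sop \<gamma> (GD k) (sop \<gamma> (GD l) f) = sop \<gamma> (GD l) (sop \<gamma> (GD k) f)"
proof
  show "sop \<gamma> (GD k) (sop \<gamma> (GD l) f) z = sop \<gamma> (GD l) (sop \<gamma> (GD k) f) z" for z
    by (cases "z \<in> S") (simp_all add: sop_S sop_notin)
qed

lemma fact_relator:
  assumes "r \<in> h1_relators" and f: "f \<in> VA \<gamma>"
  shows "facto \<gamma> r f = 0"
  using assms(1)
proof cases
  case YX
  then show ?thesis by (simp add: fact_lin fact_mult f fact_gen sop_YX sop_VA)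
next
  case (YD k)
  have "facto \<gamma> (of_nat (k + 1) * gen (GD k)) f = of_nat (Suc k) *\<^sub>C sop \<gamma> (GD k) f"
    unfolding fact_mult[OF f] fact_gen Suc_eq_plus1 by (rule fact_of_nat[OF sop_VA[OF f]])
  then show ?thesis unfolding YD by (simp add: fact_lin fact_mult f fact_gen sop_YD sop_VA del: of_nat_Suc of_nat_add)
next
  case (XD k)
  then show ?thesis by (simp add: fact_lin fact_mult f fact_gen sop_XD sop_VA)
next
  case (DD k l)
  then show ?thesis by (simp add: fact_lin fact_mult f fact_gen sop_VA sop_DD[of k l])
qed

lemma fact_ideal:
  assumes "p \<in> h1_ideal" and f: "f \<in> VA \<gamma>"
  shows "facto \<gamma> p f = 0"
proof -
  have z: "facto \<gamma> p 0 = 0" for p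
    using fact_linf(2)[OF VA_lin(3), of p 0] by (simp add: cvec.scale_zero_left)
  show ?thesis
    using assms(1) unfolding h1_ideal_def
    by (rule clinear_vanish_span[OF clinear_fact, rotated])
      (auto simp: fact_mult f fact_VA fact_relator z)
qed

text \<open>The relators annihilate \<open>VA \<gamma>\<close>, hence so does the ideal, and the
  action through a chosen representative is the action of the class.\<close>

lemma hact_abs: "f \<in> VA \<gamma> \<Longrightarrow> hact \<gamma> (abs_h1 p) f = facto \<gamma> p f"
proof -
  assume f: "f \<in> VA \<gamma>"
  have "rep_h1 (abs_h1 p) - p \<in> h1_ideal"
    by (rule Quotient_rep_abs[OF Quotient_h1]) (simp add: h1_ideal_def cvec.span_zero)
  from fact_ideal[OF this f] show ?thesis by (simp add: hact_def fact_lin)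
qed

lemma hact_VA: "f \<in> VA \<gamma> \<Longrightarrow> hact \<gamma> h f \<in> VA \<gamma>"
  unfolding hact_def by (rule fact_VA)

context fixes f assumes f: "f \<in> VA \<gamma>" begin

lemma hact_mult: "hact \<gamma> (x * y) f = hact \<gamma> x (hact \<gamma> y f)"
  by (induct x, induct y) (simp add: times_h1.abs_eq hact_abs f fact_mult fact_VA)

lemma hact_one: "hact \<gamma> 1 f = f"
  using fact_of_nat[OF f, of 1] by (simp add: one_h1.abs_eq hact_abs f scaleC_one)

lemma clinear_hact: "clinear (\<lambda>h. hact \<gamma> h f)"
proof (rule clinearI)
  show "hact \<gamma> (x + y) f = hact \<gamma> x f + hact \<gamma> y f" for x y
    by (induct x, induct y) (simp add: plus_h1.abs_eq hact_abs f fact_lin)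
  show "hact \<gamma> (c *\<^sub>C x) f = c *\<^sub>C hact \<gamma> x f" for c x
    by (induct x) (simp add: scaleC_h1.abs_eq hact_abs f fact_lin)
qed

lemma hact_gen: "hact \<gamma> (h1_of g) f = sop \<gamma> g f"
  by (simp add: h1_of.abs_eq hact_abs f fact_gen)

end

lemma hact_linf:
  assumes "f \<in> VA \<gamma>" "f' \<in> VA \<gamma>"
  shows "hact \<gamma> h (f + f') = hact \<gamma> h f + hact \<gamma> h f'" "hact \<gamma> h (c *\<^sub>C f) = c *\<^sub>C hact \<gamma> h f"
  unfolding hact_def using assms by (simp_all only: fact_linf)

end

section \<open>Closed supports and the action on the crossed product\<close>

definition CS :: "(real \<rightharpoonup> real) \<Rightarrow> (pt \<Rightarrow> complex) set" where
  "CS \<gamma> = {f \<in> VA \<gamma>. closure {z. f z \<noteq> 0} \<subseteq> ran (lift \<gamma>)}"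

lemma Cc_CS: "f \<in> Cc_smooth (ran (lift \<gamma>)) \<Longrightarrow> f \<in> CS \<gamma>"
  using closure_subset[of "{z. f z \<noteq> 0}"] smooth_subset[of UNIV f "ran (lift \<gamma>)"]
  by (auto simp: CS_def VA_def Cc_smooth_def)

context ldiff begin

lemma gen_op_off:
  assumes "z \<notin> closure {z. f z \<noteq> 0}"
  shows "gen_op g \<gamma> f z = 0"
proof -
  define C where "C = closure {z. f z \<noteq> 0}"
  have o: "open (- C)" unfolding C_def by (rule open_Compl[OF closed_closure])
  have z: "z \<in> - C" using assms unfolding C_def by simp
  have sub: "{z. f z \<noteq> 0} \<subseteq> C" unfolding C_def by (rule closure_subset)
  have f0: "f w = 0" if "w \<in> - C" for w
  proof (rule ccontr)
    assume "f w \<noteq> 0"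
    then have "w \<in> C" by (intro subsetD[OF sub] CollectI)
    with that show False by simp
  qed
  have "pdx f z = pdx (\<lambda>_. 0) z" "pdy f z = pdy (\<lambda>_. 0) z"
    by (rule pdxy_cong(1)[OF o z f0], assumption) (rule pdxy_cong(2)[OF o z f0], assumption)
  then show ?thesis using f0[OF z] by (cases z, cases g) (simp_all add: pdxy_const)
qed

lemma gen_op_sop: assumes "f \<in> CS \<gamma>" shows "gen_op g \<gamma> f = sop \<gamma> g f"
proof
  fix z
  have c: "closure {z. f z \<noteq> 0} \<subseteq> S" using assms by (simp only: CS_def mem_Collect_eq)
  show "gen_op g \<gamma> f z = sop \<gamma> g f z"
  proof (cases "z \<in> S")
    case True
    then show ?thesis by (simp only: sop_def if_True)
  next
    case False
    then have "z \<notin> closure {z. f z \<noteq> 0}" by (rule contra_subsetD[OF c])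
    from gen_op_off[OF this] False show ?thesis by (simp only: sop_def if_False)
  qed
qed

lemma sop_CS: assumes f: "f \<in> CS \<gamma>" shows "sop \<gamma> g f \<in> CS \<gamma>"
proof -
  have c: "closure {z. f z \<noteq> 0} \<subseteq> S" and v: "f \<in> VA \<gamma>" using f by (simp_all only: CS_def mem_Collect_eq)
  have "{z. sop \<gamma> g f z \<noteq> 0} \<subseteq> closure {z. f z \<noteq> 0}"
  proof
    fix z assume "z \<in> {z. sop \<gamma> g f z \<noteq> 0}"
    then have "gen_op g \<gamma> f z \<noteq> 0" by (simp only: gen_op_sop[OF f] mem_Collect_eq not_False_eq_True)
    then show "z \<in> closure {z. f z \<noteq> 0}" using gen_op_off by blast
  qed
  then have "closure {z. sop \<gamma> g f z \<noteq> 0} \<subseteq> closure {z. f z \<noteq> 0}"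
    by (rule closure_minimal) (rule closed_closure)
  then have "closure {z. sop \<gamma> g f z \<noteq> 0} \<subseteq> S" using c by (rule order_trans)
  with sop_VA[OF v] show ?thesis by (simp only: CS_def mem_Collect_eq simp_thms)
qed

lemma wd_CS: "f \<in> CS \<gamma> \<Longrightarrow> wd w f \<in> CS \<gamma>"
  by (induction w) (auto intro: sop_CS)

lemma gen_act_cmon: "f \<in> CS \<gamma> \<Longrightarrow> gen_act g (cmon f \<gamma>) = cmon (sop \<gamma> g f) \<gamma>"
  using gen_op_sop[of f g] by (cases "f = 0") (simp_all add: gen_act_def sop_zero)

lemma foldr_gen_act: "f \<in> CS \<gamma> \<Longrightarrow> foldr gen_act w (cmon f \<gamma>) = cmon (wd w f) \<gamma>"
  by (induction w) (simp_all add: gen_act_cmon wd_CS)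

lemma h1_act_cmon: "f \<in> CS \<gamma> \<Longrightarrow> h1_act h (cmon f \<gamma>) = cmon (hact \<gamma> h f) \<gamma>"
proof -
  assume f: "f \<in> CS \<gamma>"
  have "free_extend (\<lambda>w. foldr gen_act (letters w) (cmon f \<gamma>)) p = cmon (facto \<gamma> p f) \<gamma>" for p
    by (simp add: free_extend_def facto_def foldr_gen_act[OF f] clinear_sum[OF clinear_single] clinear_scale[OF clinear_single])
  then show ?thesis by (simp add: h1_act_def hact_def)
qed

end

lemma fun_act_lin: "fun_act \<gamma> (f + g) z = fun_act \<gamma> f z + fun_act \<gamma> g z" "fun_act \<gamma> (c *\<^sub>C f) z = c * fun_act \<gamma> f z"
  "fun_act \<gamma> 0 z = 0"
  by (auto simp: fun_act_def scaleC_fun_def scaleC_complex_def split: option.split)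

lemma cmult_superset:
  assumes "finite A" "Poly_Mapping.keys a \<subseteq> A" "finite B" "Poly_Mapping.keys b \<subseteq> B"
  shows "cmult a b = (\<Sum>\<alpha>\<in>A. \<Sum>\<beta>\<in>B.
     cmon (\<lambda>z. Poly_Mapping.lookup a \<alpha> z * fun_act \<alpha> (Poly_Mapping.lookup b \<beta>) z) (\<alpha> \<circ>\<^sub>m \<beta>))"
proof -
  have z: "(\<lambda>z. 0) = (0 :: pt \<Rightarrow> complex)" by auto
  have "cmult a b = (\<Sum>\<alpha>\<in>Poly_Mapping.keys a. \<Sum>\<beta>\<in>B.
     cmon (\<lambda>z. Poly_Mapping.lookup a \<alpha> z * fun_act \<alpha> (Poly_Mapping.lookup b \<beta>) z) (\<alpha> \<circ>\<^sub>m \<beta>))"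
    unfolding cmult_def
    by (intro sum.cong refl sum.mono_neutral_left assms) (auto simp: in_keys_iff fun_act_lin z)
  also have "\<dots> = (\<Sum>\<alpha>\<in>A. \<Sum>\<beta>\<in>B.
     cmon (\<lambda>z. Poly_Mapping.lookup a \<alpha> z * fun_act \<alpha> (Poly_Mapping.lookup b \<beta>) z) (\<alpha> \<circ>\<^sub>m \<beta>))"
    by (intro sum.mono_neutral_left assms) (auto simp: in_keys_iff z)
  finally show ?thesis .
qed

lemma cmult_cmon: "cmult (cmon f \<alpha>) (cmon g \<beta>) = cmon (\<lambda>z. f z * fun_act \<alpha> g z) (\<alpha> \<circ>\<^sub>m \<beta>)"
  by (subst cmult_superset[of "{\<alpha>}" _ "{\<beta>}"]) auto

lemma cbilinear_cmult: "cbilinear cmult"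
proof (intro cbilinearI clinearI)
  fix a b c :: crossed and r
  let ?A = "Poly_Mapping.keys a \<union> Poly_Mapping.keys b \<union> Poly_Mapping.keys c"
  have k: "Poly_Mapping.keys (r *\<^sub>C b) \<subseteq> ?A" "Poly_Mapping.keys (a + b) \<subseteq> ?A" "Poly_Mapping.keys (b + c) \<subseteq> ?A"
    using keys_add[of a b] keys_add[of b c] by (auto simp: in_keys_iff cvec.scale_zero_right dest: subsetD)
  have k': "Poly_Mapping.keys a \<subseteq> ?A" "Poly_Mapping.keys b \<subseteq> ?A" "Poly_Mapping.keys c \<subseteq> ?A" "finite ?A" by auto
  have add: "cmon (\<lambda>z. F z + G z) \<alpha> = cmon F \<alpha> + cmon G \<alpha>" for F G :: "pt \<Rightarrow> complex" and \<alpha>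
    using clinear_add[OF clinear_single, of \<alpha> F G] by (simp add: plus_fun_def)
  have scale: "cmon (\<lambda>z. r * F z) \<alpha> = r *\<^sub>C cmon F \<alpha>" for F :: "pt \<Rightarrow> complex" and \<alpha>
    using clinear_scale[OF clinear_single, of \<alpha> r F] by (simp add: scaleC_fun_def scaleC_complex_def)
  note cs = cmult_superset[OF k'(4) _ k'(4)]
  show "cmult a (b + c) = cmult a b + cmult a c"
    by (simp add: cs k k' lookup_add fun_act_lin distrib_left add sum.distrib)
  show "cmult (a + b) c = cmult a c + cmult b c"
    by (simp add: cs k k' lookup_add distrib_right add sum.distrib)
  show "cmult a (r *\<^sub>C b) = r *\<^sub>C cmult a b"
    by (simp add: cs k k' fun_act_lin mult.left_commute[of _ r] scale cvec.scale_sum_right)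
  show "cmult (r *\<^sub>C b) c = r *\<^sub>C cmult b c"
    by (simp add: cs k k' scaleC_fun_def scaleC_complex_def mult.assoc scale cvec.scale_sum_right)
qed

section \<open>Composition of diffeomorphisms and the module algebra property\<close>

locale ldiff2 = A: ldiff \<alpha> + B: ldiff \<beta> + AB: ldiff "\<alpha> \<circ>\<^sub>m \<beta>" for \<alpha> \<beta>
begin

lemma map_comp_ran: "\<alpha> s = Some x \<Longrightarrow> \<beta> t = Some s \<Longrightarrow> (\<alpha> \<circ>\<^sub>m \<beta>) t = Some x"
  by (simp add: map_comp_def)

lemma ran_AB: "x \<in> ran (\<alpha> \<circ>\<^sub>m \<beta>) \<longleftrightarrow> x \<in> ran \<alpha> \<and> ps \<alpha> x \<in> ran \<beta>"
proof
  assume "x \<in> ran (\<alpha> \<circ>\<^sub>m \<beta>)"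
  then obtain t where "(\<alpha> \<circ>\<^sub>m \<beta>) t = Some x" by (auto simp: ran_def)
  then obtain s where s: "\<beta> t = Some s" "\<alpha> s = Some x" unfolding map_comp_Some_iff by (elim exE conjE)
  have "ps \<alpha> x = s" using A.ps_the[OF domI, OF s(2)] s(2) by (simp only: option.sel)
  with ranI[of \<beta> t s, OF s(1)] ranI[of \<alpha> s x, OF s(2)] show "x \<in> ran \<alpha> \<and> ps \<alpha> x \<in> ran \<beta>" by simp
next
  assume x: "x \<in> ran \<alpha> \<and> ps \<alpha> x \<in> ran \<beta>"
  from x obtain t where "\<beta> t = Some (ps \<alpha> x)" by (auto simp: ran_def)
  from ranI[of "\<alpha> \<circ>\<^sub>m \<beta>", OF map_comp_ran[OF A.ps_ran this]] x show "x \<in> ran (\<alpha> \<circ>\<^sub>m \<beta>)" by simp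
qed

lemma ps_AB: assumes "x \<in> ran (\<alpha> \<circ>\<^sub>m \<beta>)" shows "ps (\<alpha> \<circ>\<^sub>m \<beta>) x = ps \<beta> (ps \<alpha> x)"
proof -
  have x: "x \<in> ran \<alpha>" "ps \<alpha> x \<in> ran \<beta>" using assms unfolding ran_AB by simp_all
  show ?thesis by (rule AB.inj[OF AB.ps_ran[OF assms] map_comp_ran[OF A.ps_ran[OF x(1)] B.ps_ran[OF x(2)]]])
qed

lemma ps_AB': assumes x: "x \<in> ran (\<alpha> \<circ>\<^sub>m \<beta>)"
  shows "deriv (ps (\<alpha> \<circ>\<^sub>m \<beta>)) x = deriv (ps \<beta>) (ps \<alpha> x) * deriv (ps \<alpha>) x"
proof -
  have "((\<lambda>x. ps \<beta> (ps \<alpha> x)) has_real_derivative deriv (ps \<beta>) (ps \<alpha> x) * deriv (ps \<alpha>) x) (at x)"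
    by (rule DERIV_chain2[OF B.ps_deriv A.ps_deriv]) (use x ran_AB in auto)
  then have "(ps (\<alpha> \<circ>\<^sub>m \<beta>) has_real_derivative deriv (ps \<beta>) (ps \<alpha> x) * deriv (ps \<alpha>) x) (at x)"
    by (rule has_field_derivative_transform_within_open[OF _ AB.open_ran x]) (simp add: ps_AB)
  then show ?thesis by (rule DERIV_imp_deriv)
qed

lemma lnd_AB: assumes x: "x \<in> ran (\<alpha> \<circ>\<^sub>m \<beta>)"
  shows "lnd (\<alpha> \<circ>\<^sub>m \<beta>) x = lnd \<alpha> x + deriv (ps \<alpha>) x * lnd \<beta> (ps \<alpha> x)"
proof -
  have xa: "x \<in> ran \<alpha>" "ps \<alpha> x \<in> ran \<beta>" using x ran_AB by auto
  have "((\<lambda>x. deriv (ps \<beta>) (ps \<alpha> x) * deriv (ps \<alpha>) x) has_real_derivative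
      deriv (deriv (ps \<beta>)) (ps \<alpha> x) * deriv (ps \<alpha>) x * deriv (ps \<alpha>) x + deriv (deriv (ps \<alpha>)) x * deriv (ps \<beta>) (ps \<alpha> x)) (at x)"
    by (intro DERIV_mult DERIV_chain2[OF _ A.ps_deriv[OF xa(1)]] smooth_deriv(2)[OF B.open_ran B.smooth_ps' xa(2)]
       smooth_deriv(2)[OF A.open_ran A.smooth_ps' xa(1)])
  then have "(deriv (ps (\<alpha> \<circ>\<^sub>m \<beta>)) has_real_derivative
      deriv (deriv (ps \<beta>)) (ps \<alpha> x) * deriv (ps \<alpha>) x * deriv (ps \<alpha>) x + deriv (deriv (ps \<alpha>)) x * deriv (ps \<beta>) (ps \<alpha> x)) (at x)"
    by (rule has_field_derivative_transform_within_open[OF _ AB.open_ran x]) (simp add: ps_AB')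
  then have "deriv (deriv (ps (\<alpha> \<circ>\<^sub>m \<beta>))) x =
      deriv (deriv (ps \<beta>)) (ps \<alpha> x) * deriv (ps \<alpha>) x * deriv (ps \<alpha>) x + deriv (deriv (ps \<alpha>)) x * deriv (ps \<beta>) (ps \<alpha> x)"
    by (rule DERIV_imp_deriv)
  then show ?thesis
    using A.ps'_pos[OF xa(1)] B.ps'_pos[OF xa(2)]
    by (simp add: AB.lnd_eq[OF x] A.lnd_eq[OF xa(1)] B.lnd_eq[OF xa(2)] ps_AB'[OF x] field_simps)
qed

lemma S_AB: "z \<in> AB.S \<longleftrightarrow> z \<in> A.S \<and> phi \<alpha> z \<in> B.S"
  using A.ps'_pos[of "fst z"] by (auto simp: A.S_iff B.S_iff AB.S_iff ran_AB phi_def zero_less_divide_iff)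

lemma phi_AB: "z \<in> AB.S \<Longrightarrow> phi (\<alpha> \<circ>\<^sub>m \<beta>) z = phi \<beta> (phi \<alpha> z)"
  by (simp add: AB.S_iff phi_def ps_AB ps_AB' field_simps)

lemma delta0_AB: "z \<in> AB.S \<Longrightarrow> delta_fun (\<alpha> \<circ>\<^sub>m \<beta>) 0 z = delta_fun \<alpha> 0 z + delta_fun \<beta> 0 (phi \<alpha> z)"
proof -
  assume z: "z \<in> AB.S"
  then have z': "z \<in> A.S" "phi \<alpha> z \<in> B.S" using S_AB by auto
  have p: "deriv (ps \<alpha>) (fst z) > 0" "snd z > 0" using z' A.S_iff A.ps'_pos by auto
  show ?thesis
    unfolding A.delta_fun_eq[OF z'(1)] B.delta_fun_eq[OF z'(2)] AB.delta_fun_eq[OF z]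
    using p z AB.S_iff by (simp add: lnd_AB phi_def field_simps)
qed

definition FF :: "(pt \<Rightarrow> complex) \<Rightarrow> (pt \<Rightarrow> complex) \<Rightarrow> pt \<Rightarrow> complex" where
  "FF f g z = f z * fun_act \<alpha> g z"

lemma FF_S: "z \<in> AB.S \<Longrightarrow> FF f g z = f z * g (phi \<alpha> z)"
  by (simp add: FF_def A.fun_act_eq S_AB)

lemma FF_off: "f \<in> VA \<alpha> \<Longrightarrow> g \<in> VA \<beta> \<Longrightarrow> z \<notin> AB.S \<Longrightarrow> FF f g z = 0"
  by (auto simp: FF_def A.fun_act_eq S_AB VA_def simp del: split_paired_All)

lemma smooth_phi_AB: "smooth_on AB.S (phi \<alpha>)"
  by (rule smooth_subset[OF A.smooth_phi]) (use S_AB in auto)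

lemma FF_VA: assumes "f \<in> VA \<alpha>" "g \<in> VA \<beta>" shows "FF f g \<in> VA (\<alpha> \<circ>\<^sub>m \<beta>)"
proof -
  have f: "smooth_on A.S f" and g: "smooth_on B.S g" using assms by (simp_all only: VA_def mem_Collect_eq)
  have sub: "AB.S \<subseteq> A.S" and im: "phi \<alpha> ` AB.S \<subseteq> B.S" using S_AB by blast+
  have "smooth_on AB.S (\<lambda>z. f z * g (phi \<alpha> z))"
    by (rule smooth_mult[OF AB.open_S smooth_subset[OF f sub] smooth_comp[OF AB.open_S B.open_S smooth_phi_AB g im]])
  then have "smooth_on AB.S (FF f g)" by (rule smooth_cong[OF AB.open_S, rotated]) (simp add: FF_S)
  then show ?thesis using FF_off[OF assms] by (simp add: VA_def del: split_paired_All)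
qed

lemma FF_lin: "FF (f + f') g = FF f g + FF f' g" "FF (c *\<^sub>C f) g = c *\<^sub>C FF f g"
  "FF f (g + g') = FF f g + FF f g'" "FF f (c *\<^sub>C g) = c *\<^sub>C FF f g"
proof -
  have sc: "(c *\<^sub>C h) x = c * h x" for h :: "pt \<Rightarrow> complex" and x by (simp add: scaleC_fun_def scaleC_complex_def)
  show "FF (f + f') g = FF f g + FF f' g" "FF (c *\<^sub>C f) g = c *\<^sub>C FF f g"
    "FF f (g + g') = FF f g + FF f g'" "FF f (c *\<^sub>C g) = c *\<^sub>C FF f g"
    by (rule ext, simp only: FF_def fun_act_lin plus_fun_apply sc distrib_left distrib_right mult.assoc mult.left_commute)+
qed

lemma clinear_FF_right: "clinear (FF f)" and clinear_FF_left: "clinear (\<lambda>f. FF f g)"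
  by (rule clinearI; rule FF_lin)+

lemma FF_pd:
  assumes f: "f \<in> VA \<alpha>" and g: "g \<in> VA \<beta>" and z: "z \<in> AB.S"
  shows "pdx (FF f g) z = pdx f z * g (phi \<alpha> z) + f z * pdx (\<lambda>z. g (phi \<alpha> z)) z"
    "pdy (FF f g) z = pdy f z * g (phi \<alpha> z) + f z * pdy (\<lambda>z. g (phi \<alpha> z)) z"
proof -
  have z': "z \<in> A.S" "phi \<alpha> z \<in> B.S" using z S_AB by auto
  have e: "pdx (FF f g) z = pdx (\<lambda>z. f z * g (phi \<alpha> z)) z" "pdy (FF f g) z = pdy (\<lambda>z. f z * g (phi \<alpha> z)) z"
    by (rule pdxy_cong[OF AB.open_S z], simp add: FF_S)+
  show "pdx (FF f g) z = pdx f z * g (phi \<alpha> z) + f z * pdx (\<lambda>z. g (phi \<alpha> z)) z"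
    "pdy (FF f g) z = pdy f z * g (phi \<alpha> z) + f z * pdy (\<lambda>z. g (phi \<alpha> z)) z"
    unfolding e by (intro pdxy_mult A.VA_diff[OF f z'(1)] A.fun_act_pd(3)[OF z'(1) B.VA_diff[OF g z'(2)]])+
qed

text \<open>The second coordinate of the inverse lift is y divided by the derivative of the inverse
  map at x. Differentiating it in x brings in the y-derivative of g with the logarithmic derivative
  as factor; this is the term delta_1 (x) Y of the coproduct.\<close>

lemma FF_X:
  assumes f: "f \<in> VA \<alpha>" and g: "g \<in> VA \<beta>"
  shows "sop (\<alpha> \<circ>\<^sub>m \<beta>) GX (FF f g) = FF (sop \<alpha> GX f) g + FF f (sop \<beta> GX g) + FF (sop \<alpha> (GD 0) f) (sop \<beta> GY g)"
proof
  fix z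
  show "sop (\<alpha> \<circ>\<^sub>m \<beta>) GX (FF f g) z = (FF (sop \<alpha> GX f) g + FF f (sop \<beta> GX g) + FF (sop \<alpha> (GD 0) f) (sop \<beta> GY g)) z"
  proof (cases "z \<in> AB.S")
    case True
    then have z: "z \<in> A.S" "phi \<alpha> z \<in> B.S" using S_AB by auto
    have p: "deriv (ps \<alpha>) (fst z) > 0" "snd z > 0" "fst z \<in> ran \<alpha>" using z A.S_iff A.ps'_pos by auto
    have n: "complex_of_real (deriv (ps \<alpha>) (fst z)) \<noteq> 0" "complex_of_real (snd z) \<noteq> 0" using p by auto
    have s: "snd (phi \<alpha> z) = snd z / deriv (ps \<alpha>) (fst z)" by (simp add: phi_def)
    show ?thesis
      using n by (simp add: AB.sop_S[OF True] A.sop_S[OF z(1)] B.sop_S[OF z(2)] FF_S[OF True] FF_pd[OF f g True]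
          A.fun_act_pd[OF z(1) B.VA_diff[OF g z(2)]] s A.delta_fun_eq[OF z(1), of 0, simplified] A.lnd_eq[OF p(3)]
          field_simps power2_eq_square)
  qed (simp add: AB.sop_notin FF_off f g A.sop_VA B.sop_VA)
qed

lemma FF_Y:
  assumes f: "f \<in> VA \<alpha>" and g: "g \<in> VA \<beta>"
  shows "sop (\<alpha> \<circ>\<^sub>m \<beta>) GY (FF f g) = FF (sop \<alpha> GY f) g + FF f (sop \<beta> GY g)"
proof
  fix z
  show "sop (\<alpha> \<circ>\<^sub>m \<beta>) GY (FF f g) z = (FF (sop \<alpha> GY f) g + FF f (sop \<beta> GY g)) z"
  proof (cases "z \<in> AB.S")
    case True
    then have z: "z \<in> A.S" "phi \<alpha> z \<in> B.S" using S_AB by auto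
    have s: "snd (phi \<alpha> z) = snd z / deriv (ps \<alpha>) (fst z)" by (simp add: phi_def)
    show ?thesis
      by (simp add: AB.sop_S[OF True] A.sop_S[OF z(1)] B.sop_S[OF z(2)] FF_S[OF True] FF_pd[OF f g True]
          A.fun_act_pd[OF z(1) B.VA_diff[OF g z(2)]] s algebra_simps)
  qed (simp add: AB.sop_notin FF_off f g A.sop_VA B.sop_VA)
qed

lemma FF_D:
  assumes f: "f \<in> VA \<alpha>" and g: "g \<in> VA \<beta>"
  shows "sop (\<alpha> \<circ>\<^sub>m \<beta>) (GD 0) (FF f g) = FF (sop \<alpha> (GD 0) f) g + FF f (sop \<beta> (GD 0) g)"
proof
  fix z
  show "sop (\<alpha> \<circ>\<^sub>m \<beta>) (GD 0) (FF f g) z = (FF (sop \<alpha> (GD 0) f) g + FF f (sop \<beta> (GD 0) g)) z"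
  proof (cases "z \<in> AB.S")
    case True
    then have z: "z \<in> A.S" "phi \<alpha> z \<in> B.S" using S_AB by auto
    show ?thesis
      by (simp add: AB.sop_S[OF True] A.sop_S[OF z(1)] B.sop_S[OF z(2)] FF_S[OF True] delta0_AB[OF True] algebra_simps
          del: delta_fun.simps)
  qed (simp add: AB.sop_notin FF_off f g A.sop_VA B.sop_VA)
qed

definition m2 :: "(pt \<Rightarrow> complex) \<Rightarrow> (pt \<Rightarrow> complex) \<Rightarrow> (h1, h1) tensor \<Rightarrow> pt \<Rightarrow> complex" where
  "m2 f g t = tensor_lift (\<lambda>h k. FF (hact \<alpha> h f) (hact \<beta> k g)) t"

context
  fixes f g assumes f: "f \<in> VA \<alpha>" and g: "g \<in> VA \<beta>"
begin

lemma cbilinear_m2: "cbilinear (\<lambda>h k. FF (hact \<alpha> h f) (hact \<beta> k g))"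
  by (rule cbilinearI)
    (rule clinear_comp[OF clinear_FF_right B.clinear_hact[OF g]] clinear_comp[OF clinear_FF_left A.clinear_hact[OF f]])+

lemma clinear_m2: "clinear (m2 f g)"
  unfolding m2_def[abs_def] by (rule clinear_tensor_lift[OF cbilinear_m2])

lemmas m2_lin = clinear_add[OF clinear_m2] clinear_scale[OF clinear_m2] clinear_sum[OF clinear_m2] clinear_zero[OF clinear_m2]

lemma m2_mk: "m2 f g (h \<otimes> k) = FF (hact \<alpha> h f) (hact \<beta> k g)"
  by (simp add: m2_def tensor_lift_mk[OF cbilinear_m2])

lemma m2_VA: "m2 f g t \<in> VA (\<alpha> \<circ>\<^sub>m \<beta>)"
proof (induction t rule: tensor_induct)
  case (mk a b)
  show ?case unfolding m2_mk by (intro FF_VA A.hact_VA B.hact_VA f g)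
next
  case (add s t)
  show ?case unfolding m2_lin(1) by (rule VA_lin(1)[OF AB.ld add])
qed

text \<open>The crossed product is a module algebra: h acts on a product through its coproduct. It
  suffices to check X, Y and delta_1, where it is the product rule (\<open>FF_X\<close>,
  \<open>FF_Y\<close>) and the cocycle property of delta_1 (\<open>FF_D\<close>).\<close>

lemma m2_coproduct: "hact (\<alpha> \<circ>\<^sub>m \<beta>) h (m2 f g t) = m2 f g (coproduct h * t)"
proof (induction h arbitrary: t rule: h1_induct)
  case one
  show ?case by (simp add: AB.hact_one m2_VA coproduct_simps)
next
  case X
  show ?case
  proof (induction t rule: tensor_induct)
    case (mk a b)
    show ?case
      by (simp add: m2_mk AB.hact_gen FF_VA A.hact_VA B.hact_VA f g FF_X coproduct_simps distrib_right tensor_times_mk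
          m2_lin A.hact_mult B.hact_mult A.hact_gen B.hact_gen hdelta_def)
  next
    case (add s t)
    then show ?case by (simp only: m2_lin(1) AB.hact_linf(1)[OF m2_VA m2_VA] distrib_left)
  qed
next
  case Y
  show ?case
  proof (induction t rule: tensor_induct)
    case (mk a b)
    show ?case
      by (simp add: m2_mk AB.hact_gen FF_VA A.hact_VA B.hact_VA f g FF_Y coproduct_simps distrib_right tensor_times_mk
          m2_lin A.hact_mult B.hact_mult A.hact_gen B.hact_gen)
  next
    case (add s t)
    then show ?case by (simp only: m2_lin(1) AB.hact_linf(1)[OF m2_VA m2_VA] distrib_left)
  qed
next
  case D
  have c: "coproduct (h1_of (GD 0)) = h1_of (GD 0) \<otimes> 1 + 1 \<otimes> h1_of (GD 0)"
    using coproduct_simps(3) by (simp add: hdelta_def)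
  show ?case
  proof (induction t rule: tensor_induct)
    case (mk a b)
    show ?case
      by (simp add: m2_mk AB.hact_gen FF_VA A.hact_VA B.hact_VA f g FF_D c distrib_right tensor_times_mk
          m2_lin A.hact_mult B.hact_mult A.hact_gen B.hact_gen hdelta_def)
  next
    case (add s t)
    then show ?case by (simp only: m2_lin(1) AB.hact_linf(1)[OF m2_VA m2_VA] distrib_left)
  qed
next
  case (add x y)
  then show ?case
    by (simp only: clinear_add[OF AB.clinear_hact[OF m2_VA]] clinear_add[OF clinear_coproduct] distrib_right m2_lin(1))
next
  case (scale c x)
  then show ?case
    by (simp only: clinear_scale[OF AB.clinear_hact[OF m2_VA]] clinear_scale[OF clinear_coproduct] scaleC_mult_left m2_lin(2))
next
  case (mult x y)
  then show ?case
    by (simp only: AB.hact_mult[OF m2_VA] coproduct_simps(5) mult.assoc)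
qed

end

lemma cm_h1_act2:
  assumes f: "f \<in> CS \<alpha>" and g: "g \<in> CS \<beta>"
  shows "cm (h1_act2 t (cmon f \<alpha>) (cmon g \<beta>)) = cmon (m2 f g t) (\<alpha> \<circ>\<^sub>m \<beta>)"
proof -
  have fg: "f \<in> VA \<alpha>" "g \<in> VA \<beta>" using f g by (simp_all only: CS_def mem_Collect_eq)
  have B: "cbilinear (\<lambda>h k. h1_act h (cmon f \<alpha>) \<otimes> h1_act k (cmon g \<beta>))"
    unfolding A.h1_act_cmon[OF f] B.h1_act_cmon[OF g]
    by (rule cbilinearI)
      (rule clinear_comp[OF clinear_mk1 clinear_comp[OF clinear_single B.clinear_hact[OF fg(2)]]]
        clinear_comp[OF clinear_mk2 clinear_comp[OF clinear_single A.clinear_hact[OF fg(1)]]])+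
  have cm: "clinear cm" using clinear_tensor_lift[OF cbilinear_cmult] by (simp add: cm_def)
  have cm_mk: "cm (a \<otimes> b) = cmult a b" for a b by (simp add: cm_def tensor_lift_mk[OF cbilinear_cmult])
  define T where "T = tensor_lift (\<lambda>h k. h1_act h (cmon f \<alpha>) \<otimes> h1_act k (cmon g \<beta>))"
  have T: "clinear T" and T_mk: "T (h \<otimes> k) = h1_act h (cmon f \<alpha>) \<otimes> h1_act k (cmon g \<beta>)" for h k
    unfolding T_def by (rule clinear_tensor_lift[OF B], rule tensor_lift_mk[OF B])
  have "cm (T t) = cmon (m2 f g t) (\<alpha> \<circ>\<^sub>m \<beta>)"
  proof (induction t rule: tensor_induct)
    case (mk h k)
    show ?case
      unfolding T_mk cm_mk A.h1_act_cmon[OF f] B.h1_act_cmon[OF g] cmult_cmon m2_mk[OF fg] FF_def[abs_def] ..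
  next
    case (add s t)
    show ?case
      unfolding clinear_add[OF T] clinear_add[OF cm] m2_lin(1)[OF fg] add by (rule single_add[symmetric])
  qed
  then show ?thesis by (simp only: h1_act2_def T_def)
qed

end

declare split_paired_All [simp del] split_paired_Ex [simp del]

section \<open>Sections of the Weyl bundle in the invariant frame\<close>

abbreviation yc :: "pt \<Rightarrow> complex" where "yc z \<equiv> of_real (snd z)"

type_synonym fpol = "(pt \<Rightarrow> complex) pol"

definition cf :: "(nat \<Rightarrow> fpol) \<Rightarrow> int \<Rightarrow> nat \<Rightarrow> nat \<Rightarrow> pt \<Rightarrow> complex" where
  "cf A i m n = (if 0 \<le> i then Poly_Mapping.lookup (A (nat i)) (m, n) else 0)"

text \<open>The section whose components by total degree, in the coordinates yu and v/y, are the
  polynomials A. The shift e reads A at a degree higher by e, as needed after a fibre derivative (e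
  = 1), a division by hbar (e = 2) or a multiplication by u or v (e = -1).\<close>

definition secs :: "int \<Rightarrow> (nat \<Rightarrow> fpol) \<Rightarrow> wsec" where
  "secs e A z k m n = cf A (2 * k + int m + int n + e) m n z * yc z ^ m / yc z ^ n"

abbreviation sec :: "(nat \<Rightarrow> fpol) \<Rightarrow> wsec" where "sec \<equiv> secs 0"

definition vl :: "'c::cvector set \<Rightarrow> 'c pol \<Rightarrow> bool" where "vl V p \<longleftrightarrow> (\<forall>k. Poly_Mapping.lookup p k \<in> V)"

definition gd :: "(real \<rightharpoonup> real) \<Rightarrow> (nat \<Rightarrow> fpol) \<Rightarrow> bool" where
  "gd \<gamma> A \<longleftrightarrow> (\<forall>N. vl (VA \<gamma>) (A N)) \<and> par A"

lemma gd_vl: "gd \<gamma> A \<Longrightarrow> vl (VA \<gamma>) (A N)" and gd_par: "gd \<gamma> A \<Longrightarrow> par A"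
  by (simp_all add: gd_def)

lemma gd_lookup: "gd \<gamma> A \<Longrightarrow> Poly_Mapping.lookup (A N) k \<in> VA \<gamma>"
  by (simp add: gd_def vl_def)

lemma VA_off: "f \<in> VA \<gamma> \<Longrightarrow> z \<notin> ran (lift \<gamma>) \<Longrightarrow> f z = 0"
  unfolding VA_def by blast

lemma subspace_VA: "local_diffeo \<gamma> \<Longrightarrow> cvec.subspace (VA \<gamma>)"
  by (rule cvec.subspaceI) (rule VA_lin; assumption)+

lemma par_iff: "par a \<longleftrightarrow> (\<forall>N k. odd (N + fst k + snd k) \<longrightarrow> Poly_Mapping.lookup (a N) k = 0)"
proof
  assume *: "\<forall>N k. odd (N + fst k + snd k) \<longrightarrow> Poly_Mapping.lookup (a N) k = 0"
  show "par a" unfolding par_def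
  proof (intro allI poly_mapping_eqI)
    fix N k
    show "Poly_Mapping.lookup (sg (a N)) k = Poly_Mapping.lookup ((- 1) ^ N *\<^sub>C a N) k"
    proof (cases "odd (N + fst k + snd k)")
      case True
      with * have "Poly_Mapping.lookup (a N) k = 0" by blast
      then show ?thesis by simp
    next
      case False
      then have "(- 1 :: complex) ^ (fst k + snd k) = (- 1) ^ N" by (auto simp: minus_one_power_iff)
      then show ?thesis by simp
    qed
  qed
qed (blast intro: par_lookup)

context
  fixes V :: "'c::cvector set"
  assumes V: "cvec.subspace V"
begin

lemmas V_rules = cvec.subspace_0[OF V] cvec.subspace_add[OF V] cvec.subspace_diff[OF V] cvec.subspace_scale[OF V] cvec.subspace_neg[OF V]

lemma vl_zero: "vl V 0" and vl_add: "vl V p \<Longrightarrow> vl V q \<Longrightarrow> vl V (p + q)" and vl_diff: "vl V p \<Longrightarrow> vl V q \<Longrightarrow> vl V (p - q)"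
  and vl_scale: "vl V p \<Longrightarrow> vl V (c *\<^sub>C p)" and vl_minus: "vl V p \<Longrightarrow> vl V (- p)"
  and vl_du: "vl V p \<Longrightarrow> vl V (du p)" and vl_dv: "vl V p \<Longrightarrow> vl V (dv p)"
  and vl_mu: "vl V p \<Longrightarrow> vl V (mu p)" and vl_mv: "vl V p \<Longrightarrow> vl V (mv p)"
  and vl_single: "x \<in> V \<Longrightarrow> vl V (Poly_Mapping.single k x)"
proof -
  show "vl V 0" by (simp add: vl_def V_rules(1))
  show "vl V (p + q)" "vl V (p - q)" if "vl V p" "vl V q" using that by (simp_all add: vl_def lookup_add lookup_minus V_rules)
  show "vl V (c *\<^sub>C p)" "vl V (- p)" "vl V (du p)" "vl V (dv p)" if "vl V p"
    using that by (simp_all add: vl_def V_rules(4,5))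
  show "vl V (mu p)" "vl V (mv p)" if "vl V p"
    using that by (simp_all add: vl_def V_rules(1) split: nat.split)
  show "vl V (Poly_Mapping.single k x)" if "x \<in> V" using that by (simp add: vl_def lookup_single when_def V_rules(1))
qed

lemma vl_sum: "(\<And>i. i \<in> I \<Longrightarrow> vl V (p i)) \<Longrightarrow> vl V (sum p I)"
  by (induction I rule: infinite_finite_induct) (auto intro: vl_zero vl_add)

lemma vl_mono_v: "vl V p \<Longrightarrow> vl V (mono_v b p)"
  by (induction b arbitrary: p) (auto intro!: vl_add vl_scale vl_du vl_mv)

lemma vl_mono_uv: "vl V p \<Longrightarrow> vl V (mono_uv a b p)"
  by (induction a arbitrary: p) (auto intro!: vl_diff vl_scale vl_dv vl_mu vl_mono_v)

lemma vl_Nop: "vl V p \<Longrightarrow> vl V (Nop p)"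
  unfolding Nop_def by (intro vl_mu vl_dv)

lemma vl_P0: "vl V p \<Longrightarrow> (\<And>x. x \<in> V \<Longrightarrow> X x \<in> V) \<Longrightarrow> clinear X \<Longrightarrow> vl V (P0 X p)"
  unfolding P0_def by (intro vl_diff vl_scale vl_mv vl_du) (auto simp: vl_def)

end

lemma vl_pm: "vl V p \<Longrightarrow> clinear f \<Longrightarrow> (\<And>x. x \<in> V \<Longrightarrow> f x \<in> W) \<Longrightarrow> vl W (pm f p)"
  by (simp add: vl_def)

lemma pm_cong: "clinear f \<Longrightarrow> clinear g \<Longrightarrow> vl V p \<Longrightarrow> (\<And>x. x \<in> V \<Longrightarrow> f x = g x) \<Longrightarrow> pm f p = pm g p"
  by (rule poly_mapping_eqI) (simp add: vl_def)

lemma vl_moy: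
  assumes B: "cbilinear B" and U: "cvec.subspace U" and BU: "\<And>x y. x \<in> V \<Longrightarrow> y \<in> W \<Longrightarrow> B x y \<in> U"
    and p: "vl V p" and q: "vl W q"
  shows "vl U (moy B p q)"
  unfolding moy_def
proof (intro vl_sum[OF U] vl_mono_uv[OF U])
  fix k
  have "Poly_Mapping.lookup p k \<in> V" using p by (simp add: vl_def)
  then show "vl U (pm (B (Poly_Mapping.lookup p k)) q)" using BU by (intro vl_pm[OF q cbilinearD1[OF B]])
qed

lemma vl_conv:
  assumes U: "cvec.subspace U" and "\<And>i. vl V (a i)" "\<And>i. vl W (b i)" "\<And>p q. vl V p \<Longrightarrow> vl W q \<Longrightarrow> vl U (T p q)"
  shows "vl U (conv T a b n)"
  unfolding conv_def by (intro vl_sum[OF U] assms)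

lemma clinear_ev: "clinear (\<lambda>f :: pt \<Rightarrow> complex. f z)"
  by (rule clinearI) (simp_all add: scaleC_fun_def)

lemma cbil_pt: "cbilinear (\<lambda>f g :: pt \<Rightarrow> complex. f * g)"
  by (intro cbilinearI clinearI)
    (simp_all add: algebra_simps times_fun_def plus_fun_def scaleC_fun_def scaleC_complex_def fun_eq_iff)

abbreviation mf :: "fpol \<Rightarrow> fpol \<Rightarrow> fpol" where "mf \<equiv> moy (\<lambda>f g. f * g)"
abbreviation ev :: "pt \<Rightarrow> fpol \<Rightarrow> complex pol" where "ev z \<equiv> pm (\<lambda>f. f z)"

lemma ev_mf: "ev z (mf p q) = mo (ev z p) (ev z q)"
  by (rule moy_nat[OF cbil_pt mo_bil clinear_ev clinear_ev clinear_ev]) simp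

lemma sec_finite: "finite {(k, m, n). 2 * k + int m + int n = d \<and> (\<exists>z. sec A z k m n \<noteq> 0)}"
proof (rule finite_subset)
  show "{(k, m, n). 2 * k + int m + int n = d \<and> (\<exists>z. sec A z k m n \<noteq> 0)}
    \<subseteq> (\<lambda>(m, n). ((d - int m - int n) div 2, m, n)) ` Poly_Mapping.keys (A (nat d))"
  proof clarify
    fix k m n z
    assume "sec A z k m n \<noteq> 0"
    then have "Poly_Mapping.lookup (A (nat (2 * k + int m + int n))) (m, n) \<noteq> 0"
      by (auto simp: secs_def cf_def split: if_splits)
    then have "(m, n) \<in> Poly_Mapping.keys (A (nat (2 * k + int m + int n)))" by (simp add: in_keys_iff)
    then show "(k, m, n) \<in> (\<lambda>(m', n'). ((2 * k + int m + int n - int m' - int n') div 2, m', n')) ` Poly_Mapping.keys (A (nat (2 * k + int m + int n)))"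
      by (rule rev_image_eqI) simp
  qed
qed simp

lemma wp_sec: "wp (sec A z)"
  unfolding wp_def
proof (intro conjI allI impI)
  show "finite {(k, m, n). 2 * k + int m + int n = d \<and> sec A z k m n \<noteq> 0}" for d
    by (rule finite_subset[OF _ sec_finite[of d A]]) auto
qed (simp add: secs_def cf_def)

lemma fs_sec:
  assumes "par A" "snd z \<noteq> 0"
  shows "fs (yc z) (sec A z) N = ev z (A N)"
proof (rule poly_mapping_eqI)
  fix k :: "nat \<times> nat"
  obtain m n where k: "k = (m, n)" by (cases k)
  show "Poly_Mapping.lookup (fs (yc z) (sec A z) N) k = Poly_Mapping.lookup (ev z (A N)) k"
  proof (cases "even (int N - int m - int n)")
    case True
    then have "2 * ((int N - int m - int n) div 2) + int m + int n + 0 = int N" by simp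
    then show ?thesis using True assms(2) by (simp add: k lookup_fs[OF wp_sec] lk_def secs_def cf_def clinear_ev)
  next
    case False
    then have "odd (int N + int m + int n)" by simp
    then have "odd (N + fst k + snd k)" unfolding k by (simp flip: of_nat_add)
    from par_lookup[OF assms(1) this] False show ?thesis by (simp add: k lookup_fs[OF wp_sec] lk_def clinear_ev)
  qed
qed

lemma wp_zero: "wp 0"
proof -
  have "{(k, m, n). 2 * k + int m + int n = d \<and> (0 :: fib) k m n \<noteq> 0} = {}" for d by auto
  then show ?thesis unfolding wp_def by (metis finite.emptyI zero_fun_def)
qed

lemma fs_zero: "fs y 0 N = 0"
proof (rule poly_mapping_eqI, clarify)
  note wp_zero
  then show "Poly_Mapping.lookup (fs y 0 N) (m, n) = Poly_Mapping.lookup 0 (m, n)" for m n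
    by (simp add: lookup_fs lk_def)
qed

lemma moyal_zero: "wp b \<Longrightarrow> moyal 0 b = 0" "wp b \<Longrightarrow> moyal b 0 = 0"
proof -
  assume b: "wp b"
  note z = wp_zero
  have "fs 1 (moyal 0 b) = fs 1 0" "fs 1 (moyal b 0) = fs 1 0"
    by (simp_all add: fs_moyal b z conv_def fs_zero fun_eq_iff moy_lin_left[OF mo_bil] moy_lin_right[OF mo_bil])
  then show "moyal 0 b = 0" "moyal b 0 = 0"
    using fs_inject[of _ 0 1] wp_moyal b z by (metis one_neq_zero)+
qed

lemma secs_off: "(\<And>N k. Poly_Mapping.lookup (A N) k z = 0) \<Longrightarrow> secs e A z = 0"
  by (intro ext) (simp add: secs_def cf_def)

lemma par_conv_mf: "par A \<Longrightarrow> par B \<Longrightarrow> par (conv mf A B)"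
  by (rule par_conv[OF cbilinear_moy[OF cbil_pt] _ _ sg_moy[OF cbil_pt]])

lemma ev_conv_mf: "ev z (conv mf A B N) = conv mo (\<lambda>N. ev z (A N)) (\<lambda>N. ev z (B N)) N"
  unfolding pm_conv[OF clinear_ev] ev_mf unfolding conv_def ..

text \<open>Pointwise this is \<open>fs_moyal\<close>. The rescaling degenerates on the line y = 0,
  but that line lies outside the range and both sides vanish there. The factors may belong to
  different diffeomorphisms, as in the star product.\<close>

lemma sec_mult:
  assumes A: "local_diffeo \<gamma>" "gd \<gamma> A" and B: "local_diffeo \<gamma>'" "gd \<gamma>' B"
  shows "sec A \<star>\<^sub>w sec B = sec (conv mf A B)"
proof
  fix z
  show "(sec A \<star>\<^sub>w sec B) z = sec (conv mf A B) z"
  proof (cases "snd z = 0")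
    case True
    then have z: "z \<notin> ran (lift \<gamma>)" using ldiff.S_iff[OF ldiff.intro[OF A(1)]] by simp
    have a0: "Poly_Mapping.lookup (A N) k z = 0" for N k by (rule VA_off[OF gd_lookup[OF A(2)] z])
    then have "ev z (A N) = 0" for N by (intro poly_mapping_eqI) (simp add: clinear_ev)
    then have "ev z (conv mf A B N) = 0" for N
      unfolding ev_conv_mf unfolding conv_def by (simp add: moy_lin_left[OF mo_bil])
    then have "Poly_Mapping.lookup (conv mf A B N) k z = 0" for N k
      using lookup_pm[OF clinear_ev, of z "conv mf A B N" k] by simp
    then show ?thesis using a0 by (simp add: wmult_def secs_off moyal_zero wp_sec)
  next
    case False
    then have y: "yc z \<noteq> 0" by simp
    show ?thesis unfolding wmult_def
    proof (rule fs_inject[OF wp_moyal[OF wp_sec wp_sec] wp_sec y], rule ext)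
      fix N
      show "fs (yc z) (moyal (sec A z) (sec B z)) N = fs (yc z) (sec (conv mf A B) z) N"
        unfolding fs_moyal[OF wp_sec wp_sec y] fs_sec[OF par_conv_mf[OF gd_par[OF A(2)] gd_par[OF B(2)]] False] ev_conv_mf
        unfolding conv_def fs_sec[OF gd_par[OF A(2)] False] fs_sec[OF gd_par[OF B(2)] False] ..
    qed
  qed
qed

lemma VA_mult: "local_diffeo \<gamma> \<Longrightarrow> f \<in> VA \<gamma> \<Longrightarrow> g \<in> VA \<gamma>' \<Longrightarrow> ran (lift \<gamma>) \<subseteq> ran (lift \<gamma>') \<Longrightarrow> f * g \<in> VA \<gamma>"
proof -
  assume a: "local_diffeo \<gamma>" "f \<in> VA \<gamma>" "g \<in> VA \<gamma>'" "ran (lift \<gamma>) \<subseteq> ran (lift \<gamma>')"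
  have "smooth_on (ran (lift \<gamma>)) f" "smooth_on (ran (lift \<gamma>)) g"
    using a smooth_subset unfolding VA_def by blast+
  from smooth_mult[OF ldiff.open_S[OF ldiff.intro[OF a(1)]] this] a(2) show ?thesis
    by (simp add: VA_def times_fun_def del: split_paired_All)
qed

lemma VA_mult': "local_diffeo \<gamma>' \<Longrightarrow> f \<in> VA \<gamma> \<Longrightarrow> g \<in> VA \<gamma>' \<Longrightarrow> ran (lift \<gamma>') \<subseteq> ran (lift \<gamma>) \<Longrightarrow> f * g \<in> VA \<gamma>'"
  using VA_mult[of \<gamma>' g f \<gamma>] by (simp add: mult.commute)

lemma gd_conv_mf:
  assumes "local_diffeo \<gamma>" "gd \<gamma> A" "gd \<gamma>' B" "ran (lift \<gamma>) \<subseteq> ran (lift \<gamma>')"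
  shows "gd \<gamma> (conv mf A B)"
  unfolding gd_def
proof (intro conjI allI par_conv_mf gd_par[OF assms(2)] gd_par[OF assms(3)] vl_conv[OF subspace_VA[OF assms(1)] gd_vl[OF assms(2)] gd_vl[OF assms(3)]])
  show "vl (VA \<gamma>) (mf p q)" if "vl (VA \<gamma>) p" "vl (VA \<gamma>') q" for p q
    by (rule vl_moy[OF cbil_pt subspace_VA[OF assms(1)] _ that]) (rule VA_mult[OF assms(1) _ _ assms(4)])
qed

lemma gd_conv_mf':
  assumes "local_diffeo \<gamma>'" "gd \<gamma> A" "gd \<gamma>' B" "ran (lift \<gamma>') \<subseteq> ran (lift \<gamma>)"
  shows "gd \<gamma>' (conv mf A B)"
  unfolding gd_def
proof (intro conjI allI par_conv_mf gd_par[OF assms(2)] gd_par[OF assms(3)] vl_conv[OF subspace_VA[OF assms(1)] gd_vl[OF assms(2)] gd_vl[OF assms(3)]])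
  show "vl (VA \<gamma>') (mf p q)" if "vl (VA \<gamma>) p" "vl (VA \<gamma>') q" for p q
    by (rule vl_moy[OF cbil_pt subspace_VA[OF assms(1)] _ that]) (rule VA_mult'[OF assms(1) _ _ assms(4)])
qed

lemma exists_prj: "local_diffeo \<gamma> \<Longrightarrow> \<exists>g. clinear g \<and> range g \<subseteq> VA \<gamma> \<and> (\<forall>f\<in>VA \<gamma>. g f = f)"
proof -
  assume "local_diffeo \<gamma>"
  interpret vector_space_pair "scaleC :: complex \<Rightarrow> (pt \<Rightarrow> complex) \<Rightarrow> _" "scaleC :: complex \<Rightarrow> (pt \<Rightarrow> complex) \<Rightarrow> _" ..
  from linear_exists_left_inverse_on[OF clinear_id subspace_VA[OF \<open>local_diffeo \<gamma>\<close>]] show ?thesis by auto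
qed

text \<open>A linear projection onto \<open>VA \<gamma>\<close>, which exists by choosing a
  complement. The algebraic part works with operators that are linear on all functions, whereas
  differentiation is linear only on differentiable ones; \<open>Xb\<close> and \<open>Yb\<close> are
  therefore composed with this projection.\<close>

definition prj :: "(real \<rightharpoonup> real) \<Rightarrow> (pt \<Rightarrow> complex) \<Rightarrow> pt \<Rightarrow> complex" where
  "prj \<gamma> = (SOME g. clinear g \<and> range g \<subseteq> VA \<gamma> \<and> (\<forall>f\<in>VA \<gamma>. g f = f))"

definition Xb :: "(real \<rightharpoonup> real) \<Rightarrow> (pt \<Rightarrow> complex) \<Rightarrow> pt \<Rightarrow> complex" where "Xb \<gamma> f = sop \<gamma> GX (prj \<gamma> f)"
definition Yb :: "(real \<rightharpoonup> real) \<Rightarrow> (pt \<Rightarrow> complex) \<Rightarrow> pt \<Rightarrow> complex" where "Yb \<gamma> f = sop \<gamma> GY (prj \<gamma> f)"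

context ldiff begin

lemma clinear_prj: "clinear (prj \<gamma>)" and prj_VA: "prj \<gamma> f \<in> VA \<gamma>" and prj_id: "f \<in> VA \<gamma> \<Longrightarrow> prj \<gamma> f = f"
  using someI_ex[OF exists_prj[OF ld], folded prj_def] by blast+

lemma clinear_Xb: "clinear (Xb \<gamma>)" and clinear_Yb: "clinear (Yb \<gamma>)"
  by (rule clinearI; simp add: Xb_def Yb_def clinear_add[OF clinear_prj] clinear_scale[OF clinear_prj] sop_lin(1)[OF prj_VA prj_VA] sop_lin(2)[OF prj_VA prj_VA])+

lemma Xb_VA: "Xb \<gamma> f \<in> VA \<gamma>" and Yb_VA: "Yb \<gamma> f \<in> VA \<gamma>"
  by (simp_all add: Xb_def Yb_def sop_VA prj_VA)

lemma Xb_eq: "f \<in> VA \<gamma> \<Longrightarrow> Xb \<gamma> f = sop \<gamma> GX f" and Yb_eq: "f \<in> VA \<gamma> \<Longrightarrow> Yb \<gamma> f = sop \<gamma> GY f"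
  by (simp_all add: Xb_def Yb_def prj_id)

lemma sec_smooth: assumes "gd \<gamma> A" shows "section_on S (sec A)"
  unfolding section_on_def
proof (intro conjI allI impI)
  fix k m n
  have f: "smooth_on S (cf A (2 * k + int m + int n + 0) m n)"
    using gd_lookup[OF assms] by (auto simp: cf_def VA_def smooth_const zero_fun_def)
  have "smooth_on S (\<lambda>z. cf A (2 * k + int m + int n + 0) m n z * of_real (snd z ^ m / snd z ^ n))"
    by (intro smooth_mult[OF open_S f] smooth_of_real[OF open_S] smooth_divide[OF open_S] smooth_power[OF open_S] smooth_snd)
      (use S_iff in auto)
  then show "smooth_on S (\<lambda>z. sec A z k m n)"
    by (rule smooth_cong[OF open_S, rotated]) (simp add: secs_def)
next
  show "sec A z = 0" if "z \<notin> S" for z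
    by (rule secs_off) (rule VA_off[OF gd_lookup[OF assms] that])
qed

lemma sec_Wplus: "gd \<gamma> A \<Longrightarrow> Wplus_on S (sec A)"
  unfolding Wplus_on_def using sec_smooth sec_finite by (simp add: secs_def cf_def)

text \<open>Every section of the extended bundle comes from a series. The finiteness condition in
  \<open>Wplus_on\<close> is uniform in the base point, so each component is a polynomial with
  function coefficients; integrality of the exponent of hbar gives the parity.\<close>

lemma Wplus_sec: assumes "Wplus_on S a" shows "\<exists>A. gd \<gamma> A \<and> a = sec A"
proof -
  define F where "F N = (\<lambda>(m, n) z. lk (a z) (int N) m n * yc z ^ n / yc z ^ m)" for N
  define A where "A N = Abs_poly_mapping (F N)" for N
  have fin: "finite {x. F N x \<noteq> 0}" for N
  proof (rule finite_subset)
    show "{x. F N x \<noteq> 0} \<subseteq> (\<lambda>(k, m, n). (m, n)) ` {(k, m, n). 2 * k + int m + int n = int N \<and> (\<exists>z. a z k m n \<noteq> 0)}"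
    proof
      fix x assume "x \<in> {x. F N x \<noteq> 0}"
      moreover obtain m n where x: "x = (m, n)" by (cases x)
      ultimately have "(\<lambda>z. lk (a z) (int N) m n * yc z ^ n / yc z ^ m) \<noteq> 0" by (simp add: F_def)
      then obtain z where "lk (a z) (int N) m n * yc z ^ n / yc z ^ m \<noteq> 0" by (auto simp: fun_eq_iff)
      then have "even (int N - int m - int n)" "a z ((int N - int m - int n) div 2) m n \<noteq> 0"
        by (auto simp: lk_def split: if_splits)
      then have "((int N - int m - int n) div 2, m, n) \<in> {(k, m, n). 2 * k + int m + int n = int N \<and> (\<exists>z. a z k m n \<noteq> 0)}"
        by auto
      then show "x \<in> (\<lambda>(k, m, n). (m, n)) ` {(k, m, n). 2 * k + int m + int n = int N \<and> (\<exists>z. a z k m n \<noteq> 0)}"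
        unfolding x by (rule rev_image_eqI) simp
    qed
    show "finite ((\<lambda>(k, m, n). (m, n)) ` {(k, m, n). 2 * k + int m + int n = int N \<and> (\<exists>z. a z k m n \<noteq> 0)})"
      using assms by (simp add: Wplus_on_def)
  qed
  then have l: "Poly_Mapping.lookup (A N) (m, n) = (\<lambda>z. lk (a z) (int N) m n * yc z ^ n / yc z ^ m)" for N m n
    unfolding A_def by (simp add: F_def)
  have off: "a z = 0" if "z \<notin> S" for z using assms that by (simp add: Wplus_on_def section_on_def del: split_paired_All)
  have sm: "smooth_on S (\<lambda>z. a z k m n)" for k m n using assms by (simp add: Wplus_on_def section_on_def)
  have "Poly_Mapping.lookup (A N) k \<in> VA \<gamma>" for N k
  proof -
    obtain m n where k: "k = (m, n)" by (cases k)
    have "smooth_on S (\<lambda>z. lk (a z) (int N) m n)" by (cases "even (int N - int m - int n)") (simp_all add: lk_def sm smooth_const)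
    from smooth_mult[OF open_S this] have "smooth_on S (\<lambda>z. lk (a z) (int N) m n * of_real (snd z ^ n / snd z ^ m))"
      by (rule meta_mp) (intro smooth_of_real[OF open_S] smooth_divide[OF open_S] smooth_power[OF open_S] smooth_snd, use S_iff in auto)
    then have "smooth_on S (\<lambda>z. lk (a z) (int N) m n * yc z ^ n / yc z ^ m)" by simp
    then show ?thesis unfolding k l VA_def using off by (simp add: lk_def del: split_paired_All)
  qed
  moreover have "par A" unfolding par_iff
  proof (intro allI impI)
    fix N :: nat and k :: "nat \<times> nat" assume "odd (N + fst k + snd k)"
    moreover obtain m n where k: "k = (m, n)" by (cases k)
    ultimately have "odd (int N + int m + int n)" by (simp flip: of_nat_add)
    then have "odd (int N - int m - int n)" by simp
    then show "Poly_Mapping.lookup (A N) k = 0" by (simp add: k l lk_def fun_eq_iff)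
  qed
  moreover have "a = sec A"
  proof (intro ext)
    fix z k m n
    show "a z k m n = sec A z k m n"
    proof (cases "z \<in> S \<and> 0 \<le> 2 * k + int m + int n")
      case True
      then have "lk (a z) (2 * k + int m + int n) m n = a z k m n" "snd z \<noteq> 0" using S_iff by (auto simp: lk_def)
      then show ?thesis using True by (simp add: secs_def cf_def l)
    next
      case False
      have "a z k m n = 0" if "2 * k + int m + int n < 0" using assms that by (simp add: Wplus_on_def)
      moreover have "a z k m n = 0" if "z \<notin> S" using off[OF that] by simp
      ultimately have a0: "a z k m n = 0" using False by linarith
      show ?thesis
      proof (cases "z \<in> S")
        case True
        then show ?thesis using False a0 by (simp add: secs_def cf_def)
      next
        case False
        then show ?thesis using a0 off[OF False] by (simp add: secs_def cf_def l lk_def)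
      qed
    qed
  qed
  ultimately show ?thesis unfolding gd_def vl_def by blast
qed

lemma sec_eqD:
  assumes "gd \<gamma> A" "gd \<gamma> B" "\<And>z. z \<in> S \<Longrightarrow> sec A z = sec B z"
  shows "A = B"
proof (rule ext, rule poly_mapping_eqI, rule ext)
  fix N k z
  show "Poly_Mapping.lookup (A N) k z = Poly_Mapping.lookup (B N) k z"
  proof (cases "z \<in> S")
    case True
    then have y: "snd z \<noteq> 0" using S_iff by simp
    have "ev z (A N) = ev z (B N)"
      using fs_sec[OF gd_par[OF assms(1)] y] fs_sec[OF gd_par[OF assms(2)] y] assms(3)[OF True] by metis
    then show ?thesis using lookup_pm[OF clinear_ev] by metis
  next
    case False
    then show ?thesis using VA_off[OF gd_lookup] assms by metis
  qed
qed

end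

lemma scf: "(c *\<^sub>C f) z = c * f z" for f :: "pt \<Rightarrow> complex"
  by (simp add: scaleC_fun_def scaleC_complex_def)

lemma cf_du: "cf (\<lambda>N. du (A N)) i m n z = of_nat (Suc m) * cf A i (Suc m) n z"
  and cf_dv: "cf (\<lambda>N. dv (A N)) i m n z = of_nat (Suc n) * cf A i m (Suc n) z"
  by (simp_all add: cf_def scf)

lemma cf_mu: "cf (\<lambda>N. mu (A N)) i m n z = (case m of 0 \<Rightarrow> 0 | Suc m' \<Rightarrow> cf A i m' n z)"
  and cf_mv: "cf (\<lambda>N. mv (A N)) i m n z = (case n of 0 \<Rightarrow> 0 | Suc n' \<Rightarrow> cf A i m n' z)"
  by (simp_all add: cf_def split: nat.split)

lemma fdu_sec: "snd z \<noteq> 0 \<Longrightarrow> fdu (sec A z) k m n = yc z * secs 1 (\<lambda>N. du (A N)) z k m n"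
  and fdv_sec: "snd z \<noteq> 0 \<Longrightarrow> fdv (sec A z) k m n = secs 1 (\<lambda>N. dv (A N)) z k m n / yc z"
proof -
  have "2 * k + int (Suc m) + int n + 0 = 2 * k + int m + int n + 1" "2 * k + int m + int (Suc n) + 0 = 2 * k + int m + int n + 1" by auto
  note e = this
  show "fdu (sec A z) k m n = yc z * secs 1 (\<lambda>N. du (A N)) z k m n"
    by (simp only: fdu_def secs_def cf_du e Suc_eq_plus1[symmetric]) simp
  show "snd z \<noteq> 0 \<Longrightarrow> fdv (sec A z) k m n = secs 1 (\<lambda>N. dv (A N)) z k m n / yc z"
    by (simp only: fdv_def secs_def cf_dv e Suc_eq_plus1[symmetric]) (simp add: ac_simps)
qed

lemma pdxy_yc:
  fixes L :: "pt \<Rightarrow> complex"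
  assumes L: "L differentiable (at z)" and y: "snd z > 0"
  shows "pdx (\<lambda>w. L w * yc w ^ m / yc w ^ n) z = pdx L z * yc z ^ m / yc z ^ n"
    "pdy (\<lambda>w. L w * yc w ^ m / yc w ^ n) z = (pdy L z + (of_nat m - of_nat n) / yc z * L z) * yc z ^ m / yc z ^ n"
proof -
  define h where "h = (\<lambda>w :: pt. snd w ^ m / snd w ^ n)"
  have o: "open {w :: pt. snd w > 0}" by (simp add: open_Collect_less continuous_on_snd continuous_on_id)
  have "smooth_on {w :: pt. snd w > 0} h"
    unfolding h_def by (intro smooth_divide[OF o] smooth_power[OF o] smooth_snd) auto
  from smooth_diffable[OF this] have h: "h differentiable (at z)" using y by simp
  have d: "((\<lambda>t. t ^ m / t ^ n) has_real_derivative (real m - real n) / snd z * (snd z ^ m / snd z ^ n)) (at (snd z))"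
    using y by (auto intro!: derivative_eq_intros simp: field_simps power_add[symmetric]) (cases m; cases n; simp add: field_simps)+
  have hx: "pdx h z = 0" by (simp add: pdx_def h_def)
  have hy: "pdy h z = (real m - real n) / snd z * (snd z ^ m / snd z ^ n)"
    unfolding pdy_def h_def snd_conv using d by (intro vector_derivative_at) (simp add: has_real_derivative_iff_has_vector_derivative)
  have e: "(\<lambda>w. L w * yc w ^ m / yc w ^ n) = (\<lambda>w. L w * of_real (h w))" by (simp add: h_def)
  show "pdx (\<lambda>w. L w * yc w ^ m / yc w ^ n) z = pdx L z * yc z ^ m / yc z ^ n"
    unfolding e pdxy_mult[OF L pdxy_of_real(3)[OF h]] pdxy_of_real[OF h] hx by (simp add: h_def)
  show "pdy (\<lambda>w. L w * yc w ^ m / yc w ^ n) z = (pdy L z + (of_nat m - of_nat n) / yc z * L z) * yc z ^ m / yc z ^ n"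
    unfolding e pdxy_mult[OF L pdxy_of_real(3)[OF h]] pdxy_of_real[OF h] hy
    using y by (simp add: h_def field_simps)
qed

text \<open>The left side also contains the component \<open>A 0\<close>, placed in total degree -1,
  and must lose it before the index can be shifted.\<close>

lemma secs1_Suc: "A 0 = 0 \<Longrightarrow> secs 1 A = sec (\<lambda>N. A (Suc N))"
proof (intro ext)
  fix z k m n assume A: "A 0 = 0"
  have "nat (2 * k + int m + int n + 1) = Suc (nat (2 * k + int m + int n + 0))" if "0 \<le> 2 * k + int m + int n + 0"
    using that by simp
  moreover have "2 * k + int m + int n + 1 = 0" if "\<not> 0 \<le> 2 * k + int m + int n + 0" "0 \<le> 2 * k + int m + int n + 1"
    using that by simp
  ultimately show "secs 1 A z k m n = sec (\<lambda>N. A (Suc N)) z k m n"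
    using A by (cases "0 \<le> 2 * k + int m + int n + 0"; cases "0 \<le> 2 * k + int m + int n + 1") (simp_all add: secs_def cf_def)
qed

lemma secs2_Suc: "A 0 = 0 \<Longrightarrow> A 1 = 0 \<Longrightarrow> secs 2 A = sec (\<lambda>N. A (Suc (Suc N)))"
proof -
  assume A: "A 0 = 0" "A 1 = 0"
  have "secs 2 A = secs 1 (\<lambda>N. A (Suc N))"
  proof (intro ext)
    fix z k m n
    consider "0 \<le> 2 * k + int m + int n + 1" | "2 * k + int m + int n + 2 = 0" | "2 * k + int m + int n + 2 < 0" by linarith
    then show "secs 2 A z k m n = secs 1 (\<lambda>N. A (Suc N)) z k m n"
    proof cases
      case 1
      then have "nat (2 * k + int m + int n + 2) = Suc (nat (2 * k + int m + int n + 1))" by simp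
      with 1 show ?thesis by (simp add: secs_def cf_def)
    qed (use A in \<open>simp_all add: secs_def cf_def\<close>)
  qed
  then show ?thesis using secs1_Suc[of "\<lambda>N. A (Suc N)"] A(2) by simp
qed

section \<open>The Fedosov connection in the frame\<close>

context ldiff begin

lemma cf_VA: "gd \<gamma> A \<Longrightarrow> cf A i m n \<in> VA \<gamma>"
  by (simp add: cf_def gd_lookup VA_lin(3))

lemma cf_P0: "cf (\<lambda>N. P0 (Xb \<gamma>) (A N)) i m n z = Xb \<gamma> (cf A i m n) z
    - 1/2 * (case n of 0 \<Rightarrow> 0 | Suc n' \<Rightarrow> of_nat (Suc m) * cf A i (Suc m) n' z)"
  by (cases n) (simp_all add: cf_def P0_def lookup_minus clinear_Xb clinear_zero[OF clinear_Xb] scf)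

lemma cf_Qo: "cf (\<lambda>N. Qo (Yb \<gamma>) (A N)) i m n z = - Yb \<gamma> (cf A i m n) z + 1/2 * (of_nat m - of_nat n) * cf A i m n z"
  by (cases m; cases n) (simp_all add: cf_def Qo_def lookup_minus lookup_add clinear_Yb clinear_zero[OF clinear_Yb] scf algebra_simps)

text \<open>The factor y comes from d/dx = y X. The frame coordinates do not depend on x, so only
  the connection term v d/du is added to X.\<close>

lemma D_fst:
  assumes A: "gd \<gamma> A" and z: "z \<in> S"
  shows "fst (fedosov_D (sec A)) z k m n = yc z * (sec (\<lambda>N. P0 (Xb \<gamma>) (A N)) z k m n - secs 1 (\<lambda>N. du (A N)) z k m n)"
proof -
  have y: "snd z > 0" "snd z \<noteq> 0" using z S_iff by auto
  define i where "i = 2 * k + int m + int n + 0"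
  have x: "Xb \<gamma> (cf A i m n) z = 1 / yc z * pdx (cf A i m n) z"
    by (simp add: Xb_eq[OF cf_VA[OF A]] sop_S[OF z])
  have p: "pdx (\<lambda>w. sec A w k m n) z = pdx (cf A i m n) z * yc z ^ m / yc z ^ n"
    unfolding secs_def i_def[symmetric] by (rule pdxy_yc(1)[OF VA_diff[OF cf_VA[OF A] z] y(1)])
  have f: "fmulv (fdu (sec A z)) k m n = (case n of 0 \<Rightarrow> 0 | Suc n' \<Rightarrow> of_nat (Suc m) * cf A i (Suc m) n' z * yc z ^ Suc m / yc z ^ n')"
    by (cases n) (simp_all add: fmulv_def fdu_def secs_def i_def ac_simps)
  have "fst (fedosov_D (sec A)) z k m n
      = pdx (\<lambda>w. sec A w k m n) z - fdu (sec A z) k m n - 1 / (2 * yc z) * fmulv (fdu (sec A z)) k m n"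
    by (simp add: fedosov_D_def scaleC_fun_def scaleC_complex_def)
  also have "\<dots> = yc z * (sec (\<lambda>N. P0 (Xb \<gamma>) (A N)) z k m n - secs 1 (\<lambda>N. du (A N)) z k m n)"
    unfolding p f fdu_sec[OF y(2)] unfolding secs_def[of 0] i_def[symmetric] cf_P0 x using y
    by (cases n) (simp_all add: field_simps)
  finally show ?thesis .
qed

text \<open>Here d/dy = -(1/y) Y. The frame factors y^m / y^n contribute (m - n)/y and the
  connection contributes (n - m)/(2y); their sum is the term (1/2)(u d/du - v d/dv) of
  \<open>Qo\<close>.\<close>

lemma D_snd:
  assumes A: "gd \<gamma> A" and z: "z \<in> S"
  shows "snd (fedosov_D (sec A)) z k m n = (sec (\<lambda>N. Qo (Yb \<gamma>) (A N)) z k m n - secs 1 (\<lambda>N. dv (A N)) z k m n) / yc z"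
proof -
  have y: "snd z > 0" "snd z \<noteq> 0" using z S_iff by auto
  define i where "i = 2 * k + int m + int n + 0"
  have x: "Yb \<gamma> (cf A i m n) z = - (yc z * pdy (cf A i m n) z)"
    by (simp add: Yb_eq[OF cf_VA[OF A]] sop_S[OF z])
  have p: "pdy (\<lambda>w. sec A w k m n) z = (pdy (cf A i m n) z + (of_nat m - of_nat n) / yc z * cf A i m n z) * yc z ^ m / yc z ^ n"
    unfolding secs_def i_def[symmetric] by (rule pdxy_yc(2)[OF VA_diff[OF cf_VA[OF A] z] y(1)])
  have f: "fmulv (fdv (sec A z)) k m n = of_nat n * cf A i m n z * yc z ^ m / yc z ^ n"
    "fmulu (fdu (sec A z)) k m n = of_nat m * cf A i m n z * yc z ^ m / yc z ^ n"
    by (cases n, simp_all add: fmulv_def fdv_def secs_def i_def ac_simps) (cases m, simp_all add: fmulu_def fdu_def secs_def i_def ac_simps)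
  have "snd (fedosov_D (sec A)) z k m n
      = pdy (\<lambda>w. sec A w k m n) z - fdv (sec A z) k m n
        + 1 / (2 * yc z) * (fmulv (fdv (sec A z)) k m n - fmulu (fdu (sec A z)) k m n)"
    by (simp add: fedosov_D_def scaleC_fun_def scaleC_complex_def)
  also have "\<dots> = (sec (\<lambda>N. Qo (Yb \<gamma>) (A N)) z k m n - secs 1 (\<lambda>N. dv (A N)) z k m n) / yc z"
    unfolding p f fdv_sec[OF y(2)] unfolding secs_def[of 0] i_def[symmetric] cf_Qo x using y
    by (simp add: field_simps)
  finally show ?thesis .
qed

lemma gd_P0: "gd \<gamma> A \<Longrightarrow> gd \<gamma> (\<lambda>N. P0 (Xb \<gamma>) (A N))"
  and gd_Qo: "gd \<gamma> A \<Longrightarrow> gd \<gamma> (\<lambda>N. Qo (Yb \<gamma>) (A N))"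
  and gd_du: "gd \<gamma> A \<Longrightarrow> gd \<gamma> (\<lambda>N. du (A (Suc N)))"
  and gd_dv: "gd \<gamma> A \<Longrightarrow> gd \<gamma> (\<lambda>N. dv (A (Suc N)))"
proof -
  note V = subspace_VA[OF ld]
  assume A: "gd \<gamma> A"
  note v = gd_vl[OF A]
  have p: "sg (A N) = (- 1) ^ N *\<^sub>C A N" for N using gd_par[OF A] by (simp add: par_def)
  have X: "vl (VA \<gamma>) (pm (Xb \<gamma>) (A N))" and Y: "vl (VA \<gamma>) (pm (Yb \<gamma>) (A N))" for N
    by (rule vl_pm[OF v clinear_Xb Xb_VA] vl_pm[OF v clinear_Yb Yb_VA])+
  have "vl (VA \<gamma>) (P0 (Xb \<gamma>) (A N))" for N
    unfolding P0_def by (intro vl_diff[OF V] vl_scale[OF V] vl_mv[OF V] vl_du[OF V] v X)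
  then show "gd \<gamma> (\<lambda>N. P0 (Xb \<gamma>) (A N))"
    by (simp add: gd_def par_def sg_P(2)[OF clinear_Xb] p clinear_scale[OF clinear_P0[OF clinear_Xb]])
  have "vl (VA \<gamma>) (Qo (Yb \<gamma>) (A N))" for N
    unfolding Qo_def by (intro vl_diff[OF V] vl_add[OF V] vl_scale[OF V] vl_mv[OF V] vl_mu[OF V] vl_du[OF V] vl_dv[OF V] vl_minus[OF V] v Y)
  then show "gd \<gamma> (\<lambda>N. Qo (Yb \<gamma>) (A N))"
    by (simp add: gd_def par_def sg_P(3)[OF clinear_Yb] p clinear_scale[OF clinear_Qo[OF clinear_Yb]])
  show "gd \<gamma> (\<lambda>N. du (A (Suc N)))" "gd \<gamma> (\<lambda>N. dv (A (Suc N)))"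
    using v by (simp_all add: gd_def par_def sg_ops p lin_du lin_dv vl_du[OF V] vl_dv[OF V] cvec.scale_minus_left)
qed

lemma D_zero_iff:
  assumes A: "gd \<gamma> A" and A0: "du (A 0) = 0" "dv (A 0) = 0"
  shows "(\<forall>z\<in>S. fst (fedosov_D (sec A)) z = 0 \<and> snd (fedosov_D (sec A)) z = 0) \<longleftrightarrow> flat (P0 (Xb \<gamma>)) (Qo (Yb \<gamma>)) A"
proof -
  have 1: "secs 1 (\<lambda>N. du (A N)) = sec (\<lambda>N. du (A (Suc N)))" "secs 1 (\<lambda>N. dv (A N)) = sec (\<lambda>N. dv (A (Suc N)))"
    by (rule secs1_Suc, rule A0)+
  have y: "yc z \<noteq> 0" if "z \<in> S" for z using that S_iff by simp
  have f: "fst (fedosov_D (sec A)) z = 0 \<longleftrightarrow> sec (\<lambda>N. P0 (Xb \<gamma>) (A N)) z = sec (\<lambda>N. du (A (Suc N))) z"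
    and s: "snd (fedosov_D (sec A)) z = 0 \<longleftrightarrow> sec (\<lambda>N. Qo (Yb \<gamma>) (A N)) z = sec (\<lambda>N. dv (A (Suc N))) z" if "z \<in> S" for z
    using y[OF that] by (simp_all add: fun_eq_iff D_fst[OF A that] D_snd[OF A that] 1)
  have "(\<forall>z\<in>S. sec (\<lambda>N. P0 (Xb \<gamma>) (A N)) z = sec (\<lambda>N. du (A (Suc N))) z) \<longleftrightarrow> (\<lambda>N. P0 (Xb \<gamma>) (A N)) = (\<lambda>N. du (A (Suc N)))"
    using sec_eqD[OF gd_P0[OF A] gd_du[OF A]] by metis
  moreover have "(\<forall>z\<in>S. sec (\<lambda>N. Qo (Yb \<gamma>) (A N)) z = sec (\<lambda>N. dv (A (Suc N))) z) \<longleftrightarrow> (\<lambda>N. Qo (Yb \<gamma>) (A N)) = (\<lambda>N. dv (A (Suc N)))"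
    using sec_eqD[OF gd_Qo[OF A] gd_dv[OF A]] by metis
  moreover have "(\<forall>z\<in>S. fst (fedosov_D (sec A)) z = 0 \<and> snd (fedosov_D (sec A)) z = 0) \<longleftrightarrow>
      (\<forall>z\<in>S. sec (\<lambda>N. P0 (Xb \<gamma>) (A N)) z = sec (\<lambda>N. du (A (Suc N))) z)
    \<and> (\<forall>z\<in>S. sec (\<lambda>N. Qo (Yb \<gamma>) (A N)) z = sec (\<lambda>N. dv (A (Suc N))) z)"
    unfolding ball_conj_distrib[symmetric] by (rule ball_cong[OF refl]) (simp only: f s)
  moreover have "flat (P0 (Xb \<gamma>)) (Qo (Yb \<gamma>)) A \<longleftrightarrow>
      (\<lambda>N. P0 (Xb \<gamma>) (A N)) = (\<lambda>N. du (A (Suc N))) \<and> (\<lambda>N. Qo (Yb \<gamma>) (A N)) = (\<lambda>N. dv (A (Suc N)))"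
    unfolding flat_def using A0 by (simp only: simp_thms fun_eq_iff all_conj_distrib eq_commute)
  ultimately show ?thesis by (simp only:)
qed

definition hseq :: "(nat \<Rightarrow> h1 pol) \<Rightarrow> (pt \<Rightarrow> complex) \<Rightarrow> nat \<Rightarrow> fpol" where
  "hseq c f N = pm (\<lambda>h. hact \<gamma> h f) (c N)"

lemma gd_hseq: "f \<in> VA \<gamma> \<Longrightarrow> par c \<Longrightarrow> gd \<gamma> (hseq c f)"
  unfolding gd_def par_iff vl_def
  by (simp add: hseq_def clinear_hact hact_VA clinear_zero[OF clinear_hact] par_lookup)

lemma hact_X: "f \<in> VA \<gamma> \<Longrightarrow> hact \<gamma> (hX * h) f = Xb \<gamma> (hact \<gamma> h f)"
  and hact_Y: "f \<in> VA \<gamma> \<Longrightarrow> hact \<gamma> (hY * h) f = Yb \<gamma> (hact \<gamma> h f)"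
  by (simp_all add: hact_mult hact_gen hact_VA Xb_eq Yb_eq)

lemma flat_hseq_J0: "f \<in> VA \<gamma> \<Longrightarrow> flat (P0 (Xb \<gamma>)) (Qo (Yb \<gamma>)) (hseq J0 f)"
  unfolding hseq_def[abs_def]
  by (rule flat_pm[OF flat_J0 clinear_hact])
    (simp_all add: pm_P0[OF clinear_hact clinear_lmult clinear_Xb] pm_Qo[OF clinear_hact clinear_lmult clinear_Yb] hact_X hact_Y)

definition one :: "pt \<Rightarrow> complex" where "one z = (if z \<in> S then 1 else 0)"

lemma one_VA: "one \<in> VA \<gamma>"
proof -
  have "smooth_on S one" by (rule smooth_cong[OF open_S _ smooth_const[of S 1]]) (simp add: one_def)
  then show ?thesis by (simp add: VA_def one_def)
qed

lemma XY_one: "Xb \<gamma> one = 0" "Yb \<gamma> one = 0"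
proof -
  have "pdx one z = pdx (\<lambda>_. 1) z" "pdy one z = pdy (\<lambda>_. 1) z" if "z \<in> S" for z
    by (rule pdxy_cong[OF open_S that], simp add: one_def)+
  then have "sop \<gamma> GX one z = 0" "sop \<gamma> GY one z = 0" for z
    by (cases "z \<in> S"; simp add: sop_S sop_notin pdxy_const)+
  then show "Xb \<gamma> one = 0" "Yb \<gamma> one = 0" by (auto simp: Xb_eq[OF one_VA] Yb_eq[OF one_VA])
qed

lemma mult_one: "f \<in> VA \<gamma> \<Longrightarrow> f * one = f" "f \<in> VA \<gamma> \<Longrightarrow> one * f = f"
  using VA_off by (force simp: one_def fun_eq_iff)+

text \<open>Each delta_n acts by multiplication with a function, so the action of a polynomial in
  them is multiplication by its value on the local unit.\<close>

lemma hact_delta_alg: "h \<in> delta_alg \<Longrightarrow> f \<in> VA \<gamma> \<Longrightarrow> hact \<gamma> h f = hact \<gamma> h one * f"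
proof (induction arbitrary: f rule: delta_alg.induct)
  case one
  then show ?case by (simp add: hact_one one_VA mult_one)
next
  case (GD k)
  show ?case
  proof
    fix z show "hact \<gamma> (h1_of (GD k)) f z = (hact \<gamma> (h1_of (GD k)) one * f) z"
      using GD by (cases "z \<in> S") (simp_all add: hact_gen one_VA sop_S sop_notin one_def del: delta_fun.simps)
  qed
next
  case (add x y)
  show ?case unfolding clinear_add[OF clinear_hact[OF add.prems]] clinear_add[OF clinear_hact[OF one_VA]]
      add.IH(1)[OF add.prems] add.IH(2)[OF add.prems] by (rule distrib_right[symmetric])
next
  case (scale x c)
  show ?case unfolding clinear_scale[OF clinear_hact[OF scale.prems]] clinear_scale[OF clinear_hact[OF one_VA]] scale.IH[OF scale.prems]
    by (rule ext) (simp only: scf times_fun_def mult.assoc)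
next
  case (mult x y)
  have "hact \<gamma> x (hact \<gamma> y f) = hact \<gamma> x one * (hact \<gamma> y one * f)"
    unfolding mult.IH(2)[OF mult.prems, symmetric] by (rule mult.IH(1)[OF hact_VA[OF mult.prems]])
  moreover have "hact \<gamma> x (hact \<gamma> y one) = hact \<gamma> x one * hact \<gamma> y one"
    using mult.IH(1)[OF hact_VA[OF one_VA]] .
  ultimately show ?case unfolding hact_mult[OF mult.prems] hact_mult[OF one_VA] by (simp only: mult.assoc)
qed

end

section \<open>Moyal inverses, degrees and flat lifts\<close>

lemma mo_assoc: "mo (mo p q) r = mo p (mo q r)"
proof -
  have "tw (*) (\<lambda>_. 0) (tw (*) (\<lambda>_. 0) p q) r = tw (*) (\<lambda>_. 0) p (tw (*) (\<lambda>_. 0 :: complex) q r)"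
    by (rule tw_assoc[OF mo_bil mo_bil mo_bil mo_bil clinear_zero_fun clinear_zero_fun clinear_zero_fun]) simp_all
  then show ?thesis by (simp add: tw_zero[OF mo_bil])
qed

lemmas cbil_mo = cbilinear_moy[OF mo_bil]

lemma moyal_assoc: "wp a \<Longrightarrow> wp b \<Longrightarrow> wp c \<Longrightarrow> moyal (moyal a b) c = moyal a (moyal b c)"
proof -
  assume w: "wp a" "wp b" "wp c"
  have "conv mo (conv mo (fs 1 a) (fs 1 b)) (fs 1 c) n = conv mo (fs 1 a) (conv mo (fs 1 b) (fs 1 c)) n" for n
    by (rule conv_assoc[OF cbil_mo cbil_mo cbil_mo cbil_mo mo_assoc])
  then have "fs 1 (moyal (moyal a b) c) = fs 1 (moyal a (moyal b c))"
    by (simp add: fs_moyal w wp_moyal fun_eq_iff)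
  then show ?thesis by (rule fs_inject[rotated 3]) (simp_all add: w wp_moyal)
qed

lemma wp_fone: "wp fone"
proof -
  have "finite {(k, m, n). 2 * k + int m + int n = d \<and> fone k m n \<noteq> 0}" for d
    by (rule finite_subset[of _ "{(0, 0, 0)}"]) (auto simp: fone_def split: if_splits)
  then show ?thesis by (simp add: wp_def fone_def)
qed

lemma fs_fone: "fs y fone = (\<lambda>N. if N = 0 then cst 1 else 0)"
proof (rule ext, rule poly_mapping_eqI)
  fix N and k :: "nat \<times> nat"
  obtain m n where k: "k = (m, n)" by (cases k)
  show "Poly_Mapping.lookup (fs y fone N) k = Poly_Mapping.lookup (if N = 0 then cst 1 else 0) k"
    unfolding k lookup_fs[OF wp_fone] by (auto simp: lk_def fone_def lookup_single when_def)
qed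

lemma mo_unit: "mo (cst 1) p = p" "mo p (cst 1) = p"
  by (simp_all add: moy_cst_left[OF mo_bil] moy_cst_right[OF mo_bil] pm_id)

lemma moyal_one: "wp a \<Longrightarrow> moyal fone a = a" "wp a \<Longrightarrow> moyal a fone = a"
  by (rule fs_inject[of _ _ 1]; simp add: wp_moyal wp_fone fs_moyal fs_fone fun_eq_iff
      conv_unit_left[OF cbil_mo] conv_unit_right[OF cbil_mo] mo_unit)+

text \<open>From b a = 1 follows b (a b) = b, and b can be cancelled on the left because it begins
  with 1.\<close>

lemma moyal_right_inverse:
  assumes w: "wp a" "wp b" and ba: "moyal b a = fone" and y: "y \<noteq> 0" "fs y b 0 = cst 1"
  shows "moyal a b = fone"
proof (rule fs_inject[OF wp_moyal[OF w] wp_fone y(1)])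
  have "moyal b (moyal a b) = b" using moyal_assoc[of b a b] w ba moyal_one by simp
  then have "conv mo (fs y b) (fs y (moyal a b)) = conv mo (fs y b) (fs y fone)"
    using fs_moyal[OF w(2) wp_moyal[OF w] y(1)] fs_moyal[OF w(2) wp_fone y(1)] moyal_one(2)[OF w(2)] by simp
  then have "conv mo (fs y b) (\<lambda>n. fs y (moyal a b) n - fs y fone n) n = 0" for n
    by (simp add: conv_diff_right[OF cbil_mo])
  then have "fs y (moyal a b) n - fs y fone n = 0" for n
    by (rule conv_cancel_left[OF cbil_mo, rotated]) (simp add: y mo_unit)
  then show "fs y (moyal a b) = fs y fone" by (simp add: fun_eq_iff)
qed

lemma Wplus_wp: "Wplus_on T a \<Longrightarrow> wp (a z)"
proof -
  assume a: "Wplus_on T a"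
  have "finite {(k, m, n). 2 * k + int m + int n = d \<and> a z k m n \<noteq> 0}" for d
    by (rule finite_subset[of _ "{(k, m, n). 2 * k + int m + int n = d \<and> (\<exists>z. a z k m n \<noteq> 0)}"])
      (use a in \<open>auto simp: Wplus_on_def\<close>)
  then show ?thesis using a by (simp add: wp_def Wplus_on_def)
qed

lemma Wplus_off: "Wplus_on T a \<Longrightarrow> z \<notin> T \<Longrightarrow> a z = 0"
  unfolding Wplus_on_def section_on_def by blast

lemma winv_eq:
  assumes b: "Wplus_on T b" and a: "\<And>z. wp (a z)"
    and ba: "\<And>z. z \<in> T \<Longrightarrow> moyal (b z) (a z) = fone" and y: "\<And>z. z \<in> T \<Longrightarrow> snd z \<noteq> 0"
    and b0: "\<And>z. z \<in> T \<Longrightarrow> fs (yc z) (b z) 0 = cst 1"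
  shows "winv T a = b"
  unfolding winv_def
proof (rule the_equality)
  have "moyal (a z) (b z) = fone" if "z \<in> T" for z
    by (rule moyal_right_inverse[OF a Wplus_wp[OF b] ba[OF that] _ b0[OF that]]) (use y[OF that] in simp)
  then show "Wplus_on T b \<and> (\<forall>z\<in>T. (a \<star>\<^sub>w b) z = fone \<and> (b \<star>\<^sub>w a) z = fone)"
    using b ba by (simp add: wmult_def)
next
  fix c assume c: "Wplus_on T c \<and> (\<forall>z\<in>T. (a \<star>\<^sub>w c) z = fone \<and> (c \<star>\<^sub>w a) z = fone)"
  show "c = b"
  proof
    fix z show "c z = b z"
    proof (cases "z \<in> T")
      case True
      have w: "wp (c z)" "wp (b z)" using c b Wplus_wp by blast+
      have ac: "moyal (a z) (c z) = fone" using c True by (simp add: wmult_def)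
      show ?thesis using moyal_assoc[OF w(2) a[of z] w(1)] unfolding ba[OF True] ac moyal_one(1)[OF w(1)] moyal_one(2)[OF w(2)] .
    next
      case False
      then show ?thesis using Wplus_off b c by metis
    qed
  qed
qed

text \<open>Naturality of the product when the compatibility of the pairings is known only for
  coefficients of the right factor in V; used with V the algebra of the delta_n.\<close>

lemma moy_nat_on:
  assumes B: "cbilinear B" and B': "cbilinear B'" and l: "clinear f" "clinear g" "clinear h"
    and q: "vl V q" and eq: "\<And>x y. y \<in> V \<Longrightarrow> f (B x y) = B' (g x) (h y)"
  shows "pm f (moy B p q) = moy B' (pm g p) (pm h q)"
proof (induction p rule: pol_induct)
  case (single k c)
  obtain a b where k: "k = (a, b)" by (cases k)
  have "pm f (pm (B c) q) = pm (B' (g c)) (pm h q)"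
    by (rule poly_mapping_eqI) (use q in \<open>simp add: l cbilinearD1[OF B] cbilinearD1[OF B'] eq vl_def\<close>)
  then show ?case by (simp add: k moy_single[OF B] moy_single[OF B'] pm_single l pm_mono_uv)
next
  case (add p q)
  then show ?case by (simp add: moy_lin_left[OF B] moy_lin_left[OF B'] clinear_add[OF clinear_pm[OF l(1)]] clinear_add[OF clinear_pm[OF l(2)]])
qed

text \<open>The fibre degree in component N is at most N, so the exponent of hbar is nonnegative and
  a flat series gives a section of the unextended bundle.\<close>

lemma deg_flat:
  assumes a: "flat (P0 X) (Qo Y) a" and l: "clinear X" "clinear Y"
  shows "m + n > N \<Longrightarrow> Poly_Mapping.lookup (a N) (m, n) = 0"
proof (induction N arbitrary: m n)
  case 0
  have z: "Poly_Mapping.lookup (du (a 0)) k = 0" "Poly_Mapping.lookup (dv (a 0)) k = 0" for k using a by (simp_all add: flat_def)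
  show ?case
  proof (cases m)
    case (Suc m')
    then show ?thesis using z(1)[of "(m', n)"] by (simp del: of_nat_Suc)
  next
    case 0
    then obtain n' where "n = Suc n'" using \<open>m + n > 0\<close> by (cases n) auto
    then show ?thesis using z(2)[of "(m, n')"] 0 by (simp del: of_nat_Suc)
  qed
next
  case (Suc N)
  have z: "du (a (Suc N)) = P0 X (a N)" "dv (a (Suc N)) = Qo Y (a N)" using a by (simp_all add: flat_def)
  have P: "Poly_Mapping.lookup (P0 X (a N)) (i, j) = 0" "Poly_Mapping.lookup (Qo Y (a N)) (i, j) = 0" if "i + j > N" for i j
    using that Suc.IH by (auto simp: P0_def Qo_def lookup_minus lookup_add l clinear_zero[OF l(1)] clinear_zero[OF l(2)] split: nat.split)
  show ?case
  proof (cases m)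
    case (Suc m')
    then have "Poly_Mapping.lookup (du (a (Suc N))) (m', n) = 0" using P(1)[of m' n] Suc.prems unfolding z by simp
    then show ?thesis using Suc by (simp del: of_nat_Suc)
  next
    case 0
    then obtain n' where n: "n = Suc n'" using Suc.prems by (cases n) auto
    then have "Poly_Mapping.lookup (dv (a (Suc N))) (m, n') = 0" using P(2)[of m n'] Suc.prems unfolding z by simp
    then show ?thesis using n by (simp del: of_nat_Suc)
  qed
qed

lemma mf_LuLu: "mf (Poly_Mapping.single (2, 0) \<kappa>) q = Lu (Lu (pm (\<lambda>f. \<kappa> * f) q))"
proof -
  have "mono_uv 2 0 p = Lu (Lu p)" for p :: fpol
    by (simp add: numeral_2_eq_2 Lu_def lin_all weyl_comm algebra_simps)
  then show ?thesis by (simp add: moy_single[OF cbil_pt])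
qed

lemma mf_RuRu: "mf q (Poly_Mapping.single (2, 0) \<kappa>) = Ru (Ru (pm (\<lambda>f. f * \<kappa>) q))"
proof -
  have "Poly_Mapping.single (2, 0) \<kappa> = Ru (Ru (cst \<kappa>))"
    by (simp add: numeral_2_eq_2 Ru_def lin_all mu_single dv_single0 cvec.scale_zero_right)
  then show ?thesis by (simp add: moy_R[OF cbil_pt] moy_cst_right[OF cbil_pt])
qed

lemma ev_lookup: "Poly_Mapping.lookup p k z = Poly_Mapping.lookup (ev z p) k"
  by (simp add: clinear_ev)

lemma ev_pm_mult: "ev z (pm (\<lambda>f. \<kappa> * f) p) = \<kappa> z *\<^sub>C ev z p" "ev z (pm (\<lambda>f. f * \<kappa>) p) = \<kappa> z *\<^sub>C ev z p"
  by (rule poly_mapping_eqI; simp add: clinear_ev cbilinearD1[OF cbil_pt] cbilinearD2[OF cbil_pt] scaleC_complex_def)+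

lemma
  fixes z :: pt and p :: fpol
  shows lookup_LuLu: "Poly_Mapping.lookup (Lu (Lu (pm (\<lambda>f. \<kappa> * f) p))) k z = \<kappa> z * Poly_Mapping.lookup (Lu (Lu p)) k z"
  and lookup_RuRu: "Poly_Mapping.lookup (Ru (Ru (pm (\<lambda>f. f * \<kappa>) p))) k z = \<kappa> z * Poly_Mapping.lookup (Ru (Ru p)) k z"
proof -
  have "ev z (Lu (Lu (pm (\<lambda>f. \<kappa> * f) p))) = \<kappa> z *\<^sub>C ev z (Lu (Lu p))"
    "ev z (Ru (Ru (pm (\<lambda>f. f * \<kappa>) p))) = \<kappa> z *\<^sub>C ev z (Ru (Ru p))"
    by (simp_all only: pm_LR[OF clinear_ev] ev_pm_mult lin_LR)
  then have "Poly_Mapping.lookup (ev z (Lu (Lu (pm (\<lambda>f. \<kappa> * f) p)))) k = \<kappa> z * Poly_Mapping.lookup (ev z (Lu (Lu p))) k"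
    "Poly_Mapping.lookup (ev z (Ru (Ru (pm (\<lambda>f. f * \<kappa>) p)))) k = \<kappa> z * Poly_Mapping.lookup (ev z (Ru (Ru p))) k"
    by (simp_all only: lookup_scaleC scaleC_complex_def)
  then show "Poly_Mapping.lookup (Lu (Lu (pm (\<lambda>f. \<kappa> * f) p))) k z = \<kappa> z * Poly_Mapping.lookup (Lu (Lu p)) k z"
    "Poly_Mapping.lookup (Ru (Ru (pm (\<lambda>f. f * \<kappa>) p))) k z = \<kappa> z * Poly_Mapping.lookup (Ru (Ru p)) k z"
    by (simp_all only: ev_lookup)
qed

context ldiff begin

lemma W_on_Wplus: assumes "W_on S a" shows "Wplus_on S a"
proof -
  have k: "k < 0 \<Longrightarrow> a z k m n = 0" for z k m n using assms by (simp add: W_on_def)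
  have "finite {(k, m, n). 2 * k + int m + int n = d \<and> (\<exists>z. a z k m n \<noteq> 0)}" for d
  proof (rule finite_subset)
    show "{(k, m, n). 2 * k + int m + int n = d \<and> (\<exists>z. a z k m n \<noteq> 0)} \<subseteq> {0..d} \<times> {..nat d} \<times> {..nat d}"
    proof
      fix x assume "x \<in> {(k, m, n). 2 * k + int m + int n = d \<and> (\<exists>z. a z k m n \<noteq> 0)}"
      then obtain l m n z where x: "x = (l, m, n)" "2 * l + int m + int n = d" "a z l m n \<noteq> 0" by blast
      then have "0 \<le> l" using k[of l z m n] by (cases "l < 0") auto
      then show "x \<in> {0..d} \<times> {..nat d} \<times> {..nat d}" using x(2) by (auto simp: x(1) le_nat_iff)
    qed
  qed simp
  moreover have "a z k m n = 0" if "2 * k + int m + int n < 0" for z k m n by (rule k) (use that in linarith)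
  ultimately show ?thesis using assms by (simp add: Wplus_on_def W_on_def)
qed

lemma W_on_deg:
  assumes A: "gd \<gamma> A" "W_on S (sec A)" and mn: "m + n > N"
  shows "Poly_Mapping.lookup (A N) (m, n) = 0"
proof
  fix z
  show "Poly_Mapping.lookup (A N) (m, n) z = 0 z"
  proof (cases "z \<in> S \<and> even (N + m + n)")
    case True
    then have "even (int N + int m + int n)" by (simp flip: of_nat_add)
    then have e: "even (int N - int m - int n)" by simp
    define k where "k = (int N - int m - int n) div 2"
    have k: "2 * k + int m + int n + 0 = int N" "k < 0" using e mn unfolding k_def by auto
    have "sec A z k m n = 0" using A(2) k(2) by (simp add: W_on_def)
    then show ?thesis using True S_iff k(1) by (simp add: secs_def cf_def)
  next
    case False
    then consider "z \<notin> S" | "odd (N + m + n)" by blast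
    then show ?thesis
    proof cases
      case 1
      then show ?thesis by (simp add: VA_off[OF gd_lookup[OF A(1)]])
    next
      case 2
      then show ?thesis using par_lookup[OF gd_par[OF A(1)], of N "(m, n)"] by simp
    qed
  qed
qed

text \<open>The section built from J_0 is flat with the right value at u = v = 0. A competitor is
  again a series by \<open>Wplus_sec\<close>, flat by \<open>D_zero_iff\<close>, and has the same
  constant terms, so \<open>flat_unique\<close> applies.\<close>

lemma flat_lift_eq:
  assumes H: "half_plane = S" and f: "f \<in> VA \<gamma>"
  shows "flat_lift f = sec (hseq J0 f)"
  unfolding flat_lift_def H
proof (rule the_equality)
  let ?A = "hseq J0 f"
  have A: "gd \<gamma> ?A" by (rule gd_hseq[OF f par_J0])
  have fl: "flat (P0 (Xb \<gamma>)) (Qo (Yb \<gamma>)) ?A" by (rule flat_hseq_J0[OF f])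
  have "sec ?A z k m n = 0" if "k < 0" for z k m n
    using deg_flat[OF fl clinear_Xb clinear_Yb, of "nat (2 * k + int m + int n)" m n] that by (auto simp: secs_def cf_def)
  then have W: "W_on S (sec ?A)" using sec_smooth[OF A] by (simp add: W_on_def)
  have "Poly_Mapping.lookup (?A N) (0, 0) = (if N = 0 then f else 0)" for N
    by (simp add: hseq_def clinear_hact[OF f] J0_0 hact_one[OF f] clinear_zero[OF clinear_hact[OF f]])
  note A00 = this
  have "sec ?A z k 0 0 = (if k = 0 then f z else 0)" for z k by (simp add: secs_def cf_def A00)
  then show "W_on S (sec ?A) \<and> (\<forall>z\<in>S. fst (fedosov_D (sec ?A)) z = 0 \<and> snd (fedosov_D (sec ?A)) z = 0
      \<and> (\<forall>k. sec ?A z k 0 0 = (if k = 0 then f z else 0)))"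
    using W D_zero_iff[OF A] fl by (simp add: flat_def)
  fix b assume b: "W_on S b \<and> (\<forall>z\<in>S. fst (fedosov_D b) z = 0 \<and> snd (fedosov_D b) z = 0 \<and> (\<forall>k. b z k 0 0 = (if k = 0 then f z else 0)))"
  then obtain B where B: "gd \<gamma> B" "b = sec B" using Wplus_sec[OF W_on_Wplus] by blast
  \<comment> \<open>Without negative powers of hbar, the component of total degree 0 has no fibre
    variables.\<close>
  have d: "du (B 0) = 0" "dv (B 0) = 0"
    by (rule poly_mapping_eqI; use b B W_on_deg[OF B(1)] in \<open>auto simp: cvec.scale_zero_right\<close>)+
  have flB: "flat (P0 (Xb \<gamma>)) (Qo (Yb \<gamma>)) B"
    using D_zero_iff[OF B(1) d] b unfolding B(2) by blast
  have "Poly_Mapping.lookup (B N) (0, 0) = Poly_Mapping.lookup (?A N) (0, 0)" for N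
  proof
    fix z
    show "Poly_Mapping.lookup (B N) (0, 0) z = Poly_Mapping.lookup (?A N) (0, 0) z"
    proof (cases "z \<in> S \<and> even N")
      case True
      then obtain j where j: "N = 2 * j" by (auto elim: evenE)
      have "b z (int j) 0 0 = (if int j = 0 then f z else 0)" using b True by blast
      moreover have "nat (2 * int j) = N" by (simp add: j)
      ultimately show ?thesis by (auto simp: B(2) secs_def cf_def A00 j)
    next
      case False
      then show ?thesis
        using par_lookup[OF gd_par[OF B(1)], of N "(0, 0)"] par_lookup[OF gd_par[OF A], of N "(0, 0)"]
          VA_off[OF gd_lookup[OF B(1)], of z] VA_off[OF gd_lookup[OF A], of z] by auto
    qed
  qed
  from flat_unique[OF flB fl this] show "b = sec ?A" using B(2) by simp
qed

text \<open>The identity defining J as a quotient, evaluated on f: a coefficient y x with y from U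
  acts as the function x f times the function y 1, which turns the opposite product into the
  fibrewise product.\<close>

lemma conv_hseq:
  assumes f: "f \<in> VA \<gamma>"
  shows "conv mf (hseq JJ f) (hseq Uu one) = hseq J0 f"
proof
  fix N
  have "hseq J0 f N = (\<Sum>i\<le>N. pm (\<lambda>h. hact \<gamma> h f) (moy (\<lambda>x y. y * x) (JJ i) (Uu (N - i))))"
    by (simp only: hseq_def conv_om_JJ[symmetric] pm_conv[OF clinear_hact[OF f]] om_def)
  also have "\<dots> = (\<Sum>i\<le>N. mf (hseq JJ f i) (hseq Uu one (N - i)))"
    unfolding hseq_def
  proof (intro sum.cong[OF refl] moy_nat_on[OF cbilinear_opp cbil_pt clinear_hact[OF f] clinear_hact[OF f] clinear_hact[OF one_VA]])
    show "vl delta_alg (Uu (N - i))" for i by (simp add: vl_def Uu_delta_alg)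
    show "hact \<gamma> (y * x) f = hact \<gamma> x f * hact \<gamma> y one" if "y \<in> delta_alg" for x y
      unfolding hact_mult[OF f] hact_delta_alg[OF that hact_VA[OF f]] by (rule mult.commute)
  qed
  finally show "conv mf (hseq JJ f) (hseq Uu one) N = hseq J0 f N" by (simp add: conv_def)
qed

definition unitS :: "nat \<Rightarrow> fpol" where "unitS N = (if N = 0 then cst one else 0)"

lemma gd_unit: "gd \<gamma> unitS"
  by (auto simp: gd_def par_iff vl_def unitS_def lookup_single when_def one_VA VA_lin(3))

lemma sec_unit: "z \<in> S \<Longrightarrow> sec unitS z = fone"
  by (intro ext) (auto simp: secs_def cf_def unitS_def lookup_single when_def one_def fone_def)

lemma hseq_J0_one: "hseq J0 one = unitS"
proof (rule flat_unique[OF flat_hseq_J0[OF one_VA]])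
  show "flat (P0 (Xb \<gamma>)) (Qo (Yb \<gamma>)) unitS"
    by (simp add: flat_def unitS_def du_single0 dv_single0 P0_def Qo_def pm_single clinear_Xb clinear_Yb XY_one lin_all
        mv_single mu_single cvec.scale_zero_right clinear_zero[OF clinear_pm])
  show "Poly_Mapping.lookup (hseq J0 one n) (0, 0) = Poly_Mapping.lookup (unitS n) (0, 0)" for n
    by (simp add: hseq_def clinear_hact[OF one_VA] J0_0 hact_one[OF one_VA] clinear_zero[OF clinear_hact[OF one_VA]] unitS_def)
qed

section \<open>The form Delta and the section U\<close>

text \<open>The function by which the Schwarzian element acts. In the frame, \<open>T0\<close> is
  the dx-coefficient of Delta_gamma: the monomial (yu)^2 in total degree 2 with coefficient (y/2)
  times \<open>sgm\<close>. The dy-coefficient is 0.\<close>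

definition sgm :: "pt \<Rightarrow> complex" where "sgm = hact \<gamma> hS one"
definition kap :: "pt \<Rightarrow> complex" where "kap z = 1/2 * yc z * sgm z"
definition T0 :: "nat \<Rightarrow> fpol" where "T0 N = (if N = 2 then Poly_Mapping.single (2, 0) kap else 0)"

lemma sgm_VA: "sgm \<in> VA \<gamma>"
  unfolding sgm_def by (rule hact_VA[OF one_VA])

lemma kap_VA: "kap \<in> VA \<gamma>"
proof -
  have "smooth_on S sgm" using sgm_VA by (simp add: VA_def)
  then have "smooth_on S (\<lambda>z. of_real (1/2 * snd z) * sgm z)"
    by (intro smooth_mult[OF open_S] smooth_of_real[OF open_S] smooth_const smooth_snd)
  then have "smooth_on S kap" by (rule smooth_cong[OF open_S, rotated]) (simp add: kap_def)
  then show ?thesis using VA_off[OF sgm_VA] by (simp add: VA_def kap_def)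
qed

lemma gd_T0: "gd \<gamma> T0"
  by (auto simp: gd_def par_iff vl_def T0_def lookup_single when_def kap_VA VA_lin(3))

lemma conv_T0: "conv mf T0 A 0 = 0" "conv mf T0 A 1 = 0" "conv mf T0 A (Suc (Suc N)) = Lu (Lu (pm (\<lambda>f. kap * f) (A N)))"
  "conv mf A T0 0 = 0" "conv mf A T0 1 = 0" "conv mf A T0 (Suc (Suc N)) = Ru (Ru (pm (\<lambda>f. f * kap) (A N)))"
proof -
  have 1: "conv mf T0 A M = (\<Sum>i\<le>M. if i = 2 then mf (Poly_Mapping.single (2, 0) kap) (A (M - 2)) else 0)" for M
    unfolding conv_def by (rule sum.cong) (auto simp: T0_def moy_lin_left[OF cbil_pt])
  show "conv mf T0 A 0 = 0" "conv mf T0 A 1 = 0" "conv mf T0 A (Suc (Suc N)) = Lu (Lu (pm (\<lambda>f. kap * f) (A N)))"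
    unfolding 1 by (simp_all add: sum.delta mf_LuLu)
  have 2: "conv mf A T0 M = (\<Sum>i\<le>M. if i = M - 2 then (if M < 2 then 0 else mf (A (M - 2)) (Poly_Mapping.single (2, 0) kap)) else 0)" for M
    unfolding conv_def
  proof (rule sum.cong[OF refl])
    fix i assume "i \<in> {..M}"
    then have "M - i = 2 \<longleftrightarrow> i = M - 2 \<and> \<not> M < 2" by auto
    then show "mf (A i) (T0 (M - i)) = (if i = M - 2 then (if M < 2 then 0 else mf (A (M - 2)) (Poly_Mapping.single (2, 0) kap)) else 0)"
      by (auto simp: T0_def moy_lin_right[OF cbil_pt])
  qed
  show "conv mf A T0 0 = 0" "conv mf A T0 1 = 0" "conv mf A T0 (Suc (Suc N)) = Ru (Ru (pm (\<lambda>f. f * kap) (A N)))"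
    unfolding 2 by (simp_all add: sum.delta mf_RuRu)
qed

lemma ioh_sec: "C 0 = 0 \<Longrightarrow> C 1 = 0 \<Longrightarrow> i_over_hbar (sec C z) k m n = \<i> * sec (\<lambda>N. C (Suc (Suc N))) z k m n"
proof -
  assume C: "C 0 = 0" "C 1 = 0"
  have "sec C z (k + 1) m n = secs 2 C z k m n" by (simp add: secs_def algebra_simps)
  then show ?thesis by (simp add: i_over_hbar_def secs2_Suc[OF C])
qed

end

lemma secs_add: "secs e (\<lambda>N. A N + B N) z k m n = secs e A z k m n + secs e B z k m n"
  by (simp add: secs_def cf_def lookup_add distrib_right add_divide_distrib)

lemma fmulu_sec: "(\<And>k m n. w k m n = yc z * sec G z k m n) \<Longrightarrow> fmulu w k m n = secs (- 1) (\<lambda>N. mu (G N)) z k m n"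
proof (cases m)
  case (Suc j)
  assume w: "\<And>k m n. w k m n = yc z * sec G z k m n"
  have "2 * k + int (Suc j) + int n + - 1 = 2 * k + int j + int n + 0" by simp
  then show ?thesis by (simp only: Suc fmulu_def secs_def cf_mu nat.case w) simp
qed (simp add: fmulu_def secs_def cf_mu)

lemma fmulv_sec: "snd z \<noteq> 0 \<Longrightarrow> (\<And>k m n. w k m n = sec G z k m n / yc z) \<Longrightarrow> fmulv w k m n = secs (- 1) (\<lambda>N. mv (G N)) z k m n"
proof (cases n)
  case (Suc j)
  assume w: "\<And>k m n. w k m n = sec G z k m n / yc z" and "snd z \<noteq> 0"
  have "2 * k + int m + int (Suc j) + - 1 = 2 * k + int m + int j + 0" by simp
  then show ?thesis by (simp only: Suc fmulv_def secs_def cf_mv nat.case w) (simp add: mult.commute)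
qed (simp add: fmulv_def secs_def cf_mv)

lemma euler: "Poly_Mapping.lookup (mu (du p) + mv (dv p)) (m, n) = of_nat (m + n) *\<^sub>C Poly_Mapping.lookup p (m, n)"
  by (cases m; cases n) (simp_all add: lookup_add ac_simps flip: scaleC_add_left)

context ldiff begin

abbreviation PL where "PL \<equiv> Pl (Xb \<gamma>) (\<lambda>f. sgm * f)"
abbreviation QL where "QL \<equiv> Qo (Yb \<gamma>)"

lemma clinear_sgm: "clinear (\<lambda>f. sgm * f)"
  by (rule cbilinearD1[OF cbil_pt])

lemma cf_Pl: "cf (\<lambda>N. PL (A N)) i m n z = cf (\<lambda>N. P0 (Xb \<gamma>) (A N)) i m n z + \<i> / 2 * (sgm z * cf (\<lambda>N. Lu (Lu (A N))) i m n z)"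
  by (simp add: cf_def Pl_def lookup_add scf clinear_sgm)

text \<open>X and Y annihilate the local unit, so the commutator with X or Y, evaluated on the unit,
  is X or Y applied to the value. The adjoint action in the equation of U thereby becomes
  differentiation of coefficients.\<close>

lemma flat_hseq_Uu: "flat PL QL (hseq Uu one)"
  unfolding hseq_def[abs_def]
proof (rule flat_pm[OF flat_Uu clinear_hact[OF one_VA]])
  have z: "hact \<gamma> x 0 = 0" for x using hact_linf(2)[OF VA_lin(3) VA_lin(3), of x 0] by (simp add: cvec.scale_zero_left)
  have X: "hact \<gamma> (ad hX x) one = Xb \<gamma> (hact \<gamma> x one)" and Y: "hact \<gamma> (ad hY x) one = Yb \<gamma> (hact \<gamma> x one)" for x
    by (simp_all add: ad_def clinear_diff[OF clinear_hact[OF one_VA]] hact_X[OF one_VA] hact_Y[OF one_VA])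
      (simp_all add: hact_mult[OF one_VA] hact_gen[OF one_VA] Xb_eq[OF one_VA, symmetric] Yb_eq[OF one_VA, symmetric] XY_one z)
  have S: "hact \<gamma> (hS * x) one = sgm * hact \<gamma> x one" for x
    unfolding hact_mult[OF one_VA] sgm_def by (rule hact_delta_alg[OF hS_delta_alg hact_VA[OF one_VA]])
  show "pm (\<lambda>h. hact \<gamma> h one) (Pl (ad hX) (\<lambda>x. hS * x) p) = PL (pm (\<lambda>h. hact \<gamma> h one) p)" for p
    by (rule pm_Pl[OF clinear_hact[OF one_VA] clinear_ad clinear_Xb clinear_lmult clinear_sgm X S])
  show "pm (\<lambda>h. hact \<gamma> h one) (Qo (ad hY) p) = QL (pm (\<lambda>h. hact \<gamma> h one) p)" for p
    by (rule pm_Qo[OF clinear_hact[OF one_VA] clinear_ad clinear_Yb Y])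
qed

lemma hseq_cst: "f \<in> VA \<gamma> \<Longrightarrow> c 0 = cst 1 \<Longrightarrow> hseq c f 0 = cst f"
  by (simp add: hseq_def pm_single clinear_hact hact_one)

context
  assumes D: "Delta_form \<gamma> = (sec T0, 0)"
begin

lemma U_fst:
  assumes A: "gd \<gamma> A" and z: "z \<in> S"
  shows "fst (U_equation_form \<gamma> (sec A)) z k m n = yc z * sec (\<lambda>N. PL (A N)) z k m n"
proof -
  have y: "snd z \<noteq> 0" using z S_iff by auto
  have "i_over_hbar ((sec T0 \<star>\<^sub>w sec A) z) k m n = \<i> * sec (\<lambda>N. Lu (Lu (pm (\<lambda>f. kap * f) (A N)))) z k m n"
    unfolding sec_mult[OF ld gd_T0 ld A] using ioh_sec[of "conv mf T0 A" z k m n, OF conv_T0(1,2)] by (simp only: conv_T0(3))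
  also have "sec (\<lambda>N. Lu (Lu (pm (\<lambda>f. kap * f) (A N)))) z k m n = kap z * sec (\<lambda>N. Lu (Lu (A N))) z k m n"
    by (simp add: secs_def cf_def lookup_LuLu)
  finally have i: "i_over_hbar ((sec T0 \<star>\<^sub>w sec A) z) k m n = \<i> * (kap z * sec (\<lambda>N. Lu (Lu (A N))) z k m n)" .
  show ?thesis
    by (simp add: U_equation_form_def D fedosov_delta_def D_fst[OF A z] fdu_sec[OF y] i kap_def)
      (simp only: secs_def cf_Pl, use y in \<open>simp add: field_simps\<close>)
qed

lemma U_snd:
  assumes A: "gd \<gamma> A" and z: "z \<in> S"
  shows "snd (U_equation_form \<gamma> (sec A)) z k m n = sec (\<lambda>N. QL (A N)) z k m n / yc z"
proof -
  have y: "snd z \<noteq> 0" using z S_iff by auto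
  have "i_over_hbar ((0 \<star>\<^sub>w sec A) z) k m n = 0"
    by (simp add: wmult_def moyal_zero wp_sec i_over_hbar_def)
  then show ?thesis
    by (simp add: U_equation_form_def D fedosov_delta_def D_snd[OF A z] fdv_sec[OF y] diff_divide_distrib)
qed

lemma U_rhs:
  assumes A: "gd \<gamma> A" and z: "z \<in> S"
  shows "(fone + fedosov_delta_inv (U_equation_form \<gamma> (sec A)) z) k m n
    = fone k m n + secs (- 1) (\<lambda>N. mu (PL (A N)) + mv (QL (A N))) z k m n / of_nat (m + n)"
proof -
  have y: "snd z \<noteq> 0" using z S_iff by auto
  show ?thesis
    by (simp add: fedosov_delta_inv_def secs_add fmulu_sec[of "fst (U_equation_form \<gamma> (sec A)) z", OF U_fst[OF A z]]
        fmulv_sec[OF y, of "snd (U_equation_form \<gamma> (sec A)) z", OF U_snd[OF A z]])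
qed

lemma sec_eqN:
  assumes "gd \<gamma> A" "gd \<gamma> B" and e: "\<And>z k m n. z \<in> S \<Longrightarrow> 2 * k + int m + int n = int N \<Longrightarrow> sec A z k m n = sec B z k m n"
  shows "A N = B N"
proof (rule poly_mapping_eqI, rule ext)
  fix j :: "nat \<times> nat" and z
  obtain m n where j: "j = (m, n)" by (cases j)
  consider "z \<notin> S" | "odd (N + m + n)" | "z \<in> S" "even (N + m + n)" by blast
  then show "Poly_Mapping.lookup (A N) j z = Poly_Mapping.lookup (B N) j z"
  proof cases
    case 1
    then show ?thesis by (simp add: VA_off[OF gd_lookup[OF assms(1)]] VA_off[OF gd_lookup[OF assms(2)]])
  next
    case 2
    then show ?thesis using par_lookup[OF gd_par[OF assms(1)], of N j] par_lookup[OF gd_par[OF assms(2)], of N j] by (simp add: j)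
  next
    case 3
    then have "even (int N + int m + int n)" by (simp flip: of_nat_add)
    then have k: "2 * ((int N - int m - int n) div 2) + int m + int n = int N" by simp
    show ?thesis using e[OF 3(1) k] S_iff 3 by (simp add: secs_def cf_def j k)
  qed
qed

text \<open>In total degree i > 0 the equation says that the component is (u P + v Q) of the
  previous component, divided by the fibre degree, with P, Q the operators \<open>PL\<close>,
  \<open>QL\<close>. This determines a solution recursively. For a flat series P and Q of the
  previous component are the derivatives of the present one, and Euler's identity shows that it is a
  solution.\<close>

lemma U_section_eq: "U_section \<gamma> = sec (hseq Uu one)"
  unfolding U_section_def
proof (rule the_equality)
  let ?A = "hseq Uu one"
  have A: "gd \<gamma> ?A" by (rule gd_hseq[OF one_VA par_Uu])
  have fl: "PL (?A N) = du (?A (Suc N))" "QL (?A N) = dv (?A (Suc N))" for N using flat_hseq_Uu by (simp_all add: flat_def)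
  have U: "sec ?A z k m n = (fone + fedosov_delta_inv (U_equation_form \<gamma> (sec ?A)) z) k m n" if z: "z \<in> S" for z k m n
  proof -
    define i where "i = 2 * k + int m + int n"
    have c: "secs (- 1) (\<lambda>N. mu (PL (?A N)) + mv (QL (?A N))) z k m n = cf (\<lambda>N. mu (PL (?A N)) + mv (QL (?A N))) (i - 1) m n z * yc z ^ m / yc z ^ n"
      "sec ?A z k m n = cf ?A i m n z * yc z ^ m / yc z ^ n"
      by (simp_all add: secs_def i_def)
    consider "i < 0" | "i = 0" | N where "i = int (Suc N)"
    proof -
      assume a: "i < 0 \<Longrightarrow> thesis" "i = 0 \<Longrightarrow> thesis" "\<And>N. i = int (Suc N) \<Longrightarrow> thesis"
      have "i = int (Suc (nat (i - 1)))" if "i > 0" using that by simp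
      then show thesis using a by (cases i "0 :: int" rule: linorder_cases) blast+
    qed
    then show ?thesis
    proof cases
      case 1
      then have "fone k m n = 0" by (auto simp: fone_def i_def)
      with 1 show ?thesis unfolding U_rhs[OF A z] c by (simp add: cf_def)
    next
      case 2
      have "?A 0 = cst one" by (rule hseq_cst[of _ Uu, OF one_VA Uu_cst])
      moreover have "k = 0" if "m = 0" "n = 0" using 2 that by (simp add: i_def)
      ultimately show ?thesis unfolding U_rhs[OF A z] c 2 using z
        by (auto simp: cf_def lookup_single when_def one_def fone_def)
    next
      case 3
      have e: "cf (\<lambda>N. mu (PL (?A N)) + mv (QL (?A N))) (i - 1) m n z = of_nat (m + n) * cf ?A i m n z"
      proof -
        have "nat (int (Suc N)) = Suc N" "nat (int (Suc N) - 1) = N" "0 \<le> int (Suc N)" "0 \<le> int (Suc N) - 1" by simp_all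
        then show ?thesis unfolding 3 cf_def by (simp only: if_True fl euler scf of_nat_add)
      qed
      show ?thesis
      \<comment> \<open>At fibre degree zero the quotient is 0/0, which has the value 0, in
        agreement with the vanishing constant terms of U in positive degree.\<close>
      proof (cases "m + n = 0")
        case True
        have "Poly_Mapping.lookup (?A (Suc N)) (0, 0) = 0"
          by (simp add: hseq_def clinear_hact[OF one_VA] Uu_0 clinear_zero[OF clinear_hact[OF one_VA]])
        moreover have "fone k m n = 0" using 3 True by (auto simp: fone_def i_def)
        moreover have "nat (1 + int N) = Suc N" by simp
        ultimately show ?thesis unfolding U_rhs[OF A z] c e using True 3 by (simp add: cf_def)
      next
        case False
        then have "fone k m n = 0" "of_nat (m + n) \<noteq> (0 :: complex)" by (auto simp: fone_def simp del: of_nat_add)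
        then show ?thesis unfolding U_rhs[OF A z] c e using False by (auto simp del: of_nat_add)
      qed
    qed
  qed
  then show "Wplus_on S (sec ?A) \<and> (\<forall>z\<in>S. sec ?A z = fone + fedosov_delta_inv (U_equation_form \<gamma> (sec ?A)) z)"
    using sec_Wplus[OF A] by blast
  fix b assume b: "Wplus_on S b \<and> (\<forall>z\<in>S. b z = fone + fedosov_delta_inv (U_equation_form \<gamma> b) z)"
  then obtain B where B: "gd \<gamma> B" "b = sec B" using Wplus_sec by blast
  have UB: "sec B z k m n = (fone + fedosov_delta_inv (U_equation_form \<gamma> (sec B)) z) k m n" if "z \<in> S" for z k m n
    using b B that by metis
  have "B N = ?A N" for N
  proof (induction N)
    case 0
    show ?case
    proof (rule sec_eqN[OF B(1) A])
      fix z k m n assume z: "z \<in> S" and i: "2 * k + int m + int n = int 0"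
      show "sec B z k m n = sec ?A z k m n"
        unfolding UB[OF z] U[OF z] U_rhs[OF A z] U_rhs[OF B(1) z] using i by (simp add: secs_def cf_def)
    qed
  next
    case (Suc N)
    show ?case
    proof (rule sec_eqN[OF B(1) A])
      fix z k m n assume z: "z \<in> S" and i: "2 * k + int m + int n = int (Suc N)"
      show "sec B z k m n = sec ?A z k m n"
        unfolding UB[OF z] U[OF z] U_rhs[OF A z] U_rhs[OF B(1) z] using i by (simp add: secs_def cf_def Suc)
    qed
  qed
  then show "b = sec ?A" using B(2) by (metis ext)
qed

end

lemma moyal_JJ_Uu: "z \<in> S \<Longrightarrow> moyal (sec (hseq JJ one) z) (sec (hseq Uu one) z) = fone"
  using sec_mult[OF ld gd_hseq[OF one_VA par_JJ] ld gd_hseq[OF one_VA par_Uu]]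
  by (simp add: wmult_def conv_hseq[OF one_VA] hseq_J0_one sec_unit fun_eq_iff)

lemma winv_U: "winv S (sec (hseq Uu one)) = sec (hseq JJ one)"
proof (rule winv_eq[OF sec_Wplus[OF gd_hseq[OF one_VA par_JJ]] wp_sec moyal_JJ_Uu])
  fix z assume z: "z \<in> S"
  then show y: "snd z \<noteq> 0" using S_iff by auto
  have "hseq JJ one 0 = cst one" by (simp add: hseq_def JJ_cst pm_single clinear_hact one_VA hact_one)
  then show "fs (yc z) (sec (hseq JJ one) z) 0 = cst 1"
    using z by (simp add: fs_sec[OF gd_par[OF gd_hseq[OF one_VA par_JJ]] y] pm_single clinear_ev one_def)
qed

end

section \<open>The action of a diffeomorphism on the fibre\<close>

text \<open>The coefficient of u^m v^n in p(u, v + s u).\<close>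

definition fsub :: "complex \<Rightarrow> complex pol \<Rightarrow> nat \<Rightarrow> nat \<Rightarrow> complex" where
  "fsub s p m n = (\<Sum>i\<le>m. s ^ i * of_nat ((n + i) choose i) * Poly_Mapping.lookup p (m - i, n + i))"

lemma fsubst_lower:
  "fsubst D 0 C (1 / D) w k m n = (\<Sum>i\<le>m. w k (m - i) (n + i) * of_real (D ^ (m - i) * of_nat ((n + i) choose i) * C ^ i * (1 / D) ^ n))"
proof -
  have inner: "(\<Sum>i\<le>min p m. of_nat (p choose i) * D ^ i * 0 ^ (p - i)
        * (of_nat ((m + n - p) choose (m - i)) * C ^ (m - i) * (1 / D) ^ (m + n - p - (m - i))))
      = (if p \<le> m then D ^ p * (of_nat ((m + n - p) choose (m - p)) * C ^ (m - p) * (1 / D) ^ n) else 0)" (is "?L p = ?R p") for p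
  proof -
    have "?L p = (\<Sum>i\<le>min p m. if i = p then D ^ p * (of_nat ((m + n - p) choose (m - p)) * C ^ (m - p) * (1 / D) ^ (m + n - p - (m - p))) else 0)"
      by (rule sum.cong[OF refl]) auto
    moreover have "m + n - p - (m - p) = n" if "p \<le> m" using that by simp
    ultimately show ?thesis by (simp add: sum.delta)
  qed
  have "fsubst D 0 C (1 / D) w k m n = (\<Sum>p\<le>m + n. w k p (m + n - p) * of_real (?R p))"
    unfolding fsubst_def inner ..
  also have "\<dots> = (\<Sum>p\<le>m. w k p (m + n - p) * of_real (?R p))"
    by (rule sum.mono_neutral_right) auto
  also have "\<dots> = (\<Sum>i\<le>m. w k (m - i) (m + n - (m - i)) * of_real (?R (m - i)))"
    by (rule sum.reindex_bij_witness[of _ "\<lambda>i. m - i" "\<lambda>i. m - i"]) auto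
  also have "\<dots> = (\<Sum>i\<le>m. w k (m - i) (n + i) * of_real (D ^ (m - i) * of_nat ((n + i) choose i) * C ^ i * (1 / D) ^ n))"
  proof (rule sum.cong[OF refl])
    fix i assume "i \<in> {..m}"
    then have "m + n - (m - i) = n + i" "m - (m - i) = i" by auto
    then show "w k (m - i) (m + n - (m - i)) * of_real (?R (m - i)) = w k (m - i) (n + i) * of_real (D ^ (m - i) * of_nat ((n + i) choose i) * C ^ i * (1 / D) ^ n)"
      by (simp add: mult.assoc)
  qed
  finally show ?thesis .
qed

lemma frame_pow:
  fixes a D t :: real
  assumes "a > 0" "D > 0" "i \<le> m"
  shows "(a / D) ^ (m - i) / (a / D) ^ (n + i) * (D ^ (m - i) * (t * a * a / D) ^ i * (1 / D) ^ n) = t ^ i * a ^ m / a ^ n"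
proof -
  have "a ^ m = a ^ (m - i) * a ^ i" using assms(3) by (simp flip: power_add)
  then show ?thesis using assms(1,2) by (simp add: power_divide power_mult_distrib power_add field_simps)
qed

lemma lookup_Nop_pow: "Poly_Mapping.lookup ((Nop ^^ i) p) (m, n)
    = (if i \<le> m then (fact (n + i) / fact n) *\<^sub>C Poly_Mapping.lookup p (m - i, n + i) else 0)"
proof (induction i arbitrary: m n)
  case 0
  then show ?case by simp
next
  case (Suc i)
  show ?case
  proof (cases m)
    case 0
    then show ?thesis by (simp add: Nop_def)
  next
    case (Suc m')
    have "of_nat (Suc n) * (fact (Suc n + i) / fact (Suc n)) = (fact (n + Suc i) / fact n :: complex)"
      by (simp add: fact_Suc field_simps del: of_nat_Suc)
    moreover have "Poly_Mapping.lookup ((Nop ^^ Suc i) p) (m, n) = of_nat (Suc n) *\<^sub>C Poly_Mapping.lookup ((Nop ^^ i) p) (m', Suc n)"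
      by (simp add: Suc Nop_def[of "(Nop ^^ i) p"])
    ultimately show ?thesis by (simp add: Suc Suc.IH scaleC_scaleC cvec.scale_zero_right del: of_nat_Suc fact_Suc funpow.simps)
  qed
qed

context ldiff begin

definition FFm :: "(pt \<Rightarrow> complex) \<Rightarrow> (pt \<Rightarrow> complex) \<Rightarrow> pt \<Rightarrow> complex" where "FFm f g z = f z * fun_act \<gamma> g z"
definition dl :: "(pt \<Rightarrow> complex) \<Rightarrow> pt \<Rightarrow> complex" where "dl f z = of_real (delta_fun \<gamma> 0 z) * f z"
text \<open>The action of gamma on series in the frame, written as a twisted product with the unit
  so that the rules for \<open>tw\<close> apply to it.\<close>

definition EE :: "fpol \<Rightarrow> fpol" where "EE p = tw FFm dl (cst one) p"

lemma cbil_FFm: "cbilinear FFm"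
  by (intro cbilinearI clinearI; rule ext)
    (simp_all only: FFm_def fun_act_lin plus_fun_apply scf distrib_left distrib_right mult.assoc mult.left_commute)

lemma clinear_dl: "clinear dl"
  by (rule clinearI; rule ext) (simp_all only: dl_def plus_fun_apply scf distrib_left mult.left_commute)

lemma dl_pow: "(dl ^^ i) f z = of_real (delta_fun \<gamma> 0 z) ^ i * f z"
  by (induction i) (simp_all add: dl_def del: delta_fun.simps)

text \<open>The exponential of -delta_1 u d/dv is the substitution v -> v - delta_1 u by Taylor's
  formula; the pairing \<open>FFm\<close> adds the pullback of the coefficients.\<close>

lemma lookup_EE: "Poly_Mapping.lookup (EE p) (m, n) z
    = (if z \<in> S then fsub (- of_real (delta_fun \<gamma> 0 z)) (ev (phi \<gamma> z) p) m n else 0)"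
proof -
  obtain M where M: "\<And>i. i \<ge> M \<Longrightarrow> (Nop ^^ i) p = 0" using Nop_nilpotent by blast
  let ?M = "max M (Suc m)" and ?s = "of_real (delta_fun \<gamma> 0 z) :: complex"
  have t: "Poly_Mapping.lookup (((- 1) ^ i / fact i) *\<^sub>C moy FFm (pm (dl ^^ i) (cst one)) ((Nop ^^ i) p)) (m, n) z
     = (if i \<le> m then (if z \<in> S then (- ?s) ^ i * of_nat ((n + i) choose i) * Poly_Mapping.lookup p (m - i, n + i) (phi \<gamma> z) else 0) else 0)" for i
  proof -
    have b: "of_nat ((n + i) choose i) = (fact (n + i) / (fact i * fact n) :: complex)"
      by (simp add: binomial_fact)
    show ?thesis
      by (simp add: pm_single clinear_funpow[OF clinear_dl] moy_cst_left[OF cbil_FFm] cbilinearD1[OF cbil_FFm] scf FFm_def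
          lookup_Nop_pow dl_pow fun_act_eq one_def b power_minus[of ?s] mult.commute mult.left_commute mult.assoc del: delta_fun.simps)
  qed
  have "Poly_Mapping.lookup (EE p) (m, n) z = (\<Sum>i<?M. if i \<le> m then (if z \<in> S then (- ?s) ^ i * of_nat ((n + i) choose i) * Poly_Mapping.lookup p (m - i, n + i) (phi \<gamma> z) else 0) else 0)"
  proof -
    have "(Nop ^^ i) p = 0" if "i \<ge> ?M" for i by (rule M) (use that in simp)
    from tw_eq[OF cbil_FFm clinear_dl this] have "EE p = (\<Sum>i<?M. ((- 1) ^ i / fact i) *\<^sub>C moy FFm (pm (dl ^^ i) (cst one)) ((Nop ^^ i) p))"
      unfolding EE_def by blast
    then show ?thesis by (simp only: lookup_sum clinear_sum[OF clinear_ev] t)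
  qed
  also have "\<dots> = (\<Sum>i\<le>m. if i \<le> m then (if z \<in> S then (- ?s) ^ i * of_nat ((n + i) choose i) * Poly_Mapping.lookup p (m - i, n + i) (phi \<gamma> z) else 0) else 0)"
    by (rule sum.mono_neutral_right) auto
  finally show ?thesis by (simp add: fsub_def clinear_ev)
qed

lemma ev_EE: "z \<in> S \<Longrightarrow> Poly_Mapping.lookup (ev z (EE p)) (m, n) = fsub (- of_real (delta_fun \<gamma> 0 z)) (ev (phi \<gamma> z) p) m n"
  by (simp add: clinear_ev lookup_EE)

definition cC :: "pt \<Rightarrow> real" where "cC z = - snd z * deriv (deriv (ps \<gamma>)) (fst z) / (deriv (ps \<gamma>) (fst z))\<^sup>2"

lemma pd_phi:
  assumes z: "z \<in> S"
  shows "pdx (\<lambda>w. fst (the (pm_inv (lift \<gamma>) w))) z = deriv (ps \<gamma>) (fst z)" "pdy (\<lambda>w. fst (the (pm_inv (lift \<gamma>) w))) z = 0"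
    "pdx (\<lambda>w. snd (the (pm_inv (lift \<gamma>) w))) z = cC z" "pdy (\<lambda>w. snd (the (pm_inv (lift \<gamma>) w))) z = 1 / deriv (ps \<gamma>) (fst z)"
proof -
  have f: "fst (the (pm_inv (lift \<gamma>) w)) = ps \<gamma> (fst w)" and s: "snd (the (pm_inv (lift \<gamma>) w)) = snd w / deriv (ps \<gamma>) (fst w)" if "w \<in> S" for w
    using that by (simp_all add: pm_inv_lift phi_def)
  show "pdx (\<lambda>w. fst (the (pm_inv (lift \<gamma>) w))) z = deriv (ps \<gamma>) (fst z)" "pdy (\<lambda>w. fst (the (pm_inv (lift \<gamma>) w))) z = 0"
    using pdxy_cong[OF open_S z f] phi_pd(1,2)[OF z] by simp_all
  show "pdx (\<lambda>w. snd (the (pm_inv (lift \<gamma>) w))) z = cC z" "pdy (\<lambda>w. snd (the (pm_inv (lift \<gamma>) w))) z = 1 / deriv (ps \<gamma>) (fst z)"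
    using pdxy_cong[OF open_S z s] phi_pd(3,4)[OF z] by (simp_all add: cC_def)
qed

lemma sec_act_fsubst: "sec_act \<gamma> a z = (if z \<in> S then fsubst (deriv (ps \<gamma>) (fst z)) 0 (cC z) (1 / deriv (ps \<gamma>) (fst z)) (a (phi \<gamma> z)) else 0)"
proof -
  have "the (pm_inv (lift \<gamma>) z) = phi \<gamma> z" if "z \<in> S" using that by (simp add: pm_inv_lift)
  then show ?thesis by (simp add: sec_act_def Let_def pd_phi)
qed

lemma form_act_eq:
  assumes z: "z \<in> S"
  shows "fst (form_act \<gamma> \<omega>) z k m n = of_real (deriv (ps \<gamma>) (fst z)) * sec_act \<gamma> (fst \<omega>) z k m n + of_real (cC z) * sec_act \<gamma> (snd \<omega>) z k m n"
    "snd (form_act \<gamma> \<omega>) z k m n = of_real (1 / deriv (ps \<gamma>) (fst z)) * sec_act \<gamma> (snd \<omega>) z k m n"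
  by (simp_all add: form_act_def Let_def pd_phi[OF z] scaleC_fun_def scaleC_complex_def)

text \<open>The Jacobian of the inverse lift is lower triangular. Its diagonal entries, inverse to
  each other, are absorbed by the frame factors at the two points, and the off-diagonal entry
  becomes -delta_1. What remains is the unipotent action \<open>EE\<close>.\<close>

lemma sec_act_secs: "sec_act \<gamma> (secs e B) = secs e (\<lambda>N. EE (B N))"
proof (intro ext)
  fix z k m n
  show "sec_act \<gamma> (secs e B) z k m n = secs e (\<lambda>N. EE (B N)) z k m n"
  proof (cases "z \<in> S")
    case False
    then show ?thesis by (simp add: sec_act_fsubst secs_def cf_def lookup_EE)
  next
    case True
    define I where "I = 2 * k + int m + int n + e"
    define D where "D = deriv (ps \<gamma>) (fst z)"
    define s where "s = delta_fun \<gamma> 0 z"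
    have y: "snd z > 0" "fst z \<in> ran \<gamma>" using True S_iff by auto
    have D: "D > 0" using ps'_pos[OF y(2)] by (simp add: D_def)
    have C: "cC z = - s * snd z * snd z / D"
      unfolding s_def delta_fun_eq[OF True] using y D lnd_eq[OF y(2)]
      by (simp add: cC_def D_def[symmetric] power2_eq_square)
    have snd: "snd (phi \<gamma> z) = snd z / D" by (simp add: phi_def D_def)
    have t: "secs e B (phi \<gamma> z) k (m - i) (n + i) * of_real (D ^ (m - i) * of_nat ((n + i) choose i) * cC z ^ i * (1 / D) ^ n)
        = (- of_real s) ^ i * of_nat ((n + i) choose i) * cf B I (m - i) (n + i) (phi \<gamma> z) * yc z ^ m / yc z ^ n" if "i \<le> m" for i
    proof -
      have I: "2 * k + int (m - i) + int (n + i) + e = I" using that by (simp add: I_def)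
      have "complex_of_real ((snd z / D) ^ (m - i) / (snd z / D) ^ (n + i) * (D ^ (m - i) * cC z ^ i * (1 / D) ^ n)) = of_real ((- s) ^ i * snd z ^ m / snd z ^ n)"
        using frame_pow[OF y(1) D that, of n "- s"] unfolding C by simp
      note E = this
      have "secs e B (phi \<gamma> z) k (m - i) (n + i) * of_real (D ^ (m - i) * of_nat ((n + i) choose i) * cC z ^ i * (1 / D) ^ n)
        = of_nat ((n + i) choose i) * cf B I (m - i) (n + i) (phi \<gamma> z)
          * complex_of_real ((snd z / D) ^ (m - i) / (snd z / D) ^ (n + i) * (D ^ (m - i) * cC z ^ i * (1 / D) ^ n))"
        unfolding secs_def I snd
        by (simp only: of_real_mult of_real_divide of_real_power of_real_of_nat_eq times_divide_eq_right times_divide_eq_left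
            mult.commute mult.left_commute mult.assoc)
      also have "\<dots> = (- of_real s) ^ i * of_nat ((n + i) choose i) * cf B I (m - i) (n + i) (phi \<gamma> z) * yc z ^ m / yc z ^ n"
        unfolding E by simp
      finally show ?thesis .
    qed
    have "sec_act \<gamma> (secs e B) z k m n = (\<Sum>i\<le>m. (- of_real s) ^ i * of_nat ((n + i) choose i) * cf B I (m - i) (n + i) (phi \<gamma> z) * yc z ^ m / yc z ^ n)"
      using True by (simp only: sec_act_fsubst if_True fsubst_lower D_def[symmetric]) (rule sum.cong[OF refl], rule t, simp)
    also have "\<dots> = (if 0 \<le> I then fsub (- of_real s) (ev (phi \<gamma> z) (B (nat I))) m n else 0) * yc z ^ m / yc z ^ n"
      by (simp add: fsub_def cf_def clinear_ev sum_distrib_right sum_divide_distrib)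
    also have "\<dots> = secs e (\<lambda>N. EE (B N)) z k m n"
      using True by (simp add: secs_def cf_def I_def[symmetric] lookup_EE s_def)
    finally show ?thesis .
  qed
qed

lemma fsubst_lin: "fsubst a b c d (\<lambda>k m n. r * (w k m n - w' k m n)) k m n = r * (fsubst a b c d w k m n - fsubst a b c d w' k m n)"
  by (simp add: fsubst_def sum_distrib_left sum_subtractf algebra_simps)

lemma par_EE: "par B \<Longrightarrow> par (\<lambda>N. EE (B N))"
  by (simp add: par_def EE_def sg_tw[OF cbil_FFm clinear_dl] sg_cst clinear_scale[OF clinear_tw_right[OF cbil_FFm clinear_dl]])

lemma tw_dl: "tw FFm dl (pm dl p) q = pm dl (tw FFm dl p q)"
  by (subst tw_nat[OF cbil_FFm cbil_FFm clinear_dl clinear_dl clinear_id clinear_dl clinear_dl])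
    (auto simp: pm_id dl_def FFm_def fun_eq_iff)

lemma tw_mf: "tw FFm dl (mf p q) r = mf p (tw FFm dl q r)"
proof -
  have "tw FFm dl (tw (\<lambda>f g. f * g) (\<lambda>_. 0) p q) r = tw (\<lambda>f g. f * g) (\<lambda>_. 0) p (tw FFm dl q r)"
    by (rule tw_assoc[OF cbil_pt cbil_FFm cbil_pt cbil_FFm clinear_zero_fun clinear_dl clinear_dl])
      (auto simp: FFm_def dl_def fun_eq_iff)
  then show ?thesis by (simp add: tw_zero[OF cbil_pt])
qed

lemma pm_mult_one: "vl (VA \<gamma>) p \<Longrightarrow> pm (\<lambda>f. f * one) p = p"
  using pm_cong[of "\<lambda>f. f * one" "\<lambda>f. f" "VA \<gamma>" p] by (simp add: cbilinearD2[OF cbil_pt] clinear_id pm_id mult_one)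

lemma mf_EE: "vl (VA \<gamma>) p \<Longrightarrow> mf p (EE q) = tw FFm dl p q"
  by (simp add: EE_def tw_mf[symmetric] moy_cst_right[OF cbil_pt] pm_mult_one)

lemma EE_ops: "du (EE q) = EE (du q) - pm dl (EE (dv q))" "dv (EE q) = EE (dv q)"
  using tw_du[OF cbil_FFm clinear_dl, of "cst one" q] tw_dv[OF cbil_FFm clinear_dl, of "cst one" q]
  by (simp_all add: EE_def tw_dl du_single0 dv_single0 tll[OF cbil_FFm clinear_dl])

end

section \<open>Uniqueness of the form Delta\<close>

lemma commutator_unique_single:
  assumes "cbilinear T"
  shows "conv T a (\<lambda>N. if N = 1 then c else 0) (Suc N) = T (a N) c" "conv T (\<lambda>N. if N = 1 then c else 0) a (Suc N) = T c (a N)"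
proof -
  have "conv T a (\<lambda>N. if N = 1 then c else 0) (Suc N) = (\<Sum>i\<le>Suc N. if i = N then T (a N) c else 0)"
    unfolding conv_def by (rule sum.cong[OF refl]) (auto simp: cbil_lin[OF assms])
  then show "conv T a (\<lambda>N. if N = 1 then c else 0) (Suc N) = T (a N) c" by (simp add: sum.delta)
  have "conv T (\<lambda>N. if N = 1 then c else 0) a (Suc N) = (\<Sum>i\<le>Suc N. if i = 1 then T c (a N) else 0)"
    unfolding conv_def by (rule sum.cong[OF refl]) (auto simp: cbil_lin[OF assms])
  then show "conv T (\<lambda>N. if N = 1 then c else 0) a (Suc N) = T c (a N)" by (simp add: sum.delta)
qed

context ldiff begin

lemma pm_one_mult: "vl (VA \<gamma>) p \<Longrightarrow> pm (\<lambda>f. one * f) p = p"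
  using pm_mult_one by (simp add: mult.commute)

lemma gd_diff: "gd \<gamma> A \<Longrightarrow> gd \<gamma> B \<Longrightarrow> gd \<gamma> (\<lambda>N. A N - B N)"
  by (simp add: gd_def vl_diff[OF subspace_VA[OF ld]] par_def lin_sg cvec.scale_right_diff_distrib)

lemma secs_diff: "secs e (\<lambda>N. A N - B N) z k m n = secs e A z k m n - secs e B z k m n"
  by (simp add: secs_def cf_def lookup_minus left_diff_distrib diff_divide_distrib)

lemma commutator_sec:
  assumes T: "gd \<gamma> T" and A: "gd \<gamma> A"
  shows "(sec T \<star>\<^sub>w sec A) z - (sec A \<star>\<^sub>w sec T) z = sec (\<lambda>N. conv mf T A N - conv mf A T N) z"
    "gd \<gamma> (\<lambda>N. conv mf T A N - conv mf A T N)"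
  by (simp_all add: sec_mult[OF ld T ld A] sec_mult[OF ld A ld T] fun_eq_iff secs_diff gd_diff gd_conv_mf[OF ld T A subset_refl] gd_conv_mf[OF ld A T subset_refl])

lemma gd_gen: "odd (m + n) \<Longrightarrow> gd \<gamma> (\<lambda>N. if N = 1 then Poly_Mapping.single (m, n) one else 0)"
  by (auto simp: gd_def par_iff vl_def lookup_single when_def one_VA VA_lin(3))

text \<open>Commutators with u and v determine the two fibre derivatives, so a section is determined
  by its commutators up to a constant; the constant terms are excluded by hypothesis.\<close>

lemma commutator_unique:
  assumes T: "gd \<gamma> T" and T': "gd \<gamma> T'"
    and c: "\<And>N. Poly_Mapping.lookup (T N) (0, 0) = 0" "\<And>N. Poly_Mapping.lookup (T' N) (0, 0) = 0"
    and eq: "\<And>a z. W_on S a \<Longrightarrow> z \<in> S \<Longrightarrow>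
      i_over_hbar ((sec T \<star>\<^sub>w a) z - (a \<star>\<^sub>w sec T) z) = i_over_hbar ((sec T' \<star>\<^sub>w a) z - (a \<star>\<^sub>w sec T') z)"
  shows "T = T'"
proof
  fix N
  have key: "mf (T N) g - mf g (T N) = mf (T' N) g - mf g (T' N)"
    if g: "g = Poly_Mapping.single (m, n) one" "m + n = 1" for g m n
  proof -
    \<comment> \<open>The test section is u or v in the frame: the local unit times the generator,
      placed in total degree 1.\<close>
    define A where "A = (\<lambda>N :: nat. if N = 1 then g else 0 :: fpol)"
    have A: "gd \<gamma> A" unfolding A_def g(1) by (rule gd_gen) (simp add: g(2))
    have "sec A z k i j = 0" if "k < 0" for z k i j
      using that g(2) by (auto simp: secs_def cf_def A_def g(1) lookup_single when_def)
    then have W: "W_on S (sec A)" using sec_smooth[OF A] by (simp add: W_on_def)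
    have "(\<lambda>N. conv mf T A N - conv mf A T N) = (\<lambda>N. conv mf T' A N - conv mf A T' N)"
    proof (rule sec_eqD[OF commutator_sec(2)[OF T A] commutator_sec(2)[OF T' A]], intro ext)
      fix z k i j assume "z \<in> S"
      \<comment> \<open>The equation is read one exponent lower, which undoes the shift made by
        \<open>i_over_hbar\<close>.\<close>
      from eq[OF W this] have "i_over_hbar (sec (\<lambda>N. conv mf T A N - conv mf A T N) z) (k - 1) i j
          = i_over_hbar (sec (\<lambda>N. conv mf T' A N - conv mf A T' N) z) (k - 1) i j"
        unfolding commutator_sec(1)[OF T A] commutator_sec(1)[OF T' A] by simp
      then show "sec (\<lambda>N. conv mf T A N - conv mf A T N) z k i j = sec (\<lambda>N. conv mf T' A N - conv mf A T' N) z k i j"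
        by (simp add: i_over_hbar_def)
    qed
    from fun_cong[OF this, of "Suc N"] show ?thesis
      unfolding A_def commutator_unique_single[OF cbilinear_moy[OF cbil_pt]] .
  qed
  have v: "vl (VA \<gamma>) (T N)" "vl (VA \<gamma>) (T' N)" using T T' gd_vl by blast+
  have u: "Poly_Mapping.single (1, 0) one = Ru (cst one)" "Poly_Mapping.single (0, 1) one = Rv (cst one)"
    by (simp_all add: Ru_def Rv_def mu_single mv_single du_single0 dv_single0 cvec.scale_zero_right)
  have L: "mf (Ru (cst one)) p = Lu p" "mf (Rv (cst one)) p = Lv p" "mf p (Ru (cst one)) = Ru p" "mf p (Rv (cst one)) = Rv p"
    if "vl (VA \<gamma>) p" for p
  proof -
    show "mf p (Ru (cst one)) = Ru p" "mf p (Rv (cst one)) = Rv p"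
      by (simp_all add: moy_R[OF cbil_pt] moy_cst_right[OF cbil_pt] pm_mult_one that)
    show "mf (Ru (cst one)) p = Lu p" "mf (Rv (cst one)) p = Lv p"
      unfolding cst_LR[symmetric] by (simp_all add: moy_L[OF cbil_pt] moy_cst_left[OF cbil_pt] pm_one_mult that)
  qed
  have "Ru (T N) - Lu (T N) = Ru (T' N) - Lu (T' N)" "Rv (T N) - Lv (T N) = Rv (T' N) - Lv (T' N)"
    using key[OF refl, of 1 0] key[OF refl, of 0 1] unfolding u by (simp_all add: L v)
  then have "Lu (T N) - Ru (T N) = Lu (T' N) - Ru (T' N)" "Lv (T N) - Rv (T N) = Lv (T' N) - Rv (T' N)"
    by (metis minus_diff_eq)+
  note e = this
  show "T N = T' N"
  proof (rule pol_eqI)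
    show "du (T N) = du (T' N)" by (simp only: du_LR e)
    show "dv (T N) = dv (T' N)" by (simp only: dv_LR e)
  qed (simp only: c)
qed

end

lemma (in ldiff2) vl_tw:
  assumes p: "vl (VA \<alpha>) p" and q: "vl (VA \<beta>) q"
  shows "vl (VA (\<alpha> \<circ>\<^sub>m \<beta>)) (tw A.FFm A.dl p q)"
proof -
  obtain M where M: "\<And>i. i \<ge> M \<Longrightarrow> (Nop ^^ i) q = 0" using Nop_nilpotent by blast
  have dl: "A.dl f \<in> VA \<alpha>" if "f \<in> VA \<alpha>" for f
  proof -
    have "A.dl f = sop \<alpha> (GD 0) f"
      using that VA_off by (auto simp: fun_eq_iff A.dl_def sop_def simp del: delta_fun.simps)
    then show ?thesis using A.sop_VA[OF that] by simp
  qed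
  have d: "vl (VA \<alpha>) (pm (A.dl ^^ i) p)" for i
  proof (rule vl_pm[OF p clinear_funpow[OF A.clinear_dl]])
    show "(A.dl ^^ i) f \<in> VA \<alpha>" if "f \<in> VA \<alpha>" for f using that by (induction i) (simp_all add: dl)
  qed
  have n: "vl (VA \<beta>) ((Nop ^^ i) q)" for i
    by (induction i) (simp_all add: q vl_Nop[OF subspace_VA[OF B.ld]])
  have "vl (VA (\<alpha> \<circ>\<^sub>m \<beta>)) (moy A.FFm (pm (A.dl ^^ i) p) ((Nop ^^ i) q))" for i
  proof (rule vl_moy[OF A.cbil_FFm subspace_VA[OF AB.ld] _ d n])
    show "A.FFm f g \<in> VA (\<alpha> \<circ>\<^sub>m \<beta>)" if "f \<in> VA \<alpha>" "g \<in> VA \<beta>" for f g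
      using FF_VA[OF that] by (simp add: FF_def[abs_def] A.FFm_def[abs_def])
  qed
  moreover have "tw A.FFm A.dl p q = (\<Sum>i<M. ((- 1) ^ i / fact i) *\<^sub>C moy A.FFm (pm (A.dl ^^ i) p) ((Nop ^^ i) q))"
    by (rule tw_eq[OF A.cbil_FFm A.clinear_dl M])
  ultimately show ?thesis by (simp only:) (intro vl_sum[OF subspace_VA[OF AB.ld]] vl_scale[OF subspace_VA[OF AB.ld]])
qed

section \<open>Transport of the connection\<close>

locale ldiffi = ldiff2 \<gamma> "pm_inv \<gamma>" for \<gamma>
begin

abbreviation (input) "gi \<equiv> \<gamma> \<circ>\<^sub>m pm_inv \<gamma>"

lemma comp_id: "x \<in> ran \<gamma> \<Longrightarrow> gi x = Some x"
proof -
  assume "x \<in> ran \<gamma>"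
  then obtain t where "\<gamma> t = Some x" by (auto simp: ran_def)
  then show ?thesis using map_comp_ran[of t x x] A.pm_inv_iff by blast
qed

lemma ran_id: "ran gi = ran \<gamma>"
proof
  show "ran gi \<subseteq> ran \<gamma>" using ran_AB by blast
  show "ran \<gamma> \<subseteq> ran gi" using comp_id by (blast intro: ranI)
qed

lemma S_id: "AB.S = A.S"
  using A.S_iff AB.S_iff ran_id by blast

lemma VA_id: "VA gi = VA \<gamma>"
  by (simp only: VA_def S_id)

lemma ps_id: "x \<in> ran \<gamma> \<Longrightarrow> ps gi x = x"
  using AB.ps_the[of x] comp_id by fastforce

lemma ps'_id: "x \<in> ran \<gamma> \<Longrightarrow> deriv (ps gi) x = 1"
proof -
  assume x: "x \<in> ran \<gamma>"
  have "(ps gi has_real_derivative 1) (at x)"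
    by (rule has_field_derivative_transform_within_open[OF DERIV_ident A.open_ran x]) (simp add: ps_id)
  then show ?thesis by (rule DERIV_imp_deriv)
qed

lemma phi_id: "z \<in> A.S \<Longrightarrow> phi (pm_inv \<gamma>) (phi \<gamma> z) = z" and phi_S: "z \<in> A.S \<Longrightarrow> phi \<gamma> z \<in> B.S"
  and delta0_id: "z \<in> A.S \<Longrightarrow> delta_fun \<gamma> 0 z + delta_fun (pm_inv \<gamma>) 0 (phi \<gamma> z) = 0"
proof -
  assume z: "z \<in> A.S"
  then have x: "fst z \<in> ran \<gamma>" "snd z > 0" using A.S_iff by auto
  have z': "z \<in> AB.S" using z S_id by simp
  then show "phi \<gamma> z \<in> B.S" using S_AB by blast
  have "phi gi z = z" using x by (simp add: phi_def ps_id ps'_id)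
  then show "phi (pm_inv \<gamma>) (phi \<gamma> z) = z" using phi_AB[OF z'] by simp
  have "(deriv (ps gi) has_real_derivative 0) (at (fst z))"
    by (rule has_field_derivative_transform_within_open[OF DERIV_const A.open_ran x(1)]) (simp add: ps'_id)
  then have "deriv (deriv (ps gi)) (fst z) = 0" by (rule DERIV_imp_deriv)
  then have "lnd gi (fst z) = 0" using AB.lnd_eq[of "fst z"] x ran_id by simp
  then have "delta_fun gi 0 z = 0" unfolding AB.delta_fun_eq[OF z'] by simp
  then show "delta_fun \<gamma> 0 z + delta_fun (pm_inv \<gamma>) 0 (phi \<gamma> z) = 0" using delta0_AB[OF z'] by simp
qed

text \<open>Associativity of the twisted product with twist 0 on the composite: gamma followed by
  its inverse is the identity on the range, so the two values of delta_1 add up to zero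
  (\<open>delta0_id\<close>).\<close>

lemma EE_EE: assumes q: "vl (VA \<gamma>) q" shows "A.EE (B.EE q) = q"
proof -
  have "tw (\<lambda>f g. f * g) (\<lambda>_. 0) (tw A.FFm A.dl (cst A.one) (cst B.one)) q = tw A.FFm A.dl (cst A.one) (tw B.FFm B.dl (cst B.one) q)"
  proof (rule tw_assoc[OF A.cbil_FFm cbil_pt A.cbil_FFm B.cbil_FFm A.clinear_dl B.clinear_dl clinear_zero_fun]; rule ext)
    fix f g h z
    show "(A.FFm f g * h) z = A.FFm f (B.FFm g h) z"
      by (cases "z \<in> A.S") (simp_all add: A.FFm_def B.FFm_def A.fun_act_eq B.fun_act_eq phi_S phi_id)
    have d: "of_real (delta_fun \<gamma> 0 z) + of_real (delta_fun (pm_inv \<gamma>) 0 (phi \<gamma> z)) = (0 :: complex)" if "z \<in> A.S"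
      using delta0_id[OF that] by (metis of_real_0 of_real_add)
    show "0 z = (A.FFm (A.dl f) g + A.FFm f (B.dl g)) z"
    proof (cases "z \<in> A.S")
      case True
      have "(A.FFm (A.dl f) g + A.FFm f (B.dl g)) z = (of_real (delta_fun \<gamma> 0 z) + of_real (delta_fun (pm_inv \<gamma>) 0 (phi \<gamma> z))) * (f z * g (phi \<gamma> z))"
        using True by (simp add: A.FFm_def A.dl_def B.dl_def A.fun_act_eq algebra_simps del: delta_fun.simps)
      then show ?thesis unfolding d[OF True] by simp
    qed (simp add: A.FFm_def A.fun_act_eq)
  qed
  moreover have "tw A.FFm A.dl (cst A.one) (cst B.one) = cst A.one"
  proof -
    have "A.FFm A.one B.one = A.one" by (rule ext) (simp add: A.FFm_def A.fun_act_eq A.one_def B.one_def phi_S)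
    then show ?thesis by (simp add: tw_cst_right[OF A.cbil_FFm A.clinear_dl] pm_single cbilinearD2[OF A.cbil_FFm])
  qed
  ultimately show ?thesis
    by (simp add: A.EE_def B.EE_def tw_zero[OF cbil_pt] moy_cst_left[OF cbil_pt] A.pm_one_mult[OF q])
qed

text \<open>Versions of the pairing and of the operators that are linear on all functions, obtained
  with \<open>prj\<close>, as \<open>coproduct_action\<close> requires. On functions supported on
  the ranges they agree with \<open>FFm\<close>, \<open>dl\<close> and the actual operators.\<close>

definition Bp where "Bp f g = A.FFm (prj \<gamma> f) (prj (pm_inv \<gamma>) g)"
definition d1 where "d1 f = sop \<gamma> (GD 0) (prj \<gamma> f)"
definition d2 where "d2 f = sop \<gamma> (GD 1) (prj \<gamma> f)"
definition s1 where "s1 f = A.sgm * prj \<gamma> f"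

lemma FF_FFm: "FF = A.FFm"
  by (intro ext) (simp add: FF_def A.FFm_def)

lemma sop_id: "sop gi GX = sop \<gamma> GX" "sop gi GY = sop \<gamma> GY"
  by (intro ext; simp add: sop_def S_id)+

lemma Bp_VA: "Bp f g \<in> VA \<gamma>"
  using FF_VA[OF A.prj_VA B.prj_VA] by (simp add: Bp_def FF_FFm VA_id)

lemma sgm_eq: assumes f: "f \<in> VA \<gamma>" shows "A.sgm * f = sop \<gamma> (GD 1) f - (1/2) *\<^sub>C sop \<gamma> (GD 0) (sop \<gamma> (GD 0) f)"
proof -
  have "A.sgm * f = hact \<gamma> hS f" unfolding A.sgm_def by (rule A.hact_delta_alg[OF hS_delta_alg f, symmetric])
  also have "\<dots> = hact \<gamma> (hdelta 2) f - (1/2) *\<^sub>C hact \<gamma> (hdelta 1) (hact \<gamma> (hdelta 1) f)"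
    by (simp add: hS_def clinear_diff[OF A.clinear_hact[OF f]] clinear_scale[OF A.clinear_hact[OF f]] A.hact_mult[OF f])
  finally show ?thesis by (simp add: hdelta_def A.hact_gen f A.sop_VA)
qed

lemma clinear_s1: "clinear s1"
  unfolding s1_def[abs_def] by (rule clinear_comp[OF A.clinear_sgm A.clinear_prj])

text \<open>The product lands in functions on the range of gamma, and the Schwarzian of gamma is
  used both there and on the left factor, with 0 on the right factor: multiplication by one fixed
  function passes through the left factor.\<close>

lemma cop: "coproduct_action Bp d1 d2 (Xb \<gamma>) (Yb \<gamma>) s1 (Xb (pm_inv \<gamma>)) (Yb (pm_inv \<gamma>)) (\<lambda>_. 0) (Xb \<gamma>) (Yb \<gamma>) s1"
proof (rule coproduct_action.intro)
  show B: "cbilinear Bp" unfolding Bp_def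
    by (intro cbilinearI clinear_comp[OF cbilinearD1[OF A.cbil_FFm] B.clinear_prj] clinear_comp[OF cbilinearD2[OF A.cbil_FFm] A.clinear_prj])
  show "clinear d1" "clinear d2"
    by (rule clinearI; simp only: d1_def d2_def clinear_add[OF A.clinear_prj] clinear_scale[OF A.clinear_prj]
        A.sop_lin(1)[OF A.prj_VA A.prj_VA] A.sop_lin(2)[OF A.prj_VA A.prj_VA])+
  show "clinear s1" by (rule clinear_s1)
  show "clinear (Xb \<gamma>)" "clinear (Yb \<gamma>)" "clinear (Xb (pm_inv \<gamma>))" "clinear (Yb (pm_inv \<gamma>))" "clinear (\<lambda>_ :: pt \<Rightarrow> complex. 0 :: pt \<Rightarrow> complex)"
    by (rule A.clinear_Xb A.clinear_Yb B.clinear_Xb B.clinear_Yb clinear_zero_fun)+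
  fix x y
  have px: "prj \<gamma> x \<in> VA \<gamma>" and py: "prj (pm_inv \<gamma>) y \<in> VA (pm_inv \<gamma>)" by (rule A.prj_VA B.prj_VA)+
  note pr = A.prj_id[OF A.sop_VA[OF px]] B.prj_id[OF B.sop_VA[OF py]]
  show "Xb \<gamma> (Bp x y) = Bp (Xb \<gamma> x) y + Bp x (Xb (pm_inv \<gamma>) y) + Bp (d1 x) (Yb (pm_inv \<gamma>) y)"
    unfolding A.Xb_eq[OF Bp_VA] unfolding Bp_def Xb_def Yb_def d1_def pr FF_FFm[symmetric]
    by (rule FF_X[OF px py, unfolded sop_id(1)])
  show "Yb \<gamma> (Bp x y) = Bp (Yb \<gamma> x) y + Bp x (Yb (pm_inv \<gamma>) y)"
    unfolding A.Yb_eq[OF Bp_VA] unfolding Bp_def Yb_def pr FF_FFm[symmetric]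
    by (rule FF_Y[OF px py, unfolded sop_id(2)])
  have "A.sgm * prj \<gamma> x \<in> VA \<gamma>" by (rule VA_mult[OF A.ld A.sgm_VA px]) simp
  then show "s1 (Bp x y) = Bp (s1 x) y + Bp x 0"
    unfolding s1_def A.prj_id[OF Bp_VA] unfolding Bp_def A.prj_id clinear_zero[OF B.clinear_prj] clinear_zero[OF cbilinearD1[OF A.cbil_FFm]]
    by (simp add: A.FFm_def fun_eq_iff A.prj_id)
  show "Xb \<gamma> (d1 x) = d1 (Xb \<gamma> x) + d2 x" "Yb \<gamma> (d1 x) = d1 (Yb \<gamma> x) + d1 x"
    unfolding Xb_def Yb_def d1_def d2_def pr using A.sop_XD[OF px, of 0] A.sop_YD[OF px, of 0] by (simp_all add: scaleC_one)
  show "d2 (d1 x) = d1 (d2 x)" unfolding d1_def d2_def pr by (rule A.sop_DD)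
  show "s1 x = d2 x - (1/2) *\<^sub>C d1 (d1 x)" unfolding s1_def d1_def d2_def pr by (rule sgm_eq[OF px])
qed (rule A.clinear_Xb A.clinear_Yb clinear_s1)+

lemma pm_prj: "vl (VA \<gamma>) p \<Longrightarrow> pm (prj \<gamma>) p = p" and pm_prj': "vl (VA (pm_inv \<gamma>)) q \<Longrightarrow> pm (prj (pm_inv \<gamma>)) q = q"
  by (rule poly_mapping_eqI; simp add: A.clinear_prj B.clinear_prj vl_def A.prj_id B.prj_id)+

lemma tw_Bp: assumes p: "vl (VA \<gamma>) p" and q: "vl (VA (pm_inv \<gamma>)) q" shows "tw Bp d1 p q = tw A.FFm A.dl p q"
proof -
  have d: "prj \<gamma> (d1 x) = A.dl (prj \<gamma> x)" for x
    unfolding d1_def A.prj_id[OF A.sop_VA[OF A.prj_VA]]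
    using VA_off[OF A.prj_VA] by (auto simp: fun_eq_iff A.dl_def sop_def simp del: delta_fun.simps)
  interpret coproduct_action Bp d1 d2 "Xb \<gamma>" "Yb \<gamma>" s1 "Xb (pm_inv \<gamma>)" "Yb (pm_inv \<gamma>)" "\<lambda>_. 0" "Xb \<gamma>" "Yb \<gamma>" s1 by (rule cop)
  have "pm (\<lambda>x. x) (tw Bp d1 p q) = tw A.FFm A.dl (pm (prj \<gamma>) p) (pm (prj (pm_inv \<gamma>)) q)"
    by (rule tw_nat[OF B A.cbil_FFm clinear_id A.clinear_prj B.clinear_prj lins(1) A.clinear_dl]) (rule Bp_def d)+
  then show ?thesis by (simp add: pm_id pm_prj[OF p] pm_prj'[OF q])
qed

lemma vl_cst: "f \<in> VA \<gamma> \<Longrightarrow> vl (VA \<gamma>) (cst f)"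
  by (rule vl_single[OF subspace_VA[OF A.ld]])

lemma vl_EE: "vl (VA (pm_inv \<gamma>)) q \<Longrightarrow> vl (VA \<gamma>) (A.EE q)"
  using vl_tw[OF vl_cst[OF A.one_VA]] by (simp add: A.EE_def VA_id)

lemma d1_one: "pm d1 (cst A.one) = pm A.dl (cst A.one)" "vl (VA \<gamma>) (pm A.dl (cst A.one))"
proof -
  have d: "d1 A.one = A.dl A.one"
    unfolding d1_def A.prj_id[OF A.one_VA] by (auto simp: fun_eq_iff A.dl_def sop_def A.one_def simp del: delta_fun.simps)
  have "clinear d1" using cop by (simp add: coproduct_action_def)
  then show "pm d1 (cst A.one) = pm A.dl (cst A.one)" by (simp add: pm_single A.clinear_dl d)
  have "d1 A.one \<in> VA \<gamma>" unfolding d1_def by (rule A.sop_VA[OF A.prj_VA])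
  then show "vl (VA \<gamma>) (pm A.dl (cst A.one))" by (simp add: pm_single A.clinear_dl d[symmetric] vl_cst)
qed

text \<open>This is \<open>tw_Pr\<close> with the unit as left factor. Being annihilated by X and Y,
  the unit contributes only its Schwarzian term, so conjugating the connection by gamma adds (i/2) S
  (L_u^2 - R_u^2), the commutator with (1/2) S u^2. In the second direction nothing is
  added.\<close>

lemma EE_transport:
  assumes B: "gd (pm_inv \<gamma>) B"
  shows "A.EE (P0 (Xb (pm_inv \<gamma>)) (B N)) - pm A.dl (A.EE (Qo (Yb (pm_inv \<gamma>)) (B N)))
      = P0 (Xb \<gamma>) (A.EE (B N)) + (\<i>/2) *\<^sub>C Lu (Lu (pm (\<lambda>f. A.sgm * f) (A.EE (B N)))) - (\<i>/2) *\<^sub>C Ru (Ru (pm (\<lambda>f. A.sgm * f) (A.EE (B N))))"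
    "A.EE (Qo (Yb (pm_inv \<gamma>)) (B N)) = Qo (Yb \<gamma>) (A.EE (B N))"
proof -
  interpret C: coproduct_action Bp d1 d2 "Xb \<gamma>" "Yb \<gamma>" s1 "Xb (pm_inv \<gamma>)" "Yb (pm_inv \<gamma>)" "\<lambda>_. 0" "Xb \<gamma>" "Yb \<gamma>" s1 by (rule cop)
  let ?q = "B N" and ?o = "cst A.one"
  have q: "vl (VA (pm_inv \<gamma>)) ?q" by (rule gd_vl[OF B])
  have P: "vl (VA (pm_inv \<gamma>)) (P0 (Xb (pm_inv \<gamma>)) ?q)" and Q: "vl (VA (pm_inv \<gamma>)) (Qo (Yb (pm_inv \<gamma>)) ?q)"
    using gd_vl[OF B.gd_P0[OF B]] gd_vl[OF B.gd_Qo[OF B]] by blast+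
  have o: "vl (VA \<gamma>) ?o" by (rule vl_cst[OF A.one_VA])
  have E: "tw Bp d1 ?o r = A.EE r" if "vl (VA (pm_inv \<gamma>)) r" for r unfolding A.EE_def by (rule tw_Bp[OF o that])
  have Po: "P0 (Xb \<gamma>) ?o = 0" and Qo: "Qo (Yb \<gamma>) ?o = 0"
    by (simp_all add: P0_def Qo_def pm_single A.clinear_Xb A.clinear_Yb A.XY_one du_single0 dv_single0 lin_all cvec.scale_zero_right)
  have s1: "s1 A.one = A.sgm" unfolding s1_def A.prj_id[OF A.one_VA] by (rule A.mult_one(1)[OF A.sgm_VA])
  have RL: "Ru (Ru (cst x)) = Lu (Lu (cst x))" for x :: "pt \<Rightarrow> complex" by (metis cst_LR(1) LR_comm(1))
  \<comment> \<open>On constants left and right multiplication by u agree; in the left form the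
    factor u^2 can be pulled out of the twisted product.\<close>
  have Pro: "Pr (Xb \<gamma>) s1 ?o = - ((\<i>/2) *\<^sub>C Lu (Lu (cst A.sgm)))"
    unfolding Pr_def Po pm_LR[OF C.lins(5)] pm_single[OF C.lins(5)] s1 RL by simp
  have sg: "tw Bp d1 (cst A.sgm) ?q = pm (\<lambda>f. A.sgm * f) (A.EE ?q)"
  proof -
    have "cst A.sgm = mf (cst A.sgm) ?o" by (simp add: moy_cst_left[OF cbil_pt] pm_single cbilinearD1[OF cbil_pt] A.mult_one A.sgm_VA)
    then have "tw Bp d1 (cst A.sgm) ?q = tw A.FFm A.dl (mf (cst A.sgm) ?o) ?q" by (metis tw_Bp[OF vl_cst[OF A.sgm_VA] q])
    then show ?thesis unfolding A.tw_mf A.EE_def[symmetric] by (simp only: moy_cst_left[OF cbil_pt])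
  qed
  have dd: "tw Bp d1 (pm d1 ?o) r = pm A.dl (A.EE r)" if "vl (VA (pm_inv \<gamma>)) r" for r
    unfolding d1_one(1) tw_Bp[OF d1_one(2) that] A.tw_dl A.EE_def ..
  have Pr2: "Pr (Xb (pm_inv \<gamma>)) (\<lambda>_. 0) r = P0 (Xb (pm_inv \<gamma>)) r" for r
  proof -
    have "pm (\<lambda>_ :: pt \<Rightarrow> complex. 0 :: pt \<Rightarrow> complex) s = 0" for s by (rule poly_mapping_eqI) (simp add: clinear_zero_fun)
    then show ?thesis by (simp add: Pr_def cvec.scale_zero_right)
  qed
  have "Pr (Xb \<gamma>) s1 (A.EE ?q) = - ((\<i>/2) *\<^sub>C Lu (Lu (pm (\<lambda>f. A.sgm * f) (A.EE ?q)))) + A.EE (P0 (Xb (pm_inv \<gamma>)) ?q) - pm A.dl (A.EE (Qo (Yb (pm_inv \<gamma>)) ?q))"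
    using C.tw_Pr[of ?o ?q] unfolding E[OF q] Pro Pr2 E[OF P] dd[OF Q]
    by (simp only: tll[OF C.B C.lins(1)] tw_L[OF C.B C.lins(1)] sg)
  moreover have "Pr (Xb \<gamma>) s1 (A.EE ?q) = P0 (Xb \<gamma>) (A.EE ?q) - (\<i>/2) *\<^sub>C Ru (Ru (pm (\<lambda>f. A.sgm * f) (A.EE ?q)))"
  proof -
    have "pm s1 (A.EE ?q) = pm (\<lambda>f. A.sgm * f) (A.EE ?q)"
      by (rule pm_cong[OF C.lins(5) A.clinear_sgm vl_EE[OF q]]) (simp add: s1_def A.prj_id)
    then show ?thesis unfolding Pr_def pm_LR[OF C.lins(5)] by simp
  qed
  ultimately have "P0 (Xb \<gamma>) (A.EE ?q) - (\<i>/2) *\<^sub>C Ru (Ru (pm (\<lambda>f. A.sgm * f) (A.EE ?q)))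
     = - ((\<i>/2) *\<^sub>C Lu (Lu (pm (\<lambda>f. A.sgm * f) (A.EE ?q)))) + (A.EE (P0 (Xb (pm_inv \<gamma>)) ?q) - pm A.dl (A.EE (Qo (Yb (pm_inv \<gamma>)) ?q)))"
    by simp
  then show "A.EE (P0 (Xb (pm_inv \<gamma>)) (B N)) - pm A.dl (A.EE (Qo (Yb (pm_inv \<gamma>)) (B N)))
      = P0 (Xb \<gamma>) (A.EE (B N)) + (\<i>/2) *\<^sub>C Lu (Lu (pm (\<lambda>f. A.sgm * f) (A.EE (B N)))) - (\<i>/2) *\<^sub>C Ru (Ru (pm (\<lambda>f. A.sgm * f) (A.EE (B N))))"
    by (simp add: algebra_simps)
  have "tw Bp d1 0 ?q = 0" by (simp add: tll[OF C.B C.lins(1)])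
  then show "A.EE (Qo (Yb (pm_inv \<gamma>)) (B N)) = Qo (Yb \<gamma>) (A.EE (B N))"
    using C.tw_Qo[of ?o ?q] unfolding E[OF q] Qo E[OF Q] by simp
qed

end

context ldiff begin

lemma clinear_EE: "clinear EE"
  unfolding EE_def[abs_def] by (rule clinear_tw_right[OF cbil_FFm clinear_dl])

lemma secs_dl: "secs e (\<lambda>N. pm dl (F N)) z k m n = of_real (delta_fun \<gamma> 0 z) * secs e F z k m n"
  by (simp add: secs_def cf_def clinear_dl dl_def del: delta_fun.simps)

lemma sec_act_scaled:
  assumes z: "z \<in> S" and \<omega>: "\<And>k m n. \<omega> (phi \<gamma> z) k m n = r * (secs e G (phi \<gamma> z) k m n - secs e' H (phi \<gamma> z) k m n)"
  shows "sec_act \<gamma> \<omega> z k m n = r * (secs e (\<lambda>N. EE (G N)) z k m n - secs e' (\<lambda>N. EE (H N)) z k m n)"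
proof -
  have w: "\<omega> (phi \<gamma> z) = (\<lambda>k m n. r * (secs e G (phi \<gamma> z) k m n - secs e' H (phi \<gamma> z) k m n))" by (intro ext \<omega>)
  have "sec_act \<gamma> \<omega> z k m n = r * (sec_act \<gamma> (secs e G) z k m n - sec_act \<gamma> (secs e' H) z k m n)"
    using z by (simp only: sec_act_fsubst if_True w fsubst_lin)
  then show ?thesis by (simp only: sec_act_secs)
qed

lemma phi_scale:
  assumes z: "z \<in> S"
  shows "of_real (deriv (ps \<gamma>) (fst z)) * yc (phi \<gamma> z) = yc z" "yc (phi \<gamma> z) \<noteq> 0"
    "of_real (cC z) / yc (phi \<gamma> z) = - (of_real (delta_fun \<gamma> 0 z) * yc z)"
    "of_real (1 / deriv (ps \<gamma>) (fst z)) / yc (phi \<gamma> z) = 1 / yc z"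
proof -
  have y: "snd z > 0" "fst z \<in> ran \<gamma>" using z S_iff by auto
  have D: "deriv (ps \<gamma>) (fst z) > 0" using ps'_pos[OF y(2)] .
  have s: "snd (phi \<gamma> z) = snd z / deriv (ps \<gamma>) (fst z)" by (simp add: phi_def)
  show "of_real (deriv (ps \<gamma>) (fst z)) * yc (phi \<gamma> z) = yc z" "yc (phi \<gamma> z) \<noteq> 0"
    "of_real (1 / deriv (ps \<gamma>) (fst z)) / yc (phi \<gamma> z) = 1 / yc z"
    using D y unfolding s by simp_all
  have "cC z / snd (phi \<gamma> z) = - (delta_fun \<gamma> 0 z * snd z)"
    using D y unfolding s delta_fun_eq[OF z] by (simp add: cC_def lnd_eq power2_eq_square field_simps)
  then show "of_real (cC z) / yc (phi \<gamma> z) = - (of_real (delta_fun \<gamma> 0 z) * yc z)"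
    by (metis of_real_divide of_real_minus of_real_mult)
qed

lemma W_on_zero: "W_on S 0"
  by (simp add: W_on_def section_on_def smooth_const)

lemma W_on_T0: "W_on S (sec T0)"
proof -
  have "sec T0 z k m n = 0" if "k < 0" for z k m n
    using that by (auto simp: secs_def cf_def T0_def lookup_single when_def)
  then show ?thesis using sec_smooth[OF gd_T0] by (simp add: W_on_def)
qed

lemma homogeneous2_T0: "homogeneous2 (sec T0)"
  by (auto simp: homogeneous2_def secs_def cf_def T0_def lookup_single when_def split: if_splits)

lemma ioh_commutator_T0:
  assumes A: "gd \<gamma> A"
  shows "i_over_hbar ((sec T0 \<star>\<^sub>w sec A) z - (sec A \<star>\<^sub>w sec T0) z) k m n
    = \<i> * (kap z * (sec (\<lambda>N. Lu (Lu (A N))) z k m n - sec (\<lambda>N. Ru (Ru (A N))) z k m n))"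
proof -
  have c: "conv mf T0 A 0 - conv mf A T0 0 = 0" "conv mf T0 A 1 - conv mf A T0 1 = 0" by (simp_all only: conv_T0 diff_self)
  show ?thesis unfolding commutator_sec(1)[OF gd_T0 A] ioh_sec[of "\<lambda>N. conv mf T0 A N - conv mf A T0 N", OF c] conv_T0(3,6)
    by (simp add: secs_def cf_def lookup_minus lookup_LuLu lookup_RuRu algebra_simps diff_divide_distrib)
qed

lemma homogeneous2_lookup0: "gd \<gamma> T \<Longrightarrow> homogeneous2 (sec T) \<Longrightarrow> Poly_Mapping.lookup (T N) (0, 0) = 0"
proof
  fix z assume T: "gd \<gamma> T" "homogeneous2 (sec T)"
  show "Poly_Mapping.lookup (T N) (0, 0) z = 0 z"
  proof (cases "even N")
    case True
    then obtain j where j: "N = 2 * j" by (auto elim: evenE)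
    have "sec T z (int j) 0 0 = 0" using T(2) unfolding homogeneous2_def by fastforce
    moreover have "nat (2 * int j) = N" by (simp add: j)
    ultimately show ?thesis by (simp add: secs_def cf_def)
  next
    case False
    then show ?thesis using par_lookup[OF gd_par[OF T(1)], of N "(0, 0)"] by simp
  qed
qed

end

context ldiffi begin

lemma transported:
  assumes A: "gd \<gamma> A" and z: "z \<in> A.S" and i: "ldiff2 (pm_inv \<gamma>) \<gamma>"
  shows "fst (transported_D \<gamma> (sec A)) z k m n = fst (fedosov_D (sec A)) z k m n
      + i_over_hbar ((sec A.T0 \<star>\<^sub>w sec A) z - (sec A \<star>\<^sub>w sec A.T0) z) k m n"
    "snd (transported_D \<gamma> (sec A)) z k m n = snd (fedosov_D (sec A)) z k m n"
proof -
  interpret C: ldiff2 "pm_inv \<gamma>" \<gamma> by (rule i)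
  \<comment> \<open>The section is pulled back by the inverse of gamma; by \<open>EE_EE\<close> the
    original is the gamma-image of B, to which \<open>EE_transport\<close> applies.\<close>
  define B where "B N = B.EE (A N)" for N
  have SC: "C.AB.S = B.S"
  proof (intro set_eqI iffI)
    fix w assume w: "w \<in> B.S"
    then have x: "fst w \<in> ran (pm_inv \<gamma>)" "snd w > 0" using B.S_iff by auto
    have "\<gamma> (fst w) = Some (ps (pm_inv \<gamma>) (fst w))" using B.ps_ran[OF x(1)] A.pm_inv_iff by blast
    then have "ps (pm_inv \<gamma>) (fst w) \<in> ran \<gamma>" by (rule ranI)
    then have "phi (pm_inv \<gamma>) w \<in> A.S" using B.ps'_pos[OF x(1)] x(2) A.S_iff by (simp add: phi_def)
    then show "w \<in> C.AB.S" using C.S_AB w by blast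
  qed (use C.S_AB in blast)
  have vB: "vl (VA (pm_inv \<gamma>)) (B N)" for N
    using C.vl_tw[OF vl_single[OF subspace_VA[OF B.ld] B.one_VA] gd_vl[OF A]] by (simp add: B_def B.EE_def VA_def SC)
  have B: "gd (pm_inv \<gamma>) B" using vB B.par_EE[OF gd_par[OF A]] by (simp add: gd_def B_def[abs_def])
  have AB: "A.EE (B N) = A N" for N unfolding B_def by (rule EE_EE[OF gd_vl[OF A]])
  have sB: "sec_act (pm_inv \<gamma>) (sec A) = sec B" unfolding B.sec_act_secs B_def ..
  note w = phi_S[OF z]
  have f: "sec_act \<gamma> (fst (fedosov_D (sec B))) z k m n
     = yc (phi \<gamma> z) * (sec (\<lambda>N. A.EE (P0 (Xb (pm_inv \<gamma>)) (B N))) z k m n - secs 1 (\<lambda>N. A.EE (du (B N))) z k m n)"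
    by (rule A.sec_act_scaled[OF z]) (rule B.D_fst[OF B w])
  have g: "sec_act \<gamma> (snd (fedosov_D (sec B))) z k m n
     = 1 / yc (phi \<gamma> z) * (sec (\<lambda>N. A.EE (Qo (Yb (pm_inv \<gamma>)) (B N))) z k m n - secs 1 (\<lambda>N. A.EE (dv (B N))) z k m n)"
    by (rule A.sec_act_scaled[OF z]) (simp add: B.D_snd[OF B w])
  let ?s = "of_real (delta_fun \<gamma> 0 z) :: complex"
  have du: "secs 1 (\<lambda>N. du (A N)) z k m n = secs 1 (\<lambda>N. A.EE (du (B N))) z k m n - ?s * secs 1 (\<lambda>N. A.EE (dv (B N))) z k m n"
    unfolding AB[symmetric] A.EE_ops(1) A.secs_diff A.secs_dl ..
  have dv: "secs 1 (\<lambda>N. A.EE (dv (B N))) z k m n = secs 1 (\<lambda>N. dv (A N)) z k m n"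
    unfolding AB[symmetric] A.EE_ops(2) ..
  have P: "sec (\<lambda>N. A.EE (P0 (Xb (pm_inv \<gamma>)) (B N))) z k m n - ?s * sec (\<lambda>N. A.EE (Qo (Yb (pm_inv \<gamma>)) (B N))) z k m n
      = sec (\<lambda>N. P0 (Xb \<gamma>) (A N)) z k m n
        + \<i> / 2 * (A.sgm z * (sec (\<lambda>N. Lu (Lu (A N))) z k m n - sec (\<lambda>N. Ru (Ru (A N))) z k m n))"
  proof -
    have "sec (\<lambda>N. A.EE (P0 (Xb (pm_inv \<gamma>)) (B N))) z k m n - ?s * sec (\<lambda>N. A.EE (Qo (Yb (pm_inv \<gamma>)) (B N))) z k m n
      = sec (\<lambda>N. A.EE (P0 (Xb (pm_inv \<gamma>)) (B N)) - pm A.dl (A.EE (Qo (Yb (pm_inv \<gamma>)) (B N)))) z k m n"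
      unfolding A.secs_diff A.secs_dl ..
    also have "\<dots> = sec (\<lambda>N. P0 (Xb \<gamma>) (A N) + (\<i>/2) *\<^sub>C Lu (Lu (pm (\<lambda>f. A.sgm * f) (A N))) - (\<i>/2) *\<^sub>C Ru (Ru (pm (\<lambda>f. A.sgm * f) (A N)))) z k m n"
      unfolding EE_transport(1)[OF B] AB ..
    also have "\<dots> = sec (\<lambda>N. P0 (Xb \<gamma>) (A N)) z k m n
        + \<i> / 2 * (A.sgm z * (sec (\<lambda>N. Lu (Lu (A N))) z k m n - sec (\<lambda>N. Ru (Ru (A N))) z k m n))"
    proof -
      have R: "Poly_Mapping.lookup (Ru (Ru (pm (\<lambda>f. A.sgm * f) p))) j z = A.sgm z * Poly_Mapping.lookup (Ru (Ru p)) j z" for p j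
        using lookup_RuRu[of A.sgm p j z] by (simp only: mult.commute[of _ A.sgm])
      show ?thesis
        by (simp add: secs_def cf_def lookup_add lookup_minus scf lookup_LuLu R)
          (simp add: algebra_simps diff_divide_distrib add_divide_distrib)
    qed
    finally show ?thesis .
  qed
  have Q: "sec (\<lambda>N. A.EE (Qo (Yb (pm_inv \<gamma>)) (B N))) z k m n = sec (\<lambda>N. Qo (Yb \<gamma>) (A N)) z k m n"
    unfolding EE_transport(2)[OF B] AB ..
  have ring: "y * (a - b) + - (s * y) * (c - d) = y * (a - s * c - (b - s * d))" for a b c d s y :: complex
    by (simp add: algebra_simps)
  have "fst (transported_D \<gamma> (sec A)) z k m n
      = of_real (deriv (ps \<gamma>) (fst z)) * yc (phi \<gamma> z) * (sec (\<lambda>N. A.EE (P0 (Xb (pm_inv \<gamma>)) (B N))) z k m n - secs 1 (\<lambda>N. A.EE (du (B N))) z k m n)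
      + of_real (A.cC z) / yc (phi \<gamma> z) * (sec (\<lambda>N. A.EE (Qo (Yb (pm_inv \<gamma>)) (B N))) z k m n - secs 1 (\<lambda>N. A.EE (dv (B N))) z k m n)"
    unfolding transported_D_def sB A.form_act_eq[OF z] f g by simp
  also have "\<dots> = yc z * ((sec (\<lambda>N. A.EE (P0 (Xb (pm_inv \<gamma>)) (B N))) z k m n - ?s * sec (\<lambda>N. A.EE (Qo (Yb (pm_inv \<gamma>)) (B N))) z k m n)
      - secs 1 (\<lambda>N. du (A N)) z k m n)"
    unfolding A.phi_scale[OF z] du by (rule ring)
  finally show "fst (transported_D \<gamma> (sec A)) z k m n = fst (fedosov_D (sec A)) z k m n
      + i_over_hbar ((sec A.T0 \<star>\<^sub>w sec A) z - (sec A \<star>\<^sub>w sec A.T0) z) k m n"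
    unfolding P A.D_fst[OF A z] A.ioh_commutator_T0[OF A] A.kap_def by (simp add: algebra_simps)
  have "snd (transported_D \<gamma> (sec A)) z k m n
      = of_real (1 / deriv (ps \<gamma>) (fst z)) / yc (phi \<gamma> z) * (sec (\<lambda>N. Qo (Yb \<gamma>) (A N)) z k m n - secs 1 (\<lambda>N. dv (A N)) z k m n)"
    unfolding transported_D_def sB A.form_act_eq[OF z] g Q dv by simp
  then show "snd (transported_D \<gamma> (sec A)) z k m n = snd (fedosov_D (sec A)) z k m n"
    unfolding A.phi_scale[OF z] A.D_snd[OF A z] by simp
qed

text \<open>Existence is \<open>transported\<close>. Any other candidate has the same commutators
  with all sections, and homogeneity of degree 2 excludes constant terms, so
  \<open>commutator_unique\<close> gives equality in both components.\<close>

lemma Delta_form_eq: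
  assumes i: "ldiff2 (pm_inv \<gamma>) \<gamma>"
  shows "Delta_form \<gamma> = (sec A.T0, 0)"
  unfolding Delta_form_def Let_def
proof (rule the_equality)
  have z0: "i_over_hbar ((0 \<star>\<^sub>w sec A) z - (sec A \<star>\<^sub>w 0) z) = 0" for A z
    by (simp add: wmult_def moyal_zero wp_sec i_over_hbar_def fun_eq_iff)
  have gd0: "gd \<gamma> (\<lambda>_. 0)" by (simp add: gd_def vl_zero[OF subspace_VA[OF A.ld]] par_iff)
  have s0: "sec (\<lambda>_. 0) = 0" by (intro ext) (simp add: secs_def cf_def)
  have ex: "fst (transported_D \<gamma> a) z = fst (fedosov_D a) z + i_over_hbar ((sec A.T0 \<star>\<^sub>w a) z - (a \<star>\<^sub>w sec A.T0) z)
      \<and> snd (transported_D \<gamma> a) z = snd (fedosov_D a) z + i_over_hbar ((0 \<star>\<^sub>w a) z - (a \<star>\<^sub>w 0) z)"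
    if a: "W_on A.S a" and z: "z \<in> A.S" for a z
  proof -
    obtain A where A: "gd \<gamma> A" "a = sec A" using A.Wplus_sec[OF A.W_on_Wplus[OF a]] by blast
    show ?thesis unfolding A(2) z0 by (intro conjI ext) (simp_all add: transported[OF A(1) z i])
  qed
  then show "W_on A.S (fst (sec A.T0, 0)) \<and> W_on A.S (snd (sec A.T0, 0)) \<and> homogeneous2 (fst (sec A.T0, 0)) \<and> homogeneous2 (snd (sec A.T0, 0)) \<and>
    (\<forall>a. W_on A.S a \<longrightarrow> (\<forall>z\<in>A.S.
        fst (transported_D \<gamma> a) z = fst (fedosov_D a) z + i_over_hbar ((fst (sec A.T0, 0) \<star>\<^sub>w a) z - (a \<star>\<^sub>w fst (sec A.T0, 0)) z) \<and>
        snd (transported_D \<gamma> a) z = snd (fedosov_D a) z + i_over_hbar ((snd (sec A.T0, 0) \<star>\<^sub>w a) z - (a \<star>\<^sub>w snd (sec A.T0, 0)) z)))"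
    using A.W_on_T0 A.W_on_zero A.homogeneous2_T0 by (simp add: homogeneous2_def)
  fix \<omega> :: form1
  assume \<omega>: "W_on A.S (fst \<omega>) \<and> W_on A.S (snd \<omega>) \<and> homogeneous2 (fst \<omega>) \<and> homogeneous2 (snd \<omega>) \<and>
    (\<forall>a. W_on A.S a \<longrightarrow> (\<forall>z\<in>A.S.
        fst (transported_D \<gamma> a) z = fst (fedosov_D a) z + i_over_hbar ((fst \<omega> \<star>\<^sub>w a) z - (a \<star>\<^sub>w fst \<omega>) z) \<and>
        snd (transported_D \<gamma> a) z = snd (fedosov_D a) z + i_over_hbar ((snd \<omega> \<star>\<^sub>w a) z - (a \<star>\<^sub>w snd \<omega>) z)))"
  obtain P where P: "gd \<gamma> P" "fst \<omega> = sec P" using \<omega> A.Wplus_sec[OF A.W_on_Wplus] by blast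
  obtain Q where Q: "gd \<gamma> Q" "snd \<omega> = sec Q" using \<omega> A.Wplus_sec[OF A.W_on_Wplus] by blast
  have "P = A.T0"
  proof (rule A.commutator_unique[OF P(1) A.gd_T0])
    show "Poly_Mapping.lookup (P N) (0, 0) = 0" "Poly_Mapping.lookup (A.T0 N) (0, 0) = 0" for N
      using A.homogeneous2_lookup0 P \<omega> A.gd_T0 A.homogeneous2_T0 by metis+
    fix a z assume "W_on A.S a" "z \<in> A.S"
    then show "i_over_hbar ((sec P \<star>\<^sub>w a) z - (a \<star>\<^sub>w sec P) z) = i_over_hbar ((sec A.T0 \<star>\<^sub>w a) z - (a \<star>\<^sub>w sec A.T0) z)"
      using ex \<omega> unfolding P(2) by (metis add_left_cancel)
  qed
  moreover have "Q = (\<lambda>_. 0)"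
  proof (rule A.commutator_unique[OF Q(1) gd0])
    show "Poly_Mapping.lookup (Q N) (0, 0) = 0" for N
      using A.homogeneous2_lookup0 Q \<omega> by metis
    fix a z assume "W_on A.S a" "z \<in> A.S"
    then show "i_over_hbar ((sec Q \<star>\<^sub>w a) z - (a \<star>\<^sub>w sec Q) z) = i_over_hbar ((sec (\<lambda>_. 0) \<star>\<^sub>w a) z - (a \<star>\<^sub>w sec (\<lambda>_. 0)) z)"
      using ex \<omega> unfolding Q(2) s0 by (metis add_left_cancel)
  qed simp
  ultimately show "\<omega> = (sec A.T0, 0)" using P(2) Q(2) s0 by (metis prod.collapse)
qed

end

section \<open>Evaluation of the star product\<close>

lemma mf_assoc: "mf (mf p q) r = mf p (mf q r)"
proof -
  have "tw (\<lambda>f g. f * g) (\<lambda>_. 0) (tw (\<lambda>f g. f * g) (\<lambda>_. 0) p q) r = tw (\<lambda>f g. f * g) (\<lambda>_. 0) p (tw (\<lambda>f g. f * g) (\<lambda>_. 0 :: pt \<Rightarrow> complex) q r)"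
    by (rule tw_assoc[OF cbil_pt cbil_pt cbil_pt cbil_pt clinear_zero_fun clinear_zero_fun clinear_zero_fun])
      (simp_all add: mult.assoc)
  then show ?thesis by (simp add: tw_zero[OF cbil_pt])
qed

lemmas cbil_mf = cbilinear_moy[OF cbil_pt]

lemma conv_mf_assoc: "conv mf (conv mf a b) c = conv mf a (conv mf b c)"
  by (rule ext) (rule conv_assoc[OF cbil_mf cbil_mf cbil_mf cbil_mf mf_assoc])

lemma ck_on_Un: "ck_on n S f \<Longrightarrow> ck_on n T f \<Longrightarrow> open S \<Longrightarrow> open T \<Longrightarrow> ck_on n (S \<union> T) f"
proof (induction n arbitrary: f)
  case 0
  then show ?case by (simp add: ck_on_0 continuous_on_open_Un)
next
  case (Suc n)
  then show ?case by (simp add: ck_on_Suc ball_Un)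
qed

lemma ck_on_zero: "(\<And>z. z \<in> S \<Longrightarrow> f z = 0) \<Longrightarrow> open S \<Longrightarrow> ck_on n S f"
  by (rule ck_on_cong[OF _ _ ck_const[of n S 0]]) auto

context ldiff begin

lemma CS_add: "f \<in> CS \<gamma> \<Longrightarrow> g \<in> CS \<gamma> \<Longrightarrow> f + g \<in> CS \<gamma>" and CS_scale: "f \<in> CS \<gamma> \<Longrightarrow> c *\<^sub>C f \<in> CS \<gamma>"
proof -
  assume f: "f \<in> CS \<gamma>"
  then have cf: "closure {z. f z \<noteq> 0} \<subseteq> S" and vf: "f \<in> VA \<gamma>" by (simp_all only: CS_def mem_Collect_eq)
  show "f + g \<in> CS \<gamma>" if "g \<in> CS \<gamma>"
  proof -
    have cg: "closure {z. g z \<noteq> 0} \<subseteq> S" and vg: "g \<in> VA \<gamma>" using that by (simp_all only: CS_def mem_Collect_eq)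
    have "{z. (f + g) z \<noteq> 0} \<subseteq> {z. f z \<noteq> 0} \<union> {z. g z \<noteq> 0}" by auto
    from closure_mono[OF this] have "closure {z. (f + g) z \<noteq> 0} \<subseteq> S"
      unfolding closure_Un by (rule order_trans) (rule Un_least[OF cf cg])
    then show ?thesis using VA_lin(1)[OF ld vf vg] by (simp only: CS_def mem_Collect_eq simp_thms)
  qed
  have "{z. (c *\<^sub>C f) z \<noteq> 0} \<subseteq> {z. f z \<noteq> 0}" by (auto simp: scf)
  from closure_mono[OF this] have "closure {z. (c *\<^sub>C f) z \<noteq> 0} \<subseteq> S" by (rule order_trans) (rule cf)
  then show "c *\<^sub>C f \<in> CS \<gamma>" using VA_lin(2)[OF ld vf] by (simp only: CS_def mem_Collect_eq simp_thms)
qed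

lemma CS_VA: "f \<in> CS \<gamma> \<Longrightarrow> f \<in> VA \<gamma>"
  by (simp only: CS_def mem_Collect_eq)

lemma hact_CS: "f \<in> CS \<gamma> \<Longrightarrow> hact \<gamma> h f \<in> CS \<gamma>"
proof (induction h arbitrary: f rule: h1_induct)
  case one
  then show ?case by (simp only: hact_one[OF CS_VA])
next
  case X
  then show ?case by (simp only: hact_gen[OF CS_VA] sop_CS)
next
  case Y
  then show ?case by (simp only: hact_gen[OF CS_VA] sop_CS)
next
  case D
  then show ?case by (simp only: hdelta_def hact_gen[OF CS_VA] sop_CS)
next
  case (add x y)
  show ?case unfolding clinear_add[OF clinear_hact[OF CS_VA[OF add.prems]]] by (rule CS_add[OF add.IH(1)[OF add.prems] add.IH(2)[OF add.prems]])
next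
  case (scale c x)
  show ?case unfolding clinear_scale[OF clinear_hact[OF CS_VA[OF scale.prems]]] by (rule CS_scale[OF scale.IH[OF scale.prems]])
next
  case (mult x y)
  show ?case unfolding hact_mult[OF CS_VA[OF mult.prems]] by (rule mult.IH(1)[OF mult.IH(2)[OF mult.prems]])
qed

lemma half_plane_Some: "half_plane = ran (lift Some)" if "local_diffeo Some"
  using ldiff.S_iff[OF ldiff.intro[OF that]] by (auto simp: half_plane_def ran_def)

text \<open>A function with closed support in the range is smooth there and zero on the open
  complement of the support. These two open sets cover the half plane, so it is smooth on all of
  it.\<close>

lemma CS_Some:
  assumes I: "local_diffeo Some" and f: "f \<in> CS \<gamma>"
  shows "f \<in> CS Some"
proof -
  interpret I: ldiff Some by (rule ldiff.intro[OF I])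
  have cf: "closure {z. f z \<noteq> 0} \<subseteq> S" and sm: "smooth_on S f" and off: "\<And>z. z \<notin> S \<Longrightarrow> f z = 0"
    using f VA_off[OF CS_VA[OF f]] CS_VA[OF f] by (simp_all only: CS_def VA_def mem_Collect_eq)
  have sub: "S \<subseteq> I.S" using S_iff I.S_iff by (auto simp: ran_def)
  define C where "C = closure {z. f z \<noteq> 0}"
  have C: "open (- C)" unfolding C_def by (rule open_Compl[OF closed_closure])
  have fC: "f z = 0" if "z \<in> - C" for z
  proof (rule ccontr)
    assume "f z \<noteq> 0"
    then have "z \<in> C" unfolding C_def by (intro subsetD[OF closure_subset] CollectI)
    with that show False by simp
  qed
  have "ck_on n (S \<union> - C) f" for n
    using sm ck_on_zero[OF fC C] by (intro ck_on_Un[OF _ _ open_S C]) (simp_all only: smooth_on_def)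
  then have "smooth_on (S \<union> - C) f" by (simp only: smooth_on_def simp_thms)
  then have "smooth_on I.S f" by (rule smooth_subset) (use cf in \<open>unfold C_def, blast\<close>)
  moreover have "f z = 0" if "z \<notin> I.S" for z using off sub that by blast
  ultimately show ?thesis using order_trans[OF cf sub] by (simp only: CS_def VA_def mem_Collect_eq simp_thms) blast
qed

text \<open>The lift is defined over the half plane, the range of the lifted identity. On functions
  with closed support in the range of gamma, X and Y do not depend on the diffeomorphism, so the
  series J_0 f for gamma and for the identity solve the same equations.\<close>

lemma flat_lift_CS:
  assumes I: "local_diffeo Some" and f: "f \<in> CS \<gamma>"
  shows "flat_lift f = sec (hseq J0 f)"
proof -
  interpret I: ldiff Some by (rule ldiff.intro[OF I])
  have XY: "Xb Some g = Xb \<gamma> g" "Yb Some g = Yb \<gamma> g" if g: "g \<in> CS \<gamma>" for g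
  proof -
    have g': "g \<in> CS Some" by (rule CS_Some[OF I g])
    have "gen_op GX Some g = gen_op GX \<gamma> g" "gen_op GY Some g = gen_op GY \<gamma> g" by simp_all
    then show "Xb Some g = Xb \<gamma> g" "Yb Some g = Yb \<gamma> g"
      using gen_op_sop[OF g] I.gen_op_sop[OF g'] by (simp_all only: Xb_eq[OF CS_VA[OF g]] I.Xb_eq[OF I.CS_VA[OF g']] Yb_eq[OF CS_VA[OF g]] I.Yb_eq[OF I.CS_VA[OF g']])
  qed
  note fv = CS_VA[OF f] and fi = I.CS_VA[OF CS_Some[OF I f]]
  have v: "vl (CS \<gamma>) (hseq J0 f N)" for N
    by (simp add: vl_def hseq_def clinear_hact[OF fv] hact_CS[OF f])
  have "P0 (Xb Some) (hseq J0 f N) = P0 (Xb \<gamma>) (hseq J0 f N)" "Qo (Yb Some) (hseq J0 f N) = Qo (Yb \<gamma>) (hseq J0 f N)" for N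
    using pm_cong[OF I.clinear_Xb clinear_Xb v XY(1)] pm_cong[OF I.clinear_Yb clinear_Yb v XY(2)] by (simp_all add: P0_def Qo_def)
  then have "flat (P0 (Xb Some)) (Qo (Yb Some)) (hseq J0 f)"
    using flat_hseq_J0[OF fv] by (simp add: flat_def)
  then have "I.hseq J0 f = hseq J0 f"
  proof (rule flat_unique[OF I.flat_hseq_J0[OF fi]])
    show "Poly_Mapping.lookup (I.hseq J0 f n) (0, 0) = Poly_Mapping.lookup (hseq J0 f n) (0, 0)" for n
      by (simp add: I.hseq_def hseq_def I.clinear_hact[OF fi] clinear_hact[OF fv] J0_0 I.hact_one[OF fi] hact_one[OF fv]
          clinear_zero[OF I.clinear_hact[OF fi]] clinear_zero[OF clinear_hact[OF fv]])
  qed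
  then show ?thesis using I.flat_lift_eq[OF half_plane_Some[OF I] fi] by simp
qed

lemma conv_unit: "(\<And>N. pm (\<lambda>f. f * one) (a N) = a N) \<Longrightarrow> conv mf a unitS = a"
  unfolding unitS_def[abs_def] by (rule ext) (simp add: conv_unit_right[OF cbil_mf] moy_cst_right[OF cbil_pt])

lemma conv_Uu_JJ: "conv mf (hseq Uu one) (hseq JJ one) = unitS"
proof (rule sec_eqD[OF gd_conv_mf[OF ld gd_hseq[OF one_VA par_Uu] gd_hseq[OF one_VA par_JJ] subset_refl] gd_unit])
  fix z assume z: "z \<in> S"
  then have y: "snd z \<noteq> 0" using S_iff by auto
  have b0: "fs (yc z) (sec (hseq JJ one) z) 0 = cst 1"
    using z by (simp add: fs_sec[OF gd_par[OF gd_hseq[OF one_VA par_JJ]] y] hseq_cst[of _ JJ, OF one_VA JJ_cst] pm_single clinear_ev one_def)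
  have "moyal (sec (hseq Uu one) z) (sec (hseq JJ one) z) = fone"
    by (rule moyal_right_inverse[OF wp_sec wp_sec moyal_JJ_Uu[OF z] _ b0]) (simp add: y)
  then show "sec (conv mf (hseq Uu one) (hseq JJ one)) z = sec unitS z"
    unfolding sec_unit[OF z] sec_mult[OF ld gd_hseq[OF one_VA par_Uu] ld gd_hseq[OF one_VA par_JJ], symmetric] wmult_def .
qed

text \<open>From J_0 f = (J f) U and associativity: U times J 1 is the local unit, because J 1 is a
  left inverse that begins with 1 and hence a right inverse.\<close>

lemma conv_J0_JJ: "f \<in> VA \<gamma> \<Longrightarrow> conv mf (hseq J0 f) (hseq JJ one) = hseq JJ f"
  unfolding conv_hseq[symmetric] conv_mf_assoc conv_Uu_JJ
  by (rule conv_unit) (rule pm_mult_one[OF gd_vl[OF gd_hseq[OF _ par_JJ]]])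

lemma EE_mf: "EE (mf p q) = tw FFm dl (EE p) q"
proof -
  have "tw FFm dl (tw FFm dl (cst one) p) q = tw FFm dl (cst one) (tw (\<lambda>f g. f * g) (\<lambda>_. 0) p q)"
    by (rule tw_assoc[OF cbil_FFm cbil_FFm cbil_FFm cbil_pt clinear_dl clinear_zero_fun clinear_dl])
      (auto simp: FFm_def dl_def fun_eq_iff fun_act_eq)
  then show ?thesis by (simp add: EE_def tw_zero[OF cbil_pt])
qed

lemma mf_EE': "pm (\<lambda>f. f * one) p = p \<Longrightarrow> mf p (EE q) = tw FFm dl p q"
  by (simp add: EE_def tw_mf[symmetric] moy_cst_right[OF cbil_pt])

end

context ldiff2 begin

lemma sub_S: "AB.S \<subseteq> A.S"
  using S_AB by blast

lemma vl_EE: "vl (VA \<beta>) q \<Longrightarrow> vl (VA (\<alpha> \<circ>\<^sub>m \<beta>)) (A.EE q)"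
  unfolding A.EE_def by (rule vl_tw[OF vl_single[OF subspace_VA[OF A.ld] A.one_VA]])

lemma gd_EE: "gd \<beta> B \<Longrightarrow> gd (\<alpha> \<circ>\<^sub>m \<beta>) (\<lambda>N. A.EE (B N))"
  by (simp add: gd_def vl_EE A.par_EE)

lemma mult_one_AB: "vl (VA (\<alpha> \<circ>\<^sub>m \<beta>)) p \<Longrightarrow> pm (\<lambda>f. f * A.one) p = p"
proof -
  assume p: "vl (VA (\<alpha> \<circ>\<^sub>m \<beta>)) p"
  have "f * A.one = f" if "f \<in> VA (\<alpha> \<circ>\<^sub>m \<beta>)" for f
    using VA_off[OF that] S_AB by (fastforce simp: fun_eq_iff A.one_def)
  then have "pm (\<lambda>f. f * A.one) p = pm (\<lambda>f. f) p" by (rule pm_cong[OF cbilinearD2[OF cbil_pt] clinear_id p])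
  then show ?thesis by (simp add: pm_id)
qed

lemma conv_EE: "(\<And>N. vl (VA \<beta>) (a N)) \<Longrightarrow> conv mf (\<lambda>N. A.EE (a N)) (\<lambda>N. A.EE (b N)) = (\<lambda>N. A.EE (conv mf a b N))"
  by (rule ext) (simp add: conv_def clinear_sum[OF A.clinear_EE] A.EE_mf A.mf_EE'[OF mult_one_AB[OF vl_EE]])

lemma EE_unit: "A.EE (B.unitS N) = AB.unitS N"
proof -
  have "A.FFm A.one B.one = AB.one"
    using S_AB by (auto simp: fun_eq_iff A.FFm_def A.fun_act_eq A.one_def B.one_def AB.one_def)
  then show ?thesis
    by (simp add: B.unitS_def AB.unitS_def clinear_zero[OF A.clinear_EE])
      (simp add: A.EE_def tw_cst_right[OF A.cbil_FFm A.clinear_dl] pm_single cbilinearD2[OF A.cbil_FFm])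
qed

text \<open>The action of alpha is multiplicative (\<open>conv_EE\<close>), so it carries the
  inverse of U_beta to the inverse of its image, on the range of the composition.\<close>

lemma winv_EE: "winv AB.S (sec (\<lambda>N. A.EE (B.hseq Uu B.one N))) = sec (\<lambda>N. A.EE (B.hseq JJ B.one N))"
proof -
  note gJ = B.gd_hseq[OF B.one_VA par_JJ] and gU = B.gd_hseq[OF B.one_VA par_Uu]
  show ?thesis
  proof (rule winv_eq[OF AB.sec_Wplus[OF gd_EE[OF gJ]] wp_sec])
    fix z assume z: "z \<in> AB.S"
    then show y: "snd z \<noteq> 0" using AB.S_iff by auto
    have "(sec (\<lambda>N. A.EE (B.hseq JJ B.one N)) \<star>\<^sub>w sec (\<lambda>N. A.EE (B.hseq Uu B.one N))) = sec AB.unitS"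
      unfolding sec_mult[OF AB.ld gd_EE[OF gJ] AB.ld gd_EE[OF gU]] conv_EE[OF gd_vl[OF gJ]] B.conv_hseq[OF B.one_VA] B.hseq_J0_one EE_unit ..
    from fun_cong[OF this, of z] show "moyal (sec (\<lambda>N. A.EE (B.hseq JJ B.one N)) z) (sec (\<lambda>N. A.EE (B.hseq Uu B.one N)) z) = fone"
      unfolding wmult_def AB.sec_unit[OF z] .
    have "B.hseq JJ B.one 0 = B.unitS 0" by (simp add: B.hseq_cst[of _ JJ, OF B.one_VA JJ_cst] B.unitS_def)
    then show "fs (yc z) (sec (\<lambda>N. A.EE (B.hseq JJ B.one N)) z) 0 = cst 1"
      using z by (simp add: fs_sec[OF gd_par[OF gd_EE[OF gJ]] y] EE_unit AB.unitS_def pm_single clinear_ev AB.one_def)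
  qed
qed

text \<open>Multiplication by an alpha-image is the twisted product (\<open>mf_EE\<close>);
  naturality of \<open>tw\<close> carries J * J to its value on f and g.\<close>

lemma hseq_JJ_MM:
  assumes f: "f \<in> VA \<alpha>" and g: "g \<in> VA \<beta>"
  shows "conv (tw A.FFm A.dl) (A.hseq JJ f) (B.hseq JJ g) N = pm (m2 f g) (MM N)"
proof -
  have d: "hact \<alpha> (hdelta 1 * x) f = A.dl (hact \<alpha> x f)" for x
    using VA_off[OF A.hact_VA[OF f]]
    by (auto simp: A.hact_mult[OF f] hdelta_def A.hact_gen A.hact_VA f fun_eq_iff sop_def A.dl_def simp del: delta_fun.simps)
  have "pm (m2 f g) (tw2 p q) = tw A.FFm A.dl (pm (\<lambda>h. hact \<alpha> h f) p) (pm (\<lambda>h. hact \<beta> h g) q)" for p q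
    by (rule tw_nat[OF cbilinear_tensor_mk A.cbil_FFm clinear_m2[OF f g] A.clinear_hact[OF f] B.clinear_hact[OF g] clinear_lmult A.clinear_dl])
      (simp_all only: m2_mk[OF f g] d, simp add: FF_def[abs_def] A.FFm_def[abs_def])
  then show ?thesis
    unfolding MM_def pm_conv[OF clinear_m2[OF f g]] unfolding conv_def A.hseq_def B.hseq_def by simp
qed

text \<open>Since coefficients of U act over the composition by multiplication, multiplying by
  U_(alpha beta) is acting with them, and by \<open>m2_coproduct\<close> that is multiplication by
  their coproducts.\<close>

lemma conv_MM_Uu:
  assumes f: "f \<in> VA \<alpha>" and g: "g \<in> VA \<beta>"
  shows "conv mf (\<lambda>N. pm (m2 f g) (MM N)) (AB.hseq Uu AB.one) N = pm (m2 f g) (conv om MM dU N)"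
proof -
  have c: "cbilinear (\<lambda>x y. coproduct y * x)"
    by (intro cbilinearI clinear_rmult clinear_comp[OF clinear_rmult clinear_coproduct] clinear_lmult)
  have "pm (m2 f g) (om p (dU j)) = mf (pm (m2 f g) p) (AB.hseq Uu AB.one j)" for p j
  proof -
    have "pm (\<lambda>x. x) (moy (\<lambda>x y. coproduct y * x) p (Uu j)) = moy (\<lambda>x y. y * x) (pm (\<lambda>x. x) p) (pm coproduct (Uu j))"
      by (rule moy_nat[OF c cbilinear_opp clinear_id clinear_id clinear_coproduct]) simp
    then have "om p (dU j) = moy (\<lambda>x y. coproduct y * x) p (Uu j)" by (simp add: om_def dU_def pm_id)
    moreover have "pm (m2 f g) (moy (\<lambda>x y. coproduct y * x) p (Uu j)) = mf (pm (m2 f g) p) (pm (\<lambda>h. hact (\<alpha> \<circ>\<^sub>m \<beta>) h AB.one) (Uu j))"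
    proof (rule moy_nat_on[OF c cbil_pt clinear_m2[OF f g] clinear_m2[OF f g] AB.clinear_hact[OF AB.one_VA]])
      show "vl delta_alg (Uu j)" by (simp add: vl_def Uu_delta_alg)
      show "m2 f g (coproduct y * x) = m2 f g x * hact (\<alpha> \<circ>\<^sub>m \<beta>) y AB.one" if "y \<in> delta_alg" for x y
        unfolding m2_coproduct[OF f g, symmetric] AB.hact_delta_alg[OF that m2_VA[OF f g]] by (rule mult.commute)
    qed
    ultimately show ?thesis by (simp add: AB.hseq_def)
  qed
  then show ?thesis unfolding pm_conv[OF clinear_m2[OF f g]] unfolding conv_def by simp
qed

text \<open>The five factors are grouped as (lift of f, inverse of U_alpha), which is J f, and
  (image of the lift of g, image of the inverse of U_beta), which is the alpha-image of J g. Their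
  product is J * J on f and g, and the last factor multiplies it by Delta(U), whose product with J *
  J has constant term R.\<close>

lemma star_eq:
  assumes I: "local_diffeo Some" and f: "f \<in> CS \<alpha>" and g: "g \<in> CS \<beta>"
    and D: "Delta_form \<alpha> = (sec A.T0, 0)" "Delta_form \<beta> = (sec B.T0, 0)" "Delta_form (\<alpha> \<circ>\<^sub>m \<beta>) = (sec AB.T0, 0)"
  shows "star f \<alpha> g \<beta> = Abs_fps (\<lambda>n. cmon (m2 f g (Rser (2 * n))) (\<alpha> \<circ>\<^sub>m \<beta>))"
proof -
  note fv = A.CS_VA[OF f] and gv = B.CS_VA[OF g]
  note gJf = A.gd_hseq[OF fv par_JJ] and g0f = A.gd_hseq[OF fv par_J0] and g0g = B.gd_hseq[OF gv par_J0]
    and gJ = B.gd_hseq[OF B.one_VA par_JJ] and gJg = B.gd_hseq[OF gv par_JJ]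
  have s1: "flat_lift f \<star>\<^sub>w winv A.S (U_section \<alpha>) = sec (A.hseq JJ f)"
    unfolding A.flat_lift_CS[OF I f] A.U_section_eq[OF D(1)] A.winv_U sec_mult[OF A.ld g0f A.ld A.gd_hseq[OF A.one_VA par_JJ]]
      A.conv_J0_JJ[OF fv] ..
  have s2: "sec_act \<alpha> (flat_lift g) = sec (\<lambda>N. A.EE (B.hseq J0 g N))"
    unfolding B.flat_lift_CS[OF I g] A.sec_act_secs ..
  have s3: "winv AB.S (sec_act \<alpha> (U_section \<beta>)) = sec (\<lambda>N. A.EE (B.hseq JJ B.one N))"
    unfolding B.U_section_eq[OF D(2)] A.sec_act_secs winv_EE ..
  let ?a = "A.hseq JJ f" and ?b = "\<lambda>N. A.EE (B.hseq J0 g N)" and ?c = "\<lambda>N. A.EE (B.hseq JJ B.one N)" and ?u = "AB.hseq Uu AB.one"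
  have gab: "gd (\<alpha> \<circ>\<^sub>m \<beta>) (conv mf ?a ?b)" by (rule gd_conv_mf'[OF AB.ld gJf gd_EE[OF g0g] sub_S])
  have gabc: "gd (\<alpha> \<circ>\<^sub>m \<beta>) (conv mf (conv mf ?a ?b) ?c)" by (rule gd_conv_mf[OF AB.ld gab gd_EE[OF gJ] subset_refl])
  have "star_section f \<alpha> g \<beta> = sec (conv mf (conv mf (conv mf ?a ?b) ?c) ?u)"
    unfolding star_section_def s1 s2 s3 AB.U_section_eq[OF D(3)] sec_mult[OF A.ld gJf AB.ld gd_EE[OF g0g]]
      sec_mult[OF AB.ld gab AB.ld gd_EE[OF gJ]] sec_mult[OF AB.ld gabc AB.ld AB.gd_hseq[OF AB.one_VA par_Uu]] ..
  moreover have "conv mf (conv mf ?a ?b) ?c = (\<lambda>N. pm (m2 f g) (MM N))"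
  proof -
    have "conv mf (conv mf ?a ?b) ?c = conv mf ?a (\<lambda>N. A.EE (B.hseq JJ g N))"
      unfolding conv_mf_assoc conv_EE[OF gd_vl[OF g0g]] B.conv_J0_JJ[OF gv] ..
    also have "\<dots> = conv (tw A.FFm A.dl) ?a (B.hseq JJ g)"
      by (rule ext) (simp add: conv_def A.mf_EE[OF gd_vl[OF gJf]])
    finally show ?thesis by (simp add: fun_eq_iff hseq_JJ_MM[OF fv gv])
  qed
  ultimately have s: "star_section f \<alpha> g \<beta> = sec (\<lambda>N. pm (m2 f g) (conv om MM dU N))"
    by (simp add: conv_MM_Uu[OF fv gv, abs_def])
  \<comment> \<open>At u = v = 0 the coefficient of hbar^n is the constant term in total degree
    2n.\<close>
  have "star_section f \<alpha> g \<beta> z (int n) 0 0 = m2 f g (Rser (2 * n)) z" for z n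
  proof -
    have "nat (2 * int n) = 2 * n" by simp
    then show ?thesis by (simp add: s secs_def cf_def clinear_m2[OF fv gv] Rser_def)
  qed
  then show ?thesis by (simp add: star_def)
qed

end

theorem theorem3p2:
  shows "\<exists>R :: (h1, h1) tensor fps.
    (\<forall>\<Gamma>. pseudogroup \<Gamma> \<longrightarrow>
      (\<forall>\<alpha>\<in>\<Gamma>. \<forall>\<beta>\<in>\<Gamma>. \<forall>f\<in>Cc_smooth (ran (lift \<alpha>)). \<forall>g\<in>Cc_smooth (ran (lift \<beta>)).
        star f \<alpha> g \<beta> = fps_map (\<lambda>t. cm (h1_act2 t (cmon f \<alpha>) (cmon g \<beta>))) R)) \<and>
    fps_map (tensor_map coproduct id) R * fps_map (\<lambda>t. t \<otimes> 1) R =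
      fps_map (\<lambda>t. tensor_assoc (tensor_map id coproduct t)) R * fps_map (\<lambda>t. tensor_assoc (1 \<otimes> t)) R \<and>
    fps_map (tensor_map counit id) R = 1 \<and>
    fps_map (tensor_map id counit) R = 1"
proof (intro exI conjI allI impI ballI)
  show "fps_map (tensor_map coproduct id) Rfps * fps_map (\<lambda>t. t \<otimes> 1) Rfps =
      fps_map (\<lambda>t. tensor_assoc (tensor_map id coproduct t)) Rfps * fps_map (\<lambda>t. tensor_assoc (1 \<otimes> t)) Rfps"
    "fps_map (tensor_map counit id) Rfps = 1" "fps_map (tensor_map id counit) Rfps = 1"
    by (rule twist_fps counit_fps)+
  fix \<Gamma> \<alpha> \<beta> f g
  assume G: "pseudogroup \<Gamma>" and ab: "\<alpha> \<in> \<Gamma>" "\<beta> \<in> \<Gamma>"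
    and f: "f \<in> Cc_smooth (ran (lift \<alpha>))" and g: "g \<in> Cc_smooth (ran (lift \<beta>))"
  note P = G[unfolded pseudogroup_def]
  note P2 = conjunct2[OF P] note P3 = conjunct2[OF P2] note P4 = conjunct2[OF P3]
  note G' = conjunct1[OF P] conjunct1[OF P2] conjunct1[OF P3] conjunct1[OF P4]
  have ld: "ldiff \<gamma>" if "\<gamma> \<in> \<Gamma>" for \<gamma> by (rule ldiff.intro) (rule bspec[OF G'(1) that])
  have comp: "\<gamma> \<circ>\<^sub>m \<gamma>' \<in> \<Gamma>" if "\<gamma> \<in> \<Gamma>" "\<gamma>' \<in> \<Gamma>" for \<gamma> \<gamma>' by (rule bspec[OF bspec[OF G'(3) that(1)] that(2)])
  have inv: "pm_inv \<gamma> \<in> \<Gamma>" if "\<gamma> \<in> \<Gamma>" for \<gamma> by (rule bspec[OF G'(4) that])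
  have ld2: "ldiff2 \<gamma> \<gamma>'" if "\<gamma> \<in> \<Gamma>" "\<gamma>' \<in> \<Gamma>" for \<gamma> \<gamma>'
    by (intro ldiff2.intro ld comp that)
  \<comment> \<open>The identity supplies the half plane as a range, over which the flat lifts are
    defined.\<close>
  have Some: "local_diffeo Some" by (rule bspec[OF G'(1) G'(2)])
  have D: "Delta_form \<gamma> = (sec (ldiff.T0 \<gamma>), 0)" if "\<gamma> \<in> \<Gamma>" for \<gamma>
    by (rule ldiffi.Delta_form_eq[OF _ ld2[OF inv[OF that] that]]) (intro ldiffi.intro ld2 inv that)
  interpret ldiff2 \<alpha> \<beta> by (rule ld2[OF ab])
  note c = Cc_CS[OF f] Cc_CS[OF g]
  show "star f \<alpha> g \<beta> = fps_map (\<lambda>t. cm (h1_act2 t (cmon f \<alpha>) (cmon g \<beta>))) Rfps"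
    unfolding star_eq[OF Some c D[OF ab(1)] D[OF ab(2)] D[OF comp[OF ab]]] cm_h1_act2[OF c]
    by (simp add: fps_map_def Rfps_def)
qed

end
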